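(* Let $R$ be a local domain (not assumed noetherian nor integrally closed) and let $R^h$ be its henselization. Let $\nu$ be a valuation centered in $R$. Then: (1) There exists a unique prime ideal $H(\nu)$ of $R^h$ lying over the zero ideal of $R$ such that $\nu$ extends to a valuation $\tilde\nu$ centered in $R^h/H(\nu)$ through the inclusion $R\subset R^h/H(\nu)$. In addition, the ideal $H(\nu)$ is a minimal prime of $R^h$ and the extension $\tilde\nu$ is unique. (2) With the notation of (1), the valuations $\nu$ and $\tilde\nu$ have the same value group.
   Context: A valuation centered in a local domain $R$ (maximal ideal $m_R$, fraction field $K$) is a valuation $\nu\colon K^*\to\Phi$ with values in a totally ordered abelian group $\Phi$ (with $\nu(0)=\infty$), whose valuation ring $R_\nu$ (maximal ideal $m_\nu$) dominates $R$: $R\subseteq R_\nu$ and $m_\nu\cap R=m_R$. The value group of $\nu$ is $\nu(K^* )$. Valuations are identified with their valuation rings (i.e. considered up to equivalence). If $K\hookrightarrow L$ is a field extension, a valuation $\tilde\nu$ of $L$ extends $\nu$ if $R_{\tilde\nu}\cap K=R_\nu$; the value group of $\nu$ is then viewed as a subgroup of that of $\tilde\nu$, and "same value group" means that this inclusion is an equality. *)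

theory Defs
  imports "HOL-Algebra.Algebra"
begin

section \<open>Local rings and local homomorphisms\<close>

definition local_ring :: "('a, 'm) ring_scheme \<Rightarrow> bool" where
  "local_ring R \<longleftrightarrow> cring R \<and> (\<exists>!I. maximalideal I R)"

definition max_ideal :: "('a, 'm) ring_scheme \<Rightarrow> 'a set" where
  "max_ideal R = (THE I. maximalideal I R)"

definition local_hom :: "('a, 'm) ring_scheme \<Rightarrow> ('b, 'n) ring_scheme \<Rightarrow> ('a \<Rightarrow> 'b) set" where
  "local_hom R S = {f \<in> ring_hom R S. f ` max_ideal R \<subseteq> max_ideal S}"

definition minimal_prime :: "'a set \<Rightarrow> ('a, 'm) ring_scheme \<Rightarrow> bool" where
  "minimal_prime P R \<longleftrightarrow> primeideal P R \<and> (\<forall>Q. primeideal Q R \<and> Q \<subseteq> P \<longrightarrow> Q = P)"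


section \<open>Henselian rings and the henselization\<close>

text \<open>Polynomials are coefficient lists with the leading coefficient first. The result below need
  not be normalized (leading zeros may occur), which does not affect evaluation.\<close>

primrec poly_deriv :: "('a, 'm) ring_scheme \<Rightarrow> 'a list \<Rightarrow> 'a list" where
  "poly_deriv R [] = []"
| "poly_deriv R (a # p) = (if p = [] then [] else ([length p] \<cdot>\<^bsub>R\<^esub> a) # poly_deriv R p)"

text \<open>Every simple root in the residue field of a monic polynomial over \<open>R\<close> lifts to a root
  in \<open>R\<close>; elements of the residue field are given by representatives.\<close>

definition henselian :: "('a, 'm) ring_scheme \<Rightarrow> bool" where
  "henselian R \<longleftrightarrow> local_ring R \<and>
     (\<forall>p \<in> carrier ((carrier R)[X]\<^bsub>R\<^esub>). \<forall>a \<in> carrier R.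
        p \<noteq> [] \<and> lead_coeff p = \<one>\<^bsub>R\<^esub> \<and>
        ring.eval R p a \<in> max_ideal R \<and> ring.eval R (poly_deriv R p) a \<notin> max_ideal R \<longrightarrow>
        (\<exists>b \<in> carrier R. ring.eval R p b = \<zero>\<^bsub>R\<^esub> \<and> b \<ominus>\<^bsub>R\<^esub> a \<in> max_ideal R))"

text \<open>The usual universal property: \<open>(Rh, i)\<close> is initial among the henselian local rings under
  \<open>R\<close> with local homomorphisms. HOL cannot quantify over the carrier type of the test
  ring \<open>S\<close>, so one type is fixed that has room for every ring of cardinality at most
  \<open>max(|R|, |Rh|, aleph_0)\<close>. This loses nothing: the henselization of \<open>R\<close> in the unrestricted sense
  has cardinality at most \<open>max(|R|, aleph_0)\<close>, so both it and \<open>Rh\<close> have isomorphic copies among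
  the test rings, and a pair \<open>(Rh, i)\<close> that is universal for these is isomorphic to it
  over \<open>R\<close>.\<close>

definition henselization ::
    "('a, 'm) ring_scheme \<Rightarrow> ('b, 'n) ring_scheme \<Rightarrow> ('a \<Rightarrow> 'b) \<Rightarrow> bool" where
  "henselization R Rh i \<longleftrightarrow> henselian Rh \<and> i \<in> local_hom R Rh \<and>
     (\<forall>(S :: ('a + 'b) list set ring) f. henselian S \<and> f \<in> local_hom R S \<longrightarrow>
        (\<exists>!g. g \<in> local_hom Rh S \<inter> extensional (carrier Rh) \<and>
              (\<forall>x \<in> carrier R. g (i x) = f x)))"


section \<open>The fraction field of a domain\<close>

definition frac_rel :: "('a, 'm) ring_scheme \<Rightarrow> (('a \<times> 'a) \<times> ('a \<times> 'a)) set" where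
  "frac_rel R = {((a, b), (c, d)). a \<in> carrier R \<and> b \<in> carrier R - {\<zero>\<^bsub>R\<^esub>} \<and>
     c \<in> carrier R \<and> d \<in> carrier R - {\<zero>\<^bsub>R\<^esub>} \<and> a \<otimes>\<^bsub>R\<^esub> d = c \<otimes>\<^bsub>R\<^esub> b}"

definition fraction :: "('a, 'm) ring_scheme \<Rightarrow> 'a \<Rightarrow> 'a \<Rightarrow> ('a \<times> 'a) set" where
  "fraction R a b = frac_rel R `` {(a, b)}"

definition frac_field :: "('a, 'm) ring_scheme \<Rightarrow> ('a \<times> 'a) set ring" where
  "frac_field R =
     \<lparr> carrier = (carrier R \<times> (carrier R - {\<zero>\<^bsub>R\<^esub>})) // frac_rel R,
       monoid.mult = (\<lambda>T Y. \<Union>p \<in> T. \<Union>q \<in> Y.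
                fraction R (fst p \<otimes>\<^bsub>R\<^esub> fst q) (snd p \<otimes>\<^bsub>R\<^esub> snd q)),
       one = fraction R \<one>\<^bsub>R\<^esub> \<one>\<^bsub>R\<^esub>,
       ring.zero = fraction R \<zero>\<^bsub>R\<^esub> \<one>\<^bsub>R\<^esub>,
       ring.add = (\<lambda>T Y. \<Union>p \<in> T. \<Union>q \<in> Y.
                fraction R (fst p \<otimes>\<^bsub>R\<^esub> snd q \<oplus>\<^bsub>R\<^esub> fst q \<otimes>\<^bsub>R\<^esub> snd p) (snd p \<otimes>\<^bsub>R\<^esub> snd q)) \<rparr>"

definition frac_emb :: "('a, 'm) ring_scheme \<Rightarrow> 'a \<Rightarrow> ('a \<times> 'a) set" where
  "frac_emb R a = fraction R a \<one>\<^bsub>R\<^esub>"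

text \<open>The map of fraction fields induced by an injective homomorphism \<open>f\<close> into the domain \<open>S\<close>.\<close>

definition frac_map :: "('b, 'n) ring_scheme \<Rightarrow> ('a \<Rightarrow> 'b) \<Rightarrow> ('a \<times> 'a) set \<Rightarrow> ('b \<times> 'b) set" where
  "frac_map S f T = (\<Union>p \<in> T. fraction S (f (fst p)) (f (snd p)))"

lemma (in domain) equiv_frac_rel:
  "equiv (carrier R \<times> (carrier R - {\<zero>})) (frac_rel R)"
proof (rule equivI)
  show "trans (frac_rel R)"
  proof (rule transI, clarsimp simp: frac_rel_def)
    fix a b c d e f
    assume c: "a \<in> carrier R" "b \<in> carrier R" "c \<in> carrier R" "d \<in> carrier R" "e \<in> carrier R"
      "f \<in> carrier R" and nz: "d \<noteq> \<zero>" and eq: "a \<otimes> d = c \<otimes> b" "c \<otimes> f = e \<otimes> d"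
    have "d \<otimes> (a \<otimes> f) = (a \<otimes> d) \<otimes> f" using c by (simp add: m_ac)
    also have "\<dots> = (c \<otimes> f) \<otimes> b" using c by (simp add: eq(1) m_ac)
    also have "\<dots> = d \<otimes> (e \<otimes> b)" using c by (simp add: eq(2) m_ac)
    finally show "a \<otimes> f = e \<otimes> b" using c nz m_lcancel by auto
  qed
qed (auto simp: frac_rel_def refl_on_def sym_def)

context domain
begin

lemma frac_eq_iff:
  assumes "a \<in> carrier R" "b \<in> carrier R - {\<zero>}" "c \<in> carrier R" "d \<in> carrier R - {\<zero>}"
  shows "fraction R a b = fraction R c d \<longleftrightarrow> a \<otimes> d = c \<otimes> b"
  using eq_equiv_class_iff[OF equiv_frac_rel, of "(a, b)" "(c, d)"] assms
  by (auto simp: fraction_def frac_rel_def)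

lemma carrier_frac_fieldE:
  assumes "T \<in> carrier (frac_field R)"
  obtains a b where "T = fraction R a b" "a \<in> carrier R" "b \<in> carrier R - {\<zero>}"
  using assms by (auto simp: frac_field_def fraction_def elim!: quotientE)

lemma frac_in_carrier [simp, intro]:
  "\<lbrakk>a \<in> carrier R; b \<in> carrier R - {\<zero>}\<rbrakk> \<Longrightarrow> fraction R a b \<in> carrier (frac_field R)"
  by (auto simp: frac_field_def fraction_def intro: quotientI)

lemma frac_mult:
  assumes ab: "a \<in> carrier R" "b \<in> carrier R - {\<zero>}" and cd: "c \<in> carrier R" "d \<in> carrier R - {\<zero>}"
  shows "fraction R a b \<otimes>\<^bsub>frac_field R\<^esub> fraction R c d = fraction R (a \<otimes> c) (b \<otimes> d)"
proof -
  have const: "fraction R (a' \<otimes> c') (b' \<otimes> d') = fraction R (a \<otimes> c) (b \<otimes> d)"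
    if "(a', b') \<in> fraction R a b" "(c', d') \<in> fraction R c d" for a' b' c' d'
  proof -
    have in': "a' \<in> carrier R" "b' \<in> carrier R - {\<zero>}" "c' \<in> carrier R" "d' \<in> carrier R - {\<zero>}"
      and eq: "a \<otimes> b' = a' \<otimes> b" "c \<otimes> d' = c' \<otimes> d"
      using that by (auto simp: fraction_def frac_rel_def)
    have "(a' \<otimes> c') \<otimes> (b \<otimes> d) = (a' \<otimes> b) \<otimes> (c' \<otimes> d)"
      using in' ab cd by (simp add: m_ac)
    also have "\<dots> = (a \<otimes> b') \<otimes> (c \<otimes> d')" by (simp add: eq)
    also have "\<dots> = (a \<otimes> c) \<otimes> (b' \<otimes> d')" using in' ab cd by (simp add: m_ac)
    finally show ?thesis
      using in' ab cd by (subst frac_eq_iff) (auto simp: integral_iff)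
  qed
  have mem: "(a, b) \<in> fraction R a b" "(c, d) \<in> fraction R c d"
    using ab cd by (auto simp: fraction_def frac_rel_def)
  have "(\<Union>p \<in> fraction R a b. \<Union>q \<in> fraction R c d.
          fraction R (fst p \<otimes> fst q) (snd p \<otimes> snd q)) =
        (\<Union>p \<in> fraction R a b. \<Union>q \<in> fraction R c d. fraction R (a \<otimes> c) (b \<otimes> d))"
    by (intro SUP_cong refl) (rule const, simp_all)
  also have "\<dots> = fraction R (a \<otimes> c) (b \<otimes> d)" using mem by blast
  finally show ?thesis by (simp add: frac_field_def)
qed

lemma frac_add:
  assumes ab: "a \<in> carrier R" "b \<in> carrier R - {\<zero>}" and cd: "c \<in> carrier R" "d \<in> carrier R - {\<zero>}"
  shows "fraction R a b \<oplus>\<^bsub>frac_field R\<^esub> fraction R c d = fraction R (a \<otimes> d \<oplus> c \<otimes> b) (b \<otimes> d)"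
proof -
  have const: "fraction R (a' \<otimes> d' \<oplus> c' \<otimes> b') (b' \<otimes> d') = fraction R (a \<otimes> d \<oplus> c \<otimes> b) (b \<otimes> d)"
    if "(a', b') \<in> fraction R a b" "(c', d') \<in> fraction R c d" for a' b' c' d'
  proof -
    have in': "a' \<in> carrier R" "b' \<in> carrier R - {\<zero>}" "c' \<in> carrier R" "d' \<in> carrier R - {\<zero>}"
      and eq: "a \<otimes> b' = a' \<otimes> b" "c \<otimes> d' = c' \<otimes> d"
      using that by (auto simp: fraction_def frac_rel_def)
    have "(a' \<otimes> d' \<oplus> c' \<otimes> b') \<otimes> (b \<otimes> d) = (a' \<otimes> b) \<otimes> (d' \<otimes> d) \<oplus> (c' \<otimes> d) \<otimes> (b' \<otimes> b)"
      using in' ab cd by (simp add: m_ac l_distr r_distr)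
    also have "\<dots> = (a \<otimes> b') \<otimes> (d' \<otimes> d) \<oplus> (c \<otimes> d') \<otimes> (b' \<otimes> b)" by (simp add: eq)
    also have "\<dots> = (a \<otimes> d \<oplus> c \<otimes> b) \<otimes> (b' \<otimes> d')" using in' ab cd by (simp add: m_ac l_distr r_distr)
    finally show ?thesis
      using in' ab cd by (subst frac_eq_iff) (auto simp: integral_iff)
  qed
  have mem: "(a, b) \<in> fraction R a b" "(c, d) \<in> fraction R c d"
    using ab cd by (auto simp: fraction_def frac_rel_def)
  have "(\<Union>p \<in> fraction R a b. \<Union>q \<in> fraction R c d.
          fraction R (fst p \<otimes> snd q \<oplus> fst q \<otimes> snd p) (snd p \<otimes> snd q)) =
        (\<Union>p \<in> fraction R a b. \<Union>q \<in> fraction R c d. fraction R (a \<otimes> d \<oplus> c \<otimes> b) (b \<otimes> d))"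
    by (intro SUP_cong refl) (rule const, simp_all)
  also have "\<dots> = fraction R (a \<otimes> d \<oplus> c \<otimes> b) (b \<otimes> d)" using mem by blast
  finally show ?thesis by (simp add: frac_field_def)
qed

lemma frac_field_zero: "\<zero>\<^bsub>frac_field R\<^esub> = fraction R \<zero> \<one>"
  and frac_field_one: "\<one>\<^bsub>frac_field R\<^esub> = fraction R \<one> \<one>"
  by (simp_all add: frac_field_def)

theorem field_frac_field: "field (frac_field R)"
proof (rule cring.cring_fieldI2)
  have nz: "b \<otimes> d \<in> carrier R - {\<zero>}"
    if "b \<in> carrier R - {\<zero>}" "d \<in> carrier R - {\<zero>}" for b d
    using that by (auto simp: integral_iff)
  show "cring (frac_field R)"
  proof (intro cringI abelian_groupI comm_monoidI)
    fix T Y W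
    assume "T \<in> carrier (frac_field R)" "Y \<in> carrier (frac_field R)" "W \<in> carrier (frac_field R)"
    then obtain a b c d e f where T: "T = fraction R a b" "a \<in> carrier R" "b \<in> carrier R - {\<zero>}"
      and Y: "Y = fraction R c d" "c \<in> carrier R" "d \<in> carrier R - {\<zero>}"
      and W: "W = fraction R e f" "e \<in> carrier R" "f \<in> carrier R - {\<zero>}"
      by (elim carrier_frac_fieldE)
    note * = T(1) Y(1) W(1) frac_mult frac_add integral_iff
    note r = T(2,3) Y(2,3) W(2,3)
    show "T \<oplus>\<^bsub>frac_field R\<^esub> Y \<oplus>\<^bsub>frac_field R\<^esub> W = T \<oplus>\<^bsub>frac_field R\<^esub> (Y \<oplus>\<^bsub>frac_field R\<^esub> W)"
      using r by (simp add: * l_distr r_distr m_ac a_ac)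
    show "T \<otimes>\<^bsub>frac_field R\<^esub> Y \<otimes>\<^bsub>frac_field R\<^esub> W = T \<otimes>\<^bsub>frac_field R\<^esub> (Y \<otimes>\<^bsub>frac_field R\<^esub> W)"
      using r by (simp add: * m_ac)
    show "(T \<oplus>\<^bsub>frac_field R\<^esub> Y) \<otimes>\<^bsub>frac_field R\<^esub> W =
          T \<otimes>\<^bsub>frac_field R\<^esub> W \<oplus>\<^bsub>frac_field R\<^esub> Y \<otimes>\<^bsub>frac_field R\<^esub> W"
    proof -
      have "fraction R ((a \<otimes> d \<oplus> c \<otimes> b) \<otimes> e) (b \<otimes> d \<otimes> f) =
            fraction R (a \<otimes> e \<otimes> (d \<otimes> f) \<oplus> c \<otimes> e \<otimes> (b \<otimes> f)) (b \<otimes> f \<otimes> (d \<otimes> f))"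
        using r by (subst frac_eq_iff) (simp_all add: integral_iff l_distr r_distr m_ac)
      thus ?thesis using r by (simp add: *)
    qed
  next
    fix T Y
    assume "T \<in> carrier (frac_field R)" "Y \<in> carrier (frac_field R)"
    then obtain a b c d where T: "T = fraction R a b" "a \<in> carrier R" "b \<in> carrier R - {\<zero>}"
      and Y: "Y = fraction R c d" "c \<in> carrier R" "d \<in> carrier R - {\<zero>}"
      by (elim carrier_frac_fieldE)
    note * = T(1) Y(1) frac_mult frac_add integral_iff
    note r = T(2,3) Y(2,3)
    show "T \<oplus>\<^bsub>frac_field R\<^esub> Y \<in> carrier (frac_field R)"
      "T \<otimes>\<^bsub>frac_field R\<^esub> Y \<in> carrier (frac_field R)"
      using r by (auto simp: *)
    show "T \<oplus>\<^bsub>frac_field R\<^esub> Y = Y \<oplus>\<^bsub>frac_field R\<^esub> T"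
      "T \<otimes>\<^bsub>frac_field R\<^esub> Y = Y \<otimes>\<^bsub>frac_field R\<^esub> T"
      using r by (simp_all add: * m_comm a_comm)
  next
    fix T assume "T \<in> carrier (frac_field R)"
    then obtain a b where T: "T = fraction R a b" "a \<in> carrier R" "b \<in> carrier R - {\<zero>}"
      by (elim carrier_frac_fieldE)
    show "\<zero>\<^bsub>frac_field R\<^esub> \<oplus>\<^bsub>frac_field R\<^esub> T = T" "\<one>\<^bsub>frac_field R\<^esub> \<otimes>\<^bsub>frac_field R\<^esub> T = T"
      using T by (simp_all add: frac_field_zero frac_field_one frac_mult frac_add)
    have "fraction R (\<ominus> a) b \<oplus>\<^bsub>frac_field R\<^esub> T = \<zero>\<^bsub>frac_field R\<^esub>"
      using T nz[of b b]
      by (simp add: frac_add frac_field_zero frac_eq_iff l_minus l_neg)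
    thus "\<exists>Y\<in>carrier (frac_field R). Y \<oplus>\<^bsub>frac_field R\<^esub> T = \<zero>\<^bsub>frac_field R\<^esub>"
      using T by (intro bexI[of _ "fraction R (\<ominus> a) b"]) auto
  qed (auto simp: frac_field_zero frac_field_one)
  show "\<zero>\<^bsub>frac_field R\<^esub> \<noteq> \<one>\<^bsub>frac_field R\<^esub>"
    by (simp add: frac_field_zero frac_field_one frac_eq_iff)
  fix T assume "T \<in> carrier (frac_field R)" "T \<noteq> \<zero>\<^bsub>frac_field R\<^esub>"
  then obtain a b where T: "T = fraction R a b" "a \<in> carrier R" "b \<in> carrier R - {\<zero>}"
    by (elim carrier_frac_fieldE)
  have "a \<noteq> \<zero>"
  proof
    assume "a = \<zero>"
    hence "fraction R a b = fraction R \<zero> \<one>" using T(3) by (subst frac_eq_iff) simp_all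
    with \<open>T \<noteq> \<zero>\<^bsub>frac_field R\<^esub>\<close> T(1) show False by (simp only: frac_field_zero)
  qed
  have "fraction R (a \<otimes> b) (b \<otimes> a) = fraction R \<one> \<one>"
    using T(2,3) \<open>a \<noteq> \<zero>\<close> by (subst frac_eq_iff) (simp_all add: integral_iff m_comm)
  hence "T \<otimes>\<^bsub>frac_field R\<^esub> fraction R b a = \<one>\<^bsub>frac_field R\<^esub>"
    using T(2,3) \<open>a \<noteq> \<zero>\<close> by (simp add: T(1) frac_mult frac_field_one)
  moreover have "fraction R b a \<in> carrier (frac_field R)" using T(2,3) \<open>a \<noteq> \<zero>\<close> by auto
  ultimately show "\<exists>Y\<in>carrier (frac_field R). T \<otimes>\<^bsub>frac_field R\<^esub> Y = \<one>\<^bsub>frac_field R\<^esub>" by blast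
qed

end


section \<open>Valuations\<close>

text \<open>Ordered groups are records with a carrier (written multiplicatively, as everywhere in
  HOL-Algebra) rather than a type class, so that the value group of an extension can be
  quantified existentially.\<close>

record 'g ordered_group = "'g monoid" +
  grp_le :: "'g \<Rightarrow> 'g \<Rightarrow> bool" (infix \<open>\<preceq>\<index>\<close> 50)

locale ordered_comm_group = comm_group \<Phi> for \<Phi> :: "('g, 'p) ordered_group_scheme" (structure) +
  assumes le_antisym: "\<lbrakk>x \<in> carrier \<Phi>; y \<in> carrier \<Phi>; x \<preceq> y; y \<preceq> x\<rbrakk> \<Longrightarrow> x = y"
    and le_trans: "\<lbrakk>x \<in> carrier \<Phi>; y \<in> carrier \<Phi>; z \<in> carrier \<Phi>; x \<preceq> y; y \<preceq> z\<rbrakk> \<Longrightarrow> x \<preceq> z"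
    and le_total: "\<lbrakk>x \<in> carrier \<Phi>; y \<in> carrier \<Phi>\<rbrakk> \<Longrightarrow> x \<preceq> y \<or> y \<preceq> x"
    and le_mult: "\<lbrakk>x \<in> carrier \<Phi>; y \<in> carrier \<Phi>; z \<in> carrier \<Phi>; x \<preceq> y\<rbrakk> \<Longrightarrow> x \<otimes> z \<preceq> y \<otimes> z"

text \<open>A valuation is only constrained on nonzero elements; its value at zero is irrelevant and
  stands for infinity. The last clause says \<open>\<nu> (x + y) \<ge> min (\<nu> x) (\<nu> y)\<close>.\<close>

definition valuation ::
    "('k, 'm) ring_scheme \<Rightarrow> ('g, 'p) ordered_group_scheme \<Rightarrow> ('k \<Rightarrow> 'g) \<Rightarrow> bool" where
  "valuation K \<Phi> \<nu> \<longleftrightarrow> field K \<and> ordered_comm_group \<Phi> \<and> \<nu> \<in> hom (Multiplicative_Group.mult_of K) \<Phi> \<and>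
     (\<forall>x \<in> carrier K - {\<zero>\<^bsub>K\<^esub>}. \<forall>y \<in> carrier K - {\<zero>\<^bsub>K\<^esub>}. x \<oplus>\<^bsub>K\<^esub> y \<noteq> \<zero>\<^bsub>K\<^esub> \<longrightarrow>
        \<nu> x \<preceq>\<^bsub>\<Phi>\<^esub> \<nu> (x \<oplus>\<^bsub>K\<^esub> y) \<or> \<nu> y \<preceq>\<^bsub>\<Phi>\<^esub> \<nu> (x \<oplus>\<^bsub>K\<^esub> y))"

definition val_ring ::
    "('k, 'm) ring_scheme \<Rightarrow> ('g, 'p) ordered_group_scheme \<Rightarrow> ('k \<Rightarrow> 'g) \<Rightarrow> 'k set" where
  "val_ring K \<Phi> \<nu> = {x \<in> carrier K. x = \<zero>\<^bsub>K\<^esub> \<or> \<one>\<^bsub>\<Phi>\<^esub> \<preceq>\<^bsub>\<Phi>\<^esub> \<nu> x}"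

definition val_ideal ::
    "('k, 'm) ring_scheme \<Rightarrow> ('g, 'p) ordered_group_scheme \<Rightarrow> ('k \<Rightarrow> 'g) \<Rightarrow> 'k set" where
  "val_ideal K \<Phi> \<nu> =
     {x \<in> carrier K. x = \<zero>\<^bsub>K\<^esub> \<or> \<one>\<^bsub>\<Phi>\<^esub> \<preceq>\<^bsub>\<Phi>\<^esub> \<nu> x \<and> \<nu> x \<noteq> \<one>\<^bsub>\<Phi>\<^esub>}"

definition value_group ::
    "('k, 'm) ring_scheme \<Rightarrow> ('g, 'p) ordered_group_scheme \<Rightarrow> ('k \<Rightarrow> 'g) \<Rightarrow>
      ('g, 'p) ordered_group_scheme" where
  "value_group K \<Phi> \<nu> = \<Phi>\<lparr>carrier := \<nu> ` (carrier K - {\<zero>\<^bsub>K\<^esub>})\<rparr>"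

definition centered_valuation ::
    "('a, 'm) ring_scheme \<Rightarrow> ('g, 'p) ordered_group_scheme \<Rightarrow> (('a \<times> 'a) set \<Rightarrow> 'g) \<Rightarrow> bool" where
  "centered_valuation R \<Phi> \<nu> \<longleftrightarrow> valuation (frac_field R) \<Phi> \<nu> \<and>
     frac_emb R ` carrier R \<subseteq> val_ring (frac_field R) \<Phi> \<nu> \<and>
     {a \<in> carrier R. frac_emb R a \<in> val_ideal (frac_field R) \<Phi> \<nu>} = max_ideal R"

text \<open>Here \<open>j\<close> is the embedding of the field \<open>K\<close> into the field \<open>L\<close>.\<close>

definition val_extends ::
    "('k, 'm) ring_scheme \<Rightarrow> ('g, 'p) ordered_group_scheme \<Rightarrow> ('k \<Rightarrow> 'g) \<Rightarrow>
     ('l, 'n) ring_scheme \<Rightarrow> ('h, 'q) ordered_group_scheme \<Rightarrow> ('l \<Rightarrow> 'h) \<Rightarrow> ('k \<Rightarrow> 'l) \<Rightarrow> bool" where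
  "val_extends K \<Phi> \<nu> L \<Psi> \<mu> j \<longleftrightarrow> {x \<in> carrier K. j x \<in> val_ring L \<Psi> \<mu>} = val_ring K \<Phi> \<nu>"

text \<open>The inclusion of value groups \<open>\<nu> x \<mapsto> \<mu> (j x)\<close> is an isomorphism of ordered groups.\<close>

definition same_value_group ::
    "('k, 'm) ring_scheme \<Rightarrow> ('g, 'p) ordered_group_scheme \<Rightarrow> ('k \<Rightarrow> 'g) \<Rightarrow>
     ('l, 'n) ring_scheme \<Rightarrow> ('h, 'q) ordered_group_scheme \<Rightarrow> ('l \<Rightarrow> 'h) \<Rightarrow> ('k \<Rightarrow> 'l) \<Rightarrow> bool" where
  "same_value_group K \<Phi> \<nu> L \<Psi> \<mu> j \<longleftrightarrow>
     (\<exists>e \<in> iso (value_group K \<Phi> \<nu>) (value_group L \<Psi> \<mu>).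
        (\<forall>x \<in> carrier K - {\<zero>\<^bsub>K\<^esub>}. e (\<nu> x) = \<mu> (j x)) \<and>
        (\<forall>a \<in> carrier (value_group K \<Phi> \<nu>). \<forall>b \<in> carrier (value_group K \<Phi> \<nu>).
           a \<preceq>\<^bsub>\<Phi>\<^esub> b \<longleftrightarrow> e a \<preceq>\<^bsub>\<Psi>\<^esub> e b))"

lemma valuation_on_fibres:
  fixes K :: "('k, 'm) ring_scheme" and \<Phi> :: "('g, 'p) ordered_group_scheme"
  assumes val: "valuation K \<Phi> \<nu>"
  obtains \<Psi> :: "'k set ordered_group" and \<mu> where
    "valuation K \<Psi> \<mu>" "val_ring K \<Psi> \<mu> = val_ring K \<Phi> \<nu>" "val_ideal K \<Psi> \<mu> = val_ideal K \<Phi> \<nu>"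
    "same_value_group K \<Phi> \<nu> K \<Psi> \<mu> id"
proof -
  interpret K: field K using val by (simp add: valuation_def)
  interpret G: ordered_comm_group \<Phi> using val by (simp add: valuation_def)
  define U where "U = carrier K - {\<zero>\<^bsub>K\<^esub>}"
  define F where "F c = {x \<in> U. \<nu> x = c}" for c
  define V where "V T = \<nu> (SOME x. x \<in> T)" for T
  define \<Psi> :: "'k set ordered_group" where
    "\<Psi> = \<lparr>carrier = F ` \<nu> ` U, monoid.mult = (\<lambda>T Y. F (V T \<otimes>\<^bsub>\<Phi>\<^esub> V Y)), one = F \<one>\<^bsub>\<Phi>\<^esub>,
          grp_le = (\<lambda>T Y. V T \<preceq>\<^bsub>\<Phi>\<^esub> V Y)\<rparr>"
  define \<mu> where "\<mu> x = F (\<nu> x)" for x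
  have VF: "V (F c) = c" if "c \<in> \<nu> ` U" for c
  proof -
    have "\<exists>x. x \<in> F c" using that by (auto simp: F_def)
    hence "(SOME x. x \<in> F c) \<in> F c" by (rule someI_ex)
    thus ?thesis by (simp add: V_def F_def)
  qed
  have hom: "\<nu> \<in> hom (Multiplicative_Group.mult_of K) \<Phi>" using val by (simp add: valuation_def)
  interpret h: group_hom "Multiplicative_Group.mult_of K" \<Phi> \<nu>
    using hom K.field_mult_group G.is_group by (simp add: group_hom_def group_hom_axioms_def)
  have carr: "carrier (Multiplicative_Group.mult_of K) = U" by (simp add: U_def)
  have sub: "subgroup (\<nu> ` U) \<Phi>" using h.img_is_subgroup by (simp add: U_def)
  have in\<Phi>: "c \<in> carrier \<Phi>" if "c \<in> \<nu> ` U" for c using subgroup.mem_carrier[OF sub that] .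
  have one: "\<one>\<^bsub>\<Phi>\<^esub> \<in> \<nu> ` U" using subgroup.one_closed[OF sub] .
  have mc: "a \<otimes>\<^bsub>\<Phi>\<^esub> b \<in> \<nu> ` U" if "a \<in> \<nu> ` U" "b \<in> \<nu> ` U" for a b
    using subgroup.m_closed[OF sub that] .
  have ic: "inv\<^bsub>\<Phi>\<^esub> a \<in> \<nu> ` U" if "a \<in> \<nu> ` U" for a
    using subgroup.m_inv_closed[OF sub that] .
  have \<Psi>_simps: "carrier \<Psi> = F ` \<nu> ` U" "\<one>\<^bsub>\<Psi>\<^esub> = F \<one>\<^bsub>\<Phi>\<^esub>" by (simp_all add: \<Psi>_def)
  have \<Psi>_mult: "F a \<otimes>\<^bsub>\<Psi>\<^esub> F b = F (a \<otimes>\<^bsub>\<Phi>\<^esub> b)" if "a \<in> \<nu> ` U" "b \<in> \<nu> ` U" for a b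
    using that by (simp add: \<Psi>_def VF)
  have \<Psi>_le: "F a \<preceq>\<^bsub>\<Psi>\<^esub> F b \<longleftrightarrow> a \<preceq>\<^bsub>\<Phi>\<^esub> b" if "a \<in> \<nu> ` U" "b \<in> \<nu> ` U" for a b
    using that by (simp add: \<Psi>_def VF)
  have F_inj: "F a = F b \<longleftrightarrow> a = b" if "a \<in> \<nu> ` U" "b \<in> \<nu> ` U" for a b
    using VF that by metis
  have cg: "comm_group \<Psi>"
  proof (rule comm_groupI)
    fix T Y W assume "T \<in> carrier \<Psi>" "Y \<in> carrier \<Psi>" "W \<in> carrier \<Psi>"
    then obtain a b c where *: "T = F a" "Y = F b" "W = F c" "a \<in> \<nu> ` U" "b \<in> \<nu> ` U" "c \<in> \<nu> ` U"
      by (auto simp only: \<Psi>_simps image_iff)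
    note i = *(4-6)[THEN in\<Phi>]
    show "T \<otimes>\<^bsub>\<Psi>\<^esub> Y \<otimes>\<^bsub>\<Psi>\<^esub> W = T \<otimes>\<^bsub>\<Psi>\<^esub> (Y \<otimes>\<^bsub>\<Psi>\<^esub> W)"
      using i by (simp only: * \<Psi>_mult mc G.m_assoc)
  next
    fix T Y assume "T \<in> carrier \<Psi>" "Y \<in> carrier \<Psi>"
    then obtain a b where *: "T = F a" "Y = F b" "a \<in> \<nu> ` U" "b \<in> \<nu> ` U"
      by (auto simp only: \<Psi>_simps image_iff)
    note i = *(3-4)[THEN in\<Phi>]
    show "T \<otimes>\<^bsub>\<Psi>\<^esub> Y \<in> carrier \<Psi>"
      unfolding * \<Psi>_mult[OF *(3,4)] \<Psi>_simps using mc[OF *(3,4)] by (rule imageI)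
    show "T \<otimes>\<^bsub>\<Psi>\<^esub> Y = Y \<otimes>\<^bsub>\<Psi>\<^esub> T"
      using G.m_comm[OF i] by (simp only: * \<Psi>_mult)
  next
    fix T assume "T \<in> carrier \<Psi>"
    then obtain a where *: "T = F a" "a \<in> \<nu> ` U" by (auto simp only: \<Psi>_simps image_iff)
    note i = *(2)[THEN in\<Phi>]
    show "\<one>\<^bsub>\<Psi>\<^esub> \<otimes>\<^bsub>\<Psi>\<^esub> T = T"
      unfolding * \<Psi>_simps \<Psi>_mult[OF one *(2)] using i by simp
    show "\<exists>Y\<in>carrier \<Psi>. Y \<otimes>\<^bsub>\<Psi>\<^esub> T = \<one>\<^bsub>\<Psi>\<^esub>"
    proof
      show "F (inv\<^bsub>\<Phi>\<^esub> a) \<otimes>\<^bsub>\<Psi>\<^esub> T = \<one>\<^bsub>\<Psi>\<^esub>"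
        unfolding * \<Psi>_simps \<Psi>_mult[OF ic[OF *(2)] *(2)] using i by simp
      show "F (inv\<^bsub>\<Phi>\<^esub> a) \<in> carrier \<Psi>" unfolding \<Psi>_simps using ic[OF *(2)] by (rule imageI)
    qed
  next
    show "\<one>\<^bsub>\<Psi>\<^esub> \<in> carrier \<Psi>" unfolding \<Psi>_simps using one by (rule imageI)
  qed
  have ocg: "ordered_comm_group \<Psi>"
  proof (intro ordered_comm_group.intro ordered_comm_group_axioms.intro cg)
    fix T Y assume "T \<in> carrier \<Psi>" "Y \<in> carrier \<Psi>"
    then obtain a b where *: "T = F a" "Y = F b" "a \<in> \<nu> ` U" "b \<in> \<nu> ` U"
      by (auto simp only: \<Psi>_simps image_iff)
    note i = *(3-4)[THEN in\<Phi>]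
    show "T \<preceq>\<^bsub>\<Psi>\<^esub> Y \<or> Y \<preceq>\<^bsub>\<Psi>\<^esub> T" using G.le_total[OF i] by (simp only: * \<Psi>_le)
    assume "T \<preceq>\<^bsub>\<Psi>\<^esub> Y" "Y \<preceq>\<^bsub>\<Psi>\<^esub> T"
    thus "T = Y" using G.le_antisym[OF i] by (simp only: * \<Psi>_le)
  next
    fix T Y W assume "T \<in> carrier \<Psi>" "Y \<in> carrier \<Psi>" "W \<in> carrier \<Psi>" and XY: "T \<preceq>\<^bsub>\<Psi>\<^esub> Y"
    then obtain a b c where *: "T = F a" "Y = F b" "W = F c" "a \<in> \<nu> ` U" "b \<in> \<nu> ` U" "c \<in> \<nu> ` U"
      by (auto simp only: \<Psi>_simps image_iff)
    note i = *(4-6)[THEN in\<Phi>]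
    show "T \<otimes>\<^bsub>\<Psi>\<^esub> W \<preceq>\<^bsub>\<Psi>\<^esub> Y \<otimes>\<^bsub>\<Psi>\<^esub> W"
      using G.le_mult[OF i] XY by (simp only: * \<Psi>_le \<Psi>_mult mc)
    assume "Y \<preceq>\<^bsub>\<Psi>\<^esub> W"
    thus "T \<preceq>\<^bsub>\<Psi>\<^esub> W" using G.le_trans[OF i] XY by (simp only: * \<Psi>_le)
  qed
  have \<nu>U: "\<nu> x \<in> \<nu> ` U" if "x \<in> U" for x using that by (rule imageI)
  have hom': "\<mu> \<in> hom (Multiplicative_Group.mult_of K) \<Psi>"
  proof (rule homI)
    fix x y assume "x \<in> carrier (Multiplicative_Group.mult_of K)" "y \<in> carrier (Multiplicative_Group.mult_of K)"
    hence xy: "x \<in> U" "y \<in> U" by (auto simp: U_def)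
    show "\<mu> x \<in> carrier \<Psi>" unfolding \<mu>_def \<Psi>_simps using xy by blast
    show "\<mu> (x \<otimes>\<^bsub>Multiplicative_Group.mult_of K\<^esub> y) = \<mu> x \<otimes>\<^bsub>\<Psi>\<^esub> \<mu> y"
      unfolding \<mu>_def \<Psi>_mult[OF \<nu>U[OF xy(1)] \<nu>U[OF xy(2)]]
      using h.hom_mult[of x y] xy by (simp add: U_def)
  qed
  have "valuation K \<Psi> \<mu>"
    unfolding valuation_def
  proof (intro conjI ballI impI K.field_axioms ocg hom')
    fix x y assume "x \<in> carrier K - {\<zero>\<^bsub>K\<^esub>}" "y \<in> carrier K - {\<zero>\<^bsub>K\<^esub>}" "x \<oplus>\<^bsub>K\<^esub> y \<noteq> \<zero>\<^bsub>K\<^esub>"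
    moreover from this have "x \<in> U" "y \<in> U" "x \<oplus>\<^bsub>K\<^esub> y \<in> U" by (auto simp: U_def)
    ultimately show "\<mu> x \<preceq>\<^bsub>\<Psi>\<^esub> \<mu> (x \<oplus>\<^bsub>K\<^esub> y) \<or> \<mu> y \<preceq>\<^bsub>\<Psi>\<^esub> \<mu> (x \<oplus>\<^bsub>K\<^esub> y)"
      using val by (simp add: valuation_def \<mu>_def \<Psi>_le)
  qed
  moreover have le1: "\<one>\<^bsub>\<Psi>\<^esub> \<preceq>\<^bsub>\<Psi>\<^esub> \<mu> x \<longleftrightarrow> \<one>\<^bsub>\<Phi>\<^esub> \<preceq>\<^bsub>\<Phi>\<^esub> \<nu> x"
    and eq1: "\<mu> x = \<one>\<^bsub>\<Psi>\<^esub> \<longleftrightarrow> \<nu> x = \<one>\<^bsub>\<Phi>\<^esub>" if "x \<in> carrier K" "x \<noteq> \<zero>\<^bsub>K\<^esub>" for x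
  proof -
    have "\<nu> x \<in> \<nu> ` U" using that by (simp add: U_def)
    thus "\<one>\<^bsub>\<Psi>\<^esub> \<preceq>\<^bsub>\<Psi>\<^esub> \<mu> x \<longleftrightarrow> \<one>\<^bsub>\<Phi>\<^esub> \<preceq>\<^bsub>\<Phi>\<^esub> \<nu> x" "\<mu> x = \<one>\<^bsub>\<Psi>\<^esub> \<longleftrightarrow> \<nu> x = \<one>\<^bsub>\<Phi>\<^esub>"
      using one unfolding \<Psi>_simps \<mu>_def by (simp_all only: \<Psi>_le F_inj)
  qed
  have "val_ring K \<Psi> \<mu> = val_ring K \<Phi> \<nu>" "val_ideal K \<Psi> \<mu> = val_ideal K \<Phi> \<nu>"
    using le1 eq1 by (auto simp: val_ring_def val_ideal_def)
  moreover have "same_value_group K \<Phi> \<nu> K \<Psi> \<mu> id"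
    unfolding same_value_group_def
  proof (intro bexI conjI ballI)
    have img: "\<mu> ` U = F ` \<nu> ` U" by (auto simp: \<mu>_def)
    show "F \<in> iso (value_group K \<Phi> \<nu>) (value_group K \<Psi> \<mu>)"
      unfolding iso_def bij_betw_def
    proof (intro CollectI conjI homI inj_onI)
      show "F ` carrier (value_group K \<Phi> \<nu>) = carrier (value_group K \<Psi> \<mu>)"
        using img by (simp add: value_group_def U_def)
    qed (use F_inj \<Psi>_mult img in \<open>auto simp: value_group_def U_def[symmetric]\<close>)
  qed (auto simp: value_group_def \<mu>_def \<Psi>_le U_def)
  ultimately show thesis by (rule that)
qed


section \<open>Extensions to quotients of the henselization\<close>

definition quot_emb :: "('b, 'n) ring_scheme \<Rightarrow> ('a \<Rightarrow> 'b) \<Rightarrow> 'b set \<Rightarrow> 'a \<Rightarrow> 'b set" where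
  "quot_emb Rh i H x = H +>\<^bsub>Rh\<^esub> i x"

abbreviation quot_frac_map ::
    "('b, 'n) ring_scheme \<Rightarrow> ('a \<Rightarrow> 'b) \<Rightarrow> 'b set \<Rightarrow> ('a \<times> 'a) set \<Rightarrow> ('b set \<times> 'b set) set" where
  "quot_frac_map Rh i H \<equiv> frac_map (Rh Quot H) (quot_emb Rh i H)"

text \<open>The ordered group \<open>\<Psi>\<close> lives on the type of sets of elements of the fraction field \<open>L\<close>
  of \<open>Rh/H\<close>. Up to equivalence every valuation of \<open>L\<close> is of this form, the fibres of the
  valuation serving as values: see lemma \<open>valuation_on_fibres\<close>.\<close>

definition quot_extension ::
    "('a, 'm) ring_scheme \<Rightarrow> ('b, 'n) ring_scheme \<Rightarrow> ('a \<Rightarrow> 'b) \<Rightarrow>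
     ('g, 'p) ordered_group_scheme \<Rightarrow> (('a \<times> 'a) set \<Rightarrow> 'g) \<Rightarrow> 'b set \<Rightarrow>
     ('b set \<times> 'b set) set set ordered_group \<Rightarrow>
     (('b set \<times> 'b set) set \<Rightarrow> ('b set \<times> 'b set) set set) \<Rightarrow> bool" where
  "quot_extension R Rh i \<Phi> \<nu> H \<Psi> \<mu> \<longleftrightarrow>
     centered_valuation (Rh Quot H) \<Psi> \<mu> \<and>
     val_extends (frac_field R) \<Phi> \<nu> (frac_field (Rh Quot H)) \<Psi> \<mu> (quot_frac_map Rh i H)"

definition extension_prime ::
    "('a, 'm) ring_scheme \<Rightarrow> ('b, 'n) ring_scheme \<Rightarrow> ('a \<Rightarrow> 'b) \<Rightarrow>
     ('g, 'p) ordered_group_scheme \<Rightarrow> (('a \<times> 'a) set \<Rightarrow> 'g) \<Rightarrow> 'b set \<Rightarrow> bool" where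
  "extension_prime R Rh i \<Phi> \<nu> H \<longleftrightarrow>
     primeideal H Rh \<and> {x \<in> carrier R. i x \<in> H} = {\<zero>\<^bsub>R\<^esub>} \<and>
     (\<exists>\<Psi> \<mu>. quot_extension R Rh i \<Phi> \<nu> H \<Psi> \<mu>)"

end

theory Submission
  imports Defs
begin

text \<open>Valuations are handled as valuation subrings \<open>W\<close> of fields, without value groups. Let \<open>\<Omega>\<close>
  be an algebraic closure of \<open>K = Frac R\<close> with a valuation subring \<open>W\<close> extending that of \<open>\<nu>\<close>, and let
  \<open>F\<close> be a maximal subfield of \<open>\<Omega>\<close> with the same values as \<open>K\<close>. By an argument of Kaplansky
  \<open>W \<inter> F\<close> is henselian, so the universal property gives \<open>\<theta> : R\<^sup>h \<rightarrow> W \<inter> F\<close>. Its kernel is the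
  required prime, and the induced valuation has the values of \<open>K\<close> by the choice of \<open>F\<close>.

  For uniqueness let \<open>\<theta>'\<close> come from another prime and extension. An isomorphism between valued
  subfields that is compatible with \<open>\<theta>\<close> and \<open>\<theta>'\<close> on \<open>C \<subseteq> R\<^sup>h\<close> extends to simple roots, so for a
  maximal one \<open>C\<close> is henselian, and then \<open>C = R\<^sup>h\<close> by the universal property. Hence \<open>\<theta>\<close> and \<open>\<theta>'\<close>
  have the same kernel and induce the same valuation. Every prime \<open>Q\<close> contained in \<open>ker \<theta>\<close> also
  carries an extension of \<open>\<nu>\<close>, by Chevalley's theorem; so uniqueness forces \<open>Q = ker \<theta>\<close>, which
  is therefore minimal.\<close>

section \<open>Local rings and valuation subrings\<close>

text \<open>The obstacle is that the elements of \<open>Rh\<close> are inaccessible: the ring need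
  be neither a domain nor noetherian and is known only through its universal property. Every
  statement about it must come from a homomorphism into a henselian ring or from a henselian
  subring, and valued fields supply both.

  The field \<open>F\<close> need not be a henselization of \<open>K\<close>, since its residue
  field may be larger. This is harmless because only values matter, and it lets Zorn's lemma replace
  an explicit construction. The test rings of the universal property have a fixed type, so
  \<open>W \<inter> F\<close> must be coded into it; this works because its elements are algebraic
  over \<open>K\<close>.

  In the uniqueness part one field is algebraically closed, but the other is the fraction field of a
  quotient of \<open>Rh\<close>, so conjugates of a root are available on one side only. Elements
  integral at all conjugates are therefore written as polynomials with coefficients in
  \<open>W \<inter> F\<close>, divided by the derivative (Lagrange interpolation); such expressions
  make sense in both fields.\<close>

lemma local_ringI:
  assumes S: "cring S" and M: "ideal M S" and one: "\<one>\<^bsub>S\<^esub> \<notin> M"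
    and inv: "\<And>x. x \<in> carrier S \<Longrightarrow> x \<notin> M \<Longrightarrow> \<exists>y \<in> carrier S. x \<otimes>\<^bsub>S\<^esub> y = \<one>\<^bsub>S\<^esub>"
  shows "local_ring S" and "max_ideal S = M"
proof -
  interpret S: cring S by fact
  interpret M: ideal M S by fact
  \<comment> \<open>A proper ideal contains no units, and everything outside \<open>M\<close> is a
    unit. So \<open>M\<close> contains all proper ideals and is the only maximal one.\<close>
  have sub: "I \<subseteq> M" if I: "ideal I S" "\<one>\<^bsub>S\<^esub> \<notin> I" for I
  proof
    interpret I: ideal I S by fact
    fix x assume x: "x \<in> I"
    show "x \<in> M"
    proof (rule ccontr)
      assume "x \<notin> M"
      then obtain y where "y \<in> carrier S" "x \<otimes>\<^bsub>S\<^esub> y = \<one>\<^bsub>S\<^esub>" using inv[of x] x I.Icarr by blast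
      thus False using I.I_r_closed[OF x, of y] I by simp
    qed
  qed
  have proper: "\<one>\<^bsub>S\<^esub> \<notin> I" if "ideal I S" "I \<noteq> carrier S" for I
    using ideal.one_imp_carrier that by metis
  have max: "maximalideal M S"
  proof (rule maximalidealI[OF M])
    show "carrier S \<noteq> M" using one S.one_closed by auto
    fix J assume J: "ideal J S" "M \<subseteq> J" "J \<subseteq> carrier S"
    show "J = M \<or> J = carrier S" using sub[OF J(1)] proper[OF J(1)] J(2) by blast
  qed
  have "I = M" if "maximalideal I S" for I
  proof -
    interpret I: maximalideal I S by fact
    have "\<one>\<^bsub>S\<^esub> \<notin> I" using proper[OF I.is_ideal] I.I_notcarr by auto
    hence "I \<subseteq> M" using sub[OF I.is_ideal] by auto
    thus ?thesis using I.I_maximal[OF M] one M.a_subset by auto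
  qed
  with max have ex1: "\<exists>!I. maximalideal I S" by auto
  show "local_ring S" unfolding local_ring_def using S ex1 by simp
  show "max_ideal S = M" unfolding max_ideal_def using ex1 max by (rule the1_equality)
qed

lemma local_ring_max_ideal:
  assumes "local_ring S"
  shows "cring S" "maximalideal (max_ideal S) S" "ideal (max_ideal S) S" "\<one>\<^bsub>S\<^esub> \<notin> max_ideal S"
proof -
  show "cring S" and m: "maximalideal (max_ideal S) S"
    using assms theI'[of "\<lambda>I. maximalideal I S"] by (auto simp: local_ring_def max_ideal_def)
  interpret maximalideal "max_ideal S" S by fact
  show "ideal (max_ideal S) S" by (rule is_ideal)
  show "\<one>\<^bsub>S\<^esub> \<notin> max_ideal S" using I_notcarr one_imp_carrier by auto
qed

text \<open>Zorn's lemma for the ideals without \<open>\<one>\<close>: the union of a chain of them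
  still lacks \<open>\<one>\<close>.\<close>

lemma (in cring) exists_maximalideal:
  assumes I: "ideal I R" "\<one> \<notin> I"
  shows "\<exists>J. maximalideal J R \<and> I \<subseteq> J"
proof -
  define C where "C = {J. ideal J R \<and> I \<subseteq> J \<and> \<one> \<notin> J}"
  have "\<exists>J\<in>C. \<forall>J'\<in>C. J \<subseteq> J' \<longrightarrow> J' = J"
  proof (rule subset_Zorn_nonempty)
    show "C \<noteq> {}" using I by (auto simp: C_def)
    fix \<C> assume ne: "\<C> \<noteq> {}" and ch: "subset.chain C \<C>"
    have "subset.chain {J. ideal J R} \<C>"
      using ch by (auto simp: C_def subset.chain_def)
    hence "ideal (\<Union>\<C>) R" using chain_Union_is_ideal[of \<C>] ne by auto
    thus "\<Union>\<C> \<in> C" using ch ne by (auto simp: C_def subset.chain_def)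
  qed
  then obtain J where J: "J \<in> C" "\<And>J'. J' \<in> C \<Longrightarrow> J \<subseteq> J' \<Longrightarrow> J' = J" by blast
  have "maximalideal J R"
  proof (rule maximalidealI)
    show "ideal J R" "carrier R \<noteq> J" using J(1) by (auto simp: C_def)
    fix J' assume J': "ideal J' R" "J \<subseteq> J'" "J' \<subseteq> carrier R"
    show "J' = J \<or> J' = carrier R"
    proof (cases "\<one> \<in> J'")
      case True
      thus ?thesis using ideal.one_imp_carrier[OF J'(1)] by simp
    next
      case False
      hence "J' \<in> C" using J J' by (auto simp: C_def)
      thus ?thesis using J(2) J'(2) by auto
    qed
  qed
  thus ?thesis using J(1) by (auto simp: C_def)
qed

text \<open>Otherwise the principal ideal of \<open>x\<close> is proper and lies in a maximal ideal,
  which can only be \<open>max_ideal S\<close>.\<close>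

lemma local_ring_inverse:
  assumes S: "local_ring S" and x: "x \<in> carrier S" "x \<notin> max_ideal S"
  shows "\<exists>y \<in> carrier S. x \<otimes>\<^bsub>S\<^esub> y = \<one>\<^bsub>S\<^esub>"
proof -
  interpret S: cring S using S by (simp add: local_ring_def)
  have "\<one>\<^bsub>S\<^esub> \<in> PIdl\<^bsub>S\<^esub> x"
  proof (rule ccontr)
    assume "\<one>\<^bsub>S\<^esub> \<notin> PIdl\<^bsub>S\<^esub> x"
    then obtain J where J: "maximalideal J S" "PIdl\<^bsub>S\<^esub> x \<subseteq> J"
      using S.exists_maximalideal[OF S.cgenideal_ideal[OF x(1)]] by blast
    have "J = max_ideal S"
      using J(1) local_ring_max_ideal(2)[OF S] S by (auto simp: local_ring_def)
    thus False using J(2) x S.cgenideal_self by blast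
  qed
  thus ?thesis using x(1) by (force simp: cgenideal_def S.m_comm)
qed

section \<open>Fractions in a field\<close>

context field
begin

lemma inv_closed' [simp, intro]: "x \<in> carrier R \<Longrightarrow> x \<noteq> \<zero> \<Longrightarrow> inv x \<in> carrier R"
  and r_inv' [simp]: "x \<in> carrier R \<Longrightarrow> x \<noteq> \<zero> \<Longrightarrow> x \<otimes> inv x = \<one>"
  and l_inv' [simp]: "x \<in> carrier R \<Longrightarrow> x \<noteq> \<zero> \<Longrightarrow> inv x \<otimes> x = \<one>"
  and inv_inv' [simp]: "x \<in> carrier R \<Longrightarrow> x \<noteq> \<zero> \<Longrightarrow> inv (inv x) = x"
  using field_Units by auto

lemma inv_nonzero [simp]: "x \<in> carrier R \<Longrightarrow> x \<noteq> \<zero> \<Longrightarrow> inv x \<noteq> \<zero>"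
  using r_inv'[of x] by fastforce

lemma inv_mult:
  assumes "x \<in> carrier R" "y \<in> carrier R" "x \<noteq> \<zero>" "y \<noteq> \<zero>"
  shows "inv (x \<otimes> y) = inv x \<otimes> inv y"
proof (rule comm_inv_char)
  have "x \<otimes> y \<otimes> (inv x \<otimes> inv y) = (x \<otimes> inv x) \<otimes> (y \<otimes> inv y)"
    using assms by (simp add: m_ac del: r_inv' l_inv' Units_r_inv Units_l_inv)
  thus "x \<otimes> y \<otimes> (inv x \<otimes> inv y) = \<one>" using assms by simp
qed (use assms in auto)

lemma inv_eqI: "\<lbrakk>x \<in> carrier R; y \<in> carrier R; x \<otimes> y = \<one>\<rbrakk> \<Longrightarrow> inv x = y"
  by (rule comm_inv_char)

lemma eq_div_iff:
  "\<lbrakk>x \<in> carrier R; y \<in> carrier R; z \<in> carrier R; y \<noteq> \<zero>\<rbrakk> \<Longrightarrow> z = x \<otimes> inv y \<longleftrightarrow> z \<otimes> y = x"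
  by (metis inv_closed' l_inv' m_assoc r_inv' r_one)

lemma frac_add_rule:
  "\<lbrakk>a \<in> carrier R; b \<in> carrier R; c \<in> carrier R; d \<in> carrier R; b \<noteq> \<zero>; d \<noteq> \<zero>\<rbrakk> \<Longrightarrow>
    a \<otimes> inv b \<oplus> c \<otimes> inv d = (a \<otimes> d \<oplus> c \<otimes> b) \<otimes> inv (b \<otimes> d)"
proof -
  assume a: "a \<in> carrier R" "b \<in> carrier R" "c \<in> carrier R" "d \<in> carrier R" "b \<noteq> \<zero>" "d \<noteq> \<zero>"
  have "(a \<otimes> d \<oplus> c \<otimes> b) \<otimes> (inv b \<otimes> inv d) = (a \<otimes> inv b) \<otimes> (d \<otimes> inv d) \<oplus> (c \<otimes> inv d) \<otimes> (b \<otimes> inv b)"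
    using a by (simp add: l_distr r_distr m_ac del: l_inv' r_inv' Units_l_inv Units_r_inv)
  thus ?thesis using a by (simp add: inv_mult)
qed

lemma frac_mult_rule:
  "\<lbrakk>a \<in> carrier R; b \<in> carrier R; c \<in> carrier R; d \<in> carrier R; b \<noteq> \<zero>; d \<noteq> \<zero>\<rbrakk> \<Longrightarrow>
    (a \<otimes> inv b) \<otimes> (c \<otimes> inv d) = (a \<otimes> c) \<otimes> inv (b \<otimes> d)"
  by (simp add: inv_mult m_ac)

lemma frac_inv_rule:
  "\<lbrakk>a \<in> carrier R; b \<in> carrier R; a \<noteq> \<zero>; b \<noteq> \<zero>\<rbrakk> \<Longrightarrow> inv (a \<otimes> inv b) = b \<otimes> inv a"
  by (simp add: inv_mult m_comm)

end

section \<open>Valuation subrings and their maximal ideals\<close>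

definition vmax :: "('a, 'm) ring_scheme \<Rightarrow> 'a set \<Rightarrow> 'a set" where
  "vmax L V = {x \<in> V. x = \<zero>\<^bsub>L\<^esub> \<or> inv\<^bsub>L\<^esub> x \<notin> V}"

text \<open>A valuation up to equivalence, without a value group. In \<open>vmax\<close>, the
  nonunits of \<open>V\<close>, zero is a separate clause because its inverse has no prescribed
  value.\<close>

locale valuation_subring = field L for L (structure) and V +
  assumes subring: "subring V L"
    and inv_in: "\<lbrakk>x \<in> carrier L; x \<notin> V\<rbrakk> \<Longrightarrow> inv x \<in> V"
begin

abbreviation \<mm> where "\<mm> \<equiv> vmax L V"

lemma V_carr [simp, intro]: "x \<in> V \<Longrightarrow> x \<in> carrier L"
  and V_zero [simp]: "\<zero> \<in> V" and V_one [simp]: "\<one> \<in> V"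
  and V_inv: "x \<in> V \<Longrightarrow> \<ominus> x \<in> V"
  and V_mult: "x \<in> V \<Longrightarrow> y \<in> V \<Longrightarrow> x \<otimes> y \<in> V"
  and V_add: "x \<in> V \<Longrightarrow> y \<in> V \<Longrightarrow> x \<oplus> y \<in> V"
  and V_minus: "x \<in> V \<Longrightarrow> y \<in> V \<Longrightarrow> x \<ominus> y \<in> V"
  using subringE[OF subring] by (auto simp: a_minus_def)

lemma V_pow: "x \<in> V \<Longrightarrow> x [^] (n::nat) \<in> V"
  by (induct n) (auto intro: V_mult)

lemma m_V: "x \<in> \<mm> \<Longrightarrow> x \<in> V" and m_zero [simp]: "\<zero> \<in> \<mm>" and m_one [simp]: "\<one> \<notin> \<mm>"
  by (auto simp: vmax_def)

lemma m_carr [simp]: "x \<in> \<mm> \<Longrightarrow> x \<in> carrier L"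
  using m_V by blast

lemma unitD: "x \<in> V \<Longrightarrow> x \<notin> \<mm> \<Longrightarrow> x \<noteq> \<zero>" "x \<in> V \<Longrightarrow> x \<notin> \<mm> \<Longrightarrow> inv x \<in> V"
  by (auto simp: vmax_def)

lemma unit_inv: "x \<in> V \<Longrightarrow> x \<notin> \<mm> \<Longrightarrow> inv x \<notin> \<mm>"
  by (auto simp: vmax_def)

lemma unitI: "\<lbrakk>x \<in> V; y \<in> V; x \<otimes> y = \<one>\<rbrakk> \<Longrightarrow> x \<notin> \<mm>"
  using inv_eqI[of x y] by (auto simp: vmax_def)

text \<open>If \<open>x \<otimes> y\<close> were a unit of \<open>V\<close>, then so would be
  \<open>y\<close>, with inverse \<open>x \<otimes> inv (x \<otimes> y)\<close>.\<close>

lemma m_mult: assumes "x \<in> V" "y \<in> \<mm>" shows "x \<otimes> y \<in> \<mm>" "y \<otimes> x \<in> \<mm>"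
proof -
  have c: "x \<otimes> y \<in> V" using assms m_V V_mult by auto
  show "x \<otimes> y \<in> \<mm>"
  proof (rule ccontr)
    assume "x \<otimes> y \<notin> \<mm>"
    note u = unitD[OF c this]
    have cl: "x \<in> carrier L" "y \<in> carrier L" using assms by auto
    have "y \<otimes> (x \<otimes> inv (x \<otimes> y)) = \<one>"
      using r_inv'[of "x \<otimes> y"] u c cl by (metis V_carr m_assoc m_comm)
    hence "y \<notin> \<mm>" using unitI[of y "x \<otimes> inv (x \<otimes> y)"] u assms m_V V_mult by blast
    thus False using assms by simp
  qed
  thus "y \<otimes> x \<in> \<mm>" using assms by (simp add: m_comm)
qed

lemma notin_V: assumes "x \<in> carrier L" "x \<notin> V" shows "x \<noteq> \<zero>" "inv x \<in> \<mm>"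
proof -
  show n: "x \<noteq> \<zero>" using assms by auto
  show "inv x \<in> \<mm>" using assms inv_in[OF assms] n by (simp add: vmax_def)
qed

lemma m_inv_notin: "x \<in> \<mm> \<Longrightarrow> x \<noteq> \<zero> \<Longrightarrow> inv x \<notin> V"
  by (auto simp: vmax_def)

lemma m_neg: "x \<in> \<mm> \<Longrightarrow> \<ominus> x \<in> \<mm>"
  using m_mult(1)[of "\<ominus> \<one>" x] V_inv[of \<one>] by (simp add: l_minus)

text \<open>Of two nonzero elements one divides the other in \<open>V\<close>. Factoring out the
  divisor writes the sum as an element of \<open>V\<close> times an element of
  \<open>\<mm>\<close>.\<close>

lemma m_add: assumes "x \<in> \<mm>" "y \<in> \<mm>" shows "x \<oplus> y \<in> \<mm>"
proof -
  have cl: "x \<in> carrier L" "y \<in> carrier L" using assms by auto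
  have aux: "x \<oplus> y \<in> \<mm>" if "x \<in> \<mm>" "y \<in> \<mm>" "x \<noteq> \<zero>" "inv x \<otimes> y \<in> V" for x y
  proof -
    have "x \<oplus> y = x \<otimes> (\<one> \<oplus> inv x \<otimes> y)"
      using that m_carr[OF that(1)] m_carr[OF that(2)] by (simp add: r_distr m_assoc[symmetric])
    thus ?thesis using m_mult(2)[OF V_add[OF V_one that(4)] that(1)] by simp
  qed
  consider "x = \<zero>" | "y = \<zero>" | "x \<noteq> \<zero>" "inv x \<otimes> y \<in> V" | "x \<noteq> \<zero>" "y \<noteq> \<zero>" "inv x \<otimes> y \<notin> V" by blast
  thus ?thesis
  proof cases
    case 4
    have "inv (inv x \<otimes> y) = inv y \<otimes> x" using 4 cl by (simp add: inv_mult m_comm)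
    hence "inv y \<otimes> x \<in> V" using inv_in[of "inv x \<otimes> y"] 4 cl by simp
    hence "y \<oplus> x \<in> \<mm>" using aux 4 assms by blast
    thus ?thesis using cl by (simp add: a_comm)
  qed (use assms aux cl in auto)
qed

lemma m_minus: "x \<in> \<mm> \<Longrightarrow> y \<in> \<mm> \<Longrightarrow> x \<ominus> y \<in> \<mm>"
  by (simp add: a_minus_def m_add m_neg)

lemma unit_cong: assumes "x \<in> V" "y \<in> V" "x \<ominus> y \<in> \<mm>" shows "x \<in> \<mm> \<longleftrightarrow> y \<in> \<mm>"
proof -
  have cl: "x \<in> carrier L" "y \<in> carrier L" using assms by auto
  have "x = (x \<ominus> y) \<oplus> y" "y = x \<ominus> (x \<ominus> y)" using cl by algebra+
  thus ?thesis using m_add[OF assms(3)] m_minus[OF _ assms(3)] by metis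
qed

lemma unit_mult_iff: assumes "x \<in> V" "y \<in> V" shows "x \<otimes> y \<in> \<mm> \<longleftrightarrow> x \<in> \<mm> \<or> y \<in> \<mm>"
proof
  assume a: "x \<otimes> y \<in> \<mm>"
  show "x \<in> \<mm> \<or> y \<in> \<mm>"
  proof (rule ccontr)
    assume "\<not> (x \<in> \<mm> \<or> y \<in> \<mm>)"
    hence *: "x \<notin> \<mm>" by simp
    note u = unitD[OF assms(1) *]
    have "inv x \<otimes> (x \<otimes> y) = y" using u assms V_carr by (metis V_carr inv_closed' l_inv' l_one m_assoc)
    thus False using m_mult(1)[OF u(2) a] \<open>\<not> (x \<in> \<mm> \<or> y \<in> \<mm>)\<close> by simp
  qed
qed (use assms m_mult in blast)

end

section \<open>Chevalley extension of places\<close>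

text \<open>Horner sums: the values at \<open>x\<close> of the polynomials with coefficients in \<open>J\<close> and at most \<open>n\<close> terms.\<close>

primrec (in ring) hsums :: "'a set \<Rightarrow> 'a \<Rightarrow> nat \<Rightarrow> 'a set" where
  "hsums J x 0 = {\<zero>}"
| "hsums J x (Suc n) = {a \<oplus> x \<otimes> y | a y. a \<in> J \<and> y \<in> hsums J x n}"

context cring
begin

lemma hsums_carr:
  assumes "J \<subseteq> carrier R" "x \<in> carrier R" "y \<in> hsums J x n"
  shows "y \<in> carrier R"
  using assms(3) by (induction n arbitrary: y) (use assms(1,2) in auto)

lemma hsums_Suc: "\<lbrakk>\<zero> \<in> J; J \<subseteq> carrier R; x \<in> carrier R; y \<in> hsums J x n\<rbrakk> \<Longrightarrow> y \<in> hsums J x (Suc n)"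
proof (induction n arbitrary: y)
  case 0 thus ?case by (auto intro!: exI[of _ \<zero>])
next
  case (Suc n)
  then obtain a z where "y = a \<oplus> x \<otimes> z" "a \<in> J" "z \<in> hsums J x n" by auto
  thus ?case using Suc by (subst hsums.simps) blast
qed

lemma hsums_mono: "\<lbrakk>\<zero> \<in> J; J \<subseteq> carrier R; x \<in> carrier R; y \<in> hsums J x n; n \<le> m\<rbrakk> \<Longrightarrow> y \<in> hsums J x m"
  by (rotate_tac 4, induction m rule: dec_induct) (auto intro: hsums_Suc simp del: hsums.simps)

lemma hsums_add:
  assumes J: "J \<subseteq> carrier R" "\<And>a b. a \<in> J \<Longrightarrow> b \<in> J \<Longrightarrow> a \<oplus> b \<in> J" and x: "x \<in> carrier R"
  shows "\<lbrakk>y \<in> hsums J x n; z \<in> hsums J x n\<rbrakk> \<Longrightarrow> y \<oplus> z \<in> hsums J x n"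
proof (induction n arbitrary: y z)
  case (Suc n)
  then obtain a u b v where *: "y = a \<oplus> x \<otimes> u" "z = b \<oplus> x \<otimes> v" "a \<in> J" "b \<in> J" "u \<in> hsums J x n" "v \<in> hsums J x n"
    by auto
  note c = hsums_carr[OF J(1) x *(5)] hsums_carr[OF J(1) x *(6)]
  have "a \<in> carrier R" "b \<in> carrier R" using J *(3,4) by auto
  hence "y \<oplus> z = (a \<oplus> b) \<oplus> x \<otimes> (u \<oplus> v)" unfolding * using c x by algebra
  thus ?case using Suc.IH[OF *(5,6)] J(2)[OF *(3,4)] by auto
qed simp

lemma hsums_scale:
  assumes J: "J \<subseteq> carrier R" "\<And>a. a \<in> J \<Longrightarrow> v \<otimes> a \<in> J" and v: "v \<in> carrier R" and x: "x \<in> carrier R"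
  shows "y \<in> hsums J x n \<Longrightarrow> v \<otimes> y \<in> hsums J x n"
proof (induction n arbitrary: y)
  case (Suc n)
  then obtain a u where *: "y = a \<oplus> x \<otimes> u" "a \<in> J" "u \<in> hsums J x n" by auto
  note c = hsums_carr[OF J(1) x *(3)]
  have "a \<in> carrier R" using J *(2) by auto
  hence "v \<otimes> y = v \<otimes> a \<oplus> x \<otimes> (v \<otimes> u)" unfolding * using c x v by algebra
  thus ?case using Suc.IH[OF *(3)] J(2)[OF *(2)] by auto
qed (use v in simp)

text \<open>The Horner recursion exposes the constant term. Shortening a relation in Chevalley's
  argument requires the leading term instead.\<close>

lemma hsums_top:
  assumes J: "J \<subseteq> carrier R" and x: "x \<in> carrier R"
  shows "y \<in> hsums J x (Suc n) \<Longrightarrow> \<exists>u\<in>hsums J x n. \<exists>a\<in>J. y = u \<oplus> a \<otimes> x [^] n"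
proof (induction n arbitrary: y)
  case 0
  then obtain a where "a \<in> J" "y = a" using J x by auto
  thus ?case using J x by (auto intro!: bexI[of _ a])
next
  case (Suc n)
  then obtain a z where *: "y = a \<oplus> x \<otimes> z" "a \<in> J" "z \<in> hsums J x (Suc n)" by auto
  obtain u b where u: "u \<in> hsums J x n" "b \<in> J" "z = u \<oplus> b \<otimes> x [^] n" using Suc.IH[OF *(3)] by auto
  have c: "a \<in> carrier R" "b \<in> carrier R" "u \<in> carrier R" using * u J hsums_carr[OF J x] by auto
  have "y = (a \<oplus> x \<otimes> u) \<oplus> b \<otimes> x [^] Suc n"
    unfolding *(1) u(3) using c x by (simp add: r_distr m_ac a_ac)
  thus ?case using u *(2) by auto
qed

lemma hsums_power:
  assumes J: "\<zero> \<in> J" "J \<subseteq> carrier R" and a: "a \<in> J" and x: "x \<in> carrier R"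
  shows "k < n \<Longrightarrow> a \<otimes> x [^] k \<in> hsums J x n"
proof (induction n arbitrary: k)
  case (Suc n)
  have ac: "a \<in> carrier R" using a J by auto
  show ?case
  proof (cases k)
    case 0
    have "\<zero> \<in> hsums J x n" using hsums_mono[OF J x, of \<zero> 0 n] by simp
    moreover have "a \<otimes> x [^] k = a \<oplus> x \<otimes> \<zero>" using 0 ac x by simp
    ultimately show ?thesis using a by auto
  next
    case (Suc k')
    have "a \<otimes> x [^] k = \<zero> \<oplus> x \<otimes> (a \<otimes> x [^] k')" using Suc ac x by (simp add: m_ac)
    moreover have "a \<otimes> x [^] k' \<in> hsums J x n" using Suc.IH Suc Suc.prems by simp
    ultimately show ?thesis using J by auto
  qed
qed simp

text \<open>Multiplication by a power of \<open>x\<close> reverses a polynomial in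
  \<open>x' = 1/x\<close>. The additional factor \<open>x'\<close> brings the exponents into the
  range from \<open>n - k\<close> to \<open>n - 1\<close>, so \<open>n\<close> terms
  suffice.\<close>

lemma hsums_reverse:
  assumes J: "\<zero> \<in> J" "J \<subseteq> carrier R" "\<And>a b. a \<in> J \<Longrightarrow> b \<in> J \<Longrightarrow> a \<oplus> b \<in> J"
    and x: "x \<in> carrier R" "x' \<in> carrier R" "x \<otimes> x' = \<one>"
  shows "y \<in> hsums J x' k \<Longrightarrow> k \<le> n \<Longrightarrow> x [^] n \<otimes> (x' \<otimes> y) \<in> hsums J x n"
proof (induction k arbitrary: y n)
  case 0
  thus ?case using x hsums_mono[OF J(1,2) x(1), of \<zero> 0 n] by simp
next
  case (Suc k)
  then obtain a z where *: "y = a \<oplus> x' \<otimes> z" "a \<in> J" "z \<in> hsums J x' k" by auto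
  from Suc obtain m where m: "n = Suc m" "k \<le> m" by (cases n) auto
  have c: "a \<in> carrier R" "z \<in> carrier R" using * J hsums_carr[OF J(2) x(2)] by auto
  have "x [^] n \<otimes> (x' \<otimes> y) = x [^] m \<otimes> (x \<otimes> x') \<otimes> y" using m x(1,2) c * by (simp add: m_ac)
  also have "\<dots> = x [^] m \<otimes> y" using x c * by simp
  also have "\<dots> = a \<otimes> x [^] m \<oplus> x [^] m \<otimes> (x' \<otimes> z)" using x c * by (simp add: r_distr m_ac)
  finally have e: "x [^] n \<otimes> (x' \<otimes> y) = a \<otimes> x [^] m \<oplus> x [^] m \<otimes> (x' \<otimes> z)" .
  have "a \<otimes> x [^] m \<in> hsums J x n" using hsums_power[OF J(1,2) *(2) x(1), of m n] m by simp
  moreover have "x [^] m \<otimes> (x' \<otimes> z) \<in> hsums J x n"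
    using hsums_Suc[OF J(1,2) x(1) Suc.IH[OF *(3) m(2)]] m by simp
  ultimately show ?case unfolding e using hsums_add[OF J(2,3) x(1)] by blast
qed

end

context cring
begin

lemma hsums_mult_x: assumes "\<zero> \<in> J" "J \<subseteq> carrier R" "x \<in> carrier R" "y \<in> hsums J x n"
  shows "x \<otimes> y \<in> hsums J x (Suc n)"
proof -
  have "x \<otimes> y = \<zero> \<oplus> x \<otimes> y" using assms hsums_carr[of J x y n] by simp
  thus ?thesis using assms by auto
qed

text \<open>With \<open>J = A\<close> this says that \<open>A[x]\<close> is closed under products;
  with an ideal \<open>J\<close> of \<open>A\<close> it says that \<open>J A[x]\<close> is stable
  under \<open>A[x]\<close>.\<close>

lemma hsums_mult:
  assumes A: "A \<subseteq> carrier R" and J: "\<zero> \<in> J" "J \<subseteq> carrier R" "\<And>a b. a \<in> J \<Longrightarrow> b \<in> J \<Longrightarrow> a \<oplus> b \<in> J"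
    "\<And>a b. a \<in> A \<Longrightarrow> b \<in> J \<Longrightarrow> a \<otimes> b \<in> J" and x: "x \<in> carrier R"
  shows "\<lbrakk>y \<in> hsums A x n; z \<in> hsums J x m\<rbrakk> \<Longrightarrow> y \<otimes> z \<in> hsums J x (n + m)"
proof (induction n arbitrary: y)
  case 0
  thus ?case using hsums_mono[OF J(1,2) x, of \<zero> 0 m] hsums_carr[OF J(2) x] by auto
next
  case (Suc n)
  then obtain a u where *: "y = a \<oplus> x \<otimes> u" "a \<in> A" "u \<in> hsums A x n" by auto
  have c: "a \<in> carrier R" "u \<in> carrier R" "z \<in> carrier R"
    using * A hsums_carr[OF A x] Suc hsums_carr[OF J(2) x] by auto
  have "y \<otimes> z = a \<otimes> z \<oplus> x \<otimes> (u \<otimes> z)" unfolding * using c x by algebra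
  moreover have "a \<otimes> z \<in> hsums J x (Suc n + m)"
    by (rule hsums_mono[OF J(1,2) x hsums_scale[OF J(2) J(4)[OF *(2)] c(1) x Suc.prems(2)]]) (simp_all add: trans_le_add2)
  moreover have "x \<otimes> (u \<otimes> z) \<in> hsums J x (Suc n + m)"
    using hsums_mult_x[OF J(1,2) x Suc.IH[OF *(3) Suc.prems(2)]] by simp
  ultimately show ?case using hsums_add[OF J(2,3) x] by (simp del: hsums.simps)
qed

lemma subring_hsums:
  assumes A: "subring A R" and x: "x \<in> carrier R"
  shows "subring (\<Union>n. hsums A x n) R"
proof (rule subringI)
  note a = subringE[OF A]
  show "(\<Union>n. hsums A x n) \<subseteq> carrier R" using hsums_carr[OF a(1) x] by auto
  have one: "\<one> \<in> hsums A x 1" using a x by (auto intro!: exI[of _ \<one>])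
  thus "\<one> \<in> (\<Union>n. hsums A x n)" by blast
  fix y assume "y \<in> (\<Union>n. hsums A x n)"
  then obtain n where y: "y \<in> hsums A x n" by auto
  have "\<ominus> \<one> \<otimes> y \<in> hsums A x n"
    by (rule hsums_scale[OF a(1) _ _ x y]) (use a in auto)
  moreover have "\<ominus> \<one> \<otimes> y = \<ominus> y" using hsums_carr[OF a(1) x y] by (simp add: l_minus)
  ultimately show "\<ominus> y \<in> (\<Union>n. hsums A x n)" by auto
  fix z assume "z \<in> (\<Union>n. hsums A x n)"
  then obtain m where z: "z \<in> hsums A x m" by auto
  show "y \<otimes> z \<in> (\<Union>n. hsums A x n)" using hsums_mult[OF a(1,2,1) _ _ x y z] a by blast
  have "y \<oplus> z \<in> hsums A x (max n m)"
    by (rule hsums_add[OF a(1) _ x hsums_mono[OF a(2,1) x y] hsums_mono[OF a(2,1) x z]]) (use a in auto)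
  thus "y \<oplus> z \<in> (\<Union>n. hsums A x n)" by blast
qed

end

theorem (in field) chevalley_extension:
  assumes B: "subring B R" and I: "I \<subseteq> B" "\<zero> \<in> I" "\<And>a b. a \<in> I \<Longrightarrow> b \<in> I \<Longrightarrow> a \<oplus> b \<in> I"
    "\<And>a b. a \<in> B \<Longrightarrow> b \<in> I \<Longrightarrow> a \<otimes> b \<in> I" "\<one> \<notin> I"
  obtains V where "valuation_subring R V" "B \<subseteq> V" "I \<subseteq> vmax R V"
proof -
  define good where "good A J \<longleftrightarrow> subring A R \<and> J \<subseteq> A \<and> \<zero> \<in> J \<and> (\<forall>a\<in>J. \<forall>b\<in>J. a \<oplus> b \<in> J) \<and>
    (\<forall>a\<in>A. \<forall>b\<in>J. a \<otimes> b \<in> J) \<and> \<one> \<notin> J" for A J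
  \<comment> \<open>A pair of a subring and an ideal is stored as one set of tagged elements.
    Extension of pairs is then plain inclusion, as in Zorn's lemma.\<close>
  define fs sn where "fs S = {x. (x, False) \<in> S}" and "sn S = {x. (x, True) \<in> S}" for S :: "('a \<times> bool) set"
  define C where "C = {S. good (fs S) (sn S) \<and> B \<subseteq> fs S \<and> I \<subseteq> sn S}"
  have "\<exists>M\<in>C. \<forall>Y\<in>C. M \<subseteq> Y \<longrightarrow> Y = M"
  proof (rule subset_Zorn_nonempty)
    have "fs (B \<times> {False} \<union> I \<times> {True}) = B" "sn (B \<times> {False} \<union> I \<times> {True}) = I"
      by (auto simp: fs_def sn_def)
    hence "B \<times> {False} \<union> I \<times> {True} \<in> C" using B I by (simp add: C_def good_def)
    thus "C \<noteq> {}" by blast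
    fix \<C> assume ne: "\<C> \<noteq> {}" and ch: "subset.chain C \<C>"
    have g: "good (fs S) (sn S)" "B \<subseteq> fs S" "I \<subseteq> sn S" if "S \<in> \<C>" for S
      using ch that by (auto simp: subset.chain_def C_def)
    have two: "\<exists>S\<in>\<C>. p \<in> S \<and> q \<in> S" if pq: "p \<in> \<Union>\<C>" "q \<in> \<Union>\<C>" for p q
    proof -
      obtain S where "S \<in> \<C>" "p \<in> S" using pq(1) by blast
      moreover obtain T where "T \<in> \<C>" "q \<in> T" using pq(2) by blast
      moreover note *  = calculation
      ultimately have "S \<subseteq> T \<or> T \<subseteq> S" using ch by (auto simp: subset.chain_def)
      thus ?thesis using * by blast
    qed
    have sr: "subring (fs S) R" if "S \<in> \<C>" for S using g(1)[OF that] by (simp add: good_def)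
    have "subring (fs (\<Union>\<C>)) R"
    proof (rule subringI)
      show "fs (\<Union>\<C>) \<subseteq> carrier R" using subringE(1)[OF sr] by (auto simp: fs_def)
      show "\<one> \<in> fs (\<Union>\<C>)" using ne subringE(3)[OF sr] by (auto simp: fs_def)
      fix x assume x: "x \<in> fs (\<Union>\<C>)"
      then obtain T where T: "T \<in> \<C>" "x \<in> fs T" by (auto simp: fs_def)
      thus "\<ominus> x \<in> fs (\<Union>\<C>)" using subringE(5)[OF sr[OF T(1)] T(2)] by (auto simp: fs_def)
      fix y assume y: "y \<in> fs (\<Union>\<C>)"
      obtain S where "S \<in> \<C>" "x \<in> fs S" "y \<in> fs S"
        using two[of "(x, False)" "(y, False)"] x y by (auto simp: fs_def)
      hence "x \<otimes> y \<in> fs S" "x \<oplus> y \<in> fs S" using subringE(6,7)[OF sr] by auto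
      thus "x \<otimes> y \<in> fs (\<Union>\<C>)" "x \<oplus> y \<in> fs (\<Union>\<C>)" using \<open>S \<in> \<C>\<close> by (auto simp: fs_def)
    qed
    moreover have "a \<oplus> b \<in> sn (\<Union>\<C>)" if ab: "a \<in> sn (\<Union>\<C>)" "b \<in> sn (\<Union>\<C>)" for a b
    proof -
      obtain S where S: "S \<in> \<C>" "a \<in> sn S" "b \<in> sn S"
        using two[of "(a, True)" "(b, True)"] ab by (auto simp: sn_def)
      hence "a \<oplus> b \<in> sn S" using g(1)[OF S(1)] by (auto simp: good_def)
      thus ?thesis using S(1) by (auto simp: sn_def)
    qed
    moreover have "a \<otimes> b \<in> sn (\<Union>\<C>)" if ab: "a \<in> fs (\<Union>\<C>)" "b \<in> sn (\<Union>\<C>)" for a b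
    proof -
      obtain S where S: "S \<in> \<C>" "a \<in> fs S" "b \<in> sn S"
        using two[of "(a, False)" "(b, True)"] ab by (auto simp: sn_def fs_def)
      hence "a \<otimes> b \<in> sn S" using g(1)[OF S(1)] by (auto simp: good_def)
      thus ?thesis using S(1) by (auto simp: sn_def)
    qed
    moreover have "sn (\<Union>\<C>) \<subseteq> fs (\<Union>\<C>)" "\<zero> \<in> sn (\<Union>\<C>)" "\<one> \<notin> sn (\<Union>\<C>)" "B \<subseteq> fs (\<Union>\<C>)" "I \<subseteq> sn (\<Union>\<C>)"
    proof -
      obtain S where S: "S \<in> \<C>" using ne by auto
      show "sn (\<Union>\<C>) \<subseteq> fs (\<Union>\<C>)"
      proof
        fix x assume "x \<in> sn (\<Union>\<C>)"
        then obtain T where T: "T \<in> \<C>" "x \<in> sn T" by (auto simp: sn_def)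
        hence "x \<in> fs T" using g(1)[OF T(1)] by (auto simp: good_def)
        thus "x \<in> fs (\<Union>\<C>)" using T(1) by (auto simp: fs_def)
      qed
      have "\<zero> \<in> sn S" using g(1)[OF S] by (auto simp: good_def)
      thus "\<zero> \<in> sn (\<Union>\<C>)" "B \<subseteq> fs (\<Union>\<C>)" "I \<subseteq> sn (\<Union>\<C>)"
        using g(2,3)[OF S] S by (auto simp: fs_def sn_def)
      show "\<one> \<notin> sn (\<Union>\<C>)"
      proof
        assume "\<one> \<in> sn (\<Union>\<C>)"
        then obtain T where T: "T \<in> \<C>" "\<one> \<in> sn T" by (auto simp: sn_def)
        thus False using g(1)[OF T(1)] by (auto simp: good_def)
      qed
    qed
    ultimately show "\<Union>\<C> \<in> C" by (simp add: C_def good_def)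
  qed
  then obtain M where M: "M \<in> C" "\<And>Y. Y \<in> C \<Longrightarrow> M \<subseteq> Y \<Longrightarrow> Y = M" by blast
  define A J where "A = fs M" and "J = sn M"
  have A: "subring A R" and J: "J \<subseteq> A" "\<zero> \<in> J" "\<And>a b. a \<in> J \<Longrightarrow> b \<in> J \<Longrightarrow> a \<oplus> b \<in> J"
      "\<And>a b. a \<in> A \<Longrightarrow> b \<in> J \<Longrightarrow> a \<otimes> b \<in> J" "\<one> \<notin> J" and BI: "B \<subseteq> A" "I \<subseteq> J"
    using M(1) by (auto simp: C_def good_def A_def J_def)
  note AE = subringE[OF A]
  have Jc: "J \<subseteq> carrier R" using J(1) AE(1) by auto
  \<comment> \<open>If \<open>\<one>\<close> were not in \<open>J A[x]\<close>, then
    \<open>(A[x], J A[x])\<close> would be a strictly larger pair.\<close>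
  have one_in: "\<exists>n. \<one> \<in> hsums J x n" if x: "x \<in> carrier R" "x \<notin> A" for x
  proof (rule ccontr)
    assume none: "\<nexists>n. \<one> \<in> hsums J x n"
    define A' J' where "A' = (\<Union>n. hsums A x n)" and "J' = (\<Union>n. hsums J x n)"
    have JA: "hsums J x n \<subseteq> hsums A x n" for n
      by (induction n) (use J(1) in auto)
    have sub: "J \<subseteq> J'" "A \<subseteq> A'"
    proof -
      have "a \<in> hsums J x 1" if "a \<in> J" for a using that Jc x by (auto intro!: exI[of _ a])
      thus "J \<subseteq> J'" by (auto simp: J'_def simp del: hsums.simps)
      have "a \<in> hsums A x 1" if "a \<in> A" for a using that AE(1) x by (auto intro!: exI[of _ a])
      thus "A \<subseteq> A'" by (auto simp: A'_def simp del: hsums.simps)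
    qed
    have "good A' J'"
      unfolding good_def
    proof (intro conjI ballI)
      show "subring A' R" unfolding A'_def by (rule subring_hsums[OF A x(1)])
      show "J' \<subseteq> A'" using JA by (auto simp: A'_def J'_def)
      show "\<zero> \<in> J'" using sub J(2) by auto
      show "\<one> \<notin> J'" using none by (auto simp: J'_def)
      fix b assume "b \<in> J'"
      then obtain m where b: "b \<in> hsums J x m" by (auto simp: J'_def)
      { fix a assume "a \<in> A'"
        then obtain n where a: "a \<in> hsums A x n" by (auto simp: A'_def)
        show "a \<otimes> b \<in> J'" using hsums_mult[OF AE(1) J(2) Jc J(3,4) x(1) a b] by (auto simp: J'_def) }
      fix a assume "a \<in> J'"
      then obtain n where a: "a \<in> hsums J x n" by (auto simp: J'_def)
      have "a \<oplus> b \<in> hsums J x (max n m)"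
        by (rule hsums_add[OF Jc J(3) x(1) hsums_mono[OF J(2) Jc x(1) a] hsums_mono[OF J(2) Jc x(1) b]]) auto
      thus "a \<oplus> b \<in> J'" by (auto simp: J'_def)
    qed
    hence "A' \<times> {False} \<union> J' \<times> {True} \<in> C"
      using sub BI by (auto simp: C_def fs_def sn_def)
    moreover have "M \<subseteq> A' \<times> {False} \<union> J' \<times> {True}"
    proof
      fix p assume "p \<in> M"
      thus "p \<in> A' \<times> {False} \<union> J' \<times> {True}" using sub by (cases p; cases "snd p") (auto simp: A_def J_def fs_def sn_def)
    qed
    ultimately have "A' \<times> {False} \<union> J' \<times> {True} = M" by (rule M(2))
    hence "A' = A" by (auto simp: A_def fs_def)
    moreover have "x \<in> hsums A x 2"
      using x AE by (simp add: numeral_2_eq_2) (metis AE(2,3) l_zero r_null r_one r_zero zero_closed one_closed)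
    hence "x \<in> A'" by (auto simp: A'_def simp del: hsums.simps)
    ultimately show False using x by simp
  qed
  \<comment> \<open>If the inverse of \<open>u = \<one> \<ominus> b\<close> were not in
    \<open>A\<close>, then \<open>\<one>\<close> would be a polynomial in it over \<open>J\<close>,
    and clearing denominators would put a power of \<open>u\<close> into \<open>J\<close>. But
    \<open>u \<oplus> b = \<one>\<close> allows a descent from \<open>u [^] Suc k\<close> to
    \<open>u [^] k\<close>, and finally to \<open>\<one>\<close>.\<close>
  have unit: "inv (\<one> \<ominus> b) \<in> A" "\<one> \<ominus> b \<noteq> \<zero>" if b: "b \<in> J" for b
  proof -
    define u where "u = \<one> \<ominus> b"
    have bc: "b \<in> carrier R" using b Jc by auto
    have u: "u \<in> carrier R" "u \<in> A" using bc b J(1) AE by (auto simp: u_def a_minus_def)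
    have pow: "u [^] (k::nat) \<in> A" for k using u(2) AE by (induct k) auto
    have npow: "u [^] (k::nat) \<notin> J" for k
    proof (induction k)
      case (Suc k)
      show ?case
      proof
        assume *: "u [^] Suc k \<in> J"
        have "u [^] k = u [^] Suc k \<oplus> u [^] k \<otimes> b"
        proof -
          have "u \<oplus> b = \<one>" unfolding u_def using bc by algebra
          hence "u [^] k \<otimes> (u \<oplus> b) = u [^] k" using u(1) by simp
          thus ?thesis using u(1) bc by (simp add: r_distr)
        qed
        moreover have "u [^] k \<otimes> b \<in> J" using J(4)[OF pow b] .
        ultimately show False using Suc J(3)[OF *] by metis
      qed
    qed (simp add: J)
    show nz: "\<one> \<ominus> b \<noteq> \<zero>" using npow[of 1] J(2) u(1) by (auto simp: u_def)
    show "inv (\<one> \<ominus> b) \<in> A"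
    proof (rule ccontr)
      assume a: "inv (\<one> \<ominus> b) \<notin> A"
      have iu: "inv u \<in> carrier R" "u \<otimes> inv u = \<one>" using u(1) nz by (auto simp: u_def)
      obtain n where n: "\<one> \<in> hsums J (inv u) n" using one_in[OF iu(1)] a by (auto simp: u_def)
      have "u [^] Suc n \<otimes> (inv u \<otimes> \<one>) \<in> hsums J u (Suc n)"
        by (rule hsums_reverse[OF J(2) Jc J(3) u(1) iu n]) auto
      moreover have "u [^] Suc n \<otimes> (inv u \<otimes> \<one>) = u [^] n" using u(1) iu by (simp add: m_assoc)
      moreover have "hsums J u k \<subseteq> J" for k
        by (induction k) (use J u in auto)
      ultimately show False using npow[of n] by (auto simp del: hsums.simps)
    qed
  qed
  \<comment> \<open>Let the relation for \<open>x\<close> be shortest and that for \<open>x'\<close>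
    no longer. The second one reads \<open>u = x' \<otimes> z\<close> with
    \<open>u = \<one> \<ominus> b\<close> a unit of \<open>A\<close>. Dividing by \<open>u\<close>
    expresses \<open>x [^] n'\<close> by lower powers of \<open>x\<close>, and substituting this for
    the leading term of the first relation shortens it.\<close>
  have absurd: False if x: "x \<in> carrier R" "x' \<in> carrier R" "x \<otimes> x' = \<one>"
    and n: "\<one> \<in> hsums J x n" "\<And>k. k < n \<Longrightarrow> \<one> \<notin> hsums J x k" and m: "\<one> \<in> hsums J x' m" "m \<le> n" for x x' n m
  proof -
    obtain n' where n': "n = Suc n'" using n(1) by (cases n) auto
    obtain m' where m': "m = Suc m'" using m(1) by (cases m) auto
    obtain y a where y: "y \<in> hsums J x n'" "a \<in> J" "\<one> = y \<oplus> a \<otimes> x [^] n'"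
      using hsums_top[OF Jc x(1)] n(1) n' by blast
    obtain b z where z: "b \<in> J" "z \<in> hsums J x' m'" "\<one> = b \<oplus> x' \<otimes> z" using m(1) m' by auto
    have c: "a \<in> carrier R" "b \<in> carrier R" "z \<in> carrier R" "y \<in> carrier R"
      using y z Jc hsums_carr[OF Jc x(2)] hsums_carr[OF Jc x(1)] by auto
    define u where "u = \<one> \<ominus> b"
    have "u = x' \<otimes> z" unfolding u_def z(3) using c x by algebra
    have u: "u \<in> carrier R" "u \<noteq> \<zero>" "inv u \<in> A" using unit[OF z(1)] c by (auto simp: u_def)
    have "x [^] n' \<otimes> u \<in> hsums J x n'"
      using hsums_reverse[OF J(2) Jc J(3) x z(2)] m' n' m(2) \<open>u = x' \<otimes> z\<close> by simp
    moreover have v: "a \<otimes> inv u \<in> A" using y(2) J(1) u(3) AE by auto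
    ultimately have "(a \<otimes> inv u) \<otimes> (x [^] n' \<otimes> u) \<in> hsums J x n'"
      using hsums_scale[OF Jc J(4)[OF v]] AE(1) x(1) by blast
    moreover have "(a \<otimes> inv u) \<otimes> (x [^] n' \<otimes> u) = a \<otimes> x [^] n' \<otimes> (u \<otimes> inv u)"
      using c u x by (simp add: m_ac del: r_inv' l_inv' Units_r_inv Units_l_inv)
    hence "(a \<otimes> inv u) \<otimes> (x [^] n' \<otimes> u) = a \<otimes> x [^] n'" using u c x by simp
    ultimately have "\<one> \<in> hsums J x n'" using hsums_add[OF Jc J(3) x(1) y(1)] y(3) by metis
    thus False using n(2) n' by simp
  qed
  have val: "valuation_subring R A"
  proof (intro valuation_subring.intro field_axioms valuation_subring_axioms.intro A)
    fix x assume x: "x \<in> carrier R" "x \<notin> A"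
    hence nz: "x \<noteq> \<zero>" using AE(2) by auto
    show "inv x \<in> A"
    proof (rule ccontr)
      assume x': "inv x \<notin> A"
      have c: "inv x \<in> carrier R" "x \<otimes> inv x = \<one>" "inv x \<otimes> x = \<one>" using x nz by auto
      define n m where "n = (LEAST k. \<one> \<in> hsums J x k)" and "m = (LEAST k. \<one> \<in> hsums J (inv x) k)"
      have n: "\<one> \<in> hsums J x n" "\<And>k. k < n \<Longrightarrow> \<one> \<notin> hsums J x k"
        unfolding n_def using one_in[OF x] by (auto intro: LeastI dest: not_less_Least)
      have m: "\<one> \<in> hsums J (inv x) m" "\<And>k. k < m \<Longrightarrow> \<one> \<notin> hsums J (inv x) k"
        unfolding m_def using one_in[OF c(1) x'] by (auto intro: LeastI dest: not_less_Least)
      show False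
        using absurd[OF x(1) c(1,2) n m(1)] absurd[OF c(1) x(1) c(3) m n(1)] by linarith
    qed
  qed
  \<comment> \<open>An element of \<open>J\<close> with inverse in \<open>A\<close> would put
    \<open>\<one>\<close> into \<open>J\<close>.\<close>
  moreover have "J \<subseteq> vmax R A"
  proof
    fix j assume j: "j \<in> J"
    have "inv j \<notin> A" if "j \<noteq> \<zero>"
      using J(4)[of "inv j" j] J(5) j that Jc by auto
    thus "j \<in> vmax R A" using j J(1) by (auto simp: vmax_def)
  qed
  ultimately show thesis using that BI by blast
qed

section \<open>Derivatives and products of linear factors\<close>

declare (in ring) poly_add.simps [simp del] poly_mult.simps [simp del]
declare (in domain) poly_add.simps [simp del] poly_mult.simps [simp del]

lemma (in ring) set_poly_deriv:
  assumes "subring K R" "set p \<subseteq> K"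
  shows "set (poly_deriv R p) \<subseteq> K"
proof -
  have "[n] \<cdot> a \<in> K" if "a \<in> K" for a and n :: nat
    by (induction n) (use subringE[OF assms(1)] that in auto)
  thus ?thesis using assms(2) by (induction p) auto
qed

lemma (in ring) length_poly_deriv: "length (poly_deriv R p) = length p - 1"
  by (induction p) (auto simp: Suc_leI)

lemma (in ring) coeff_poly_deriv:
  "set p \<subseteq> carrier R \<Longrightarrow> coeff (poly_deriv R p) i = [Suc i] \<cdot> coeff p (Suc i)"
proof (induction p)
  case (Cons a p)
  show ?case
  proof (cases "p = []")
    case False
    hence "length (poly_deriv R p) = length p - 1" "length p > 0" by (auto simp: length_poly_deriv)
    thus ?thesis using Cons False by (auto simp del: add.nat_pow_Suc)
  qed auto
qed auto

definition (in ring) lin :: "'a \<Rightarrow> 'a list" where "lin b = [\<one>, \<ominus> b]"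

text \<open>Members of \<open>K[X]\<close> have no leading zeros, but \<open>poly_deriv\<close> may
  produce them, for instance in positive characteristic.\<close>

definition (in ring) Dp :: "'a list \<Rightarrow> 'a list" where "Dp p = normalize (poly_deriv R p)"

primrec (in ring) lprod :: "'a list \<Rightarrow> 'a list" where
  "lprod [] = [\<one>]"
| "lprod (b # bs) = lin b \<otimes>\<^bsub>poly_ring R\<^esub> lprod bs"

context domain
begin

lemma univ_poly_carrierD: "subring K R \<Longrightarrow> p \<in> carrier (K[X]) \<Longrightarrow> set p \<subseteq> K"
  "subring K R \<Longrightarrow> p \<in> carrier (K[X]) \<Longrightarrow> set p \<subseteq> carrier R"
  using subringE(1)[of K R] by (auto simp: univ_poly_def polynomial_def)

lemma univ_poly_mono: "K \<subseteq> K' \<Longrightarrow> p \<in> carrier (K[X]) \<Longrightarrow> p \<in> carrier (K'[X])"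
  by (auto simp: univ_poly_def polynomial_def)

lemma univ_poly_mult_eq: "p \<otimes>\<^bsub>K[X]\<^esub> q = p \<otimes>\<^bsub>poly_ring R\<^esub> q"
  and univ_poly_add_eq: "p \<oplus>\<^bsub>K[X]\<^esub> q = p \<oplus>\<^bsub>poly_ring R\<^esub> q"
  and univ_poly_one_eq: "\<one>\<^bsub>K[X]\<^esub> = \<one>\<^bsub>poly_ring R\<^esub>"
  by (simp_all add: univ_poly_def)

lemma lin_closed: "subring K R \<Longrightarrow> b \<in> K \<Longrightarrow> lin b \<in> carrier (K[X])"
  using subringE[of K R] by (auto simp: univ_poly_def polynomial_def lin_def)

lemma lprod_closed:
  assumes K: "subring K R" and bs: "set bs \<subseteq> K"
  shows "lprod bs \<in> carrier (K[X])"
proof -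
  interpret UP: domain "K[X]" by (rule univ_poly_is_domain[OF K])
  show ?thesis using bs
  proof (induction bs)
    case Nil
    show ?case using UP.one_closed by (simp add: univ_poly_one)
  next
    case (Cons b bs)
    hence "lin b \<otimes>\<^bsub>K[X]\<^esub> lprod bs \<in> carrier (K[X])" by (intro UP.m_closed lin_closed[OF K]) simp_all
    thus ?case by (simp only: univ_poly_mult_eq[where K = K] lprod.simps)
  qed
qed

lemma lprod_monic: "set bs \<subseteq> carrier R \<Longrightarrow> lprod bs \<noteq> [] \<and> hd (lprod bs) = \<one> \<and> length (lprod bs) = Suc (length bs)"
proof (induction bs)
  case (Cons b bs)
  have c: "polynomial (carrier R) (lin b)" "polynomial (carrier R) (lprod bs)"
    using lin_closed[OF carrier_is_subring, of b] lprod_closed[OF carrier_is_subring, of bs] Cons(2)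
    by (auto simp: univ_poly_carrier)
  have e: "lprod (b # bs) = poly_mult (lin b) (lprod bs)" by (simp add: univ_poly_mult)
  have n: "poly_mult (lin b) (lprod bs) \<noteq> []"
    using poly_mult_integral[OF carrier_is_subring c] Cons by (auto simp: lin_def)
  have "degree (poly_mult (lin b) (lprod bs)) = Suc (length bs)"
    using poly_mult_degree_eq[OF carrier_is_subring c] Cons by (simp add: lin_def)
  hence "length (poly_mult (lin b) (lprod bs)) = Suc (Suc (length bs))" using n by (cases "poly_mult (lin b) (lprod bs)") auto
  moreover have "hd (poly_mult (lin b) (lprod bs)) = \<one>"
    using poly_mult_lead_coeff[OF carrier_is_subring c] Cons by (simp add: lin_def)
  ultimately show ?case using n e by simp
qed simp

lemma eval_lin: "b \<in> carrier R \<Longrightarrow> x \<in> carrier R \<Longrightarrow> eval (lin b) x = x \<ominus> b"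
  by (simp add: lin_def a_minus_def)

lemma eval_mult: "\<lbrakk>p \<in> carrier (poly_ring R); q \<in> carrier (poly_ring R); x \<in> carrier R\<rbrakk> \<Longrightarrow>
    eval (p \<otimes>\<^bsub>poly_ring R\<^esub> q) x = eval p x \<otimes> eval q x"
  and eval_add: "\<lbrakk>p \<in> carrier (poly_ring R); q \<in> carrier (poly_ring R); x \<in> carrier R\<rbrakk> \<Longrightarrow>
    eval (p \<oplus>\<^bsub>poly_ring R\<^esub> q) x = eval p x \<oplus> eval q x"
  using ring_hom_memE[OF eval_is_hom[OF carrier_is_subring]] by auto

lemma eval_closed: "\<lbrakk>subring K R; p \<in> carrier (K[X]); x \<in> K\<rbrakk> \<Longrightarrow> eval p x \<in> K"
  using ring.eval_in_carrier[OF subring_is_ring, of K p x] univ_poly_carrierD[of K p]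
  by simp

lemma eval_closed': "\<lbrakk>subring K R; set p \<subseteq> K; x \<in> K\<rbrakk> \<Longrightarrow> eval p x \<in> K"
  using ring.eval_in_carrier[OF subring_is_ring, of K p x] by simp

lemma eval_lprod_Cons: "\<lbrakk>set bs \<subseteq> carrier R; b \<in> carrier R; x \<in> carrier R\<rbrakk> \<Longrightarrow>
    eval (lprod (b # bs)) x = (x \<ominus> b) \<otimes> eval (lprod bs) x"
  using lin_closed[OF carrier_is_subring] lprod_closed[OF carrier_is_subring] by (simp add: eval_mult eval_lin)

lemma eval_lprod_zero_iff: "\<lbrakk>set bs \<subseteq> carrier R; x \<in> carrier R\<rbrakk> \<Longrightarrow> eval (lprod bs) x = \<zero> \<longleftrightarrow> x \<in> set bs"
proof (induction bs)
  case (Cons b bs)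
  have "eval (lprod bs) x \<in> carrier R"
    using eval_closed[OF carrier_is_subring lprod_closed[OF carrier_is_subring]] Cons by auto
  thus ?case using Cons
    by (simp add: eval_lprod_Cons integral_iff del: lprod.simps)
qed simp

lemma Dp_closed: "subring K R \<Longrightarrow> set p \<subseteq> K \<Longrightarrow> Dp p \<in> carrier (K[X])"
  using normalize_gives_polynomial[OF set_poly_deriv[of K p]] by (simp add: Dp_def univ_poly_carrier)

lemma eval_Dp: "set p \<subseteq> carrier R \<Longrightarrow> x \<in> carrier R \<Longrightarrow> eval (Dp p) x = eval (poly_deriv R p) x"
  using eval_normalize[OF set_poly_deriv[OF carrier_is_subring]] by (simp add: Dp_def)

lemma coeff_Dp: "set p \<subseteq> carrier R \<Longrightarrow> coeff (Dp p) i = [Suc i] \<cdot> coeff p (Suc i)"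
  using coeff_poly_deriv[of p i] normalize_coeff[of "poly_deriv R p"] by (simp add: Dp_def)

lemma coeff_lin_mult:
  assumes "b \<in> carrier R" "set q \<subseteq> carrier R"
  shows "coeff (lin b \<otimes>\<^bsub>poly_ring R\<^esub> q) i = (if i = 0 then \<zero> else coeff q (i - 1)) \<ominus> b \<otimes> coeff q i"
proof -
  have m: "map (\<lambda>a. \<one> \<otimes> a) q = q" using assms(2) by (induction q) auto
  have s: "set (map ((\<otimes>) (\<ominus> b)) q) \<subseteq> carrier R" using assms by auto
  have "lin b \<otimes>\<^bsub>poly_ring R\<^esub> q = poly_add (q @ [\<zero>]) (poly_add (map ((\<otimes>) (\<ominus> b)) q) [])"
    using m by (simp add: univ_poly_mult lin_def poly_mult.simps)
  moreover have "set (poly_add (map ((\<otimes>) (\<ominus> b)) q) []) \<subseteq> carrier R"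
    using poly_add_in_carrier[OF s, of "[]"] by simp
  ultimately have "coeff (lin b \<otimes>\<^bsub>poly_ring R\<^esub> q) i = coeff (q @ [\<zero>]) i \<oplus> (coeff (map ((\<otimes>) (\<ominus> b)) q) i \<oplus> \<zero>)"
    using assms s by (simp add: poly_add_coeff)
  moreover have "coeff (q @ [\<zero>]) i = (if i = 0 then \<zero> else coeff q (i - 1))"
    using append_coeff[of q "[\<zero>]"] assms by (auto simp: coeff_length)
  moreover have "coeff (map ((\<otimes>) (\<ominus> b)) q) i = \<ominus> (b \<otimes> coeff q i)"
    using scalar_coeff[of "\<ominus> b" q] assms by (simp add: l_minus)
  moreover have "coeff q i \<in> carrier R" using assms by simp
  ultimately show ?thesis using assms by (simp add: a_minus_def)
qed

text \<open>The product rule for a linear factor, by comparison of coefficients: the summand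
  \<open>q\<close> supplies the difference between \<open>i\<close> and \<open>Suc i\<close> copies
  of a coefficient.\<close>

lemma Dp_lin_mult:
  assumes "b \<in> carrier R" "q \<in> carrier (poly_ring R)"
  shows "Dp (lin b \<otimes>\<^bsub>poly_ring R\<^esub> q) = q \<oplus>\<^bsub>poly_ring R\<^esub> lin b \<otimes>\<^bsub>poly_ring R\<^esub> Dp q"
proof -
  interpret UP: domain "poly_ring R" by (rule univ_poly_is_domain[OF carrier_is_subring])
  note S = carrier_is_subring
  have q: "set q \<subseteq> carrier R" using univ_poly_carrierD[OF S assms(2)] by simp
  have dq: "Dp q \<in> carrier (poly_ring R)" by (rule Dp_closed[OF S q])
  have l: "lin b \<in> carrier (poly_ring R)" by (rule lin_closed[OF S assms(1)])
  have lq: "lin b \<otimes>\<^bsub>poly_ring R\<^esub> q \<in> carrier (poly_ring R)" "lin b \<otimes>\<^bsub>poly_ring R\<^esub> Dp q \<in> carrier (poly_ring R)"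
    using l assms dq by auto
  note sc = univ_poly_carrierD(2)[OF S]
  have "coeff (Dp (lin b \<otimes>\<^bsub>poly_ring R\<^esub> q)) i = coeff (q \<oplus>\<^bsub>poly_ring R\<^esub> lin b \<otimes>\<^bsub>poly_ring R\<^esub> Dp q) i" for i
  proof -
    define c c' where "c = coeff q i" and "c' = coeff q (Suc i)"
    have cc: "c \<in> carrier R" "c' \<in> carrier R" using q by (auto simp: c_def c'_def)
    have "coeff (Dp (lin b \<otimes>\<^bsub>poly_ring R\<^esub> q)) i = [Suc i] \<cdot> (c \<ominus> b \<otimes> c')"
      using sc[OF lq(1)] assms q by (simp add: coeff_Dp coeff_lin_mult c_def c'_def del: add.nat_pow_Suc)
    also have "\<dots> = [Suc i] \<cdot> c \<oplus> \<ominus> (b \<otimes> ([Suc i] \<cdot> c'))"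
      unfolding a_minus_def
      using cc assms by (subst add.nat_pow_distrib) (auto simp: add_pow_rdistr add.nat_pow_inv simp del: add.nat_pow_Suc)
    also have "\<dots> = c \<oplus> ([i] \<cdot> c \<ominus> b \<otimes> ([Suc i] \<cdot> c'))"
      using cc assms by (simp add: a_minus_def a_ac)
    also have "[i] \<cdot> c = (if i = 0 then \<zero> else coeff (Dp q) (i - 1))"
      using q by (cases i) (simp_all add: coeff_Dp c_def del: add.nat_pow_Suc)
    also have "[Suc i] \<cdot> c' = coeff (Dp q) i" using q by (simp add: coeff_Dp c'_def)
    also have "(if i = 0 then \<zero> else coeff (Dp q) (i - 1)) \<ominus> b \<otimes> coeff (Dp q) i = coeff (lin b \<otimes>\<^bsub>poly_ring R\<^esub> Dp q) i"
      using coeff_lin_mult[OF assms(1) sc[OF dq]] by simp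
    finally show ?thesis
      using poly_add_coeff[OF q sc[OF lq(2)]] by (simp add: univ_poly_add c_def)
  qed
  hence "coeff (Dp (lin b \<otimes>\<^bsub>poly_ring R\<^esub> q)) = coeff (q \<oplus>\<^bsub>poly_ring R\<^esub> lin b \<otimes>\<^bsub>poly_ring R\<^esub> Dp q)" by auto
  moreover have "polynomial (carrier R) (Dp (lin b \<otimes>\<^bsub>poly_ring R\<^esub> q))"
    "polynomial (carrier R) (q \<oplus>\<^bsub>poly_ring R\<^esub> lin b \<otimes>\<^bsub>poly_ring R\<^esub> Dp q)"
    using Dp_closed[OF S sc[OF lq(1)]] UP.a_closed[OF assms(2) lq(2)] by (simp_all add: univ_poly_carrier)
  ultimately show ?thesis using coeff_iff_polynomial_cond by blast
qed

end

section \<open>Division by linear factors and Lagrange interpolation\<close>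

context field
begin

lemma factor_root_remainder:
  assumes h: "h \<in> carrier (poly_ring R)" and b: "b \<in> carrier R"
  shows "\<exists>h1 \<in> carrier (poly_ring R). h = poly_of_const (eval h b) \<oplus>\<^bsub>poly_ring R\<^esub> lin b \<otimes>\<^bsub>poly_ring R\<^esub> h1"
proof -
  note S = carrier_is_subring
  interpret UP: domain "poly_ring R" by (rule univ_poly_is_domain[OF S])
  have l: "lin b \<in> carrier (poly_ring R)" by (rule lin_closed[OF S b])
  obtain q r where qr: "q \<in> carrier (poly_ring R)" "r \<in> carrier (poly_ring R)"
     "h = (lin b \<otimes>\<^bsub>poly_ring R\<^esub> q) \<oplus>\<^bsub>poly_ring R\<^esub> r" "r = [] \<or> degree r < degree (lin b)"
    using field_long_division_theorem_shell[OF carrier_is_subfield h l]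
    by (auto simp: lin_def univ_poly_zero)
  have "degree r = 0" using qr(4) by (auto simp: lin_def)
  then obtain c where c: "c \<in> carrier R" "r = poly_of_const c"
    using qr(2) poly_of_const_over_carrier by blast
  have "eval r b = c" using c by (auto simp: poly_of_const_def)
  moreover have "eval h b = eval r b"
    using qr l b eval_closed[OF S qr(1) b] eval_closed[OF S qr(2) b]
    by (simp add: eval_add eval_mult eval_lin a_minus_def r_neg)
  ultimately have "h = poly_of_const (eval h b) \<oplus>\<^bsub>poly_ring R\<^esub> lin b \<otimes>\<^bsub>poly_ring R\<^esub> q"
    using qr l c UP.a_comm[of "lin b \<otimes>\<^bsub>poly_ring R\<^esub> q" r] by simp
  thus ?thesis using qr(1) by blast
qed

text \<open>The remainder of \<open>h p'\<close> modulo \<open>p = \<Prod> (X - b)\<close> is the Lagrange sum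
  \<open>\<Sum> h(b) p / (X - b)\<close>; its coefficients lie in every ring that contains all \<open>b\<close> and \<open>h(b)\<close>.\<close>

lemma lagrange_remainder:
  assumes W: "subring W R" and h: "h \<in> carrier (poly_ring R)"
    and "\<And>b. b \<in> set bs \<Longrightarrow> b \<in> W \<and> eval h b \<in> W"
  shows "\<exists>s \<in> carrier (poly_ring R). \<exists>t \<in> carrier (W[X]).
    h \<otimes>\<^bsub>poly_ring R\<^esub> Dp (lprod bs) = lprod bs \<otimes>\<^bsub>poly_ring R\<^esub> s \<oplus>\<^bsub>poly_ring R\<^esub> t \<and> length t \<le> length bs"
  using assms(3)
proof (induction bs)
  note S = carrier_is_subring
  interpret UP: domain "poly_ring R" by (rule univ_poly_is_domain[OF S])
  case Nil
  have "[\<one>] \<in> carrier (poly_ring R)" by (simp add: univ_poly_def polynomial_def)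
  have "h \<otimes>\<^bsub>poly_ring R\<^esub> [] = []" "[\<one>] \<otimes>\<^bsub>poly_ring R\<^esub> [] \<oplus>\<^bsub>poly_ring R\<^esub> [] = []"
    using UP.r_null[OF h] UP.r_null[OF \<open>[\<one>] \<in> carrier (poly_ring R)\<close>] UP.r_zero[OF UP.zero_closed]
    unfolding univ_poly_zero by simp_all
  thus ?case by (intro bexI[of _ "[]"]) (auto simp: Dp_def)
next
  note S = carrier_is_subring
  interpret UP: domain "poly_ring R" by (rule univ_poly_is_domain[OF S])
  interpret UW: domain "W[X]" by (rule univ_poly_is_domain[OF W])
  let ?P = "poly_ring R"
  case (Cons b bs)
  have b: "b \<in> W" "eval h b \<in> W" "b \<in> carrier R" using Cons(2) subringE(1)[OF W] by auto
  have bs: "set bs \<subseteq> W" "set bs \<subseteq> carrier R" using Cons(2) subringE(1)[OF W] by auto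
  obtain s0 t0 where st: "s0 \<in> carrier ?P" "t0 \<in> carrier (W[X])"
    "h \<otimes>\<^bsub>?P\<^esub> Dp (lprod bs) = lprod bs \<otimes>\<^bsub>?P\<^esub> s0 \<oplus>\<^bsub>?P\<^esub> t0" "length t0 \<le> length bs"
    using Cons by auto
  define c p0 where "c = poly_of_const (eval h b)" and "p0 = lprod bs"
  obtain h1 where h1: "h1 \<in> carrier ?P" "h = c \<oplus>\<^bsub>?P\<^esub> lin b \<otimes>\<^bsub>?P\<^esub> h1"
    using factor_root_remainder[OF h b(3)] by (auto simp: c_def)
  have l: "lin b \<in> carrier (W[X])" by (rule lin_closed[OF W b(1)])
  have cW: "c \<in> carrier (W[X])" using b(2) by (auto simp: c_def poly_of_const_def univ_poly_def polynomial_def)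
  have pW: "p0 \<in> carrier (W[X])" unfolding p0_def by (rule lprod_closed[OF W bs(1)])
  note up = univ_poly_mono[OF subringE(1)[OF W]]
  define d where "d = Dp p0"
  have d: "d \<in> carrier ?P" unfolding d_def by (rule Dp_closed[OF S univ_poly_carrierD(2)[OF W pW]])
  \<comment> \<open>Let \<open>h = c + (X - b) h1\<close> and \<open>p = (X - b) p0\<close>. By the
    product rule \<open>h p' = h p0 + (X - b) h p0'\<close>. Modulo \<open>p\<close> the first
    summand is \<open>c p0\<close>, and the second is \<open>(X - b) t0\<close> by
    induction.\<close>
  define t where "t = lin b \<otimes>\<^bsub>W[X]\<^esub> t0 \<oplus>\<^bsub>W[X]\<^esub> c \<otimes>\<^bsub>W[X]\<^esub> p0"
  have tW: "t \<in> carrier (W[X])" using l st(2) cW pW by (simp add: t_def)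
  note cl = up[OF l] up[OF cW] up[OF pW] up[OF st(2)] d st(1) h1(1) h
  have st3: "h \<otimes>\<^bsub>?P\<^esub> d = p0 \<otimes>\<^bsub>?P\<^esub> s0 \<oplus>\<^bsub>?P\<^esub> t0" using st(3) by (simp add: p0_def d_def)
  have "h \<otimes>\<^bsub>?P\<^esub> Dp (lprod (b # bs)) = h \<otimes>\<^bsub>?P\<^esub> (p0 \<oplus>\<^bsub>?P\<^esub> lin b \<otimes>\<^bsub>?P\<^esub> d)"
    using Dp_lin_mult[OF b(3) up[OF pW]] by (simp add: p0_def d_def)
  also have "\<dots> = h \<otimes>\<^bsub>?P\<^esub> p0 \<oplus>\<^bsub>?P\<^esub> lin b \<otimes>\<^bsub>?P\<^esub> (h \<otimes>\<^bsub>?P\<^esub> d)"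
    using cl by (simp add: UP.r_distr UP.m_ac)
  also have "\<dots> = (c \<oplus>\<^bsub>?P\<^esub> lin b \<otimes>\<^bsub>?P\<^esub> h1) \<otimes>\<^bsub>?P\<^esub> p0 \<oplus>\<^bsub>?P\<^esub> lin b \<otimes>\<^bsub>?P\<^esub> (p0 \<otimes>\<^bsub>?P\<^esub> s0 \<oplus>\<^bsub>?P\<^esub> t0)"
    by (simp only: st3 h1(2)[symmetric])
  also have "\<dots> = (lin b \<otimes>\<^bsub>?P\<^esub> p0) \<otimes>\<^bsub>?P\<^esub> (s0 \<oplus>\<^bsub>?P\<^esub> h1) \<oplus>\<^bsub>?P\<^esub> (lin b \<otimes>\<^bsub>?P\<^esub> t0 \<oplus>\<^bsub>?P\<^esub> c \<otimes>\<^bsub>?P\<^esub> p0)"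
    using cl by (simp add: UP.r_distr UP.l_distr UP.m_ac UP.a_ac)
  finally have "h \<otimes>\<^bsub>?P\<^esub> Dp (lprod (b # bs)) = lprod (b # bs) \<otimes>\<^bsub>?P\<^esub> (s0 \<oplus>\<^bsub>?P\<^esub> h1) \<oplus>\<^bsub>?P\<^esub> t"
    by (simp add: t_def p0_def univ_poly_mult_eq[where K = W] univ_poly_add_eq[where K = W])
  moreover have "s0 \<oplus>\<^bsub>?P\<^esub> h1 \<in> carrier ?P" using cl by simp
  moreover have "length t \<le> length (b # bs)"
  proof -
    have deg: "length q \<le> n + m + 1"
      if "q = u \<otimes>\<^bsub>W[X]\<^esub> v" "u \<in> carrier (W[X])" "v \<in> carrier (W[X])" "degree u \<le> n" "degree v \<le> m" for q u v n m
      using poly_mult_degree_eq[OF W, of u v] that by (auto simp: univ_poly_mult univ_poly_carrier[symmetric] split: if_splits)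
    have "length (lin b \<otimes>\<^bsub>W[X]\<^esub> t0) \<le> Suc (length bs)"
    \<comment> \<open>The zero polynomial has the same \<open>degree\<close> as a constant, so the
      degree formula bounds the length only for nonzero \<open>t0\<close>.\<close>
    proof (cases "t0 = []")
      case True
      thus ?thesis using UW.r_null[OF l] by (simp add: univ_poly_zero[of R W])
    next
      case False
      hence "degree t0 \<le> length bs - 1" "length bs \<ge> 1" using st(4) by (cases t0; cases bs; simp)+
      thus ?thesis using deg[OF refl l st(2), of 1 "length bs - 1"] by (simp add: lin_def)
    qed
    moreover have "length (c \<otimes>\<^bsub>W[X]\<^esub> p0) \<le> Suc (length bs)"
      using deg[OF refl cW pW, of 0 "length bs"] lprod_monic[OF bs(2)]
      by (auto simp: c_def poly_of_const_def p0_def)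
    ultimately show ?thesis
      using poly_add_length_le[of "lin b \<otimes>\<^bsub>W[X]\<^esub> t0" "c \<otimes>\<^bsub>W[X]\<^esub> p0"]
      by (simp add: t_def univ_poly_add)
  qed
  ultimately show ?case using tW by blast
qed

end

section \<open>Splitting over an algebraically closed field\<close>

lemma (in algebraically_closed) split_into_linear:
  assumes "p \<in> carrier (poly_ring L)" "p \<noteq> []"
  shows "\<exists>k bs. k \<in> carrier L \<and> k \<noteq> \<zero> \<and> set bs \<subseteq> carrier L \<and> p = [k] \<otimes>\<^bsub>poly_ring L\<^esub> lprod bs"
  using assms
proof (induction "degree p" arbitrary: p)
  note S = carrier_is_subring
  interpret UP: domain "poly_ring L" by (rule univ_poly_is_domain[OF S])
  case 0
  then obtain k where "p = [k]" by (cases p) auto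
  moreover hence "k \<in> carrier L" "k \<noteq> \<zero>" using 0 by (auto simp: univ_poly_def polynomial_def)
  moreover have "[k] \<otimes>\<^bsub>poly_ring L\<^esub> lprod [] = [k]"
    using UP.r_one[of "[k]"] 0 \<open>p = [k]\<close> by (simp add: univ_poly_one)
  ultimately show ?case by (intro exI[of _ k] exI[of _ "[]"]) auto
next
  note S = carrier_is_subring
  interpret UP: domain "poly_ring L" by (rule univ_poly_is_domain[OF S])
  case (Suc n)
  have "roots p \<noteq> {#}" using roots_over_carrier[OF Suc(3)] Suc(2) by (auto simp: splitted_def)
  then obtain a where a: "a \<in> carrier L" "lin a \<in> carrier (poly_ring L)" "lin a pdivides p"
    using not_empty_rootsE[OF Suc(3)] by (auto simp: lin_def)
  then obtain q where q: "q \<in> carrier (poly_ring L)" "p = lin a \<otimes>\<^bsub>poly_ring L\<^esub> q"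
    by (auto simp: pdivides_def)
  have "q \<noteq> []" using q Suc(4) UP.r_null[OF a(2)] by (auto simp: univ_poly_zero)
  moreover have "degree p = Suc (degree q)"
    using poly_mult_degree_eq[OF S, of "lin a" q] a q \<open>q \<noteq> []\<close>
    by (simp add: univ_poly_mult univ_poly_carrier[symmetric] lin_def)
  ultimately obtain k bs where k: "k \<in> carrier L" "k \<noteq> \<zero>" "set bs \<subseteq> carrier L" "q = [k] \<otimes>\<^bsub>poly_ring L\<^esub> lprod bs"
    using Suc(1)[OF _ q(1)] Suc(2) by (metis diff_Suc_1)
  have "[k] \<in> carrier (poly_ring L)" using k by (auto simp: univ_poly_def polynomial_def)
  hence "p = [k] \<otimes>\<^bsub>poly_ring L\<^esub> lprod (a # bs)"
    using q k(4) a(2) lprod_closed[OF S k(3)] by (simp add: UP.m_ac)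
  thus ?case using k a(1) by (intro exI[of _ k] exI[of _ "a # bs"]) auto
qed

lemma (in algebraically_closed) monic_split_into_linear:
  assumes "p \<in> carrier (poly_ring L)" "p \<noteq> []" "hd p = \<one>"
  obtains bs where "set bs \<subseteq> carrier L" "p = lprod bs"
proof -
  note S = carrier_is_subring
  interpret UP: domain "poly_ring L" by (rule univ_poly_is_domain[OF S])
  obtain k bs where k: "k \<in> carrier L" "k \<noteq> \<zero>" "set bs \<subseteq> carrier L" "p = [k] \<otimes>\<^bsub>poly_ring L\<^esub> lprod bs"
    using split_into_linear[OF assms(1,2)] by blast
  have c: "[k] \<in> carrier (poly_ring L)" "lprod bs \<in> carrier (poly_ring L)"
    using k lprod_closed[OF S] by (auto simp: univ_poly_def polynomial_def)
  have "hd p = k \<otimes> hd (lprod bs)"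
    using poly_mult_lead_coeff[OF S, of "[k]" "lprod bs"] c k lprod_monic[OF k(3)]
    by (simp add: univ_poly_mult univ_poly_carrier[symmetric])
  hence "k = \<one>" using assms(3) k lprod_monic[OF k(3)] by simp
  hence "p = lprod bs" using k(4) UP.l_one[OF c(2)] by (simp add: univ_poly_one)
  thus thesis using that k(3) by blast
qed

section \<open>Simple roots in two valued fields\<close>

context valuation_subring
begin

lemma eval_in_V: "set p \<subseteq> V \<Longrightarrow> x \<in> V \<Longrightarrow> eval p x \<in> V"
  by (rule eval_closed'[OF subring])

lemma eval_in_m: "set p \<subseteq> \<mm> \<Longrightarrow> x \<in> V \<Longrightarrow> eval p x \<in> \<mm>"
  by (induction p) (auto intro!: m_add m_mult(2) V_pow)

lemma set_V_carr: "set p \<subseteq> V \<Longrightarrow> set p \<subseteq> carrier L"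
  by auto

text \<open>Horner's scheme from the constant term upwards: the difference for
  \<open>p X + d\<close> is that for \<open>p\<close> times \<open>x\<close>, plus a multiple of
  \<open>x \<ominus> y\<close>.\<close>

lemma eval_cong_m:
  assumes x: "x \<in> V" "y \<in> V" "x \<ominus> y \<in> \<mm>"
  shows "set p \<subseteq> V \<Longrightarrow> eval p x \<ominus> eval p y \<in> \<mm>"
proof (induction p rule: rev_induct)
  case (snoc d p)
  have d: "d \<in> V" and p: "set p \<subseteq> V" using snoc(2) by auto
  have e: "eval p x \<in> V" "eval p y \<in> V" using eval_in_V[OF p] x by auto
  have c: "x \<in> carrier L" "y \<in> carrier L" "d \<in> carrier L" "eval p x \<in> carrier L" "eval p y \<in> carrier L"
    using x d e by auto
  have "eval (p @ [d]) x \<ominus> eval (p @ [d]) y = (eval p x \<otimes> x \<oplus> d) \<ominus> (eval p y \<otimes> y \<oplus> d)"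
    using eval_append_aux[OF set_V_carr[OF p] c(3)] c by simp
  also have "\<dots> = (eval p x \<ominus> eval p y) \<otimes> x \<oplus> eval p y \<otimes> (x \<ominus> y)"
    using c by algebra
  also have "\<dots> \<in> \<mm>" using snoc.IH[OF p] x e by (intro m_add m_mult) auto
  finally show ?case .
qed (simp add: a_minus_def)

text \<open>All monomials of \<open>p\<close> have degree below \<open>length p\<close>, so the
  quotient contains only positive powers of \<open>inv b\<close>, which lies in
  \<open>\<mm>\<close>.\<close>

lemma eval_reverse_in_m:
  assumes b: "b \<in> carrier L" "b \<notin> V"
  shows "set p \<subseteq> V \<Longrightarrow> eval p b \<otimes> inv b [^] length p \<in> \<mm>"
proof (induction p)
  case (Cons d p)
  note nb = notin_V[OF b]
  have c: "d \<in> carrier L" "eval p b \<in> carrier L" "inv b \<in> carrier L"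
    using Cons(2) b nb by (auto intro!: eval_in_carrier)
  have pw: "b [^] n \<otimes> inv b [^] n = \<one>" for n :: nat
    using b nb by (metis c(3) nat_pow_distrib nat_pow_one r_inv' m_comm)
  have "eval (d # p) b \<otimes> inv b [^] length (d # p)
      = d \<otimes> (b [^] length p \<otimes> inv b [^] length p) \<otimes> inv b \<oplus> (eval p b \<otimes> inv b [^] length p) \<otimes> inv b"
    using c b by (simp add: l_distr m_assoc)
  also have "\<dots> = d \<otimes> inv b \<oplus> (eval p b \<otimes> inv b [^] length p) \<otimes> inv b" using c by (simp only: pw r_one)
  also have "\<dots> \<in> \<mm>"
    using Cons m_V nb by (intro m_add m_mult) auto
  finally show ?case .
qed simp

text \<open>Valuation rings are integrally closed: for \<open>b\<close> outside \<open>V\<close>,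
  dividing the equation by the leading power of \<open>b\<close> would put \<open>\<one>\<close>
  into \<open>\<mm>\<close>.\<close>

lemma root_of_monic_in_V:
  assumes p: "set p \<subseteq> V" "p \<noteq> []" "hd p = \<one>" and b: "b \<in> carrier L" "eval p b = \<zero>"
  shows "b \<in> V"
proof (rule ccontr)
  assume n: "b \<notin> V"
  note nb = notin_V[OF b(1) n]
  obtain q where q: "p = \<one> # q" "set q \<subseteq> V" using p by (cases p) auto
  have c: "eval q b \<in> carrier L" "inv b \<in> carrier L"
    using q(2) b nb by (auto intro!: eval_in_carrier)
  have pw: "b [^] n \<otimes> inv b [^] n = \<one>" for n :: nat
    using b nb by (metis c(2) nat_pow_distrib nat_pow_one r_inv' m_comm)
  have e: "eval p b = b [^] length q \<oplus> eval q b" using q b by simp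
  have "\<zero> = eval p b \<otimes> inv b [^] length q" using b c by simp
  also have "\<dots> = b [^] length q \<otimes> inv b [^] length q \<oplus> eval q b \<otimes> inv b [^] length q"
    unfolding e using b(1) c by (simp add: l_distr)
  finally have "\<zero> = \<one> \<oplus> eval q b \<otimes> inv b [^] length q" by (simp only: pw)
  moreover have e: "eval q b \<otimes> inv b [^] length q \<in> \<mm>" by (rule eval_reverse_in_m[OF b(1) n q(2)])
  ultimately have "\<one> = \<ominus> (eval q b \<otimes> inv b [^] length q)" by (metis m_carr minus_equality one_closed)
  thus False using m_neg[OF e] m_one by simp
qed

text \<open>Let \<open>y\<close> be the intermediate Horner value. For \<open>z\<close> in
  \<open>V\<close> both claims are clear. Otherwise the relation says that \<open>y\<close> times a
  power of \<open>z\<close> is minus the value of \<open>lo\<close>, a polynomial of smaller degree;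
  so \<open>z \<otimes> y\<close> is, up to sign, the leading coefficient of \<open>lo\<close> plus
  an element of \<open>\<mm>\<close>, and \<open>y\<close> is \<open>inv z\<close> times
  that.\<close>

lemma truncated_relation:
  assumes q: "set (hi @ k # lo) \<subseteq> V" and z: "z \<in> carrier L" "eval (hi @ k # lo) z = \<zero>"
  shows "eval (hi @ [k]) z \<in> V" "z \<otimes> eval (hi @ [k]) z \<in> V"
proof -
  have sets: "set (hi @ [k]) \<subseteq> V" "set lo \<subseteq> V" using q by auto
  define y where "y = eval (hi @ [k]) z"
  have y: "y \<in> carrier L" "eval lo z \<in> carrier L"
    unfolding y_def using eval_in_carrier[OF set_V_carr z(1)] sets by blast+
  have e: "y \<otimes> z [^] length lo \<oplus> eval lo z = \<zero>"
    using eval_append[OF set_V_carr[OF sets(1)] set_V_carr[OF sets(2)] z(1)] z(2) by (simp add: y_def)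
  have "y \<in> V \<and> z \<otimes> y \<in> V"
  proof (cases "z \<in> V")
    case True
    thus ?thesis using eval_in_V[OF sets(1) True] V_mult by (simp add: y_def)
  next
    case False
    note zV = False
    note nz = notin_V[OF z(1) False]
    have iz: "inv z \<in> carrier L" "inv z \<in> V" using nz z m_V by auto
    have zy: "z \<otimes> y \<in> V"
    proof (cases "lo = []")
      case True
      thus ?thesis using e y z by simp
    next
      case False
      then obtain d lo' where lo: "lo = d # lo'" by (cases lo) auto
      have pw: "z [^] n \<otimes> inv z [^] n = \<one>" for n :: nat
        using z nz by (metis iz(1) nat_pow_distrib nat_pow_one r_inv' m_comm)
      have c: "d \<in> carrier L" "eval lo' z \<in> carrier L"
        using sets z by (auto simp: lo intro!: eval_in_carrier)
      have e': "y \<otimes> z [^] length lo = \<ominus> eval lo z" using e y z by (metis minus_equality a_comm m_closed nat_pow_closed minus_minus)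
      have "z \<otimes> y \<otimes> (z [^] length lo' \<otimes> inv z [^] length lo') = \<ominus> eval lo z \<otimes> inv z [^] length lo'"
      proof -
        have "z \<otimes> y \<otimes> (z [^] length lo' \<otimes> inv z [^] length lo') = (y \<otimes> z [^] length lo) \<otimes> inv z [^] length lo'"
          using y(1) z(1) iz(1) by (simp add: lo m_ac)
        thus ?thesis by (simp only: e')
      qed
      hence "z \<otimes> y = \<ominus> (d \<otimes> (z [^] length lo' \<otimes> inv z [^] length lo') \<oplus> eval lo' z \<otimes> inv z [^] length lo')"
        using y z iz c by (simp add: pw lo l_minus l_distr m_assoc)
      hence "z \<otimes> y = \<ominus> (d \<oplus> eval lo' z \<otimes> inv z [^] length lo')" using c by (simp only: pw r_one)
      moreover have "eval lo' z \<otimes> inv z [^] length lo' \<in> \<mm>"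
        by (rule eval_reverse_in_m[OF z(1) zV]) (use sets lo in auto)
      ultimately show ?thesis using sets lo m_V by (simp add: V_inv V_add)
    qed
    have "y = inv z \<otimes> (z \<otimes> y)" using nz z y iz by (simp add: m_assoc[symmetric])
    thus ?thesis using zy V_mult[OF iz(2) zy] by simp
  qed
  thus "eval (hi @ [k]) z \<in> V" "z \<otimes> eval (hi @ [k]) z \<in> V" by (simp_all add: y_def)
qed

text \<open>The factor \<open>e\<close> is the inverse of a coefficient of least value, which is
  thereby turned into \<open>\<one>\<close>.\<close>

lemma normalize_coefficients:
  assumes F: "subfield F L" and q: "set q \<subseteq> F" "\<exists>x\<in>set q. x \<noteq> \<zero>"
  shows "\<exists>e\<in>F. e \<noteq> \<zero> \<and> set (map ((\<otimes>) e) q) \<subseteq> V \<and> (\<exists>x\<in>set (map ((\<otimes>) e) q). x \<notin> \<mm>)"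
proof -
  have Fc: "F \<subseteq> carrier L" by (rule subfieldE(3)[OF F])
  have Finv: "inv x \<in> F" if "x \<in> F" "x \<noteq> \<zero>" for x
    using subfield_m_inv(1)[OF F, of x] that by simp
  have "\<exists>x\<in>set q. x \<noteq> \<zero> \<and> (\<forall>y\<in>set q. inv x \<otimes> y \<in> V)" if "set q \<subseteq> F" "\<exists>x\<in>set q. x \<noteq> \<zero>" for q
    using that
  proof (induction q)
    case (Cons d q)
    have d: "d \<in> F" "d \<in> carrier L" "set q \<subseteq> F" using Cons(2) Fc by auto
    show ?case
    proof (cases "\<exists>x\<in>set q. x \<noteq> \<zero>")
      case False
      hence "d \<noteq> \<zero>" using Cons(3) by auto
      moreover have "inv d \<otimes> y \<in> V" if "y \<in> set q" for y
        using False that d \<open>d \<noteq> \<zero>\<close> by auto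
      ultimately show ?thesis using d by auto
    next
      case True
      then obtain x where x: "x \<in> set q" "x \<noteq> \<zero>" "\<And>y. y \<in> set q \<Longrightarrow> inv x \<otimes> y \<in> V" using Cons d by blast
      have xc: "x \<in> carrier L" "inv x \<in> carrier L" using x d Fc by auto
      show ?thesis
      proof (cases "inv x \<otimes> d \<in> V")
        case True
        thus ?thesis using x by auto
      next
        case False
        have dn: "d \<noteq> \<zero>" using False xc by auto
        have c: "inv d \<in> carrier L" using dn d by auto
        have "inv (inv x \<otimes> d) = inv d \<otimes> x" using x xc d dn by (simp add: inv_mult m_comm)
        hence dx: "inv d \<otimes> x \<in> V" using notin_V(2)[OF _ False] xc d m_V by auto
        have "inv d \<otimes> y \<in> V" if y: "y \<in> set q" for y
        proof -
          have yc: "y \<in> carrier L" using y d Fc by auto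
          have "inv d \<otimes> y = (inv d \<otimes> x) \<otimes> (inv x \<otimes> y)"
            using yc xc c x(2) by (metis l_inv' m_assoc m_closed r_inv' r_one m_comm)
          thus ?thesis using V_mult[OF dx x(3)[OF y]] by simp
        qed
        thus ?thesis using d dn by auto
      qed
    qed
  qed simp
  then obtain x where x: "x \<in> set q" "x \<noteq> \<zero>" "\<And>y. y \<in> set q \<Longrightarrow> inv x \<otimes> y \<in> V" using q by meson
  have xF: "x \<in> F" "x \<in> carrier L" using x q Fc by auto
  have "inv x \<otimes> x = \<one>" "inv x \<in> F" "inv x \<noteq> \<zero>" using x xF Finv by auto
  thus ?thesis using x by (intro bexI[of _ "inv x"]) (auto intro!: bexI[of _ x])
qed

end

text \<open>A polynomial expression in \<open>g(x)\<close> has to become one polynomial in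
  \<open>x\<close> over \<open>F\<close>, since only such polynomials can be moved to another
  field.\<close>

lemma (in domain) poly_compose:
  assumes F: "subring F R" and g: "g \<in> carrier (F[X])"
  shows "set y \<subseteq> F \<Longrightarrow> \<exists>h \<in> carrier (F[X]). \<forall>x \<in> carrier R. eval h x = eval y (eval g x)"
proof (induction y rule: rev_induct)
  case Nil
  show ?case by (intro bexI[of _ "[]"]) (auto simp: univ_poly_zero_closed)
next
  case (snoc d y)
  interpret UP: domain "F[X]" by (rule univ_poly_is_domain[OF F])
  have d: "d \<in> F" "set y \<subseteq> F" "d \<in> carrier R" "set y \<subseteq> carrier R" using snoc(2) subringE(1)[OF F] by auto
  obtain h where h: "h \<in> carrier (F[X])" "\<And>x. x \<in> carrier R \<Longrightarrow> eval h x = eval y (eval g x)"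
    using snoc d by blast
  have k: "poly_of_const d \<in> carrier (F[X])" using d by (auto simp: poly_of_const_def univ_poly_def polynomial_def)
  note up = univ_poly_mono[OF subringE(1)[OF F]]
  have m: "h \<otimes>\<^bsub>F[X]\<^esub> g \<in> carrier (F[X])" using h g by simp
  have "eval (h \<otimes>\<^bsub>F[X]\<^esub> g \<oplus>\<^bsub>F[X]\<^esub> poly_of_const d) x = eval (y @ [d]) (eval g x)" if x: "x \<in> carrier R" for x
  proof -
    have gx: "eval g x \<in> carrier R" using eval_closed[OF carrier_is_subring up[OF g] x] .
    have "eval (poly_of_const d) x = d" using d by (auto simp: poly_of_const_def)
    thus ?thesis
      using eval_add[OF up[OF m] up[OF k] x] eval_mult[OF up[OF h(1)] up[OF g] x] h(2)[OF x]
        eval_append_aux[OF d(4,3) gx]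
      by (simp add: univ_poly_mult_eq[where K = F] univ_poly_add_eq[where K = F])
  qed
  moreover have "h \<otimes>\<^bsub>F[X]\<^esub> g \<oplus>\<^bsub>F[X]\<^esub> poly_of_const d \<in> carrier (F[X])" using m k by simp
  ultimately show ?case by blast
qed

text \<open>The product of individual annihilators. A single polynomial for all conjugates can be
  truncated at the same coefficient for all of them.\<close>

lemma (in domain) common_annihilator:
  assumes F: "subfield F R"
  shows "set zs \<subseteq> carrier R \<Longrightarrow> (\<And>z. z \<in> set zs \<Longrightarrow> (algebraic over F) z) \<Longrightarrow>
    \<exists>q \<in> carrier (F[X]). q \<noteq> [] \<and> (\<forall>z \<in> set zs. eval q z = \<zero>)"
proof (induction zs)
  case Nil
  have "[\<one>] \<in> carrier (F[X])" using subfieldE(1)[OF F] subringE(3) by (auto simp: univ_poly_def polynomial_def)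
  thus ?case by auto
next
  case (Cons z zs)
  note S = subfieldE(1)[OF F]
  interpret UP: domain "F[X]" by (rule univ_poly_is_domain[OF S])
  note up = univ_poly_mono[OF subringE(1)[OF S]]
  obtain q where q: "q \<in> carrier (F[X])" "q \<noteq> []" "\<forall>z \<in> set zs. eval q z = \<zero>" using Cons by auto
  obtain r where r: "r \<in> carrier (F[X])" "r \<noteq> []" "eval r z = \<zero>"
    using algebraicE[OF S, of z] Cons by auto
  have "eval (r \<otimes>\<^bsub>F[X]\<^esub> q) w = \<zero>" if "w \<in> set (z # zs)" for w
  proof -
    have w: "w \<in> carrier R" using that Cons by auto
    show ?thesis
      using eval_mult[OF up[OF r(1)] up[OF q(1)] w] that q r eval_closed[OF carrier_is_subring up[OF q(1)] w]
        eval_closed[OF carrier_is_subring up[OF r(1)] w]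
      by (auto simp: univ_poly_mult_eq[where K = F])
  qed
  moreover have "r \<otimes>\<^bsub>F[X]\<^esub> q \<noteq> []" using UP.integral_iff[OF r(1) q(1)] r q by (simp add: univ_poly_zero)
  ultimately show ?case using UP.m_closed[OF r(1) q(1)] by blast
qed

text \<open>The roots \<open>b\<close> and \<open>c\<close> of \<open>p\<close> and of its image
  under \<open>\<sigma>\<close> lift the same simple residual root \<open>a\<close>. The goal is
  that sending \<open>g(b)\<close> to the value at \<open>c\<close> of the image of \<open>g\<close>
  is well defined, injective and compatible with \<open>W\<close> and \<open>V\<close>. The
  polynomial \<open>p\<close> may be reducible over \<open>F\<close>, so even well-definedness is
  not formal.\<close>

locale simple_root_pair =
  Om: algebraically_closed \<Omega> + W: valuation_subring \<Omega> W + V: valuation_subring L V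
  for \<Omega> :: "('a, 'm) ring_scheme" (structure) and W and L :: "('c, 'n) ring_scheme" and V +
  fixes F \<sigma> p a b c
  assumes F: "subfield F \<Omega>" and hom: "\<sigma> \<in> ring_hom (\<Omega>\<lparr>carrier := F\<rparr>) L"
    and comp: "x \<in> F \<Longrightarrow> \<sigma> x \<in> V \<longleftrightarrow> x \<in> W"
    and p: "p \<in> carrier ((W \<inter> F)[X])" "p \<noteq> []" "hd p = \<one>"
    and a: "a \<in> W" "a \<in> F" and b: "b \<in> W" "Om.eval p b = \<zero>"
    and c: "c \<in> V" "ring.eval L (map \<sigma> p) c = \<zero>\<^bsub>L\<^esub>"
    and ba: "b \<ominus> a \<in> vmax \<Omega> W" and ca: "c \<ominus>\<^bsub>L\<^esub> \<sigma> a \<in> vmax L V"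
    and simple: "Om.eval (poly_deriv \<Omega> p) a \<notin> vmax \<Omega> W"
begin

definition evc where "evc g = V.eval (map \<sigma> g) c"

lemmas Fs = subfieldE(1)[OF F]
lemmas Fc = subfieldE(3)[OF F]

lemma bc: "b \<in> carrier \<Omega>" "c \<in> carrier L" using b c by auto

sublocale UPF: domain "F[X]" by (rule Om.univ_poly_is_domain[OF Fs])
sublocale FF: field "\<Omega>\<lparr>carrier := F\<rparr>" by (rule Om.subfield_iff(2)[OF F])
sublocale s: ring_hom_ring "\<Omega>\<lparr>carrier := F\<rparr>" L \<sigma>
  by (rule ring_hom_ringI2[OF FF.is_ring V.is_ring hom])

lemma setF: "g \<in> carrier (F[X]) \<Longrightarrow> set g \<subseteq> F"
  by (rule Om.univ_poly_carrierD(1)[OF Fs])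

lemma s_inj: "x \<in> F \<Longrightarrow> \<sigma> x = \<zero>\<^bsub>L\<^esub> \<longleftrightarrow> x = \<zero>"
  using non_trivial_field_hom_is_inj[OF hom FF.field_axioms V.field_axioms]
    s.hom_zero subringE(2)[OF Fs] by (auto simp: inj_on_def)

lemma s_mult: "x \<in> F \<Longrightarrow> y \<in> F \<Longrightarrow> \<sigma> (x \<otimes> y) = \<sigma> x \<otimes>\<^bsub>L\<^esub> \<sigma> y"
  and s_closed: "x \<in> F \<Longrightarrow> \<sigma> x \<in> carrier L" and s_one: "\<sigma> \<one> = \<one>\<^bsub>L\<^esub>"
  using s.hom_mult s.hom_closed s.hom_one by auto

lemma F_inv: "x \<in> F \<Longrightarrow> x \<noteq> \<zero> \<Longrightarrow> inv x \<in> F"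
  using Om.subfield_m_inv(1)[OF F, of x] by simp

lemma s_inv: "x \<in> F \<Longrightarrow> x \<noteq> \<zero> \<Longrightarrow> \<sigma> (inv x) = inv\<^bsub>L\<^esub> (\<sigma> x)"
proof -
  assume x: "x \<in> F" "x \<noteq> \<zero>"
  have "\<sigma> x \<otimes>\<^bsub>L\<^esub> \<sigma> (inv x) = \<one>\<^bsub>L\<^esub>"
    using s_mult[OF x(1) F_inv[OF x]] x Fc s_one by (metis Om.r_inv' subsetD)
  thus ?thesis using V.inv_eqI[OF s_closed[OF x(1)] s_closed[OF F_inv[OF x]]] by simp
qed

lemma s_m: "x \<in> F \<Longrightarrow> \<sigma> x \<in> vmax L V \<longleftrightarrow> x \<in> vmax \<Omega> W"
  using comp[of x] comp[OF F_inv[of x]] s_inj[of x] s_inv[of x] by (cases "x = \<zero>") (simp_all add: vmax_def)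

lemma evc_closed: "g \<in> carrier (F[X]) \<Longrightarrow> evc g \<in> carrier L"
  unfolding evc_def using setF[of g] s_closed bc by (intro V.eval_in_carrier) auto

lemma evc_hom:
  assumes "g \<in> carrier (F[X])" "h \<in> carrier (F[X])"
  shows "evc (g \<otimes>\<^bsub>F[X]\<^esub> h) = evc g \<otimes>\<^bsub>L\<^esub> evc h" "evc (g \<oplus>\<^bsub>F[X]\<^esub> h) = evc g \<oplus>\<^bsub>L\<^esub> evc h"
proof -
  have sets: "set g \<subseteq> F" "set h \<subseteq> F" using assms setF by auto
  hence sets': "set (map \<sigma> g) \<subseteq> carrier L" "set (map \<sigma> h) \<subseteq> carrier L" using s_closed by auto
  have ev: "V.eval (V.normalize (map \<sigma> q)) c = evc q" if "q \<in> carrier (F[X])" for q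
    unfolding evc_def using setF[OF that] s_closed bc by (intro V.eval_normalize) auto
  have m: "FF.poly_mult g h = g \<otimes>\<^bsub>F[X]\<^esub> h" "FF.poly_add g h = g \<oplus>\<^bsub>F[X]\<^esub> h"
    using Om.poly_mult_consistent[OF Fs] Om.poly_add_consistent[OF Fs]
    by (simp_all add: univ_poly_mult univ_poly_add)
  have "evc (g \<otimes>\<^bsub>F[X]\<^esub> h) = V.eval (V.poly_mult (map \<sigma> g) (map \<sigma> h)) c"
    using ev[OF UPF.m_closed[OF assms]] s.poly_mult_hom'[of g h] sets m by simp
  thus "evc (g \<otimes>\<^bsub>F[X]\<^esub> h) = evc g \<otimes>\<^bsub>L\<^esub> evc h"
    using V.eval_poly_mult[OF sets' bc(2)] by (simp add: evc_def)
  have "evc (g \<oplus>\<^bsub>F[X]\<^esub> h) = V.eval (V.poly_add (map \<sigma> g) (map \<sigma> h)) c"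
    using ev[OF UPF.a_closed[OF assms]] s.poly_add_hom'[of g h] sets m by simp
  thus "evc (g \<oplus>\<^bsub>F[X]\<^esub> h) = evc g \<oplus>\<^bsub>L\<^esub> evc h"
    using V.eval_poly_add[OF sets' bc(2)] by (simp add: evc_def)
qed

lemma evb_hom:
  assumes "g \<in> carrier (F[X])" "h \<in> carrier (F[X])" "x \<in> carrier \<Omega>"
  shows "Om.eval (g \<otimes>\<^bsub>F[X]\<^esub> h) x = Om.eval g x \<otimes> Om.eval h x"
    "Om.eval (g \<oplus>\<^bsub>F[X]\<^esub> h) x = Om.eval g x \<oplus> Om.eval h x" "Om.eval g x \<in> carrier \<Omega>"
  using ring_hom_memE[OF Om.eval_is_hom[OF Fs assms(3)]] assms by auto

text \<open>For integral coefficients the value at \<open>b\<close> is congruent to that at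
  \<open>a\<close>, and the value at \<open>c\<close> to its image under \<open>\<sigma>\<close>. At
  \<open>a\<close> the two sides are compared inside \<open>F\<close>.\<close>

lemma integral_poly:
  assumes t: "set t \<subseteq> W \<inter> F"
  shows "Om.eval t b \<in> W" "evc t \<in> V" "evc t \<in> vmax L V \<longleftrightarrow> Om.eval t b \<in> vmax \<Omega> W"
proof -
  have sets: "set t \<subseteq> W" "set (map \<sigma> t) \<subseteq> V" using t comp by auto
  show tb: "Om.eval t b \<in> W" using W.eval_in_V[OF sets(1) b(1)] .
  show tc: "evc t \<in> V" unfolding evc_def using V.eval_in_V[OF sets(2) c(1)] .
  have aF: "Om.eval t a \<in> F" using Om.eval_closed'[OF Fs _ a(2)] t by auto
  have aW: "Om.eval t a \<in> W" using W.eval_in_V[OF sets(1) a(1)] .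
  have sa: "\<sigma> (Om.eval t a) = V.eval (map \<sigma> t) (\<sigma> a)"
    using s.eval_hom'[of a t] t a Om.eval_consistent[OF Fs] by auto
  have "Om.eval t b \<in> vmax \<Omega> W \<longleftrightarrow> Om.eval t a \<in> vmax \<Omega> W"
    by (rule W.unit_cong[OF tb aW W.eval_cong_m[OF b(1) a(1) ba sets(1)]])
  also have "\<dots> \<longleftrightarrow> \<sigma> (Om.eval t a) \<in> vmax L V" using s_m[OF aF] by simp
  also have "\<dots> \<longleftrightarrow> evc t \<in> vmax L V"
  proof -
    have sV: "\<sigma> a \<in> V" using comp a by simp
    have "evc t \<ominus>\<^bsub>L\<^esub> \<sigma> (Om.eval t a) \<in> vmax L V"
      unfolding sa evc_def by (rule V.eval_cong_m[OF c(1) sV ca sets(2)])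
    thus ?thesis using V.unit_cong[OF tc] comp[OF aF] aW by simp
  qed
  finally show "evc t \<in> vmax L V \<longleftrightarrow> Om.eval t b \<in> vmax \<Omega> W" by simp
qed

lemma WF: "subring (W \<inter> F) \<Omega>" by (rule Om.subring_inter[OF W.subring Fs])

lemma pF: "p \<in> carrier (F[X])" "set p \<subseteq> W \<inter> F" "p \<in> carrier (poly_ring \<Omega>)"
  using p Om.univ_poly_carrierD[OF WF p(1)] Om.univ_poly_mono[of "W \<inter> F" F] Om.univ_poly_mono[of "W \<inter> F" "carrier \<Omega>"] Fc
  by auto

definition D where "D = Om.Dp p"

text \<open>The derivative is congruent to its value at \<open>a\<close>, hence a unit at both
  roots. Dividing by it therefore preserves integrality.\<close>

lemma D: "D \<in> carrier (F[X])" "set D \<subseteq> W \<inter> F" "Om.eval D b \<in> W" "Om.eval D b \<notin> vmax \<Omega> W"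
  "evc D \<in> V" "evc D \<notin> vmax L V"
proof -
  have "D \<in> carrier ((W \<inter> F)[X])" unfolding D_def by (rule Om.Dp_closed[OF WF pF(2)])
  thus 1: "D \<in> carrier (F[X])" "set D \<subseteq> W \<inter> F"
    using Om.univ_poly_carrierD[OF WF] Om.univ_poly_mono[of "W \<inter> F" F] by auto
  have "Om.eval D a \<notin> vmax \<Omega> W"
    using simple Om.eval_Dp[of p a] pF(2) a Fc by (auto simp: D_def)
  moreover have "set D \<subseteq> W" using 1 by auto
  ultimately show "Om.eval D b \<in> W" "Om.eval D b \<notin> vmax \<Omega> W" "evc D \<in> V" "evc D \<notin> vmax L V"
    using integral_poly[OF 1(2)]
      W.unit_cong[OF _ W.eval_in_V[OF _ a(1)] W.eval_cong_m[OF b(1) a(1) ba \<open>set D \<subseteq> W\<close>]] by auto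
qed

text \<open>The remainder of \<open>h p'\<close> modulo \<open>p\<close> is integral by Lagrange interpolation and has coefficients
  in \<open>F\<close> because division with remainder does not depend on the field.\<close>

lemma trace:
  assumes h: "h \<in> carrier (F[X])"
    and hW: "\<And>x. x \<in> carrier \<Omega> \<Longrightarrow> Om.eval p x = \<zero> \<Longrightarrow> Om.eval h x \<in> W"
  shows "\<exists>t. set t \<subseteq> W \<inter> F \<and> Om.eval h b \<otimes> Om.eval D b = Om.eval t b \<and> evc h \<otimes>\<^bsub>L\<^esub> evc D = evc t"
proof -
  let ?P = "poly_ring \<Omega>"
  interpret UP: domain ?P by (rule Om.univ_poly_is_domain[OF Om.carrier_is_subring])
  obtain bs where bs: "set bs \<subseteq> carrier \<Omega>" "p = Om.lprod bs"
    using Om.monic_split_into_linear[OF pF(3) p(2,3)] by blast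
  have roots: "Om.eval p x = \<zero>" "x \<in> carrier \<Omega>" if "x \<in> set bs" for x
    using Om.eval_lprod_zero_iff[OF bs(1)] bs that by auto
  note up = Om.univ_poly_mono[OF Fc]
  have bW: "x \<in> W" if "x \<in> set bs" for x
    using W.root_of_monic_in_V[OF _ p(2,3) roots(2,1)[OF that]] pF(2) by auto
  obtain s t where st: "s \<in> carrier ?P" "t \<in> carrier (W[X])"
    "h \<otimes>\<^bsub>?P\<^esub> Om.Dp (Om.lprod bs) = Om.lprod bs \<otimes>\<^bsub>?P\<^esub> s \<oplus>\<^bsub>?P\<^esub> t" "length t \<le> length bs"
    using Om.lagrange_remainder[OF W.subring up[OF h], of bs] bW hW roots by blast
  have tP: "t \<in> carrier ?P" using Om.univ_poly_mono[OF subringE(1)[OF W.subring] st(2)] .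
  have hD: "h \<otimes>\<^bsub>F[X]\<^esub> D \<in> carrier (F[X])" using h D(1) by simp
  obtain s' t' where st': "s' \<in> carrier (F[X])" "t' \<in> carrier (F[X])"
    "h \<otimes>\<^bsub>F[X]\<^esub> D = (p \<otimes>\<^bsub>F[X]\<^esub> s') \<oplus>\<^bsub>F[X]\<^esub> t'" "t' = [] \<or> degree t' < degree p"
    using Om.field_long_division_theorem_shell[OF F hD pF(1)] p(2) by (auto simp: univ_poly_zero)
  have "Om.long_divides (h \<otimes>\<^bsub>?P\<^esub> D) p (s, t)"
  proof (rule Om.long_dividesI[OF st(1) tP])
    show "h \<otimes>\<^bsub>?P\<^esub> D = p \<otimes>\<^bsub>?P\<^esub> s \<oplus>\<^bsub>?P\<^esub> t" using st(3) by (simp only: D_def bs(2)[symmetric])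
    have "length p = Suc (length bs)" using Om.lprod_monic[OF bs(1)] bs(2) by simp
    thus "t = [] \<or> degree t < degree p" using st(4) by (cases t) auto
  qed
  moreover have "Om.long_divides (h \<otimes>\<^bsub>?P\<^esub> D) p (s', t')"
    using st' by (intro Om.long_dividesI up)
      (auto simp: Om.univ_poly_mult_eq[where K = F] Om.univ_poly_add_eq[where K = F])
  ultimately have "t = t'"
    using Om.exists_unique_long_division[OF Om.carrier_is_subfield _ pF(3) p(2), of "h \<otimes>\<^bsub>?P\<^esub> D"]
      UP.m_closed[OF up[OF h] up[OF D(1)]] by (metis prod.inject)
  hence "set t \<subseteq> W \<inter> F" "t \<in> carrier (F[X])"
    using setF[OF st'(2)] Om.univ_poly_carrierD(1)[OF W.subring st(2)] st'(2) by auto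
  moreover have "Om.eval h b \<otimes> Om.eval D b = Om.eval t b"
  proof -
    have "Om.eval h b \<otimes> Om.eval D b = Om.eval (h \<otimes>\<^bsub>F[X]\<^esub> D) b" using evb_hom[OF h D(1) bc(1)] by simp
    also have "\<dots> = Om.eval p b \<otimes> Om.eval s' b \<oplus> Om.eval t' b"
      unfolding st'(3) using evb_hom[OF _ _ bc(1)] st' pF(1) by simp
    finally show ?thesis using b st' evb_hom[OF _ _ bc(1)] \<open>t = t'\<close> by simp
  qed
  moreover have "evc h \<otimes>\<^bsub>L\<^esub> evc D = evc t"
  proof -
    have "evc h \<otimes>\<^bsub>L\<^esub> evc D = evc (h \<otimes>\<^bsub>F[X]\<^esub> D)" using evc_hom[OF h D(1)] by simp
    also have "\<dots> = evc p \<otimes>\<^bsub>L\<^esub> evc s' \<oplus>\<^bsub>L\<^esub> evc t'"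
      unfolding st'(3) using evc_hom st' pF(1) by simp
    finally show ?thesis using c st' evc_closed \<open>t = t'\<close> by (simp add: evc_def[of p])
  qed
  ultimately show ?thesis by blast
qed

text \<open>Choose a polynomial over \<open>F\<close> that annihilates \<open>g(x)\<close> for every root \<open>x\<close> of \<open>p\<close>, with
  coefficients in \<open>W\<close> and a first unit coefficient \<open>k\<close>. Its truncation after \<open>k\<close>, composed with
  \<open>g\<close>, gives \<open>y\<close> such that \<open>y\<close> and \<open>g y\<close> are integral at all roots of \<open>p\<close>, and \<open>y(b)\<close> is a unit.
  Both values are then transferred by the trace lemma.\<close>

lemma value_transfer:
  assumes g: "g \<in> carrier (F[X])" and gb: "Om.eval g b \<in> W"
  shows "evc g \<in> V" "Om.eval g b \<in> vmax \<Omega> W \<Longrightarrow> evc g \<in> vmax L V"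
proof -
  obtain bs where bs: "set bs \<subseteq> carrier \<Omega>" "p = Om.lprod bs"
    using Om.monic_split_into_linear[OF pF(3) p(2,3)] by blast
  have roots: "x \<in> set bs \<longleftrightarrow> Om.eval p x = \<zero>" if "x \<in> carrier \<Omega>" for x
    using Om.eval_lprod_zero_iff[OF bs(1) that] bs by simp
  have alg: "(Om.algebraic over F) (Om.eval g x)" if "x \<in> set bs" for x
  proof (rule Om.simple_extesion_mem_imp_algebraic[OF F])
    show x: "x \<in> carrier \<Omega>" using bs that by auto
    show "(Om.algebraic over F) x" using roots[OF x] that p(2) by (intro Om.algebraicI[OF pF(1)]) auto
    show "Om.eval g x \<in> Om.simple_extension F x"
      unfolding Om.simple_extension_as_eval_img[OF Fc x] using g by blast
  qed
  have "set (map (Om.eval g) bs) \<subseteq> carrier \<Omega>" using bs evb_hom(3)[OF g g] by auto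
  then obtain q where q: "q \<in> carrier (F[X])" "q \<noteq> []" "\<And>x. x \<in> set bs \<Longrightarrow> Om.eval q (Om.eval g x) = \<zero>"
    using Om.common_annihilator[OF F, of "map (Om.eval g) bs"] alg by (simp only: set_map) blast
  have "\<exists>x\<in>set q. x \<noteq> \<zero>" using q(1,2) by (cases q) (auto simp: univ_poly_def polynomial_def)
  then obtain e where e: "e \<in> F" "e \<noteq> \<zero>" "set (map ((\<otimes>) e) q) \<subseteq> W" "\<exists>x\<in>set (map ((\<otimes>) e) q). x \<notin> vmax \<Omega> W"
    using W.normalize_coefficients[OF F setF[OF q(1)]] by blast
  have eq0: "Om.eval (map ((\<otimes>) e) q) z = e \<otimes> Om.eval q z" if "z \<in> carrier \<Omega>" for z
  proof -
    have "set q \<subseteq> carrier \<Omega> \<Longrightarrow> Om.eval (map ((\<otimes>) e) q) z = e \<otimes> Om.eval q z" for q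
      by (induction q) (use e Fc that in \<open>auto simp: Om.r_distr Om.m_assoc Om.eval_in_carrier\<close>)
    thus ?thesis using setF[OF q(1)] Fc by auto
  qed
  obtain hi k lo where split: "map ((\<otimes>) e) q = hi @ k # lo" "k \<notin> vmax \<Omega> W" "\<forall>x\<in>set hi. x \<in> vmax \<Omega> W"
    using split_list_first_prop[OF e(4)] by auto
  have inW: "set (hi @ k # lo) \<subseteq> W" using e(3) split(1) by simp
  have "set (map ((\<otimes>) e) q) \<subseteq> F" using setF[OF q(1)] e(1) subringE(6)[OF Fs] by auto
  hence inF: "set (hi @ [k]) \<subseteq> F" using split(1) by auto
  obtain y where y: "y \<in> carrier (F[X])" "\<And>x. x \<in> carrier \<Omega> \<Longrightarrow> Om.eval y x = Om.eval (hi @ [k]) (Om.eval g x)"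
    using Om.poly_compose[OF Fs g inF] by blast
  define x where "x = g \<otimes>\<^bsub>F[X]\<^esub> y"
  have xF: "x \<in> carrier (F[X])" using g y by (simp add: x_def)
  have rt: "Om.eval y z \<in> W" "Om.eval x z \<in> W" if z: "z \<in> carrier \<Omega>" "Om.eval p z = \<zero>" for z
  proof -
    have gz: "Om.eval g z \<in> carrier \<Omega>" using evb_hom(3)[OF g g z(1)] .
    have "Om.eval (hi @ k # lo) (Om.eval g z) = \<zero>"
      using eq0[OF gz] q(3)[of z] roots[OF z(1)] z(2) split(1) e Fc by auto
    from W.truncated_relation[OF inW gz this]
    show "Om.eval y z \<in> W" "Om.eval x z \<in> W"
      using y z evb_hom[OF g y(1) z(1)] by (simp_all add: x_def)
  qed
  \<comment> \<open>The last Horner step is \<open>y(b) = hi(g(b)) g(b) + k\<close>. The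
    coefficients of \<open>hi\<close> lie in the maximal ideal and \<open>g(b)\<close> is integral,
    so \<open>y(b)\<close> is congruent to the unit \<open>k\<close>.\<close>
  have yb: "Om.eval y b \<notin> vmax \<Omega> W"
  proof -
    have hiW: "set hi \<subseteq> vmax \<Omega> W" "set hi \<subseteq> carrier \<Omega>" "k \<in> W" using split inW by auto
    have hm: "Om.eval hi (Om.eval g b) \<otimes> Om.eval g b \<in> vmax \<Omega> W"
      using W.m_mult(2)[OF gb W.eval_in_m[OF hiW(1) gb]] .
    have "Om.eval y b = Om.eval hi (Om.eval g b) \<otimes> Om.eval g b \<oplus> k"
      using y(2)[OF bc(1)] Om.eval_append_aux[OF hiW(2)] hiW(3) gb by simp
    moreover from this have "Om.eval y b \<ominus> k = Om.eval hi (Om.eval g b) \<otimes> Om.eval g b"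
      using hm hiW(3) by (simp add: a_minus_def Om.a_assoc Om.r_neg)
    ultimately show ?thesis
      using W.unit_cong[of "Om.eval y b" k] rt(1)[OF bc(1) b(2)] hiW(3) hm split(2) by simp
  qed
  obtain ty where ty: "set ty \<subseteq> W \<inter> F" "Om.eval y b \<otimes> Om.eval D b = Om.eval ty b" "evc y \<otimes>\<^bsub>L\<^esub> evc D = evc ty"
    using trace[OF y(1) rt(1)] by blast
  obtain tx where tx: "set tx \<subseteq> W \<inter> F" "Om.eval x b \<otimes> Om.eval D b = Om.eval tx b" "evc x \<otimes>\<^bsub>L\<^esub> evc D = evc tx"
    using trace[OF xF rt(2)] by blast
  note iy = integral_poly[OF ty(1)] and ix = integral_poly[OF tx(1)]
  have "Om.eval ty b \<notin> vmax \<Omega> W"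
    using W.unit_mult_iff[OF rt(1)[OF bc(1) b(2)] D(3)] yb D(4) ty(2) by simp
  hence vty: "evc ty \<in> V" "evc ty \<notin> vmax L V" using iy by auto
  define d where "d = evc ty"
  have xc: "evc x = evc g \<otimes>\<^bsub>L\<^esub> evc y" using evc_hom[OF g y(1)] by (simp add: x_def)
  have cl: "evc g \<in> carrier L" "evc y \<in> carrier L" "evc D \<in> carrier L" "d \<in> carrier L"
    using evc_closed g y(1) D(1) vty by (auto simp: d_def)
  have "evc tx = evc g \<otimes>\<^bsub>L\<^esub> d" using tx(3) ty(3) cl xc by (simp add: d_def V.m_assoc)
  moreover have dn: "d \<noteq> \<zero>\<^bsub>L\<^esub>" "inv\<^bsub>L\<^esub> d \<in> V" using V.unitD[OF vty] by (auto simp: d_def)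
  \<comment> \<open>From \<open>x = g y\<close>, the traces \<open>tx\<close> and \<open>ty\<close>
    differ at \<open>c\<close> by the factor \<open>g(c)\<close>, and \<open>ty(c)\<close> is a
    unit.\<close>
  ultimately have eg: "evc g = evc tx \<otimes>\<^bsub>L\<^esub> inv\<^bsub>L\<^esub> d"
    using V.eq_div_iff[of "evc tx" d "evc g"] cl ix(2) by simp
  show "evc g \<in> V" unfolding eg using V.V_mult[OF ix(2) dn(2)] .
  assume gm: "Om.eval g b \<in> vmax \<Omega> W"
  have "Om.eval tx b \<in> vmax \<Omega> W"
  proof -
    have "Om.eval x b \<in> vmax \<Omega> W"
      using W.m_mult(2)[OF rt(1)[OF bc(1) b(2)] gm] evb_hom[OF g y(1) bc(1)] by (simp add: x_def)
    thus ?thesis using W.m_mult(2)[OF D(3)] tx(2) by metis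
  qed
  hence "evc tx \<in> vmax L V" using ix by simp
  thus "evc g \<in> vmax L V" unfolding eg using V.m_mult(2)[OF dn(2)] by simp
qed

lemma b_alg: "(Om.algebraic over F) b"
  using b p(2) by (intro Om.algebraicI[OF pF(1)]) auto

lemma F_b_inverse:
  assumes g: "g \<in> carrier (F[X])" "Om.eval g b \<noteq> \<zero>"
  shows "\<exists>u \<in> carrier (F[X]). Om.eval g b \<otimes> Om.eval u b = \<one>"
proof -
  have sf: "subfield (Om.simple_extension F b) \<Omega>"
    using Om.simple_extension_is_subfield[OF F bc(1)] b_alg by simp
  note im = Om.simple_extension_as_eval_img[OF Fc bc(1)]
  have "Om.eval g b \<in> Om.simple_extension F b - {\<zero>}" using im g by auto
  hence "inv (Om.eval g b) \<in> Om.simple_extension F b" "Om.eval g b \<otimes> inv (Om.eval g b) = \<one>"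
    using Om.subfield_m_inv[OF sf] by auto
  thus ?thesis using im by auto
qed

text \<open>Suppose \<open>g(b) = 0\<close> but \<open>g(c)\<close> is nonzero, with inverse
  \<open>u(c)\<close>. Then \<open>g u\<close> vanishes at \<open>b\<close>, so its value lies in
  the maximal ideal; \<open>value_transfer\<close> puts the value \<open>1\<close> at
  \<open>c\<close> into the maximal ideal of \<open>V\<close>. Conversely, if \<open>u(b)\<close> is
  inverse to \<open>g(b)\<close>, then \<open>g u - 1\<close> vanishes at \<open>b\<close>, hence at
  \<open>c\<close>, and \<open>g(c) = 0\<close> is impossible.\<close>

lemma zero_transfer:
  assumes g: "g \<in> carrier (F[X])"
  shows "Om.eval g b = \<zero> \<longleftrightarrow> evc g = \<zero>\<^bsub>L\<^esub>"
proof -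
  have imp: "evc g = \<zero>\<^bsub>L\<^esub>" if g: "g \<in> carrier (F[X])" and z: "Om.eval g b = \<zero>" for g
  proof (rule ccontr)
    assume n: "evc g \<noteq> \<zero>\<^bsub>L\<^esub>"
    have K: "subfield (\<sigma> ` F) L"
      using s.img_is_subfield(2)[OF FF.carrier_is_subfield] V.one_not_zero by simp
    have poly: "map \<sigma> u \<in> carrier ((\<sigma> ` F)[X]\<^bsub>L\<^esub>)" if "u \<in> carrier (F[X])" for u
      using that s_inj[of "hd u"] by (cases u) (auto simp: univ_poly_def polynomial_def)
    have alg: "(V.algebraic over (\<sigma> ` F)) c"
      using c p(2) by (intro V.algebraicI[OF poly[OF pF(1)]]) auto
    have sf: "subfield (V.simple_extension (\<sigma> ` F) c) L"
      using V.simple_extension_is_subfield[OF K bc(2)] alg by simp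
    note im = V.simple_extension_as_eval_img[OF subfieldE(3)[OF K] bc(2)]
    have "evc g \<in> V.simple_extension (\<sigma> ` F) c - {\<zero>\<^bsub>L\<^esub>}" using im poly[OF g] n by (auto simp: evc_def)
    hence "inv\<^bsub>L\<^esub> (evc g) \<in> V.simple_extension (\<sigma> ` F) c" "evc g \<otimes>\<^bsub>L\<^esub> inv\<^bsub>L\<^esub> (evc g) = \<one>\<^bsub>L\<^esub>"
      using V.subfield_m_inv[OF sf] by auto
    then obtain v where v: "v \<in> carrier ((\<sigma> ` F)[X]\<^bsub>L\<^esub>)" "evc g \<otimes>\<^bsub>L\<^esub> V.eval v c = \<one>\<^bsub>L\<^esub>" using im by auto
    have sv: "set v \<subseteq> \<sigma> ` F" using V.univ_poly_carrierD(1)[OF subfieldE(1)[OF K] v(1)] .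
    define u where "u = map (inv_into F \<sigma>) v"
    have uv: "map \<sigma> u = v" using sv by (auto simp: u_def map_idI f_inv_into_f subset_iff)
    have uF: "set u \<subseteq> F" using sv by (auto simp: u_def inv_into_into subset_iff)
    have "u \<in> carrier (F[X])"
    proof (cases v)
      case Nil
      thus ?thesis by (simp add: u_def univ_poly_zero_closed)
    next
      case (Cons d v')
      hence "\<sigma> (hd u) = d" "d \<noteq> \<zero>\<^bsub>L\<^esub>" "u \<noteq> []" using uv v(1) by (auto simp: u_def univ_poly_def polynomial_def)
      thus ?thesis using uF s.hom_zero by (auto simp: univ_poly_def polynomial_def)
    qed
    moreover from this have "Om.eval (g \<otimes>\<^bsub>F[X]\<^esub> u) b = \<zero>"
      using evb_hom[OF g _ bc(1), of u] evb_hom(3)[OF _ _ bc(1), of u u] z by simp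
    ultimately have "evc (g \<otimes>\<^bsub>F[X]\<^esub> u) \<in> vmax L V"
      using value_transfer(2)[OF UPF.m_closed[OF g]] by simp
    thus False using evc_hom(1)[OF g \<open>u \<in> carrier (F[X])\<close>] v(2) uv by (simp add: evc_def[of u])
  qed
  show ?thesis
  proof
    assume z: "evc g = \<zero>\<^bsub>L\<^esub>"
    show "Om.eval g b = \<zero>"
    proof (rule ccontr)
      assume "Om.eval g b \<noteq> \<zero>"
      then obtain u where u: "u \<in> carrier (F[X])" "Om.eval g b \<otimes> Om.eval u b = \<one>" using F_b_inverse[OF g] by blast
      have o: "[\<ominus> \<one>] \<in> carrier (F[X])" "Om.eval [\<ominus> \<one>] b = \<ominus> \<one>"
        using subringE[OF Fs] bc by (auto simp: univ_poly_def polynomial_def)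
      have m: "g \<otimes>\<^bsub>F[X]\<^esub> u \<in> carrier (F[X])" using g u by simp
      have "Om.eval (g \<otimes>\<^bsub>F[X]\<^esub> u \<oplus>\<^bsub>F[X]\<^esub> [\<ominus> \<one>]) b = \<zero>"
        using evb_hom[OF m o(1) bc(1)] evb_hom[OF g u(1) bc(1)] u o by (simp add: Om.r_neg)
      hence "evc (g \<otimes>\<^bsub>F[X]\<^esub> u \<oplus>\<^bsub>F[X]\<^esub> [\<ominus> \<one>]) = \<zero>\<^bsub>L\<^esub>" using imp m o by simp
      hence "evc [\<ominus> \<one>] = \<zero>\<^bsub>L\<^esub>" using evc_hom[OF m o(1)] evc_hom[OF g u(1)] z evc_closed u o by simp
      moreover have "evc [\<ominus> \<one>] = \<sigma> (\<ominus> \<one>)" using s_closed[of "\<ominus> \<one>"] subringE[OF Fs] bc by (simp add: evc_def)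
      ultimately show False using s_inj[of "\<ominus> \<one>"] subringE[OF Fs] by simp
    qed
  qed (use imp g in simp)
qed

text \<open>Apply \<open>zero_transfer\<close> to \<open>g u - 1\<close>.\<close>

lemma evc_inverse:
  assumes g: "g \<in> carrier (F[X])" "u \<in> carrier (F[X])" "Om.eval g b \<otimes> Om.eval u b = \<one>"
  shows "evc g \<otimes>\<^bsub>L\<^esub> evc u = \<one>\<^bsub>L\<^esub>"
proof -
  have o: "[\<ominus> \<one>] \<in> carrier (F[X])" "Om.eval [\<ominus> \<one>] b = \<ominus> \<one>"
    using subringE[OF Fs] bc by (auto simp: univ_poly_def polynomial_def)
  have m: "g \<otimes>\<^bsub>F[X]\<^esub> u \<in> carrier (F[X])" using g by simp
  have "Om.eval (g \<otimes>\<^bsub>F[X]\<^esub> u \<oplus>\<^bsub>F[X]\<^esub> [\<ominus> \<one>]) b = \<zero>"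
    using evb_hom[OF m o(1) bc(1)] evb_hom[OF g(1,2) bc(1)] g o by (simp add: Om.r_neg)
  hence "evc (g \<otimes>\<^bsub>F[X]\<^esub> u \<oplus>\<^bsub>F[X]\<^esub> [\<ominus> \<one>]) = \<zero>\<^bsub>L\<^esub>" using zero_transfer m o by simp
  hence "evc g \<otimes>\<^bsub>L\<^esub> evc u \<oplus>\<^bsub>L\<^esub> evc [\<ominus> \<one>] = \<zero>\<^bsub>L\<^esub>" using evc_hom[OF m o(1)] evc_hom[OF g(1,2)] by simp
  moreover have "evc [\<ominus> \<one>] = \<ominus>\<^bsub>L\<^esub> \<one>\<^bsub>L\<^esub>"
  proof -
    have "\<sigma> (\<ominus> \<one>) \<oplus>\<^bsub>L\<^esub> \<sigma> \<one> = \<zero>\<^bsub>L\<^esub>"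
      using s.hom_add[of "\<ominus> \<one>" \<one>] subringE[OF Fs] s.hom_zero by (simp add: Om.l_neg)
    hence "\<ominus>\<^bsub>L\<^esub> \<one>\<^bsub>L\<^esub> = \<sigma> (\<ominus> \<one>)"
      using V.minus_equality[of "\<sigma> (\<ominus> \<one>)" "\<one>\<^bsub>L\<^esub>"] s_closed[of "\<ominus> \<one>"] subringE[OF Fs] s_one by simp
    thus ?thesis using s_closed[of "\<ominus> \<one>"] subringE[OF Fs] bc by (simp add: evc_def)
  qed
  ultimately show ?thesis
    using evc_closed[OF g(1)] evc_closed[OF g(2)]
    by (metis a_minus_def V.m_closed V.one_closed V.r_right_minus_eq)
qed

text \<open>For the converse of \<open>value_transfer\<close>, pass to inverses: if
  \<open>g(b)\<close> is not in \<open>W\<close>, then its inverse \<open>u(b)\<close> is in the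
  maximal ideal, hence so is \<open>u(c)\<close>, and \<open>g(c) u(c) = 1\<close> keeps
  \<open>g(c)\<close> out of \<open>V\<close>.\<close>

lemma valuation_transfer:
  assumes g: "g \<in> carrier (F[X])"
  shows "Om.eval g b \<in> W \<longleftrightarrow> evc g \<in> V"
proof
  assume e: "evc g \<in> V"
  show "Om.eval g b \<in> W"
  proof (rule ccontr)
    assume n: "Om.eval g b \<notin> W"
    have gc: "Om.eval g b \<in> carrier \<Omega>" using evb_hom(3)[OF g g bc(1)] .
    note nz = W.notin_V[OF gc n]
    obtain u where u: "u \<in> carrier (F[X])" "Om.eval g b \<otimes> Om.eval u b = \<one>" using F_b_inverse[OF g nz(1)] by blast
    have uc: "Om.eval u b \<in> carrier \<Omega>" using evb_hom(3)[OF u(1) u(1) bc(1)] .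
    have "Om.eval u b \<in> vmax \<Omega> W" using Om.inv_eqI[OF gc uc u(2)] nz(2) by simp
    hence "evc u \<in> vmax L V" using value_transfer(2)[OF u(1)] W.m_V by blast
    hence "evc g \<otimes>\<^bsub>L\<^esub> evc u \<in> vmax L V" using V.m_mult(1)[OF e] by simp
    thus False using evc_inverse[OF g u] V.m_one by simp
  qed
qed (rule value_transfer(1)[OF g])

end

section \<open>Maximal extensions with the same values are henselian\<close>

lemma poly_deriv_consistent: "poly_deriv (R\<lparr>carrier := K\<rparr>) p = poly_deriv R p"
proof -
  have "add_pow (R\<lparr>carrier := K\<rparr>) (n::nat) a = add_pow R n a" for n a
    by (simp add: add_pow_def nat_pow_def)
  thus ?thesis by (induction p) auto
qed

lemma (in ring) subring_a_inv_consistent: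
  assumes "subring S R" "x \<in> S"
  shows "\<ominus>\<^bsub>R\<lparr>carrier := S\<rparr>\<^esub> x = \<ominus> x"
proof -
  interpret S: ring "R\<lparr>carrier := S\<rparr>" by (rule subring_is_ring[OF assms(1)])
  show ?thesis
    using subringE[OF assms(1)] assms(2) by (intro S.minus_equality) (auto simp: l_neg)
qed

text \<open>All conditions are phrased in the ambient ring, so that the criterion serves both
  \<open>W \<inter> F\<close> inside a field and a subring of \<open>Rh\<close>.\<close>

lemma (in cring) henselian_subringI:
  assumes S: "subring S R" and M: "M \<subseteq> S" "\<zero> \<in> M" "\<one> \<notin> M"
    "\<And>x y. x \<in> M \<Longrightarrow> y \<in> M \<Longrightarrow> x \<oplus> y \<in> M" "\<And>x y. x \<in> S \<Longrightarrow> y \<in> M \<Longrightarrow> x \<otimes> y \<in> M"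
    and inv: "\<And>x. x \<in> S \<Longrightarrow> x \<notin> M \<Longrightarrow> \<exists>y\<in>S. x \<otimes> y = \<one>"
    and root: "\<And>p a. \<lbrakk>set p \<subseteq> S; p \<noteq> []; hd p = \<one>; a \<in> S; eval p a \<in> M; eval (poly_deriv R p) a \<notin> M\<rbrakk> \<Longrightarrow>
      \<exists>b\<in>S. eval p b = \<zero> \<and> b \<ominus> a \<in> M"
  shows "henselian (R\<lparr>carrier := S\<rparr>)" "max_ideal (R\<lparr>carrier := S\<rparr>) = M"
proof -
  let ?S = "R\<lparr>carrier := S\<rparr>"
  note SE = subringE[OF S]
  interpret S: cring ?S
    using subcring_iff[OF SE(1)] subcringI'[OF S] by simp
  have neg: "\<ominus> x \<in> M" if "x \<in> M" for x
  proof -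
    have "\<ominus> \<one> \<otimes> x \<in> M" using M(5)[OF _ that] SE by simp
    moreover have "x \<in> carrier R" using that M(1) SE(1) by auto
    ultimately show ?thesis by (simp add: l_minus)
  qed
  have id: "ideal M ?S"
  proof (rule idealI)
    show "ring ?S" by (rule S.ring_axioms)
    show "subgroup M (add_monoid ?S)"
    proof (rule S.add.subgroupI)
      fix x assume "x \<in> M"
      thus "\<ominus>\<^bsub>?S\<^esub> x \<in> M" using neg subring_a_inv_consistent[OF S] M(1) by auto
    qed (use M in auto)
    fix x y assume xy: "x \<in> M" "y \<in> carrier ?S"
    thus "y \<otimes>\<^bsub>?S\<^esub> x \<in> M" using M(5) by simp
    moreover have "x \<in> carrier R" "y \<in> carrier R" using xy M(1) SE(1) by auto
    ultimately show "x \<otimes>\<^bsub>?S\<^esub> y \<in> M" by (simp add: m_comm)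
  qed
  have loc: "local_ring ?S" and max: "max_ideal ?S = M"
    using local_ringI[OF S.cring_axioms id] M(3) inv by auto
  show "max_ideal ?S = M" by (rule max)
  show "henselian ?S"
    unfolding henselian_def
  proof (intro conjI loc ballI impI, elim conjE)
    fix p a assume p: "p \<in> carrier ((carrier ?S)[X]\<^bsub>?S\<^esub>)" and a: "a \<in> carrier ?S"
      and *: "p \<noteq> []" "hd p = \<one>\<^bsub>?S\<^esub>" "ring.eval ?S p a \<in> max_ideal ?S" "ring.eval ?S (poly_deriv ?S p) a \<notin> max_ideal ?S"
    have "set p \<subseteq> S" using p by (auto simp: univ_poly_def polynomial_def)
    then obtain b where "b \<in> S" "eval p b = \<zero>" "b \<ominus> a \<in> M"
      using root[of p a] * a by (auto simp: max eval_consistent[OF S] poly_deriv_consistent)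
    thus "\<exists>b\<in>carrier ?S. ring.eval ?S p b = \<zero>\<^bsub>?S\<^esub> \<and> b \<ominus>\<^bsub>?S\<^esub> a \<in> max_ideal ?S"
      using a subring_a_inv_consistent[OF S, of a]
      by (auto simp: max eval_consistent[OF S] a_minus_def)
  qed
qed

lemma (in domain) lprod_remove1:
  "\<lbrakk>set bs \<subseteq> carrier R; b \<in> set bs\<rbrakk> \<Longrightarrow> lprod bs = lin b \<otimes>\<^bsub>poly_ring R\<^esub> lprod (remove1 b bs)"
proof (induction bs)
  case (Cons d bs)
  interpret UP: domain "poly_ring R" by (rule univ_poly_is_domain[OF carrier_is_subring])
  show ?case
  proof (cases "d = b")
    case False
    hence "b \<in> set bs" "b \<in> carrier R" using Cons by auto
    moreover have "set (remove1 b bs) \<subseteq> carrier R" using Cons set_remove1_subset[of b bs] by auto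
    ultimately show ?thesis
      using Cons False lin_closed[OF carrier_is_subring] lprod_closed[OF carrier_is_subring]
      by (simp add: UP.m_lcomm)
  qed simp
qed simp

locale val_closed_field = Om: algebraically_closed \<Omega> + W: valuation_subring \<Omega> W
  for \<Omega> :: "('a, 'm) ring_scheme" (structure) and W
begin

definition unit where "unit x \<longleftrightarrow> x \<in> W \<and> x \<notin> vmax \<Omega> W"

lemma unit_mult: "unit x \<Longrightarrow> unit y \<Longrightarrow> unit (x \<otimes> y)"
  using W.unit_mult_iff[of x y] by (auto simp: unit_def W.V_mult)

lemma unit_one: "unit \<one>"
  by (simp add: unit_def)

lemma unitD: "unit x \<Longrightarrow> x \<in> carrier \<Omega>" "unit x \<Longrightarrow> x \<noteq> \<zero>" "unit x \<Longrightarrow> inv x \<in> W" "unit x \<Longrightarrow> unit (inv x)"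
  using W.unitD[of x] W.unit_inv[of x] by (auto simp: unit_def)

lemma unit_m_minus_one: "x \<in> vmax \<Omega> W \<Longrightarrow> unit (x \<ominus> \<one>)"
proof -
  assume x: "x \<in> vmax \<Omega> W"
  have c: "x \<in> W" "x \<in> carrier \<Omega>" using x W.m_V by auto
  have "x \<ominus> (x \<ominus> \<one>) = \<one>" using c by algebra
  hence "x \<ominus> \<one> \<notin> vmax \<Omega> W" using W.m_minus[OF x] W.m_one by metis
  thus ?thesis using W.V_minus[OF c(1) W.V_one] by (simp add: unit_def)
qed

text \<open>The value group of \<open>F\<close> is that of \<open>K\<close>; nothing is asked of the
  residue field.\<close>

definition same_values where
  "same_values K F \<longleftrightarrow> (\<forall>x\<in>F - {\<zero>}. \<exists>k\<in>K - {\<zero>}. unit (x \<otimes> inv k))"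

text \<open>Zorn's lemma applies because having the same values is a condition on single elements
  and so passes to unions of chains.\<close>

lemma exists_maximal_same_values:
  assumes K: "subfield K \<Omega>"
  obtains F where "subfield F \<Omega>" "K \<subseteq> F" "same_values K F"
    "\<And>E. subfield E \<Omega> \<Longrightarrow> F \<subseteq> E \<Longrightarrow> same_values K E \<Longrightarrow> E = F"
proof -
  define C where "C = {F. subfield F \<Omega> \<and> K \<subseteq> F \<and> same_values K F}"
  have "\<exists>F\<in>C. \<forall>E\<in>C. F \<subseteq> E \<longrightarrow> E = F"
  proof (rule subset_Zorn_nonempty)
    have "same_values K K"
      unfolding same_values_def using subfieldE(3)[OF K] unit_one by (auto intro!: bexI)
    thus "C \<noteq> {}" using K by (auto simp: C_def)
    fix \<C> assume ne: "\<C> \<noteq> {}" and ch: "subset.chain C \<C>"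
    have g: "subfield F \<Omega>" "K \<subseteq> F" "same_values K F" if "F \<in> \<C>" for F
      using ch that by (auto simp: subset.chain_def C_def)
    have "subfield (\<Union>\<C>) \<Omega>"
    proof (rule Om.subfieldI')
      show "subring (\<Union>\<C>) \<Omega>"
      proof (rule Om.subringI)
        obtain F where "F \<in> \<C>" using ne by auto
        thus "\<one> \<in> \<Union>\<C>" using subringE(3)[OF subfieldE(1)[OF g(1)]] by auto
        show "\<Union>\<C> \<subseteq> carrier \<Omega>" using subfieldE(3)[OF g(1)] by auto
        fix x assume x: "x \<in> \<Union>\<C>"
        thus "\<ominus> x \<in> \<Union>\<C>" using subringE(5)[OF subfieldE(1)[OF g(1)]] by auto
        fix y assume y: "y \<in> \<Union>\<C>"
        obtain F E where *: "F \<in> \<C>" "x \<in> F" "E \<in> \<C>" "y \<in> E" using x y by auto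
        hence "F \<subseteq> E \<or> E \<subseteq> F" using ch by (auto simp: subset.chain_def)
        then obtain G where G: "G \<in> \<C>" "x \<in> G" "y \<in> G" using * by blast
        from subringE(6,7)[OF subfieldE(1)[OF g(1)[OF G(1)]] G(2,3)]
        show "x \<otimes> y \<in> \<Union>\<C>" "x \<oplus> y \<in> \<Union>\<C>" using G(1) by blast+
      qed
      fix x assume "x \<in> \<Union>\<C> - {\<zero>}"
      then obtain F where F: "F \<in> \<C>" "x \<in> F - {\<zero>}" by auto
      thus "inv x \<in> \<Union>\<C>" using Om.subfield_m_inv(1)[OF g(1)[OF F(1)] F(2)] by auto
    qed
    moreover have "same_values K (\<Union>\<C>)" using g(3) by (auto simp: same_values_def)
    ultimately show "\<Union>\<C> \<in> C" using g(2) ne by (auto simp: C_def)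
  qed
  then obtain F where F: "F \<in> C" "\<And>E. E \<in> C \<Longrightarrow> F \<subseteq> E \<Longrightarrow> E = F" by blast
  show thesis by (rule that[of F]) (use F in \<open>auto simp: C_def\<close>)
qed

lemma in_m_cases: "\<lbrakk>x \<in> carrier \<Omega>; x \<noteq> \<zero>; x \<notin> vmax \<Omega> W\<rbrakk> \<Longrightarrow> inv x \<in> W"
  using W.notin_V(2)[of x] W.m_V[of "inv x"] W.unitD(2)[of x] by (cases "x \<in> W") simp_all

lemma div_trans: "\<lbrakk>x \<in> carrier \<Omega>; y \<in> carrier \<Omega>; z \<in> carrier \<Omega>; y \<noteq> \<zero>; z \<noteq> \<zero>\<rbrakk> \<Longrightarrow>
    x \<otimes> inv z = (x \<otimes> inv y) \<otimes> (y \<otimes> inv z)"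
proof -
  assume a: "x \<in> carrier \<Omega>" "y \<in> carrier \<Omega>" "z \<in> carrier \<Omega>" "y \<noteq> \<zero>" "z \<noteq> \<zero>"
  have "(x \<otimes> inv y) \<otimes> (y \<otimes> inv z) = x \<otimes> (inv y \<otimes> y) \<otimes> inv z"
    using a by (simp add: Om.m_assoc del: Om.l_inv' Om.r_inv' Om.Units_l_inv Om.Units_r_inv)
  thus ?thesis using a by simp
qed

text \<open>The Newton step at \<open>x\<close> doubles the value of \<open>x - b\<close>; no element of \<open>F\<close> is closest to \<open>b\<close>.\<close>

lemma newton_step:
  assumes F: "subfield F \<Omega>" and bs: "set bs \<subseteq> W" and p: "p = Om.lprod bs" "set p \<subseteq> F"
    and b: "b \<in> set bs" "b \<notin> F" and a: "a \<in> F" "a \<ominus> b \<in> vmax \<Omega> W"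
    and simple: "Om.eval (poly_deriv \<Omega> p) a \<notin> vmax \<Omega> W" and x: "x \<in> F"
  shows "\<exists>x'\<in>F. (x' \<ominus> b) \<otimes> inv (x \<ominus> b) \<in> vmax \<Omega> W"
proof -
  note Fs = subfieldE(1)[OF F] and Fc = subfieldE(3)[OF F]
  have bc: "b \<in> W" "b \<in> carrier \<Omega>" using b bs by auto
  have bsc: "set bs \<subseteq> carrier \<Omega>" using bs by auto
  have xc: "x \<in> carrier \<Omega>" "a \<in> carrier \<Omega>" using x a Fc by auto
  have nb: "y \<ominus> b \<noteq> \<zero>" if "y \<in> F" for y using that b(2) bc(2) Fc by (auto simp: Om.r_right_minus_eq)
  show ?thesis
  proof (cases "x \<ominus> b \<in> vmax \<Omega> W")
    \<comment> \<open>Here \<open>a\<close> itself is closer to \<open>b\<close> than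
      \<open>x\<close>, since \<open>a \<ominus> b\<close> is in the maximal ideal and
      \<open>x \<ominus> b\<close> is not.\<close>
    case False
    have "inv (x \<ominus> b) \<in> W" using in_m_cases[OF _ nb[OF x] False] xc bc by simp
    thus ?thesis using W.m_mult(2)[OF _ a(2)] a(1) by blast
  next
    case True
    let ?P = "poly_ring \<Omega>"
    interpret UP: domain ?P by (rule Om.univ_poly_is_domain[OF Om.carrier_is_subring])
    note up = Om.univ_poly_mono[OF subringE(1)[OF W.subring]]
    define q where "q = Om.lprod (remove1 b bs)"
    have qW: "q \<in> carrier (W[X])"
      unfolding q_def using bs set_remove1_subset[of b bs] by (intro Om.lprod_closed[OF W.subring]) auto
    have pq: "p = Om.lin b \<otimes>\<^bsub>?P\<^esub> q" using Om.lprod_remove1[OF bsc b(1)] by (simp add: p q_def)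
    have D: "Om.Dp p = q \<oplus>\<^bsub>?P\<^esub> Om.lin b \<otimes>\<^bsub>?P\<^esub> Om.Dp q"
      unfolding pq by (rule Om.Dp_lin_mult[OF bc(2) up[OF qW]])
    have DW: "Om.Dp q \<in> carrier (W[X])"
      by (rule Om.Dp_closed[OF W.subring Om.univ_poly_carrierD(1)[OF W.subring qW]])
    have l: "Om.lin b \<in> carrier ?P" by (rule Om.lin_closed[OF Om.carrier_is_subring bc(2)])
    have "x = (x \<ominus> b) \<oplus> b" using xc bc by algebra
    hence xW: "x \<in> W" using W.V_add[OF W.m_V[OF True] bc(1)] by simp
    have "a = (a \<ominus> b) \<oplus> b" using xc bc by algebra
    hence aW: "a \<in> W" using W.V_add[OF W.m_V[OF a(2)] bc(1)] by simp
    \<comment> \<open>With \<open>p = (X - b) q\<close>, these are \<open>e = p'(x)\<close>,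
      \<open>s = q(x)\<close> and \<open>d = q'(x)\<close>. They satisfy
      \<open>e = s + (x - b) d\<close> and \<open>p(x) = (x - b) s\<close>.\<close>
    define e s d where "e = Om.eval (Om.Dp p) x" and "s = Om.eval q x" and "d = Om.eval (Om.Dp q) x"
    have sd: "s \<in> W" "d \<in> W"
      using Om.eval_closed[OF W.subring _ xW] qW DW by (simp_all add: s_def d_def)
    have e: "e = s \<oplus> (x \<ominus> b) \<otimes> d"
      unfolding e_def D using up[OF qW] up[OF DW] l xc bc
      by (simp add: Om.eval_add Om.eval_mult Om.eval_lin s_def d_def)
    have px: "Om.eval p x = (x \<ominus> b) \<otimes> s"
      unfolding pq using up[OF qW] l xc bc by (simp add: Om.eval_mult Om.eval_lin s_def)
    have pW: "set p \<subseteq> W" using Om.univ_poly_carrierD(1)[OF W.subring Om.lprod_closed[OF W.subring bs]] p by simp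
    have "Om.eval (Om.Dp p) a \<notin> vmax \<Omega> W" using simple Om.eval_Dp[OF W.set_V_carr[OF pW], of a] xc by simp
    moreover have "x \<ominus> a \<in> vmax \<Omega> W"
    proof -
      have "x \<ominus> a = (x \<ominus> b) \<ominus> (a \<ominus> b)" using xc bc by algebra
      thus ?thesis using W.m_minus[OF True a(2)] by simp
    qed
    ultimately have "unit e"
      using W.unit_cong[OF _ _ W.eval_cong_m[OF xW aW]] W.eval_in_V[OF _ xW, of "Om.Dp p"] W.eval_in_V[OF _ aW, of "Om.Dp p"]
        Om.univ_poly_carrierD(1)[OF W.subring Om.Dp_closed[OF W.subring pW]] by (simp add: unit_def e_def)
    note ue = unitD[OF this]
    have eF: "e \<in> F" unfolding e_def
      using Om.eval_closed[OF Fs Om.Dp_closed[OF Fs p(2)] x] .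
    define x' where "x' = x \<ominus> Om.eval p x \<otimes> inv e"
    have "inv e \<in> F" using Om.subfield_m_inv(1)[OF F, of e] eF ue by simp
    hence x'F: "x' \<in> F" unfolding x'_def a_minus_def
      using subringE[OF Fs] Om.eval_closed'[OF Fs p(2) x] x by auto
    have c: "s \<in> carrier \<Omega>" "d \<in> carrier \<Omega>" "e \<in> carrier \<Omega>" "inv e \<in> carrier \<Omega>" using sd ue by auto
    \<comment> \<open>This unfolds to \<open>x' - b = (x - b) (e - s) / e = (x - b)^2 d / e\<close>,
      where \<open>e\<close> is a unit.\<close>
    have "x' \<ominus> b = (x \<ominus> b) \<otimes> (e \<otimes> inv e) \<ominus> (x \<ominus> b) \<otimes> s \<otimes> inv e"
    proof -
      have t: "(x \<ominus> b) \<otimes> s \<otimes> inv e \<in> carrier \<Omega>" using c xc bc by simp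
      have "x' \<ominus> b = (x \<ominus> b) \<ominus> (x \<ominus> b) \<otimes> s \<otimes> inv e"
        unfolding x'_def px using t xc(1) bc(2) by (simp add: a_minus_def Om.a_ac)
      thus ?thesis using xc bc ue(1,2) by simp
    qed
    also have "\<dots> = (x \<ominus> b) \<otimes> ((x \<ominus> b) \<otimes> d \<otimes> inv e)"
    proof -
      have "(x \<ominus> b) \<otimes> (e \<otimes> inv e) \<ominus> (x \<ominus> b) \<otimes> s \<otimes> inv e = (x \<ominus> b) \<otimes> ((e \<ominus> s) \<otimes> inv e)"
        using c(1,3,4) xc bc(2) by algebra
      moreover have "e \<ominus> s = (x \<ominus> b) \<otimes> d" unfolding e using c xc bc by algebra
      ultimately show ?thesis by simp
    qed
    finally have "(x' \<ominus> b) \<otimes> inv (x \<ominus> b) = (x \<ominus> b) \<otimes> d \<otimes> inv e"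
      using nb[OF x] xc bc c by (simp add: Om.m_ac)
    moreover have "(x \<ominus> b) \<otimes> d \<otimes> inv e \<in> vmax \<Omega> W"
      using W.m_mult(2)[OF ue(3) W.m_mult(2)[OF sd(2) True]] .
    ultimately show ?thesis using x'F by metis
  qed
qed

text \<open>The value at \<open>a\<close> is the product of the differences
  \<open>a \<ominus> b\<close>, and the maximal ideal is prime.\<close>

lemma factor_in_m:
  assumes "set bs \<subseteq> W" "a \<in> W" "Om.eval (Om.lprod bs) a \<in> vmax \<Omega> W"
  shows "\<exists>b\<in>set bs. a \<ominus> b \<in> vmax \<Omega> W"
  using assms
proof (induction bs)
  case (Cons b bs)
  have "set bs \<subseteq> carrier \<Omega>" "b \<in> carrier \<Omega>" "a \<in> carrier \<Omega>" using Cons by auto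
  hence "(a \<ominus> b) \<otimes> Om.eval (Om.lprod bs) a \<in> vmax \<Omega> W" using Cons(4) Om.eval_lprod_Cons by simp
  moreover have "Om.eval (Om.lprod bs) a \<in> W"
    using Om.eval_closed[OF W.subring Om.lprod_closed[OF W.subring] Cons(3)] Cons(2) by simp
  ultimately have "a \<ominus> b \<in> vmax \<Omega> W \<or> Om.eval (Om.lprod bs) a \<in> vmax \<Omega> W"
    using W.unit_mult_iff[OF W.V_minus] Cons by simp
  thus ?case using Cons by auto
qed simp

text \<open>Kaplansky: if no element of \<open>F\<close> is closest to \<open>b\<close>, adjoining a pseudo-limit \<open>c\<close> of minimal
  degree creates no new value, because every \<open>g\<close> of smaller degree has all its roots farther
  from \<open>b\<close> than some \<open>x\<close> in \<open>F\<close>, and then \<open>g(c) / g(x)\<close> is a unit.\<close>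

lemma no_closest_point_contradiction:
  assumes F: "subfield F \<Omega>" "same_values K F"
    and max: "\<And>E. subfield E \<Omega> \<Longrightarrow> F \<subseteq> E \<Longrightarrow> same_values K E \<Longrightarrow> E = F"
    and K: "subfield K \<Omega>" and b: "b \<in> carrier \<Omega>" "b \<notin> F"
    and q0: "q0 \<in> carrier (F[X])" "q0 \<noteq> []" "Om.eval q0 b = \<zero>"
    and step: "\<And>x. x \<in> F \<Longrightarrow> \<exists>x'\<in>F. (x' \<ominus> b) \<otimes> inv (x \<ominus> b) \<in> vmax \<Omega> W"
  shows False
proof -
  note Fs = subfieldE(1)[OF F(1)] and Fc = subfieldE(3)[OF F(1)]
  have nb: "y \<ominus> b \<noteq> \<zero>" "y \<ominus> b \<in> carrier \<Omega>" if "y \<in> F" for y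
    using that b Fc by (auto simp: Om.r_right_minus_eq)
  \<comment> \<open>\<open>P c\<close> says that \<open>c\<close> is closer to \<open>b\<close> than
    every element of \<open>F\<close>, so \<open>c\<close> is as good a limit as \<open>b\<close>.
    Among all nonzero polynomials over \<open>F\<close> with such a root, \<open>q\<close> has least
    length.\<close>
  define P where "P c \<longleftrightarrow> (\<forall>x\<in>F. (c \<ominus> b) \<otimes> inv (x \<ominus> b) \<in> vmax \<Omega> W)" for c
  define Q where "Q q \<longleftrightarrow> q \<in> carrier (F[X]) \<and> q \<noteq> [] \<and> (\<exists>c\<in>carrier \<Omega>. Om.eval q c = \<zero> \<and> P c)" for q
  have "P b" unfolding P_def using b nb by (auto simp: a_minus_def Om.r_neg)
  hence "Q q0" using q0 b by (auto simp: Q_def)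
  hence ex: "\<exists>q. Q q" by blast
  define q where "q = (ARG_MIN length q. Q q)"
  have q: "Q q" "\<And>g. Q g \<Longrightarrow> length q \<le> length g"
    using arg_min_nat_lemma[of Q q0 length] \<open>Q q0\<close> by (auto simp: q_def)
  obtain c where c: "c \<in> carrier \<Omega>" "Om.eval q c = \<zero>" "P c" using q(1) by (auto simp: Q_def)
  have qF: "q \<in> carrier (F[X])" "q \<noteq> []" using q(1) by (auto simp: Q_def)
  \<comment> \<open>An element of \<open>F\<close> would have to be closer to \<open>b\<close> than
    itself.\<close>
  have cF: "c \<notin> F"
  proof
    assume cF: "c \<in> F"
    hence "(c \<ominus> b) \<otimes> inv (c \<ominus> b) \<in> vmax \<Omega> W" using c(3) by (auto simp: P_def)
    thus False using nb[OF cF] by simp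
  qed
  \<comment> \<open>Finitely many elements that are not limits are all beaten by one
    \<open>x\<close> in \<open>F\<close>.\<close>
  have far: "\<exists>x\<in>F. \<forall>d\<in>set ds. d \<ominus> b \<noteq> \<zero> \<and> (x \<ominus> b) \<otimes> inv (d \<ominus> b) \<in> vmax \<Omega> W"
    if "set ds \<subseteq> carrier \<Omega>" "\<And>d. d \<in> set ds \<Longrightarrow> \<not> P d" for ds
    using that
  proof (induction ds)
    case Nil
    thus ?case using subringE(3)[OF Fs] by auto
  next
    case (Cons d ds)
    then obtain x1 where x1: "x1 \<in> F" "\<And>d. d \<in> set ds \<Longrightarrow> d \<ominus> b \<noteq> \<zero> \<and> (x1 \<ominus> b) \<otimes> inv (d \<ominus> b) \<in> vmax \<Omega> W"
      by (auto simp: subset_iff)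
    have dc: "d \<ominus> b \<in> carrier \<Omega>" using Cons b by simp
    \<comment> \<open>As \<open>d\<close> is no limit, some \<open>x2\<close> in \<open>F\<close> is
      at least as close to \<open>b\<close>. One application of \<open>step\<close> gives
      \<open>x3\<close> strictly closer than \<open>d\<close>, and the better of \<open>x1\<close>
      and \<open>x3\<close> serves the whole list.\<close>
    obtain x2 where x2: "x2 \<in> F" "(d \<ominus> b) \<otimes> inv (x2 \<ominus> b) \<notin> vmax \<Omega> W" using Cons(3)[of d] by (auto simp: P_def)
    have dn: "d \<ominus> b \<noteq> \<zero>" using x2 nb[OF x2(1)] by (auto simp: Om.l_null)
    have "inv ((d \<ominus> b) \<otimes> inv (x2 \<ominus> b)) \<in> W"
      using in_m_cases[OF _ _ x2(2)] nb[OF x2(1)] dn dc by (simp add: Om.integral_iff)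
    hence v: "(x2 \<ominus> b) \<otimes> inv (d \<ominus> b) \<in> W" using Om.frac_inv_rule[OF dc nb(2)[OF x2(1)] dn nb(1)[OF x2(1)]] by simp
    obtain x3 where x3: "x3 \<in> F" "(x3 \<ominus> b) \<otimes> inv (x2 \<ominus> b) \<in> vmax \<Omega> W" using step[OF x2(1)] by blast
    have d3: "(x3 \<ominus> b) \<otimes> inv (d \<ominus> b) \<in> vmax \<Omega> W"
      unfolding div_trans[OF nb(2)[OF x3(1)] nb(2)[OF x2(1)] dc nb(1)[OF x2(1)] dn]
      by (rule W.m_mult(2)[OF v x3(2)])
    have tr: "(y \<ominus> b) \<otimes> inv (z \<ominus> b) \<in> vmax \<Omega> W"
      if "y \<in> F" "x \<in> F" "z \<in> carrier \<Omega>" "z \<ominus> b \<noteq> \<zero>" "(y \<ominus> b) \<otimes> inv (x \<ominus> b) \<in> W" "(x \<ominus> b) \<otimes> inv (z \<ominus> b) \<in> vmax \<Omega> W" for x y z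
      using div_trans[OF nb(2)[OF that(1)] nb(2)[OF that(2)] _ nb(1)[OF that(2)] that(4)] W.m_mult(1)[OF that(5,6)] that(3) b by simp
    show ?case
    proof (cases "(x1 \<ominus> b) \<otimes> inv (x3 \<ominus> b) \<in> W")
      case True
      have "(x1 \<ominus> b) \<otimes> inv (d \<ominus> b) \<in> vmax \<Omega> W" by (rule tr[OF x1(1) x3(1) _ dn True d3]) (use Cons in auto)
      thus ?thesis using x1 dn by auto
    next
      case False
      have "inv ((x1 \<ominus> b) \<otimes> inv (x3 \<ominus> b)) \<in> W"
        using W.notin_V(2)[OF _ False] nb[OF x1(1)] nb[OF x3(1)] W.m_V by simp
      hence v: "(x3 \<ominus> b) \<otimes> inv (x1 \<ominus> b) \<in> W"
        using Om.frac_inv_rule[OF nb(2)[OF x1(1)] nb(2)[OF x3(1)] nb(1)[OF x1(1)] nb(1)[OF x3(1)]] by simp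
      have "(x3 \<ominus> b) \<otimes> inv (d' \<ominus> b) \<in> vmax \<Omega> W" if "d' \<in> set ds" for d'
        by (rule tr[OF x3(1) x1(1) _ _ v]) (use Cons that x1 in auto)
      thus ?thesis using x1 x3(1) d3 dn by auto
    qed
  qed
  have close: "\<exists>u x. x \<in> F \<and> unit u \<and> Om.eval g c = u \<otimes> Om.eval g x"
    if g: "g \<in> carrier (F[X])" "g \<noteq> []" "length g < length q" for g
  proof -
    have gc: "g \<in> carrier (poly_ring \<Omega>)" using Om.univ_poly_mono[OF Fc g(1)] .
    obtain k ds where k: "k \<in> carrier \<Omega>" "k \<noteq> \<zero>" "set ds \<subseteq> carrier \<Omega>" "g = [k] \<otimes>\<^bsub>poly_ring \<Omega>\<^esub> Om.lprod ds"
      using Om.split_into_linear[OF gc g(2)] by blast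
    have kc: "[k] \<in> carrier (poly_ring \<Omega>)" using k by (auto simp: univ_poly_def polynomial_def)
    have lc: "Om.lprod ds \<in> carrier (poly_ring \<Omega>)" using Om.lprod_closed[OF Om.carrier_is_subring k(3)] .
    have eg: "Om.eval g z = k \<otimes> Om.eval (Om.lprod ds) z" if "z \<in> carrier \<Omega>" for z
      unfolding k(4) using Om.eval_mult[OF kc lc that] k(1) that by simp
    have "\<not> P d" if "d \<in> set ds" for d
    proof
      assume "P d"
      moreover have "Om.eval g d = \<zero>" using eg[of d] Om.eval_lprod_zero_iff[OF k(3), of d] that k by auto
      ultimately have "Q g" using g k(3) that by (auto simp: Q_def)
      thus False using q(2)[of g] g(3) by simp
    qed
    then obtain x where x: "x \<in> F" "\<And>d. d \<in> set ds \<Longrightarrow> d \<ominus> b \<noteq> \<zero> \<and> (x \<ominus> b) \<otimes> inv (d \<ominus> b) \<in> vmax \<Omega> W"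
      using far[OF k(3)] by blast
    have xc: "x \<in> carrier \<Omega>" using x Fc by auto
    have cx: "(c \<ominus> b) \<otimes> inv (x \<ominus> b) \<in> vmax \<Omega> W" using c(3) x(1) by (auto simp: P_def)
    \<comment> \<open>Write \<open>z - d = ((z - b) / (d - b) - 1) (d - b)\<close>. For
      \<open>z = c\<close> and for \<open>z = x\<close> the quotient lies in the maximal ideal, so
      the bracket is a unit, and \<open>c - d\<close> and \<open>x - d\<close> differ by a
      unit.\<close>
    have "\<exists>u. unit u \<and> c \<ominus> d = u \<otimes> (x \<ominus> d)" if d: "d \<in> set ds" for d
    proof -
      have dc: "d \<in> carrier \<Omega>" "d \<ominus> b \<in> carrier \<Omega>" "inv (d \<ominus> b) \<in> carrier \<Omega>" using d k(3) b x(2)[OF d] by auto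
      note dn = x(2)[OF d]
      have cd: "(c \<ominus> b) \<otimes> inv (d \<ominus> b) \<in> vmax \<Omega> W"
        using div_trans[OF _ nb(2)[OF x(1)] dc(2) nb(1)[OF x(1)], of "c \<ominus> b"] dn c(1) b(1)
          W.m_mult(2)[OF W.m_V cx] by simp
      have rel: "z \<ominus> d = ((z \<ominus> b) \<otimes> inv (d \<ominus> b) \<ominus> \<one>) \<otimes> (d \<ominus> b)" if "z \<in> carrier \<Omega>" for z
      proof -
        have "((z \<ominus> b) \<otimes> inv (d \<ominus> b) \<ominus> \<one>) \<otimes> (d \<ominus> b) = (z \<ominus> b) \<otimes> (inv (d \<ominus> b) \<otimes> (d \<ominus> b)) \<ominus> (d \<ominus> b)"
          using that dc b(1) by algebra
        also have "\<dots> = (z \<ominus> b) \<ominus> (d \<ominus> b)" using dc dn that b(1) by simp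
        also have "\<dots> = z \<ominus> d" using that dc b(1) by algebra
        finally show ?thesis by simp
      qed
      define v w where "v = (c \<ominus> b) \<otimes> inv (d \<ominus> b) \<ominus> \<one>" and "w = (x \<ominus> b) \<otimes> inv (d \<ominus> b) \<ominus> \<one>"
      have vw: "unit v" "unit w" using unit_m_minus_one cd dn by (auto simp: v_def w_def)
      note uv = unitD[OF vw(1)] and uw = unitD[OF vw(2)]
      have "c \<ominus> d = v \<otimes> (d \<ominus> b)" "x \<ominus> d = w \<otimes> (d \<ominus> b)"
        using rel[OF c(1)] rel[OF xc] by (simp_all add: v_def w_def)
      moreover have "(v \<otimes> inv w) \<otimes> (w \<otimes> (d \<ominus> b)) = v \<otimes> (d \<ominus> b)"
      proof -
        have "(v \<otimes> inv w) \<otimes> (w \<otimes> (d \<ominus> b)) = v \<otimes> ((inv w \<otimes> w) \<otimes> (d \<ominus> b))"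
          using uv(1) uw(1,2) dc by (simp add: Om.m_assoc del: Om.l_inv' Om.r_inv' Om.Units_l_inv Om.Units_r_inv)
        thus ?thesis using uv uw dc by simp
      qed
      ultimately show ?thesis using unit_mult[OF vw(1) uw(4)] by metis
    qed
    hence "\<exists>u. unit u \<and> Om.eval (Om.lprod ds) c = u \<otimes> Om.eval (Om.lprod ds) x"
      using k(3)
    proof (induction ds)
      case Nil
      thus ?case using unit_one c xc by (auto intro!: exI[of _ \<one>])
    next
      case (Cons d ds)
      obtain u where u: "unit u" "Om.eval (Om.lprod ds) c = u \<otimes> Om.eval (Om.lprod ds) x" using Cons by auto
      obtain v where v: "unit v" "c \<ominus> d = v \<otimes> (x \<ominus> d)" using Cons by auto
      have cl: "u \<in> carrier \<Omega>" "v \<in> carrier \<Omega>" "x \<ominus> d \<in> carrier \<Omega>" "Om.eval (Om.lprod ds) x \<in> carrier \<Omega>"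
        using unitD(1) u v xc Cons(3) Om.eval_closed[OF Om.carrier_is_subring Om.lprod_closed[OF Om.carrier_is_subring]] by auto
      have "Om.eval (Om.lprod (d # ds)) c = (v \<otimes> (x \<ominus> d)) \<otimes> (u \<otimes> Om.eval (Om.lprod ds) x)"
        using Om.eval_lprod_Cons[of ds d c] Cons(3) c(1) u(2) v(2) by simp
      also have "\<dots> = (v \<otimes> u) \<otimes> Om.eval (Om.lprod (d # ds)) x"
        using Om.eval_lprod_Cons[of ds d x] Cons(3) xc cl by (simp add: Om.m_ac del: Om.lprod.simps)
      finally show ?case using unit_mult[OF v(1) u(1)] by blast
    qed
    then obtain u where u: "unit u" "Om.eval (Om.lprod ds) c = u \<otimes> Om.eval (Om.lprod ds) x" by blast
    have "Om.eval g c = u \<otimes> Om.eval g x"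
      using eg[OF c(1)] eg[OF xc] u k(1) unitD(1)[OF u(1)] Om.eval_closed[OF Om.carrier_is_subring lc xc] by (simp add: Om.m_ac)
    thus ?thesis using x(1) u(1) by blast
  qed
  define E where "E = Om.simple_extension F c"
  have alg: "(Om.algebraic over F) c" using c qF by (intro Om.algebraicI[of q]) auto
  have E: "subfield E \<Omega>" unfolding E_def using Om.simple_extension_is_subfield[OF F(1) c(1)] alg by simp
  have "same_values K E"
    unfolding same_values_def
  proof
    fix z assume z: "z \<in> E - {\<zero>}"
    then obtain g where g: "g \<in> carrier (F[X])" "z = Om.eval g c"
      using Om.simple_extension_as_eval_img[OF Fc c(1)] by (auto simp: E_def)
    \<comment> \<open>Since \<open>q(c) = 0\<close>, the element \<open>g(c)\<close> is the value at
      \<open>c\<close> of the remainder modulo \<open>q\<close>. The remainder is shorter than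
      \<open>q\<close>, so \<open>close\<close> applies to it.\<close>
    obtain s r where sr: "s \<in> carrier (F[X])" "r \<in> carrier (F[X])" "g = (q \<otimes>\<^bsub>F[X]\<^esub> s) \<oplus>\<^bsub>F[X]\<^esub> r" "r = [] \<or> degree r < degree q"
      using Om.field_long_division_theorem_shell[OF F(1) g(1) qF(1)] qF(2) by (auto simp: univ_poly_zero)
    interpret UF: domain "F[X]" by (rule Om.univ_poly_is_domain[OF Fs])
    note h = ring_hom_memE[OF Om.eval_is_hom[OF Fs c(1)]]
    have zr: "z = Om.eval r c" using g sr qF c h(1) h(2)[OF qF(1) sr(1)] h(3)[OF UF.m_closed[OF qF(1) sr(1)] sr(2)] by simp
    have rn: "r \<noteq> []" using z zr by auto
    hence "length r < length q" using sr(4) by (cases r; cases q) auto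
    then obtain u x where ux: "x \<in> F" "unit u" "z = u \<otimes> Om.eval r x" using close[OF sr(2) rn] zr by blast
    have rx: "Om.eval r x \<in> F" using Om.eval_closed[OF Fs sr(2) ux(1)] .
    have "Om.eval r x \<noteq> \<zero>" using z ux unitD(1)[OF ux(2)] by auto
    then obtain k where k: "k \<in> K - {\<zero>}" "unit (Om.eval r x \<otimes> inv k)" using F(2) rx by (auto simp: same_values_def)
    have "z \<otimes> inv k = u \<otimes> (Om.eval r x \<otimes> inv k)"
    proof -
      have "Om.eval r x \<in> carrier \<Omega>" "k \<in> carrier \<Omega>" "k \<noteq> \<zero>" using rx Fc k(1) subfieldE(3)[OF K] by auto
      thus ?thesis using ux(3) unitD(1)[OF ux(2)] by (simp add: Om.m_assoc)
    qed
    thus "\<exists>k\<in>K - {\<zero>}. unit (z \<otimes> inv k)" using k unit_mult[OF ux(2) k(2)] by (intro bexI[of _ k]) simp_all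
  qed
  moreover have "F \<subseteq> E" unfolding E_def by (rule Om.simple_extension_incl[OF Fc c(1)])
  ultimately have "E = F" using max[OF E] by simp
  moreover have "c \<in> E" unfolding E_def by (rule Om.simple_extension_mem[OF Fs c(1)])
  ultimately show False using cF by simp
qed

text \<open>A root \<open>b\<close> congruent to \<open>a\<close> exists in \<open>\<Omega>\<close>,
  because the maximal ideal is prime. If it were outside \<open>F\<close>, Newton steps would show
  that no element of \<open>F\<close> is closest to it, and a limit could be adjoined without new
  values.\<close>

theorem maximal_same_values_henselian:
  assumes K: "subfield K \<Omega>" and F: "subfield F \<Omega>" "same_values K F"
    and max: "\<And>E. subfield E \<Omega> \<Longrightarrow> F \<subseteq> E \<Longrightarrow> same_values K E \<Longrightarrow> E = F"
  shows "henselian (\<Omega>\<lparr>carrier := W \<inter> F\<rparr>)" "max_ideal (\<Omega>\<lparr>carrier := W \<inter> F\<rparr>) = vmax \<Omega> W \<inter> F"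
proof -
  note Fs = subfieldE(1)[OF F(1)] and Fc = subfieldE(3)[OF F(1)] and FE = subringE[OF subfieldE(1)[OF F(1)]]
  have WF: "subring (W \<inter> F) \<Omega>" by (rule Om.subring_inter[OF W.subring Fs])
  have root: "\<exists>b\<in>W \<inter> F. Om.eval p b = \<zero> \<and> b \<ominus> a \<in> vmax \<Omega> W \<inter> F"
    if p: "set p \<subseteq> W \<inter> F" "p \<noteq> []" "hd p = \<one>" and a: "a \<in> W \<inter> F" "Om.eval p a \<in> vmax \<Omega> W \<inter> F"
      and simple: "Om.eval (poly_deriv \<Omega> p) a \<notin> vmax \<Omega> W \<inter> F" for p a
  proof -
    have pF: "p \<in> carrier (F[X])" "p \<in> carrier (poly_ring \<Omega>)"
      using p Fc by (auto simp: univ_poly_def polynomial_def)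
    obtain bs where bs: "set bs \<subseteq> carrier \<Omega>" "p = Om.lprod bs"
      using Om.monic_split_into_linear[OF pF(2) p(2,3)] by blast
    have roots: "Om.eval p x = \<zero>" "x \<in> carrier \<Omega>" if "x \<in> set bs" for x
      using Om.eval_lprod_zero_iff[OF bs(1)] bs that by auto
    have bW: "set bs \<subseteq> W"
      using W.root_of_monic_in_V[OF _ p(2,3) roots(2,1)] p(1) by auto
    obtain b where b: "b \<in> set bs" "a \<ominus> b \<in> vmax \<Omega> W" using factor_in_m[OF bW, of a] a bs(2) by auto
    have ac: "a \<in> carrier \<Omega>" "b \<in> carrier \<Omega>" "a \<in> F" using a b bs by auto
    have "b \<ominus> a = \<ominus> (a \<ominus> b)" using ac by algebra
    hence ba: "b \<ominus> a \<in> vmax \<Omega> W" using W.m_neg[OF b(2)] by simp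
    have "Om.eval (poly_deriv \<Omega> p) a \<in> F"
      using Om.eval_closed'[OF Fs Om.set_poly_deriv[OF Fs] ac(3)] p(1) by simp
    hence simple': "Om.eval (poly_deriv \<Omega> p) a \<notin> vmax \<Omega> W" using simple by simp
    have "b \<in> F"
    proof (rule ccontr)
      assume "b \<notin> F"
      have pF': "set p \<subseteq> F" using p(1) by auto
      show False
        by (rule no_closest_point_contradiction[OF F max K ac(2) \<open>b \<notin> F\<close> pF(1) p(2) roots(1)[OF b(1)]
              newton_step[OF F(1) bW bs(2) pF' b(1) \<open>b \<notin> F\<close> ac(3) b(2) simple']])
    qed
    thus ?thesis using roots(1)[OF b(1)] ba b(1) bW FE ac by (auto simp: a_minus_def)
  qed
  have inv: "\<exists>y\<in>W \<inter> F. x \<otimes> y = \<one>" if x: "x \<in> W \<inter> F" "x \<notin> vmax \<Omega> W \<inter> F" for x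
  proof -
    have "x \<noteq> \<zero>" "inv x \<in> W" "x \<in> carrier \<Omega>" using x W.unitD[of x] by auto
    moreover hence "inv x \<in> F" using Om.subfield_m_inv(1)[OF F(1), of x] x by simp
    ultimately show ?thesis by (intro bexI[of _ "inv x"]) auto
  qed
  have sub: "vmax \<Omega> W \<inter> F \<subseteq> W \<inter> F" using W.m_V by auto
  have zero: "\<zero> \<in> vmax \<Omega> W \<inter> F" and one: "\<one> \<notin> vmax \<Omega> W \<inter> F" using FE(2) by auto
  have add: "x \<oplus> y \<in> vmax \<Omega> W \<inter> F" if "x \<in> vmax \<Omega> W \<inter> F" "y \<in> vmax \<Omega> W \<inter> F" for x y
    using W.m_add[of x y] FE(7)[of x y] that by simp
  have mult: "x \<otimes> y \<in> vmax \<Omega> W \<inter> F" if "x \<in> W \<inter> F" "y \<in> vmax \<Omega> W \<inter> F" for x y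
    using W.m_mult(1)[of x y] FE(6)[of x y] that by simp
  show "henselian (\<Omega>\<lparr>carrier := W \<inter> F\<rparr>)" "max_ideal (\<Omega>\<lparr>carrier := W \<inter> F\<rparr>) = vmax \<Omega> W \<inter> F"
    by (rule Om.henselian_subringI(1)[OF WF sub zero one add mult inv root]; assumption)
      (rule Om.henselian_subringI(2)[OF WF sub zero one add mult inv root]; assumption)
qed

end

section \<open>The universal property of the henselization\<close>

lemma poly_deriv_hom:
  assumes "ring_hom_ring R S h" "set p \<subseteq> carrier R"
  shows "map h (poly_deriv R p) = poly_deriv S (map h p)"
proof -
  interpret ring_hom_ring R S h by fact
  have "h (add_pow R (n::nat) x) = add_pow S n (h x)" if "x \<in> carrier R" for x n
    by (induction n) (use that in auto)
  thus ?thesis using assms(2) by (induction p) auto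
qed

lemma local_homD:
  assumes "f \<in> local_hom R S"
  shows "f \<in> ring_hom R S" "\<And>x. x \<in> max_ideal R \<Longrightarrow> f x \<in> max_ideal S"
  using assms by (auto simp: local_hom_def)

lemma henselianD:
  assumes "henselian S" shows "local_ring S" "cring S" "ring S"
  using assms local_ring_max_ideal(1) cring.axioms(1) by (auto simp: henselian_def)

text \<open>Transport of structure along an injection, in order to move a henselian ring into the
  type over which \<open>henselization\<close> quantifies.\<close>

lemma henselian_image_ring:
  assumes S: "henselian S" and inj: "inj_on h (carrier S)"
  shows "henselian (image_ring h S)" "max_ideal (image_ring h S) = h ` max_ideal S"
    "h \<in> ring_iso S (image_ring h S)"
proof -
  let ?T = "image_ring h S" and ?M = "max_ideal S"
  interpret S: cring S using henselianD[OF S] by simp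
  show iso: "h \<in> ring_iso S ?T" by (rule inj_imp_image_ring_iso[OF inj])
  have hh: "h \<in> ring_hom S ?T" using iso by (simp add: ring_iso_def)
  have carT: "carrier ?T = h ` carrier S" by (rule image_ring_carrier)
  have "cring ?T"
  proof (rule cring.intro)
    show r: "ring ?T" by (rule S.inj_imp_image_ring_is_ring[OF inj])
    have "x \<otimes>\<^bsub>?T\<^esub> y = y \<otimes>\<^bsub>?T\<^esub> x" if xy: "x \<in> carrier ?T" "y \<in> carrier ?T" for x y
    proof -
      obtain x' y' where *: "x' \<in> carrier S" "y' \<in> carrier S" "x = h x'" "y = h y'" using xy carT by auto
      have "h (x' \<otimes>\<^bsub>S\<^esub> y') = h (y' \<otimes>\<^bsub>S\<^esub> x')" using S.m_comm[OF *(1,2)] by simp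
      thus ?thesis using ring_hom_mult[OF hh *(1,2)] ring_hom_mult[OF hh *(2,1)] * by simp
    qed
    thus "comm_monoid ?T" using monoid.monoid_comm_monoidI[OF ring.is_monoid[OF r]] by blast
  qed
  then interpret T: cring ?T .
  interpret h: ring_hom_ring S ?T h
    using ring_hom_ringI2[OF S.ring_axioms T.ring_axioms] iso by (auto simp: ring_iso_def)
  note loc = local_ring_max_ideal[OF henselianD(1)[OF S]]
  interpret M: ideal ?M S by (rule loc(3))
  have Mc: "?M \<subseteq> carrier S" using M.Icarr by auto
  have hM: "h x \<in> h ` ?M \<longleftrightarrow> x \<in> ?M" if "x \<in> carrier S" for x
    using inj that Mc by (auto simp: inj_on_def)
  have id: "ideal (h ` ?M) ?T"
  proof (rule idealI[OF T.ring_axioms])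
    show "subgroup (h ` ?M) (add_monoid ?T)"
      by (rule h.img_is_add_subgroup) (rule M.a_subgroup)
    fix a x assume "a \<in> h ` ?M" "x \<in> carrier ?T"
    then obtain m y where "m \<in> ?M" "a = h m" "y \<in> carrier S" "x = h y" unfolding carT by auto
    moreover hence "x \<otimes>\<^bsub>?T\<^esub> a = h (y \<otimes>\<^bsub>S\<^esub> m)" "a \<otimes>\<^bsub>?T\<^esub> x = h (m \<otimes>\<^bsub>S\<^esub> y)" using Mc by auto
    ultimately show "x \<otimes>\<^bsub>?T\<^esub> a \<in> h ` ?M" "a \<otimes>\<^bsub>?T\<^esub> x \<in> h ` ?M"
      using M.I_l_closed M.I_r_closed by (metis imageI)+
  qed
  have one: "\<one>\<^bsub>?T\<^esub> \<notin> h ` ?M" using hM[of "\<one>\<^bsub>S\<^esub>"] loc(4) by simp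
  have inv: "\<exists>y\<in>carrier ?T. x \<otimes>\<^bsub>?T\<^esub> y = \<one>\<^bsub>?T\<^esub>" if x: "x \<in> carrier ?T" "x \<notin> h ` ?M" for x
  proof -
    obtain x' where x': "x' \<in> carrier S" "x = h x'" using x carT by auto
    then obtain y where y: "y \<in> carrier S" "x' \<otimes>\<^bsub>S\<^esub> y = \<one>\<^bsub>S\<^esub>"
      using local_ring_inverse[OF henselianD(1)[OF S]] x(2) by blast
    have "h x' \<otimes>\<^bsub>?T\<^esub> h y = \<one>\<^bsub>?T\<^esub>" using h.hom_mult[OF x'(1) y(1)] y(2) h.hom_one by simp
    thus ?thesis using x' y by auto
  qed
  show max: "max_ideal ?T = h ` ?M" by (rule local_ringI(2)[OF T.cring_axioms id one inv])
  show "henselian ?T"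
    unfolding henselian_def
  proof (intro conjI ballI impI; (elim conjE)?)
    show "local_ring ?T" by (rule local_ringI(1)[OF T.cring_axioms id one inv])
    fix p a assume p: "p \<in> carrier ((carrier ?T)[X]\<^bsub>?T\<^esub>)" and a: "a \<in> carrier ?T"
      and *: "p \<noteq> []" "hd p = \<one>\<^bsub>?T\<^esub>" "T.eval p a \<in> max_ideal ?T" "T.eval (poly_deriv ?T p) a \<notin> max_ideal ?T"
    define k where "k = inv_into (carrier S) h"
    have setp: "set p \<subseteq> h ` carrier S" using p carT by (auto simp: univ_poly_def polynomial_def)
    define q where "q = map k p"
    have hq: "map h q = p" using setp by (auto simp: q_def k_def map_idI f_inv_into_f subset_iff)
    have setq: "set q \<subseteq> carrier S" using setp by (auto simp: q_def k_def inv_into_into subset_iff)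
    obtain a' where a': "a' \<in> carrier S" "a = h a'" using a carT by auto
    have qn: "q \<noteq> []" using * by (simp add: q_def)
    have "h (hd q) = h \<one>\<^bsub>S\<^esub>" using *(1,2) hq qn h.hom_one hd_map[OF qn, of h] by simp
    moreover have "hd q \<in> carrier S" using setq hd_in_set[OF qn] by auto
    ultimately have hdq: "hd q = \<one>\<^bsub>S\<^esub>" using inj_onD[OF inj] by auto
    have n0: "\<one>\<^bsub>S\<^esub> \<noteq> \<zero>\<^bsub>S\<^esub>" using loc(4) M.zero_closed by auto
    have qS: "q \<in> carrier ((carrier S)[X]\<^bsub>S\<^esub>)" using setq qn hdq n0 by (auto simp: univ_poly_def polynomial_def)
    have dq: "set (poly_deriv S q) \<subseteq> carrier S" using S.set_poly_deriv[OF S.carrier_is_subring setq] .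
    have ev: "h (S.eval q x) = T.eval p (h x)" "h (S.eval (poly_deriv S q) x) = T.eval (poly_deriv ?T p) (h x)"
      if "x \<in> carrier S" for x
      using h.eval_hom'[OF that setq] h.eval_hom'[OF that dq] poly_deriv_hom[OF h.ring_hom_ring_axioms setq] hq by simp_all
    have "S.eval q a' \<in> ?M" "S.eval (poly_deriv S q) a' \<notin> ?M"
      using *(3,4) unfolding max a'(2) ev[OF a'(1), symmetric]
      using hM[OF S.eval_in_carrier[OF setq a'(1)]] hM[OF S.eval_in_carrier[OF dq a'(1)]] by simp_all
    then obtain b where b: "b \<in> carrier S" "S.eval q b = \<zero>\<^bsub>S\<^esub>" "b \<ominus>\<^bsub>S\<^esub> a' \<in> ?M"
      using S qS a'(1) qn hdq unfolding henselian_def by blast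
    have "h (b \<ominus>\<^bsub>S\<^esub> a') = h b \<ominus>\<^bsub>?T\<^esub> a" using b a' by (simp add: a_minus_def)
    hence "h b \<ominus>\<^bsub>?T\<^esub> a \<in> max_ideal ?T" unfolding max using b(3) by (metis imageI)
    moreover have "T.eval p (h b) = \<zero>\<^bsub>?T\<^esub>" using ev(1)[OF b(1)] b(2) h.hom_zero by simp
    ultimately show "\<exists>b\<in>carrier ?T. T.eval p b = \<zero>\<^bsub>?T\<^esub> \<and> b \<ominus>\<^bsub>?T\<^esub> a \<in> max_ideal ?T" using b(1) by auto
  qed
qed

text \<open>The existence half of the universal property for a ring on any type, as long as its
  carrier injects into the type of the test rings.\<close>

lemma henselization_lift:
  fixes R :: "('a, 'm) ring_scheme" and Rh :: "('b, 'n) ring_scheme" and S :: "('c, 'k) ring_scheme"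
    and h :: "'c \<Rightarrow> ('a + 'b) list set"
  assumes H: "henselization R Rh i" and S: "henselian S" and inj: "inj_on h (carrier S)"
    and f: "f \<in> local_hom R S"
  shows "\<exists>g \<in> local_hom Rh S. \<forall>x \<in> carrier R. g (i x) = f x"
proof -
  let ?T = "image_ring h S"
  note T = henselian_image_ring[OF S inj]
  have hh: "h \<in> ring_hom S ?T" using T(3) by (simp add: ring_iso_def)
  have "h \<circ> f \<in> local_hom R ?T"
    using ring_hom_trans[OF local_homD(1)[OF f] hh] local_homD(2)[OF f] T(2) by (auto simp: local_hom_def)
  then obtain g where g: "g \<in> local_hom Rh ?T" "\<And>x. x \<in> carrier R \<Longrightarrow> g (i x) = h (f x)"

  proof -
    have "\<exists>!g. g \<in> local_hom Rh ?T \<inter> extensional (carrier Rh) \<and> (\<forall>x \<in> carrier R. g (i x) = (h \<circ> f) x)"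
      using H T(1) \<open>h \<circ> f \<in> local_hom R ?T\<close> unfolding henselization_def by blast
    thus ?thesis using that by (elim ex1E) auto
  qed
  define k where "k = inv_into (carrier S) h"
  have k: "k \<in> ring_hom ?T S"
    using ring_iso_set_sym[OF henselianD(3)[OF S] T(3)] by (simp add: k_def ring_iso_def)
  have kh: "k (h x) = x" if "x \<in> carrier S" for x using inv_into_f_f[OF inj that] by (simp add: k_def)
  have Mc: "max_ideal S \<subseteq> carrier S"
    using ideal.Icarr[OF local_ring_max_ideal(3)[OF henselianD(1)[OF S]]] by auto
  have "k \<circ> g \<in> ring_hom Rh S" by (rule ring_hom_trans[OF local_homD(1)[OF g(1)] k])
  moreover have "(k \<circ> g) x \<in> max_ideal S" if "x \<in> max_ideal Rh" for x
    using local_homD(2)[OF g(1) that] T(2) kh Mc by auto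
  ultimately have "k \<circ> g \<in> local_hom Rh S" by (auto simp: local_hom_def)
  moreover have "(k \<circ> g) (i x) = f x" if "x \<in> carrier R" for x
    using g(2)[OF that] kh ring_hom_closed[OF local_homD(1)[OF f] that] by simp
  ultimately show ?thesis by blast
qed

text \<open>The universal property gives a map \<open>g\<close> from \<open>Rh\<close> to
  \<open>C\<close> over \<open>R\<close>. Followed by the inclusion it is an endomorphism of
  \<open>Rh\<close> over \<open>R\<close>, hence the identity by uniqueness; so every element lies
  in \<open>C\<close>.\<close>

lemma henselization_rigid:
  fixes R :: "('a, 'm) ring_scheme" and Rh :: "('b, 'n) ring_scheme"
  assumes H: "henselization R Rh i" and C: "subring C Rh" "henselian (Rh\<lparr>carrier := C\<rparr>)"
      "max_ideal (Rh\<lparr>carrier := C\<rparr>) = max_ideal Rh \<inter> C"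
    and iC: "i ` carrier R \<subseteq> C" and RM: "max_ideal R \<subseteq> carrier R"
  shows "C = carrier Rh"
proof -
  let ?C = "Rh\<lparr>carrier := C\<rparr>"
  have hRh: "henselian Rh" and i: "i \<in> local_hom R Rh" using H by (auto simp: henselization_def)
  interpret Rh: cring Rh using henselianD[OF hRh] by simp
  have Cc: "C \<subseteq> carrier Rh" using subringE(1)[OF C(1)] .
  \<comment> \<open>Singletons of one-letter words embed \<open>Rh\<close> into the test
    type.\<close>
  define h :: "'b \<Rightarrow> ('a + 'b) list set" where "h x = {[Inr x]}" for x
  have inj: "inj_on h A" for A by (auto simp: h_def inj_on_def)
  have iC': "i \<in> local_hom R ?C"
    unfolding local_hom_def
  proof (intro CollectI conjI)
    show "i \<in> ring_hom R ?C"
      using ring_hom_memE[OF local_homD(1)[OF i]] iC by (intro ring_hom_memI) auto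
    show "i ` max_ideal R \<subseteq> max_ideal ?C" using local_homD(2)[OF i] iC RM C(3) by auto
  qed
  obtain g where g: "g \<in> local_hom Rh ?C" "\<And>x. x \<in> carrier R \<Longrightarrow> g (i x) = i x"
    using henselization_lift[OF H C(2) inj iC'] by blast
  let ?T = "image_ring h Rh"
  note T = henselian_image_ring[OF hRh inj]
  have hh: "h \<in> ring_hom Rh ?T" using T(3) by (simp add: ring_iso_def)
  have g': "g \<in> ring_hom Rh Rh"
    using ring_hom_memE[OF local_homD(1)[OF g(1)]] Cc by (intro ring_hom_memI) auto
  \<comment> \<open>Uniqueness in \<open>henselization\<close> concerns extensional functions, so
    the two maps to be compared are first restricted to the carrier.\<close>
  have loc: "restrict (h \<circ> f) (carrier Rh) \<in> local_hom Rh ?T \<inter> extensional (carrier Rh)"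
    if f: "f \<in> ring_hom Rh Rh" "\<And>x. x \<in> max_ideal Rh \<Longrightarrow> f x \<in> max_ideal Rh" for f
  proof -
    have "restrict (h \<circ> f) (carrier Rh) \<in> ring_hom Rh ?T"
      using Rh.ring_hom_restrict[OF ring_hom_trans[OF f(1) hh]] by simp
    moreover have "max_ideal Rh \<subseteq> carrier Rh"
      using ideal.Icarr[OF local_ring_max_ideal(3)[OF henselianD(1)[OF hRh]]] by auto
    ultimately show ?thesis using f(2) T(2) by (auto simp: local_hom_def)
  qed
  have l1: "restrict (h \<circ> g) (carrier Rh) \<in> local_hom Rh ?T \<inter> extensional (carrier Rh)"
    using loc[OF g'] local_homD(2)[OF g(1)] C(3) by auto
  have l2: "restrict (h \<circ> id) (carrier Rh) \<in> local_hom Rh ?T \<inter> extensional (carrier Rh)"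
    by (rule loc) (auto intro: ring_hom_memI)
  have ic: "i x \<in> carrier Rh" if "x \<in> carrier R" for x using ring_hom_closed[OF local_homD(1)[OF i] that] .
  have "h \<circ> i \<in> local_hom R ?T"
    using ring_hom_trans[OF local_homD(1)[OF i] hh] local_homD(2)[OF i] T(2) by (auto simp: local_hom_def)
  hence "\<exists>!f. f \<in> local_hom Rh ?T \<inter> extensional (carrier Rh) \<and> (\<forall>x \<in> carrier R. f (i x) = (h \<circ> i) x)"
    using H T(1) unfolding henselization_def by blast
  hence "restrict (h \<circ> g) (carrier Rh) = restrict (h \<circ> id) (carrier Rh)"
  proof (rule ex1E, goal_cases)
    case (1 f)
    have "restrict (h \<circ> g) (carrier Rh) = f" "restrict (h \<circ> id) (carrier Rh) = f"
      using 1(2) l1 l2 g(2) ic by auto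
    thus ?case by simp
  qed
  hence e: "restrict (h \<circ> g) (carrier Rh) x = restrict (h \<circ> id) (carrier Rh) x" for x by (simp only:)
  have "h (g x) = h x" if "x \<in> carrier Rh" for x using e[of x] that by simp
  hence "g x = x" if "x \<in> carrier Rh" for x using that by (auto simp: h_def)
  moreover have "g x \<in> C" if "x \<in> carrier Rh" for x using ring_hom_closed[OF local_homD(1)[OF g(1)] that] by simp
  ultimately show ?thesis using Cc by force
qed

section \<open>Uniqueness of places of the henselization\<close>

text \<open>A maximal correspondence \<open>G\<close> (graph of an isomorphism of valued subfields) contains the
  image of \<open>Rh\<close>: its preimage in \<open>Rh\<close> is a henselian local subring.\<close>

locale two_places = val_closed_field \<Omega> W + V: valuation_subring L V
  for \<Omega> :: "('c, 'm) ring_scheme" (structure) and W and L :: "('d, 'k) ring_scheme" and V +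
  fixes R :: "('a, 'r) ring_scheme" and Rh :: "('b, 'n) ring_scheme" and i \<theta> \<theta>'
  assumes R: "domain R" "local_ring R" and H: "henselization R Rh i"
    and \<theta>: "\<theta> \<in> ring_hom Rh \<Omega>" "\<theta> ` carrier Rh \<subseteq> W" "\<theta> ` max_ideal Rh \<subseteq> vmax \<Omega> W"
    and \<theta>': "\<theta>' \<in> ring_hom Rh L" "\<theta>' ` carrier Rh \<subseteq> V" "\<theta>' ` max_ideal Rh \<subseteq> vmax L V"
    and nonzero: "s \<in> carrier R \<Longrightarrow> s \<noteq> \<zero>\<^bsub>R\<^esub> \<Longrightarrow> \<theta> (i s) \<noteq> \<zero>"
      "s \<in> carrier R \<Longrightarrow> s \<noteq> \<zero>\<^bsub>R\<^esub> \<Longrightarrow> \<theta>' (i s) \<noteq> \<zero>\<^bsub>L\<^esub>"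
    and agree: "\<lbrakk>r \<in> carrier R; s \<in> carrier R; s \<noteq> \<zero>\<^bsub>R\<^esub>\<rbrakk> \<Longrightarrow>
      \<theta> (i r) \<otimes> inv (\<theta> (i s)) \<in> W \<longleftrightarrow> \<theta>' (i r) \<otimes>\<^bsub>L\<^esub> inv\<^bsub>L\<^esub> (\<theta>' (i s)) \<in> V"
begin

sublocale R: domain R by (rule R)
lemma hensel: "henselian Rh" and i: "i \<in> local_hom R Rh" using H by (auto simp: henselization_def)
sublocale Rh: cring Rh using henselianD(2)[OF hensel] .
sublocale t: ring_hom_ring Rh \<Omega> \<theta> by (rule ring_hom_ringI2[OF Rh.ring_axioms Om.ring_axioms \<theta>(1)])
sublocale t': ring_hom_ring Rh L \<theta>' by (rule ring_hom_ringI2[OF Rh.ring_axioms V.ring_axioms \<theta>'(1)])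
sublocale i: ring_hom_ring R Rh i by (rule ring_hom_ringI2[OF R.ring_axioms Rh.ring_axioms local_homD(1)[OF i]])

text \<open>A set of pairs in place of a function makes extension an inclusion, ready for Zorn's
  lemma. That the relation is a function follows by subtraction from the clause on zero.\<close>

definition corr where
  "corr G \<longleftrightarrow> G \<subseteq> carrier \<Omega> \<times> carrier L \<and> (\<one>, \<one>\<^bsub>L\<^esub>) \<in> G \<and>
    (\<forall>(x, y)\<in>G. (\<ominus> x, \<ominus>\<^bsub>L\<^esub> y) \<in> G \<and> (x = \<zero> \<longleftrightarrow> y = \<zero>\<^bsub>L\<^esub>) \<and> (x \<in> W \<longleftrightarrow> y \<in> V) \<and>
       (x \<noteq> \<zero> \<longrightarrow> (inv x, inv\<^bsub>L\<^esub> y) \<in> G) \<and>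
       (\<forall>(x', y')\<in>G. (x \<oplus> x', y \<oplus>\<^bsub>L\<^esub> y') \<in> G \<and> (x \<otimes> x', y \<otimes>\<^bsub>L\<^esub> y') \<in> G))"

lemma corrI:
  assumes "\<And>x y. (x, y) \<in> G \<Longrightarrow> x \<in> carrier \<Omega> \<and> y \<in> carrier L" "(\<one>, \<one>\<^bsub>L\<^esub>) \<in> G"
    "\<And>x y. (x, y) \<in> G \<Longrightarrow> (\<ominus> x, \<ominus>\<^bsub>L\<^esub> y) \<in> G" "\<And>x y. (x, y) \<in> G \<Longrightarrow> x = \<zero> \<longleftrightarrow> y = \<zero>\<^bsub>L\<^esub>"
    "\<And>x y. (x, y) \<in> G \<Longrightarrow> x \<in> W \<longleftrightarrow> y \<in> V" "\<And>x y. (x, y) \<in> G \<Longrightarrow> x \<noteq> \<zero> \<Longrightarrow> (inv x, inv\<^bsub>L\<^esub> y) \<in> G"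
    "\<And>x y x' y'. (x, y) \<in> G \<Longrightarrow> (x', y') \<in> G \<Longrightarrow> (x \<oplus> x', y \<oplus>\<^bsub>L\<^esub> y') \<in> G"
    "\<And>x y x' y'. (x, y) \<in> G \<Longrightarrow> (x', y') \<in> G \<Longrightarrow> (x \<otimes> x', y \<otimes>\<^bsub>L\<^esub> y') \<in> G"
  shows "corr G"
  unfolding corr_def by (intro conjI ballI subsetI impI; clarify?) (use assms in auto)

lemma corrE:
  assumes "corr G"
  shows "(x, y) \<in> G \<Longrightarrow> x \<in> carrier \<Omega>" "(x, y) \<in> G \<Longrightarrow> y \<in> carrier L" "(\<one>, \<one>\<^bsub>L\<^esub>) \<in> G"
    "(x, y) \<in> G \<Longrightarrow> (\<ominus> x, \<ominus>\<^bsub>L\<^esub> y) \<in> G" "(x, y) \<in> G \<Longrightarrow> x = \<zero> \<longleftrightarrow> y = \<zero>\<^bsub>L\<^esub>"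
    "(x, y) \<in> G \<Longrightarrow> x \<in> W \<longleftrightarrow> y \<in> V" "(x, y) \<in> G \<Longrightarrow> x \<noteq> \<zero> \<Longrightarrow> (inv x, inv\<^bsub>L\<^esub> y) \<in> G"
    "(x, y) \<in> G \<Longrightarrow> (x', y') \<in> G \<Longrightarrow> (x \<oplus> x', y \<oplus>\<^bsub>L\<^esub> y') \<in> G"
    "(x, y) \<in> G \<Longrightarrow> (x', y') \<in> G \<Longrightarrow> (x \<otimes> x', y \<otimes>\<^bsub>L\<^esub> y') \<in> G"
  using assms unfolding corr_def by (blast, blast, blast, fastforce+)

text \<open>The two images of the fraction field of \<open>R\<close>. For a relation the choice of
  representatives \<open>r\<close>, \<open>s\<close> is immaterial; well-definedness is contained in
  the clause of \<open>corr\<close> on zero.\<close>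

definition base where
  "base = (\<lambda>(r, s). (\<theta> (i r) \<otimes> inv (\<theta> (i s)), \<theta>' (i r) \<otimes>\<^bsub>L\<^esub> inv\<^bsub>L\<^esub> (\<theta>' (i s)))) ` (carrier R \<times> (carrier R - {\<zero>\<^bsub>R\<^esub>}))"

lemma zero_image: "r \<in> carrier R \<Longrightarrow> \<theta> (i r) = \<zero> \<longleftrightarrow> r = \<zero>\<^bsub>R\<^esub>" "r \<in> carrier R \<Longrightarrow> \<theta>' (i r) = \<zero>\<^bsub>L\<^esub> \<longleftrightarrow> r = \<zero>\<^bsub>R\<^esub>"
  using nonzero[of r] by auto

lemma corr_base: "corr base"
proof (rule corrI)
  have baseI: "(u, v) \<in> base" if "r \<in> carrier R" "s \<in> carrier R" "s \<noteq> \<zero>\<^bsub>R\<^esub>"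
    "u = \<theta> (i r) \<otimes> inv (\<theta> (i s))" "v = \<theta>' (i r) \<otimes>\<^bsub>L\<^esub> inv\<^bsub>L\<^esub> (\<theta>' (i s))" for r s u v
    using that by (auto simp: base_def)
  show "(\<one>, \<one>\<^bsub>L\<^esub>) \<in> base" by (rule baseI[of "\<one>\<^bsub>R\<^esub>" "\<one>\<^bsub>R\<^esub>"]) auto
  fix x y assume "(x, y) \<in> base"
  then obtain r s where rs: "r \<in> carrier R" "s \<in> carrier R" "s \<noteq> \<zero>\<^bsub>R\<^esub>"
    "x = \<theta> (i r) \<otimes> inv (\<theta> (i s))" "y = \<theta>' (i r) \<otimes>\<^bsub>L\<^esub> inv\<^bsub>L\<^esub> (\<theta>' (i s))" by (auto simp: base_def)
  note z = zero_image[OF rs(1)] zero_image[OF rs(2)]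
  show "x \<in> carrier \<Omega> \<and> y \<in> carrier L" using rs z by auto
  show "(\<ominus> x, \<ominus>\<^bsub>L\<^esub> y) \<in> base"
    by (rule baseI[of "\<ominus>\<^bsub>R\<^esub> r" s]) (use rs z in \<open>auto simp: Om.l_minus V.l_minus\<close>)
  show "x = \<zero> \<longleftrightarrow> y = \<zero>\<^bsub>L\<^esub>"
    using rs z by (simp add: Om.integral_iff V.integral_iff)
  show "x \<in> W \<longleftrightarrow> y \<in> V" using agree rs by simp
  show "(inv x, inv\<^bsub>L\<^esub> y) \<in> base" if "x \<noteq> \<zero>"
  proof -
    have "r \<noteq> \<zero>\<^bsub>R\<^esub>" using that rs z by (auto simp: Om.l_null)
    thus ?thesis by (intro baseI[of s r]) (use rs z in \<open>auto simp: Om.frac_inv_rule V.frac_inv_rule\<close>)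
  qed
  fix x' y' assume "(x', y') \<in> base"
  then obtain r' s' where rs': "r' \<in> carrier R" "s' \<in> carrier R" "s' \<noteq> \<zero>\<^bsub>R\<^esub>"
    "x' = \<theta> (i r') \<otimes> inv (\<theta> (i s'))" "y' = \<theta>' (i r') \<otimes>\<^bsub>L\<^esub> inv\<^bsub>L\<^esub> (\<theta>' (i s'))" by (auto simp: base_def)
  note z' = zero_image[OF rs'(2)]
  have n: "s \<otimes>\<^bsub>R\<^esub> s' \<noteq> \<zero>\<^bsub>R\<^esub>" using rs rs' R.integral_iff by auto
  show "(x \<otimes> x', y \<otimes>\<^bsub>L\<^esub> y') \<in> base"
    by (rule baseI[of "r \<otimes>\<^bsub>R\<^esub> r'" "s \<otimes>\<^bsub>R\<^esub> s'"]) (use rs rs' z z' n in \<open>auto simp: Om.frac_mult_rule V.frac_mult_rule\<close>)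
  show "(x \<oplus> x', y \<oplus>\<^bsub>L\<^esub> y') \<in> base"
    by (rule baseI[of "r \<otimes>\<^bsub>R\<^esub> s' \<oplus>\<^bsub>R\<^esub> r' \<otimes>\<^bsub>R\<^esub> s" "s \<otimes>\<^bsub>R\<^esub> s'"])
      (use rs rs' z z' n in \<open>auto simp: Om.frac_add_rule V.frac_add_rule\<close>)
qed

lemma maximal_corr:
  obtains G where "corr G" "base \<subseteq> G" "\<And>G'. corr G' \<Longrightarrow> G \<subseteq> G' \<Longrightarrow> G' = G"
proof -
  define C where "C = {G. corr G \<and> base \<subseteq> G}"
  have "\<exists>G\<in>C. \<forall>G'\<in>C. G \<subseteq> G' \<longrightarrow> G' = G"
  proof (rule subset_Zorn_nonempty)
    show "C \<noteq> {}" using corr_base by (auto simp: C_def)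
    fix \<C> assume ne: "\<C> \<noteq> {}" and ch: "subset.chain C \<C>"
    have g: "corr G" "base \<subseteq> G" if "G \<in> \<C>" for G using ch that by (auto simp: subset.chain_def C_def)
    have "corr (\<Union>\<C>)"
    proof (rule corrI)
      obtain G where "G \<in> \<C>" using ne by auto
      thus "(\<one>, \<one>\<^bsub>L\<^esub>) \<in> \<Union>\<C>" using corrE(3)[OF g(1)] by auto
      fix x y assume "(x, y) \<in> \<Union>\<C>"
      then obtain G where G: "G \<in> \<C>" "(x, y) \<in> G" by auto
      note c = corrE[OF g(1)[OF G(1)]]
      show "x \<in> carrier \<Omega> \<and> y \<in> carrier L" "(\<ominus> x, \<ominus>\<^bsub>L\<^esub> y) \<in> \<Union>\<C>" "x = \<zero> \<longleftrightarrow> y = \<zero>\<^bsub>L\<^esub>" "x \<in> W \<longleftrightarrow> y \<in> V"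
        using c(1,2,4-6)[OF G(2)] G(1) by auto
      show "(inv x, inv\<^bsub>L\<^esub> y) \<in> \<Union>\<C>" if "x \<noteq> \<zero>" using c(7)[OF G(2) that] G(1) by auto
      fix x' y' assume "(x', y') \<in> \<Union>\<C>"
      then obtain G' where G': "G' \<in> \<C>" "(x', y') \<in> G'" by auto
      have "G \<subseteq> G' \<or> G' \<subseteq> G" using ch G(1) G'(1) by (auto simp: subset.chain_def)
      then obtain J where J: "J \<in> \<C>" "(x, y) \<in> J" "(x', y') \<in> J" using G G' by blast
      show "(x \<oplus> x', y \<oplus>\<^bsub>L\<^esub> y') \<in> \<Union>\<C>" "(x \<otimes> x', y \<otimes>\<^bsub>L\<^esub> y') \<in> \<Union>\<C>"
        using corrE(8,9)[OF g(1)[OF J(1)] J(2,3)] J(1) by blast+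
    qed
    thus "\<Union>\<C> \<in> C" using g(2) ne by (auto simp: C_def)
  qed
  then obtain G where G: "G \<in> C" "\<And>G'. G' \<in> C \<Longrightarrow> G \<subseteq> G' \<Longrightarrow> G' = G" by blast
  show thesis by (rule that[of G]) (use G in \<open>auto simp: C_def\<close>)
qed

end

locale max_corr = two_places +
  fixes G
  assumes G: "corr G" "base \<subseteq> G" "\<And>G'. corr G' \<Longrightarrow> G \<subseteq> G' \<Longrightarrow> G' = G"
begin

lemmas c = corrE[OF G(1)]

definition F where "F = fst ` G"
definition \<sigma> where "\<sigma> x = (THE y. (x, y) \<in> G)"

lemma G_fun: "(x, y) \<in> G \<Longrightarrow> (x, y') \<in> G \<Longrightarrow> y = y'"
proof -
  assume a: "(x, y) \<in> G" "(x, y') \<in> G"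
  have "(x \<oplus> \<ominus> x, y \<oplus>\<^bsub>L\<^esub> \<ominus>\<^bsub>L\<^esub> y') \<in> G" using c(8)[OF a(1) c(4)[OF a(2)]] .
  hence "y \<oplus>\<^bsub>L\<^esub> \<ominus>\<^bsub>L\<^esub> y' = \<zero>\<^bsub>L\<^esub>" using c(5) c(1)[OF a(1)] Om.r_neg by auto
  thus ?thesis using c(2)[OF a(1)] c(2)[OF a(2)] by (metis V.minus_equality V.minus_minus V.a_inv_closed)
qed

lemma sigma_eq: "(x, y) \<in> G \<Longrightarrow> \<sigma> x = y"
  unfolding \<sigma>_def using G_fun by (intro the_equality) auto

lemma sigma_G: "x \<in> F \<Longrightarrow> (x, \<sigma> x) \<in> G"
  using sigma_eq by (auto simp: F_def)

lemma F_I: "(x, y) \<in> G \<Longrightarrow> x \<in> F"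
  by (force simp: F_def)

lemma F_subfield: "subfield F \<Omega>"
proof (rule Om.subfieldI'[OF Om.subringI])
  show "F \<subseteq> carrier \<Omega>" using c(1) by (auto simp: F_def)
  show "\<one> \<in> F" using F_I[OF c(3)] .
  fix x assume x: "x \<in> F"
  show "\<ominus> x \<in> F" using F_I[OF c(4)[OF sigma_G[OF x]]] .
  fix y assume y: "y \<in> F"
  show "x \<otimes> y \<in> F" "x \<oplus> y \<in> F" using F_I[OF c(9)] F_I[OF c(8)] sigma_G x y by blast+
next
  fix x assume "x \<in> F - {\<zero>}"
  thus "inv x \<in> F" using F_I[OF c(7)[OF sigma_G[of x]]] by simp
qed

lemma sigma_hom: "\<sigma> \<in> ring_hom (\<Omega>\<lparr>carrier := F\<rparr>) L"
  by (rule ring_hom_memI) (auto intro: sigma_eq c(2)[OF sigma_G] c(9) c(8) c(3) sigma_G)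

definition C where "C = {x \<in> carrier Rh. (\<theta> x, \<theta>' x) \<in> G}"

lemma C_subring: "subring C Rh"
  by (rule Rh.subringI) (auto simp: C_def c)

lemma theta_unit:
  assumes "x \<in> carrier Rh" "x \<notin> max_ideal Rh"
  shows "\<theta> x \<notin> vmax \<Omega> W"
proof -
  obtain y where y: "y \<in> carrier Rh" "x \<otimes>\<^bsub>Rh\<^esub> y = \<one>\<^bsub>Rh\<^esub>"
    using local_ring_inverse[OF henselianD(1)[OF hensel] assms] by blast
  have "\<theta> x \<otimes> \<theta> y = \<one>" using t.hom_mult[OF assms(1) y(1)] y(2) by simp
  thus ?thesis using W.unitI[of "\<theta> x" "\<theta> y"] \<theta>(2) assms(1) y(1) by auto
qed

text \<open>A simple residual root over \<open>C\<close> lifts to some \<open>b\<close> in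
  \<open>Rh\<close>. The images of \<open>b\<close> under \<open>\<theta>\<close> and
  \<open>\<theta>'\<close> form a simple root pair, so \<open>G\<close> extends to both of them; by
  maximality it contains them already, which means that \<open>b\<close> is in
  \<open>C\<close>.\<close>

lemma C_henselian: "henselian (Rh\<lparr>carrier := C\<rparr>)" "max_ideal (Rh\<lparr>carrier := C\<rparr>) = max_ideal Rh \<inter> C"
proof -
  let ?M = "max_ideal Rh"
  note loc = local_ring_max_ideal[OF henselianD(1)[OF hensel]]
  interpret M: ideal ?M Rh by (rule loc(3))
  note CE = subringE[OF C_subring]
  have inv: "\<exists>y\<in>C. x \<otimes>\<^bsub>Rh\<^esub> y = \<one>\<^bsub>Rh\<^esub>" if x: "x \<in> C" "x \<notin> ?M \<inter> C" for x
  proof -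
    have xc: "x \<in> carrier Rh" "x \<notin> ?M" "(\<theta> x, \<theta>' x) \<in> G" using x by (auto simp: C_def)
    obtain y where y: "y \<in> carrier Rh" "x \<otimes>\<^bsub>Rh\<^esub> y = \<one>\<^bsub>Rh\<^esub>"
      using local_ring_inverse[OF henselianD(1)[OF hensel] xc(1,2)] by blast
    have "\<theta> x \<otimes> \<theta> y = \<one>" "\<theta>' x \<otimes>\<^bsub>L\<^esub> \<theta>' y = \<one>\<^bsub>L\<^esub>"
      using t.hom_mult[OF xc(1) y(1)] t'.hom_mult[OF xc(1) y(1)] y(2) by simp_all
    moreover hence "\<theta> x \<noteq> \<zero>" using y(1) by (auto simp: Om.l_null)
    ultimately have "(\<theta> y, \<theta>' y) \<in> G"
      using c(7)[OF xc(3)] Om.inv_eqI[of "\<theta> x" "\<theta> y"] V.inv_eqI[of "\<theta>' x" "\<theta>' y"] xc(1) y(1) by simp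
    thus ?thesis using y by (auto simp: C_def)
  qed
  have root: "\<exists>b\<in>C. Rh.eval p b = \<zero>\<^bsub>Rh\<^esub> \<and> b \<ominus>\<^bsub>Rh\<^esub> a \<in> ?M \<inter> C"
    if p: "set p \<subseteq> C" "p \<noteq> []" "hd p = \<one>\<^bsub>Rh\<^esub>" and a: "a \<in> C" "Rh.eval p a \<in> ?M \<inter> C"
      and simple: "Rh.eval (poly_deriv Rh p) a \<notin> ?M \<inter> C" for p a
  proof -
    have n0: "\<one>\<^bsub>Rh\<^esub> \<noteq> \<zero>\<^bsub>Rh\<^esub>" using loc(4) M.zero_closed by auto
    have pc: "set p \<subseteq> carrier Rh" "a \<in> carrier Rh" using p a CE(1) by auto
    have pP: "p \<in> carrier ((carrier Rh)[X]\<^bsub>Rh\<^esub>)" using pc p n0 by (auto simp: univ_poly_def polynomial_def)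
    have dpC: "set (poly_deriv Rh p) \<subseteq> C" using Rh.set_poly_deriv[OF C_subring p(1)] .
    interpret CR: ring "Rh\<lparr>carrier := C\<rparr>" by (rule Rh.subring_is_ring[OF C_subring])
    have "Rh.eval (poly_deriv Rh p) a \<in> C"
      using CR.eval_in_carrier[of "poly_deriv Rh p" a] dpC a(1) Rh.eval_consistent[OF C_subring] by simp
    hence simple': "Rh.eval (poly_deriv Rh p) a \<notin> ?M" using simple by simp
    then obtain b where b: "b \<in> carrier Rh" "Rh.eval p b = \<zero>\<^bsub>Rh\<^esub>" "b \<ominus>\<^bsub>Rh\<^esub> a \<in> ?M"
      using hensel pP pc(2) p(2,3) a(2) unfolding henselian_def by blast
    have sG: "\<sigma> (\<theta> x) = \<theta>' x" "\<theta> x \<in> F" "\<theta> x \<in> W" if "x \<in> C" for x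
      using that sigma_eq[of "\<theta> x"] F_I[of "\<theta> x"] \<theta>(2) by (auto simp: C_def)
    have F: "subfield F \<Omega>" by (rule F_subfield)
    have mp: "map \<sigma> (map \<theta> p) = map \<theta>' p" using sG(1) p(1) by auto
    have dc: "set (poly_deriv Rh p) \<subseteq> carrier Rh" using dpC CE(1) by auto
    have evd: "\<theta> (Rh.eval (poly_deriv Rh p) a) = Om.eval (poly_deriv \<Omega> (map \<theta> p)) (\<theta> a)"
      using t.eval_hom'[OF pc(2) dc] poly_deriv_hom[OF t.ring_hom_ring_axioms pc(1)] by simp
    interpret srp: simple_root_pair \<Omega> W L V F \<sigma> "map \<theta> p" "\<theta> a" "\<theta> b" "\<theta>' b"
    proof (intro simple_root_pair.intro simple_root_pair_axioms.intro
        Om.algebraically_closed_axioms W.valuation_subring_axioms V.valuation_subring_axioms)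
      show "subfield F \<Omega>" by (rule F_subfield)
      show "\<sigma> \<in> ring_hom (\<Omega>\<lparr>carrier := F\<rparr>) L" by (rule sigma_hom)
      show "\<sigma> x \<in> V \<longleftrightarrow> x \<in> W" if "x \<in> F" for x using c(6)[OF sigma_G[OF that]] by simp
      have h: "hd (map \<theta> p) = \<one>" using p by (simp add: hd_map)
      thus "map \<theta> p \<in> carrier ((W \<inter> F)[X])" using sG p by (auto simp: univ_poly_def polynomial_def)
      show "map \<theta> p \<noteq> []" "hd (map \<theta> p) = \<one>" using p h by auto
      show "\<theta> a \<in> W" "\<theta> a \<in> F" "\<theta> b \<in> W" "\<theta>' b \<in> V" using sG a(1) b(1) \<theta>(2) \<theta>'(2) by auto
      show "Om.eval (map \<theta> p) (\<theta> b) = \<zero>" using t.eval_hom'[OF b(1) pc(1)] b(2) by simp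
      show "V.eval (map \<sigma> (map \<theta> p)) (\<theta>' b) = \<zero>\<^bsub>L\<^esub>" unfolding mp using t'.eval_hom'[OF b(1) pc(1)] b(2) by simp
      have "\<theta> (b \<ominus>\<^bsub>Rh\<^esub> a) \<in> vmax \<Omega> W" "\<theta>' (b \<ominus>\<^bsub>Rh\<^esub> a) \<in> vmax L V" using b(3) \<theta>(3) \<theta>'(3) by auto
      thus "\<theta> b \<ominus> \<theta> a \<in> vmax \<Omega> W" "\<theta>' b \<ominus>\<^bsub>L\<^esub> \<sigma> (\<theta> a) \<in> vmax L V"
        using b(1) pc(2) sG(1)[OF a(1)] by (simp_all add: a_minus_def)
      show "Om.eval (poly_deriv \<Omega> (map \<theta> p)) (\<theta> a) \<notin> vmax \<Omega> W"
        using theta_unit[OF Rh.eval_in_carrier[OF dc pc(2)] simple'] evd by simp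
    qed
    \<comment> \<open>The graph of the induced map from \<open>F(\<theta> b)\<close> to
      \<open>L\<close>. The transfer lemmas make it a correspondence, and constant polynomials show
      that it contains \<open>G\<close>.\<close>
    define G' where "G' = {(Om.eval g (\<theta> b), srp.evc g) | g. g \<in> carrier (F[X])}"
    have G'I: "(x, y) \<in> G'" if "g \<in> carrier (F[X])" "x = Om.eval g (\<theta> b)" "y = srp.evc g" for x y g
      using that by (auto simp only: G'_def)
    have const: "Om.poly_of_const x \<in> carrier (F[X])" "Om.eval (Om.poly_of_const x) (\<theta> b) = x" "srp.evc (Om.poly_of_const x) = \<sigma> x"
      if "x \<in> F" for x
    proof -
      have xc: "x \<in> carrier \<Omega>" "\<sigma> x \<in> carrier L" using that c(1,2) sigma_G by blast+
      show "Om.poly_of_const x \<in> carrier (F[X])"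
        using that by (simp add: Om.poly_of_const_def univ_poly_def polynomial_def)
      show "Om.eval (Om.poly_of_const x) (\<theta> b) = x" using xc(1) by (simp add: Om.poly_of_const_def)
      show "srp.evc (Om.poly_of_const x) = \<sigma> x"
      proof (cases "x = \<zero>")
        case True
        hence "\<sigma> x = \<zero>\<^bsub>L\<^esub>" using c(5)[OF sigma_G[OF that]] by simp
        thus ?thesis using True by (simp add: Om.poly_of_const_def srp.evc_def)
      next
        case False
        thus ?thesis using xc by (simp add: Om.poly_of_const_def srp.evc_def)
      qed
    qed
    have cb: "corr G'"
    proof (rule corrI)
      have one: "\<one> \<in> F" "\<sigma> \<one> = \<one>\<^bsub>L\<^esub>" using F_I[OF c(3)] sigma_eq[OF c(3)] by auto
      show "(\<one>, \<one>\<^bsub>L\<^esub>) \<in> G'" by (rule G'I[OF const(1)[OF one(1)]]) (simp_all only: const(2,3)[OF one(1)] one(2))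
      fix x y assume "(x, y) \<in> G'"
      then obtain g where g: "g \<in> carrier (F[X])" "x = Om.eval g (\<theta> b)" "y = srp.evc g" by (auto simp: G'_def)
      show xy: "x \<in> carrier \<Omega> \<and> y \<in> carrier L" using g srp.evb_hom(3)[OF g(1) g(1) srp.bc(1)] srp.evc_closed by auto
      show "x = \<zero> \<longleftrightarrow> y = \<zero>\<^bsub>L\<^esub>" "x \<in> W \<longleftrightarrow> y \<in> V" using srp.zero_transfer srp.valuation_transfer g by auto
      show "(inv x, inv\<^bsub>L\<^esub> y) \<in> G'" if "x \<noteq> \<zero>"
      proof -
        obtain u where u: "u \<in> carrier (F[X])" "x \<otimes> Om.eval u (\<theta> b) = \<one>"
          using srp.F_b_inverse[OF g(1)] g(2) \<open>x \<noteq> \<zero>\<close> by auto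
        have "y \<otimes>\<^bsub>L\<^esub> srp.evc u = \<one>\<^bsub>L\<^esub>" using srp.evc_inverse[OF g(1) u(1)] u(2) g by simp
        hence "inv x = Om.eval u (\<theta> b)" "inv\<^bsub>L\<^esub> y = srp.evc u"
          using Om.inv_eqI[OF _ _ u(2)] V.inv_eqI xy srp.evb_hom(3)[OF u(1) u(1) srp.bc(1)] srp.evc_closed[OF u(1)] by auto
        thus ?thesis by (rule G'I[OF u(1)])
      qed
      have mult: "(x \<otimes> x', y \<otimes>\<^bsub>L\<^esub> y') \<in> G'" "(x \<oplus> x', y \<oplus>\<^bsub>L\<^esub> y') \<in> G'" if xy': "(x', y') \<in> G'" for x' y'
      proof -
        obtain g' where g': "g' \<in> carrier (F[X])" "x' = Om.eval g' (\<theta> b)" "y' = srp.evc g'" using xy' by (auto simp: G'_def)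
        show "(x \<otimes> x', y \<otimes>\<^bsub>L\<^esub> y') \<in> G'" "(x \<oplus> x', y \<oplus>\<^bsub>L\<^esub> y') \<in> G'"
          by (rule G'I[OF srp.UPF.m_closed[OF g(1) g'(1)]] G'I[OF srp.UPF.a_closed[OF g(1) g'(1)]];
              simp only: g(2,3) g'(2,3) srp.evb_hom(1,2)[OF g(1) g'(1) srp.bc(1)] srp.evc_hom[OF g(1) g'(1)])+
      qed
      \<comment> \<open>Closure under negation is reduced to products with the pair of the elements
        minus one.\<close>
      have m1: "\<ominus> \<one> \<in> F" "\<sigma> (\<ominus> \<one>) = \<ominus>\<^bsub>L\<^esub> \<one>\<^bsub>L\<^esub>" using F_I[OF c(4)[OF c(3)]] sigma_eq[OF c(4)[OF c(3)]] by auto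
      have "(\<ominus> \<one>, \<ominus>\<^bsub>L\<^esub> \<one>\<^bsub>L\<^esub>) \<in> G'" by (rule G'I[OF const(1)[OF m1(1)]]) (simp_all only: const(2,3)[OF m1(1)] m1(2))
      hence "(x \<otimes> \<ominus> \<one>, y \<otimes>\<^bsub>L\<^esub> \<ominus>\<^bsub>L\<^esub> \<one>\<^bsub>L\<^esub>) \<in> G'" by (rule mult(1))
      thus "(\<ominus> x, \<ominus>\<^bsub>L\<^esub> y) \<in> G'" using xy by (simp add: Om.r_minus V.r_minus)
      fix x' y' assume "(x', y') \<in> G'"
      thus "(x \<oplus> x', y \<oplus>\<^bsub>L\<^esub> y') \<in> G'" "(x \<otimes> x', y \<otimes>\<^bsub>L\<^esub> y') \<in> G'" using mult by auto
    qed
    have "G \<subseteq> G'"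
    proof (rule subrelI)
      fix x y assume xy: "(x, y) \<in> G"
      note k = const[OF F_I[OF xy]]
      show "(x, y) \<in> G'" by (rule G'I[OF k(1)]) (simp_all only: k sigma_eq[OF xy])
    qed
    hence "G' = G" by (rule G(3)[OF cb])
    moreover have "(\<theta> b, \<theta>' b) \<in> G'"
    proof -
      have "var \<Omega> \<in> carrier (F[X])" using Om.var_closed(1)[OF subfieldE(1)[OF F]] .
      moreover have "Om.eval (var \<Omega>) (\<theta> b) = \<theta> b" using Om.eval_var b(1) by simp
      moreover have "srp.evc (var \<Omega>) = \<theta>' b"
        using srp.s_one srp.s.hom_zero b(1) by (simp add: srp.evc_def var_def)
      ultimately show ?thesis by (intro G'I[of "var \<Omega>"]) simp_all
    qed
    ultimately have "b \<in> C" using b(1) by (simp add: C_def)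
    thus ?thesis using b CE a(1) by (auto simp: a_minus_def)
  qed
  have zero: "\<zero>\<^bsub>Rh\<^esub> \<in> ?M \<inter> C" and one: "\<one>\<^bsub>Rh\<^esub> \<notin> ?M \<inter> C" using CE(2) M.zero_closed loc(4) by auto
  have add: "x \<oplus>\<^bsub>Rh\<^esub> y \<in> ?M \<inter> C" if "x \<in> ?M \<inter> C" "y \<in> ?M \<inter> C" for x y
    using CE(7)[of x y] M.a_closed[of x y] that by simp
  have mult: "x \<otimes>\<^bsub>Rh\<^esub> y \<in> ?M \<inter> C" if "x \<in> C" "y \<in> ?M \<inter> C" for x y
    using CE(6)[of x y] M.I_l_closed[of y x] CE(1) that by auto
  have sub: "?M \<inter> C \<subseteq> C" by simp
  show "henselian (Rh\<lparr>carrier := C\<rparr>)" "max_ideal (Rh\<lparr>carrier := C\<rparr>) = max_ideal Rh \<inter> C"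
    by (rule Rh.henselian_subringI(1)[OF C_subring sub zero one add mult inv root]; assumption)
      (rule Rh.henselian_subringI(2)[OF C_subring sub zero one add mult inv root]; assumption)
qed

text \<open>Rigidity of the henselization: \<open>C\<close> is henselian and contains the image of
  \<open>R\<close>, by taking denominator one in \<open>base\<close>.\<close>

lemma C_full: "C = carrier Rh"
proof (rule henselization_rigid[OF H C_subring C_henselian])
  show "i ` carrier R \<subseteq> C"
  proof
    fix x assume "x \<in> i ` carrier R"
    then obtain r where r: "r \<in> carrier R" "x = i r" by auto
    have "(\<theta> (i r) \<otimes> inv (\<theta> (i \<one>\<^bsub>R\<^esub>)), \<theta>' (i r) \<otimes>\<^bsub>L\<^esub> inv\<^bsub>L\<^esub> (\<theta>' (i \<one>\<^bsub>R\<^esub>))) \<in> base"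
      unfolding base_def using r by (intro image_eqI[of _ _ "(r, \<one>\<^bsub>R\<^esub>)"]) auto
    hence "(\<theta> x, \<theta>' x) \<in> base" using r by simp
    thus "x \<in> C" using G(2) r by (auto simp: C_def)
  qed
  show "max_ideal R \<subseteq> carrier R"
    using ideal.Icarr[OF local_ring_max_ideal(3)[OF R(2)]] by auto
qed

end

context two_places
begin

text \<open>By \<open>C_full\<close> all pairs of images of elements of \<open>Rh\<close> belong to
  one correspondence, which is closed under quotients and respects zero and the valuation
  rings.\<close>

theorem places_equivalent:
  shows "x \<in> carrier Rh \<Longrightarrow> \<theta> x = \<zero> \<longleftrightarrow> \<theta>' x = \<zero>\<^bsub>L\<^esub>"
    and "\<lbrakk>x \<in> carrier Rh; y \<in> carrier Rh; \<theta> y \<noteq> \<zero>\<rbrakk> \<Longrightarrow>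
      \<theta> x \<otimes> inv (\<theta> y) \<in> W \<longleftrightarrow> \<theta>' x \<otimes>\<^bsub>L\<^esub> inv\<^bsub>L\<^esub> (\<theta>' y) \<in> V"
proof -
  obtain G where G: "corr G" "base \<subseteq> G" "\<And>G'. corr G' \<Longrightarrow> G \<subseteq> G' \<Longrightarrow> G' = G"
    using maximal_corr by blast
  interpret max_corr where G = G by unfold_locales (fact G)+
  have in_G: "(\<theta> x, \<theta>' x) \<in> G" if "x \<in> carrier Rh" for x using that C_full by (auto simp: C_def)
  show "x \<in> carrier Rh \<Longrightarrow> \<theta> x = \<zero> \<longleftrightarrow> \<theta>' x = \<zero>\<^bsub>L\<^esub>" using c(5)[OF in_G] by simp
  show "\<lbrakk>x \<in> carrier Rh; y \<in> carrier Rh; \<theta> y \<noteq> \<zero>\<rbrakk> \<Longrightarrow>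
      \<theta> x \<otimes> inv (\<theta> y) \<in> W \<longleftrightarrow> \<theta>' x \<otimes>\<^bsub>L\<^esub> inv\<^bsub>L\<^esub> (\<theta>' y) \<in> V"
    using c(6)[OF c(9)[OF in_G c(7)[OF in_G]]] by simp
qed

end

section \<open>Valuations and valuation subrings\<close>

locale valued_field =
  fixes K :: "('k, 'm) ring_scheme" and \<Phi> :: "('g, 'p) ordered_group_scheme" and \<nu>
  assumes val: "valuation K \<Phi> \<nu>"
begin

sublocale K: field K using val by (simp add: valuation_def)
sublocale G: ordered_comm_group \<Phi> using val by (simp add: valuation_def)

abbreviation V where "V \<equiv> val_ring K \<Phi> \<nu>"

lemma hom: "\<nu> \<in> hom (Multiplicative_Group.mult_of K) \<Phi>" using val by (simp add: valuation_def)

sublocale h: group_hom "Multiplicative_Group.mult_of K" \<Phi> \<nu>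
  using hom K.field_mult_group G.is_group by (simp add: group_hom_def group_hom_axioms_def)

lemma nu_closed: "x \<in> carrier K \<Longrightarrow> x \<noteq> \<zero>\<^bsub>K\<^esub> \<Longrightarrow> \<nu> x \<in> carrier \<Phi>"
  using h.hom_closed[of x] by simp

lemma nu_mult: "\<lbrakk>x \<in> carrier K; x \<noteq> \<zero>\<^bsub>K\<^esub>; y \<in> carrier K; y \<noteq> \<zero>\<^bsub>K\<^esub>\<rbrakk> \<Longrightarrow> \<nu> (x \<otimes>\<^bsub>K\<^esub> y) = \<nu> x \<otimes>\<^bsub>\<Phi>\<^esub> \<nu> y"
  using h.hom_mult[of x y] by simp

lemma nu_one: "\<nu> \<one>\<^bsub>K\<^esub> = \<one>\<^bsub>\<Phi>\<^esub>"
  using h.hom_one by simp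

text \<open>Translates the order of values into membership in the valuation ring, so that value
  groups can be avoided elsewhere.\<close>

lemma le_iff:
  assumes "x \<in> carrier K" "x \<noteq> \<zero>\<^bsub>K\<^esub>" "y \<in> carrier K" "y \<noteq> \<zero>\<^bsub>K\<^esub>"
  shows "\<nu> x \<preceq>\<^bsub>\<Phi>\<^esub> \<nu> y \<longleftrightarrow> y \<otimes>\<^bsub>K\<^esub> inv\<^bsub>K\<^esub> x \<in> V"
proof -
  have n: "y \<otimes>\<^bsub>K\<^esub> inv\<^bsub>K\<^esub> x \<noteq> \<zero>\<^bsub>K\<^esub>" using assms by (simp add: K.integral_iff)
  define q where "q = \<nu> (y \<otimes>\<^bsub>K\<^esub> inv\<^bsub>K\<^esub> x)"
  have c: "q \<in> carrier \<Phi>" "\<nu> x \<in> carrier \<Phi>" "\<nu> y \<in> carrier \<Phi>" using assms n nu_closed by (auto simp: q_def)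
  have "y = (y \<otimes>\<^bsub>K\<^esub> inv\<^bsub>K\<^esub> x) \<otimes>\<^bsub>K\<^esub> x" using assms by (simp add: K.m_assoc)
  hence y: "\<nu> y = q \<otimes>\<^bsub>\<Phi>\<^esub> \<nu> x" using nu_mult[of "y \<otimes>\<^bsub>K\<^esub> inv\<^bsub>K\<^esub> x" x] n assms by (simp add: q_def)
  have "\<one>\<^bsub>\<Phi>\<^esub> \<preceq>\<^bsub>\<Phi>\<^esub> q \<longleftrightarrow> \<nu> x \<preceq>\<^bsub>\<Phi>\<^esub> \<nu> y"
  proof
    assume "\<one>\<^bsub>\<Phi>\<^esub> \<preceq>\<^bsub>\<Phi>\<^esub> q"
    thus "\<nu> x \<preceq>\<^bsub>\<Phi>\<^esub> \<nu> y" using G.le_mult[of "\<one>\<^bsub>\<Phi>\<^esub>" q "\<nu> x"] c y by simp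
  next
    assume "\<nu> x \<preceq>\<^bsub>\<Phi>\<^esub> \<nu> y"
    thus "\<one>\<^bsub>\<Phi>\<^esub> \<preceq>\<^bsub>\<Phi>\<^esub> q" using G.le_mult[of "\<nu> x" "\<nu> y" "inv\<^bsub>\<Phi>\<^esub> (\<nu> x)"] c y by (simp add: G.m_assoc)
  qed
  thus ?thesis using n assms by (auto simp: val_ring_def q_def)
qed

lemma eq_iff:
  assumes "x \<in> carrier K" "x \<noteq> \<zero>\<^bsub>K\<^esub>" "y \<in> carrier K" "y \<noteq> \<zero>\<^bsub>K\<^esub>"
  shows "\<nu> x = \<nu> y \<longleftrightarrow> y \<otimes>\<^bsub>K\<^esub> inv\<^bsub>K\<^esub> x \<in> V \<and> x \<otimes>\<^bsub>K\<^esub> inv\<^bsub>K\<^esub> y \<in> V"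
  using le_iff[of x y] le_iff[of y x] assms G.le_antisym[of "\<nu> x" "\<nu> y"] G.le_total[of "\<nu> x" "\<nu> x"] nu_closed
  by auto

lemma in_V_iff: "x \<in> carrier K \<Longrightarrow> x \<noteq> \<zero>\<^bsub>K\<^esub> \<Longrightarrow> x \<in> V \<longleftrightarrow> \<one>\<^bsub>\<Phi>\<^esub> \<preceq>\<^bsub>\<Phi>\<^esub> \<nu> x"
  by (auto simp: val_ring_def)

text \<open>The square of this value \<open>a\<close> is \<open>\<one>\<close>. If \<open>a\<close>
  is below \<open>\<one>\<close>, multiplying by \<open>a\<close> puts \<open>\<one>\<close> below
  \<open>a\<close>.\<close>

lemma minus_one: "\<one>\<^bsub>\<Phi>\<^esub> \<preceq>\<^bsub>\<Phi>\<^esub> \<nu> (\<ominus>\<^bsub>K\<^esub> \<one>\<^bsub>K\<^esub>)"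
proof -
  let ?a = "\<nu> (\<ominus>\<^bsub>K\<^esub> \<one>\<^bsub>K\<^esub>)"
  have nz: "\<ominus>\<^bsub>K\<^esub> \<one>\<^bsub>K\<^esub> \<noteq> \<zero>\<^bsub>K\<^esub>" using K.one_not_zero K.minus_minus[of "\<one>\<^bsub>K\<^esub>"] by (metis K.minus_zero K.one_closed)
  have a: "?a \<in> carrier \<Phi>" using nu_closed nz by simp
  have aa: "?a \<otimes>\<^bsub>\<Phi>\<^esub> ?a = \<one>\<^bsub>\<Phi>\<^esub>" using nu_mult[of "\<ominus>\<^bsub>K\<^esub> \<one>\<^bsub>K\<^esub>" "\<ominus>\<^bsub>K\<^esub> \<one>\<^bsub>K\<^esub>"] nz nu_one by (simp add: K.l_minus K.r_minus)
  show ?thesis using G.le_total[OF G.one_closed a] G.le_mult[OF a G.one_closed a] a aa by auto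
qed

sublocale vs: valuation_subring K V
proof (intro valuation_subring.intro K.field_axioms valuation_subring_axioms.intro)
  show "subring V K"
  proof (rule K.subringI)
    show "V \<subseteq> carrier K" by (auto simp: val_ring_def)
    \<comment> \<open>Totality with two equal arguments supplies reflexivity of the order.\<close>
    show "\<one>\<^bsub>K\<^esub> \<in> V" using G.le_total[of "\<one>\<^bsub>\<Phi>\<^esub>" "\<one>\<^bsub>\<Phi>\<^esub>"] nu_one by (auto simp: val_ring_def)
    have mult: "x \<otimes>\<^bsub>K\<^esub> y \<in> V" if xy: "x \<in> V" "y \<in> V" for x y
    proof (cases "x = \<zero>\<^bsub>K\<^esub> \<or> y = \<zero>\<^bsub>K\<^esub>")
      case True
      thus ?thesis using xy by (auto simp: val_ring_def)
    next
      case False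
      have c: "x \<in> carrier K" "y \<in> carrier K" using xy by (auto simp: val_ring_def)
      have "\<one>\<^bsub>\<Phi>\<^esub> \<preceq>\<^bsub>\<Phi>\<^esub> \<nu> x" "\<one>\<^bsub>\<Phi>\<^esub> \<preceq>\<^bsub>\<Phi>\<^esub> \<nu> y" using xy False c in_V_iff by auto
      hence "\<one>\<^bsub>\<Phi>\<^esub> \<preceq>\<^bsub>\<Phi>\<^esub> \<nu> x \<otimes>\<^bsub>\<Phi>\<^esub> \<nu> y"
        using G.le_mult[of "\<one>\<^bsub>\<Phi>\<^esub>" "\<nu> x" "\<nu> y"] G.le_trans[of "\<one>\<^bsub>\<Phi>\<^esub>" "\<nu> y" "\<nu> x \<otimes>\<^bsub>\<Phi>\<^esub> \<nu> y"]
          nu_closed[of x] nu_closed[of y] False c by simp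
      thus ?thesis using in_V_iff[of "x \<otimes>\<^bsub>K\<^esub> y"] nu_mult[of x y] False c by (simp add: K.integral_iff)
    qed
    have "\<ominus>\<^bsub>K\<^esub> \<one>\<^bsub>K\<^esub> \<in> V" using minus_one by (auto simp: val_ring_def)
    fix x assume x: "x \<in> V"
    hence xc: "x \<in> carrier K" by (auto simp: val_ring_def)
    show "\<ominus>\<^bsub>K\<^esub> x \<in> V" using mult[OF \<open>\<ominus>\<^bsub>K\<^esub> \<one>\<^bsub>K\<^esub> \<in> V\<close> x] xc by (simp add: K.l_minus)
    fix y assume y: "y \<in> V"
    hence yc: "y \<in> carrier K" by (auto simp: val_ring_def)
    show "x \<otimes>\<^bsub>K\<^esub> y \<in> V" using mult x y .
    show "x \<oplus>\<^bsub>K\<^esub> y \<in> V"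
    proof (cases "x = \<zero>\<^bsub>K\<^esub> \<or> y = \<zero>\<^bsub>K\<^esub> \<or> x \<oplus>\<^bsub>K\<^esub> y = \<zero>\<^bsub>K\<^esub>")
      case True
      thus ?thesis using x y xc yc by (auto simp: val_ring_def)
    next
      case False
      hence "\<nu> x \<preceq>\<^bsub>\<Phi>\<^esub> \<nu> (x \<oplus>\<^bsub>K\<^esub> y) \<or> \<nu> y \<preceq>\<^bsub>\<Phi>\<^esub> \<nu> (x \<oplus>\<^bsub>K\<^esub> y)" using val xc yc by (simp add: valuation_def)
      moreover have "\<one>\<^bsub>\<Phi>\<^esub> \<preceq>\<^bsub>\<Phi>\<^esub> \<nu> x" "\<one>\<^bsub>\<Phi>\<^esub> \<preceq>\<^bsub>\<Phi>\<^esub> \<nu> y" using x y False xc yc in_V_iff by auto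
      ultimately have "\<one>\<^bsub>\<Phi>\<^esub> \<preceq>\<^bsub>\<Phi>\<^esub> \<nu> (x \<oplus>\<^bsub>K\<^esub> y)"
        using G.le_trans[of "\<one>\<^bsub>\<Phi>\<^esub>" "\<nu> x" "\<nu> (x \<oplus>\<^bsub>K\<^esub> y)"] G.le_trans[of "\<one>\<^bsub>\<Phi>\<^esub>" "\<nu> y" "\<nu> (x \<oplus>\<^bsub>K\<^esub> y)"]
          nu_closed False xc yc by auto
      thus ?thesis using xc yc by (simp add: val_ring_def)
    qed
  qed
  fix x assume x: "x \<in> carrier K" "x \<notin> V"
  hence n: "x \<noteq> \<zero>\<^bsub>K\<^esub>" by (auto simp: val_ring_def)
  have "\<nu> x \<preceq>\<^bsub>\<Phi>\<^esub> \<nu> \<one>\<^bsub>K\<^esub>"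
    using G.le_total[of "\<one>\<^bsub>\<Phi>\<^esub>" "\<nu> x"] in_V_iff[OF x(1) n] x nu_closed[OF x(1) n] nu_one by auto
  thus "inv\<^bsub>K\<^esub> x \<in> V" using le_iff[of x "\<one>\<^bsub>K\<^esub>"] x n by simp
qed

lemma val_ideal_eq: "val_ideal K \<Phi> \<nu> = vmax K V"
proof -
  have "x \<in> val_ideal K \<Phi> \<nu> \<longleftrightarrow> x \<in> vmax K V" if x: "x \<in> carrier K" "x \<noteq> \<zero>\<^bsub>K\<^esub>" for x
    using eq_iff[OF x, of "\<one>\<^bsub>K\<^esub>"] in_V_iff[OF x] x nu_one by (auto simp: val_ideal_def vmax_def)
  moreover have "x \<in> carrier K" if "x \<in> vmax K V" for x using that vs.m_carr by blast
  moreover have "x \<in> carrier K" if "x \<in> val_ideal K \<Phi> \<nu>" for x using that by (auto simp: val_ideal_def)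
  moreover have "\<zero>\<^bsub>K\<^esub> \<in> val_ideal K \<Phi> \<nu>" "\<zero>\<^bsub>K\<^esub> \<in> vmax K V" by (auto simp: val_ideal_def)
  ultimately show ?thesis by blast
qed

end

text \<open>The value of \<open>x\<close> is the set of its associates, the nonzero elements that
  differ from it by a unit of \<open>V\<close>. Values are sets of field elements and thus have the
  type required of \<open>\<Psi>\<close> in \<open>quot_extension\<close>.\<close>

lemma (in valuation_subring) exists_valuation:
  obtains \<Psi> :: "'a set ordered_group" and \<mu> where "valuation L \<Psi> \<mu>" "val_ring L \<Psi> \<mu> = V"
proof -
  define U where "U = carrier L - {\<zero>}"
  define le where "le x y \<longleftrightarrow> y \<otimes> inv x \<in> V" for x y
  define c where "c x = {y \<in> U. le x y \<and> le y x}" for x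
  define r where "r T = (SOME y. y \<in> T)" for T :: "'a set"
  have U: "x \<in> U \<longleftrightarrow> x \<in> carrier L \<and> x \<noteq> \<zero>" for x by (auto simp: U_def)
  have Um: "x \<otimes> y \<in> U" if "x \<in> U" "y \<in> U" for x y using that by (simp add: U integral_iff)
  have Ui: "inv x \<in> U" if "x \<in> U" for x using that by (simp add: U)
  have U1: "\<one> \<in> U" by (simp add: U)
  have le_refl: "le x x" if "x \<in> U" for x using that by (simp add: le_def U)
  have le_trans: "le x z" if "le x y" "le y z" "x \<in> U" "y \<in> U" "z \<in> U" for x y z
  proof -
    have "z \<otimes> inv x = (z \<otimes> inv y) \<otimes> (y \<otimes> inv x)"
    proof -
      have "(z \<otimes> inv y) \<otimes> (y \<otimes> inv x) = z \<otimes> (inv y \<otimes> y) \<otimes> inv x"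
        using that by (simp add: U m_assoc del: l_inv' r_inv' Units_l_inv Units_r_inv)
      thus ?thesis using that by (simp add: U)
    qed
    thus ?thesis using V_mult that(1,2) by (simp add: le_def)
  qed
  have le_total: "le x y \<or> le y x" if "x \<in> U" "y \<in> U" for x y
    using inv_in[of "y \<otimes> inv x"] that by (auto simp: le_def U frac_inv_rule)
  have le_mult: "le (x \<otimes> z) (y \<otimes> z) \<longleftrightarrow> le x y" if "x \<in> U" "y \<in> U" "z \<in> U" for x y z
  proof -
    have "(y \<otimes> z) \<otimes> inv (x \<otimes> z) = (y \<otimes> inv x) \<otimes> (z \<otimes> inv z)"
      using that by (simp add: U inv_mult m_ac del: l_inv' r_inv' Units_l_inv Units_r_inv)
    thus ?thesis using that by (simp add: le_def U)
  qed
  have self: "x \<in> c x" if "x \<in> U" for x using that le_refl by (auto simp: c_def)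
  have rc: "r (c x) \<in> U" "le x (r (c x))" "le (r (c x)) x" if "x \<in> U" for x
  proof -
    have "r (c x) \<in> c x" unfolding r_def using self[OF that] by (rule someI)
    thus "r (c x) \<in> U" "le x (r (c x))" "le (r (c x)) x" by (auto simp: c_def)
  qed
  have c_eq: "c x = c y \<longleftrightarrow> le x y \<and> le y x" if xy: "x \<in> U" "y \<in> U" for x y
  proof
    assume "c x = c y"
    thus "le x y \<and> le y x" using self[OF xy(2)] by (auto simp: c_def)
  next
    assume "le x y \<and> le y x"
    thus "c x = c y" using le_trans xy unfolding c_def by blast
  qed
  \<comment> \<open>Product and order of classes use representatives picked by \<open>r\<close>;
    independence of that choice is shown in \<open>Pm\<close> and \<open>Pl\<close>.\<close>
  define \<Psi> :: "'a set ordered_group" where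
    "\<Psi> = \<lparr>carrier = c ` U, monoid.mult = (\<lambda>T Y. c (r T \<otimes> r Y)), one = c \<one>, grp_le = (\<lambda>T Y. le (r T) (r Y))\<rparr>"
  have Ps: "carrier \<Psi> = c ` U" "\<one>\<^bsub>\<Psi>\<^esub> = c \<one>" by (simp_all add: \<Psi>_def)
  have Pm: "c x \<otimes>\<^bsub>\<Psi>\<^esub> c y = c (x \<otimes> y)" if xy: "x \<in> U" "y \<in> U" for x y
  proof -
    note rx = rc[OF xy(1)] and ry = rc[OF xy(2)]
    define s t where "s = r (c x)" and "t = r (c y)"
    have st: "s \<in> U" "t \<in> U" "le x s" "le s x" "le y t" "le t y" using rx ry by (auto simp: s_def t_def)
    have cm: "u \<otimes> v = v \<otimes> u" if "u \<in> U" "v \<in> U" for u v using that by (simp add: U m_comm)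
    have "le (s \<otimes> t) (x \<otimes> t)" "le (x \<otimes> t) (s \<otimes> t)" using le_mult st xy by auto
    moreover have "le (x \<otimes> t) (x \<otimes> y)" "le (x \<otimes> y) (x \<otimes> t)"
      using le_mult[of t y x] le_mult[of y t x] st xy cm by auto
    ultimately have "c (s \<otimes> t) = c (x \<otimes> y)"
      using le_trans[of "s \<otimes> t" "x \<otimes> t" "x \<otimes> y"] le_trans[of "x \<otimes> y" "x \<otimes> t" "s \<otimes> t"] c_eq Um st xy by auto
    thus ?thesis by (simp add: \<Psi>_def s_def t_def)
  qed
  have Pl: "c x \<preceq>\<^bsub>\<Psi>\<^esub> c y \<longleftrightarrow> le x y" if xy: "x \<in> U" "y \<in> U" for x y
  proof -
    note rx = rc[OF xy(1)] and ry = rc[OF xy(2)]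
    have "le (r (c x)) (r (c y)) \<longleftrightarrow> le x y"
      using le_trans[OF le_trans[OF rx(2) _ xy(1) rx(1) ry(1)] ry(3) xy(1) ry(1) xy(2)]
        le_trans[OF le_trans[OF rx(3) _ rx(1) xy] ry(2) rx(1) xy(2) ry(1)] by blast
    thus ?thesis by (simp add: \<Psi>_def)
  qed
  have cg: "comm_group \<Psi>"
  proof (rule comm_groupI)
    fix T Y Z assume "T \<in> carrier \<Psi>" "Y \<in> carrier \<Psi>" "Z \<in> carrier \<Psi>"
    then obtain x y z where *: "T = c x" "Y = c y" "Z = c z" "x \<in> U" "y \<in> U" "z \<in> U" by (auto simp: Ps)
    show "T \<otimes>\<^bsub>\<Psi>\<^esub> Y \<otimes>\<^bsub>\<Psi>\<^esub> Z = T \<otimes>\<^bsub>\<Psi>\<^esub> (Y \<otimes>\<^bsub>\<Psi>\<^esub> Z)"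
      using *(4-6) Um by (simp add: *(1-3) Pm U m_assoc)
  next
    fix T Y assume "T \<in> carrier \<Psi>" "Y \<in> carrier \<Psi>"
    then obtain x y where *: "T = c x" "Y = c y" "x \<in> U" "y \<in> U" by (auto simp: Ps)
    show "T \<otimes>\<^bsub>\<Psi>\<^esub> Y \<in> carrier \<Psi>" using * Um by (simp add: Pm Ps)
    show "T \<otimes>\<^bsub>\<Psi>\<^esub> Y = Y \<otimes>\<^bsub>\<Psi>\<^esub> T" using * by (simp add: Pm U m_comm)
  next
    fix T assume "T \<in> carrier \<Psi>"
    then obtain x where *: "T = c x" "x \<in> U" by (auto simp: Ps)
    show "\<one>\<^bsub>\<Psi>\<^esub> \<otimes>\<^bsub>\<Psi>\<^esub> T = T" using * U1 Pm[OF U1 *(2)] by (simp add: Ps U)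
    show "\<exists>Y\<in>carrier \<Psi>. Y \<otimes>\<^bsub>\<Psi>\<^esub> T = \<one>\<^bsub>\<Psi>\<^esub>"
      using Pm[OF Ui *(2)] * Ui by (intro bexI[of _ "c (inv x)"]) (auto simp: Ps U)
  qed (use U1 in \<open>auto simp: Ps\<close>)
  have ocg: "ordered_comm_group \<Psi>"
  proof (intro ordered_comm_group.intro ordered_comm_group_axioms.intro cg)
    fix T Y assume "T \<in> carrier \<Psi>" "Y \<in> carrier \<Psi>"
    then obtain x y where *: "T = c x" "Y = c y" "x \<in> U" "y \<in> U" by (auto simp: Ps)
    show "T \<preceq>\<^bsub>\<Psi>\<^esub> Y \<or> Y \<preceq>\<^bsub>\<Psi>\<^esub> T" using * le_total by (simp add: Pl)
    show "T = Y" if "T \<preceq>\<^bsub>\<Psi>\<^esub> Y" "Y \<preceq>\<^bsub>\<Psi>\<^esub> T" using * that by (simp add: Pl c_eq)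
  next
    fix T Y Z assume "T \<in> carrier \<Psi>" "Y \<in> carrier \<Psi>" "Z \<in> carrier \<Psi>"
    then obtain x y z where *: "T = c x" "Y = c y" "Z = c z" "x \<in> U" "y \<in> U" "z \<in> U" by (auto simp: Ps)
    show "T \<preceq>\<^bsub>\<Psi>\<^esub> Z" if "T \<preceq>\<^bsub>\<Psi>\<^esub> Y" "Y \<preceq>\<^bsub>\<Psi>\<^esub> Z" using * that le_trans[of x y z] by (simp add: Pl)
    show "T \<otimes>\<^bsub>\<Psi>\<^esub> Z \<preceq>\<^bsub>\<Psi>\<^esub> Y \<otimes>\<^bsub>\<Psi>\<^esub> Z" if "T \<preceq>\<^bsub>\<Psi>\<^esub> Y" using * that le_mult Um by (simp add: Pl Pm)
  qed
  have "valuation L \<Psi> c"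
    unfolding valuation_def
  proof (intro conjI ballI impI field_axioms ocg)
    show "c \<in> hom (Multiplicative_Group.mult_of L) \<Psi>"
      by (rule homI) (auto simp: Ps Pm U)
    fix x y assume "x \<in> carrier L - {\<zero>}" "y \<in> carrier L - {\<zero>}" "x \<oplus> y \<noteq> \<zero>"
    hence xy: "x \<in> U" "y \<in> U" "x \<oplus> y \<in> U" by (auto simp: U)
    have aux: "le x (x \<oplus> y)" if "le x y" "x \<in> U" "y \<in> U" for x y
    proof -
      have "(x \<oplus> y) \<otimes> inv x = \<one> \<oplus> y \<otimes> inv x" using that by (simp add: U l_distr)
      thus ?thesis using that V_add[OF V_one] by (simp add: le_def)
    qed
    show "c x \<preceq>\<^bsub>\<Psi>\<^esub> c (x \<oplus> y) \<or> c y \<preceq>\<^bsub>\<Psi>\<^esub> c (x \<oplus> y)"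
      using aux[of x y] aux[of y x] le_total[OF xy(1,2)] xy a_comm[of x y] by (auto simp: Pl U)
  qed
  moreover have "val_ring L \<Psi> c = V"
  proof -
    have "x \<in> val_ring L \<Psi> c \<longleftrightarrow> x \<in> V" if "x \<in> carrier L" for x
      using Pl[OF U1, of x] that by (cases "x = \<zero>") (auto simp: val_ring_def Ps U le_def)
    thus ?thesis by (auto simp: val_ring_def)
  qed
  ultimately show thesis by (rule that)
qed

text \<open>Since the valuation ring of \<open>K\<close> is the preimage of that of
  \<open>L\<close>, equality and order of values agree on \<open>K\<close> and on its image. The
  hypothesis \<open>dense\<close> says that every element of \<open>L\<close> has the value of some
  \<open>j x\<close>, which gives surjectivity.\<close>

lemma same_value_groupI:
  assumes K: "valuation K \<Phi> \<nu>" and L: "valuation L \<Psi> \<mu>" and j: "ring_hom_ring K L j"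
    and ext: "val_extends K \<Phi> \<nu> L \<Psi> \<mu> j"
    and dense: "\<And>z. z \<in> carrier L \<Longrightarrow> z \<noteq> \<zero>\<^bsub>L\<^esub> \<Longrightarrow> \<exists>x \<in> carrier K - {\<zero>\<^bsub>K\<^esub>}.
      z \<otimes>\<^bsub>L\<^esub> inv\<^bsub>L\<^esub> (j x) \<in> val_ring L \<Psi> \<mu> \<and> j x \<otimes>\<^bsub>L\<^esub> inv\<^bsub>L\<^esub> z \<in> val_ring L \<Psi> \<mu>"
  shows "same_value_group K \<Phi> \<nu> L \<Psi> \<mu> j"
proof -
  interpret k: valued_field K \<Phi> \<nu> by unfold_locales fact
  interpret l: valued_field L \<Psi> \<mu> by unfold_locales fact
  interpret j: ring_hom_ring K L j by fact
  define U where "U = carrier K - {\<zero>\<^bsub>K\<^esub>}"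
  have U: "x \<in> U \<longleftrightarrow> x \<in> carrier K \<and> x \<noteq> \<zero>\<^bsub>K\<^esub>" for x by (auto simp: U_def)
  have jn: "j x \<noteq> \<zero>\<^bsub>L\<^esub>" "j x \<in> carrier L" "j (inv\<^bsub>K\<^esub> x) = inv\<^bsub>L\<^esub> (j x)" if "x \<in> U" for x
  proof -
    have "j x \<otimes>\<^bsub>L\<^esub> j (inv\<^bsub>K\<^esub> x) = \<one>\<^bsub>L\<^esub>" using that j.hom_mult[of x "inv\<^bsub>K\<^esub> x"] by (simp add: U)
    thus "j x \<noteq> \<zero>\<^bsub>L\<^esub>" "j (inv\<^bsub>K\<^esub> x) = inv\<^bsub>L\<^esub> (j x)" using that l.K.inv_eqI[of "j x" "j (inv\<^bsub>K\<^esub> x)"] by (auto simp: U)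
    show "j x \<in> carrier L" using that by (simp add: U)
  qed
  have le: "\<nu> x \<preceq>\<^bsub>\<Phi>\<^esub> \<nu> y \<longleftrightarrow> \<mu> (j x) \<preceq>\<^bsub>\<Psi>\<^esub> \<mu> (j y)" if xy: "x \<in> U" "y \<in> U" for x y
  proof -
    have "y \<otimes>\<^bsub>K\<^esub> inv\<^bsub>K\<^esub> x \<in> carrier K" using xy by (simp add: U)
    hence "y \<otimes>\<^bsub>K\<^esub> inv\<^bsub>K\<^esub> x \<in> val_ring K \<Phi> \<nu> \<longleftrightarrow> j (y \<otimes>\<^bsub>K\<^esub> inv\<^bsub>K\<^esub> x) \<in> val_ring L \<Psi> \<mu>"
      using ext by (auto simp: val_extends_def)
    also have "j (y \<otimes>\<^bsub>K\<^esub> inv\<^bsub>K\<^esub> x) = j y \<otimes>\<^bsub>L\<^esub> inv\<^bsub>L\<^esub> (j x)" using xy jn[OF xy(1)] by (simp add: U)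
    finally show ?thesis using k.le_iff[of x y] l.le_iff[of "j x" "j y"] xy jn by (simp add: U)
  qed
  have eq: "\<nu> x = \<nu> y \<longleftrightarrow> \<mu> (j x) = \<mu> (j y)" if "x \<in> U" "y \<in> U" for x y
    using le[OF that] le[OF that(2,1)] that jn k.G.le_antisym l.G.le_antisym k.nu_closed l.nu_closed
      k.G.le_total l.G.le_total by (metis U)
  \<comment> \<open>The choice of a preimage is harmless: by \<open>eq\<close>, elements of equal
    value in \<open>K\<close> have images of equal value.\<close>
  define e where "e a = \<mu> (j (SOME x. x \<in> U \<and> \<nu> x = a))" for a
  have e: "e (\<nu> x) = \<mu> (j x)" if "x \<in> U" for x
  proof -
    have "(SOME y. y \<in> U \<and> \<nu> y = \<nu> x) \<in> U \<and> \<nu> (SOME y. y \<in> U \<and> \<nu> y = \<nu> x) = \<nu> x"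
      by (rule someI[of "\<lambda>y. y \<in> U \<and> \<nu> y = \<nu> x" x]) (use that in simp)
    thus ?thesis using eq[of "SOME y. y \<in> U \<and> \<nu> y = \<nu> x" x] that unfolding e_def by blast
  qed
  have car: "carrier (value_group K \<Phi> \<nu>) = \<nu> ` U" by (simp add: value_group_def U_def)
  have surj: "\<exists>x\<in>U. \<mu> z = \<mu> (j x)" if z: "z \<in> carrier L" "z \<noteq> \<zero>\<^bsub>L\<^esub>" for z
    using dense[OF z] l.eq_iff[OF z] jn by (auto simp: U_def[symmetric])
  have e_im: "e ` \<nu> ` U = carrier (value_group L \<Psi> \<mu>)"
  proof
    show "e ` \<nu> ` U \<subseteq> carrier (value_group L \<Psi> \<mu>)" using e jn by (auto simp: value_group_def)
    show "carrier (value_group L \<Psi> \<mu>) \<subseteq> e ` \<nu> ` U"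
    proof
      fix b assume "b \<in> carrier (value_group L \<Psi> \<mu>)"
      then obtain z where "z \<in> carrier L" "z \<noteq> \<zero>\<^bsub>L\<^esub>" "b = \<mu> z" by (auto simp: value_group_def)
      then obtain x where "x \<in> U" "b = \<mu> (j x)" using surj by auto
      thus "b \<in> e ` \<nu> ` U" using e by force
    qed
  qed
  show ?thesis
    unfolding same_value_group_def
  proof (intro bexI conjI ballI)
    show "e \<in> iso (value_group K \<Phi> \<nu>) (value_group L \<Psi> \<mu>)"
      unfolding iso_def bij_betw_def
    proof (intro CollectI conjI homI inj_onI)
      show "e ` carrier (value_group K \<Phi> \<nu>) = carrier (value_group L \<Psi> \<mu>)" using e_im car by simp
      fix a b assume "a \<in> carrier (value_group K \<Phi> \<nu>)" "b \<in> carrier (value_group K \<Phi> \<nu>)"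
      then obtain x y where xy: "x \<in> U" "y \<in> U" "a = \<nu> x" "b = \<nu> y" by (auto simp: car)
      show "a = b" if "e a = e b" using that xy e eq by simp
      have "x \<otimes>\<^bsub>K\<^esub> y \<in> U" using xy by (simp add: U k.K.integral_iff)
      hence "e (\<nu> x \<otimes>\<^bsub>\<Phi>\<^esub> \<nu> y) = \<mu> (j x \<otimes>\<^bsub>L\<^esub> j y)" using e[of "x \<otimes>\<^bsub>K\<^esub> y"] k.nu_mult[of x y] xy by (simp add: U)
      thus "e (a \<otimes>\<^bsub>value_group K \<Phi> \<nu>\<^esub> b) = e a \<otimes>\<^bsub>value_group L \<Psi> \<mu>\<^esub> e b"
        using xy e l.nu_mult jn by (simp add: value_group_def)
    next
      fix a assume "a \<in> carrier (value_group K \<Phi> \<nu>)"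
      thus "e a \<in> carrier (value_group L \<Psi> \<mu>)" using e_im car by auto
    qed
    fix x assume "x \<in> carrier K - {\<zero>\<^bsub>K\<^esub>}"
    thus "e (\<nu> x) = \<mu> (j x)" using e by (simp add: U_def)
  next
    fix a b assume "a \<in> carrier (value_group K \<Phi> \<nu>)" "b \<in> carrier (value_group K \<Phi> \<nu>)"
    then obtain x y where xy: "x \<in> U" "y \<in> U" "a = \<nu> x" "b = \<nu> y" by (auto simp: car)
    show "a \<preceq>\<^bsub>\<Phi>\<^esub> b \<longleftrightarrow> e a \<preceq>\<^bsub>\<Psi>\<^esub> e b" using xy e le by simp
  qed
qed

section \<open>A domain inside its fraction field\<close>

context domain
begin

lemma frac_emb_closed: "a \<in> carrier R \<Longrightarrow> frac_emb R a \<in> carrier (frac_field R)"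
  by (auto simp: frac_emb_def)

lemma frac_emb_hom: "frac_emb R \<in> ring_hom R (frac_field R)"
  by (rule ring_hom_memI) (simp_all add: frac_emb_def frac_mult frac_add frac_field_one)

lemma frac_emb_zero_iff: "a \<in> carrier R \<Longrightarrow> frac_emb R a = \<zero>\<^bsub>frac_field R\<^esub> \<longleftrightarrow> a = \<zero>"
  by (simp add: frac_emb_def frac_field_zero frac_eq_iff)

lemma fraction_eq:
  assumes "a \<in> carrier R" "b \<in> carrier R" "b \<noteq> \<zero>"
  shows "fraction R a b = frac_emb R a \<otimes>\<^bsub>frac_field R\<^esub> inv\<^bsub>frac_field R\<^esub> (frac_emb R b)"
proof -
  interpret K: field "frac_field R" by (rule field_frac_field)
  have "fraction R a b \<otimes>\<^bsub>frac_field R\<^esub> frac_emb R b = fraction R (a \<otimes> b) (b \<otimes> \<one>)"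
    unfolding frac_emb_def by (rule frac_mult) (use assms in auto)
  also have "\<dots> = frac_emb R a" unfolding frac_emb_def using assms by (subst frac_eq_iff) (auto simp: integral_iff)
  finally show ?thesis
    using K.eq_div_iff[of "frac_emb R a" "frac_emb R b" "fraction R a b"] frac_emb_closed assms frac_emb_zero_iff by auto
qed

lemma frac_fieldE:
  assumes "z \<in> carrier (frac_field R)"
  obtains a b where "a \<in> carrier R" "b \<in> carrier R" "b \<noteq> \<zero>"
    "z = frac_emb R a \<otimes>\<^bsub>frac_field R\<^esub> inv\<^bsub>frac_field R\<^esub> (frac_emb R b)"
  using carrier_frac_fieldE[OF assms] fraction_eq by (metis DiffD1 DiffD2 insertI1)

lemma frac_map_fraction:
  assumes S: "domain S" and f: "f \<in> ring_hom R S" "\<And>a. a \<in> carrier R \<Longrightarrow> f a = \<zero>\<^bsub>S\<^esub> \<longleftrightarrow> a = \<zero>"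
    and ab: "a \<in> carrier R" "b \<in> carrier R" "b \<noteq> \<zero>"
  shows "frac_map S f (fraction R a b) = fraction S (f a) (f b)"
proof -
  interpret S: domain S by fact
  \<comment> \<open>All representatives contribute the same class, so the union in
    \<open>frac_map\<close> collapses to it.\<close>
  have "fraction S (f (fst p)) (f (snd p)) = fraction S (f a) (f b)" if p: "p \<in> fraction R a b" for p
  proof -
    obtain c d where cd: "p = (c, d)" "c \<in> carrier R" "d \<in> carrier R" "d \<noteq> \<zero>" "a \<otimes> d = c \<otimes> b"
      using p by (auto simp: fraction_def frac_rel_def)
    have "f c \<otimes>\<^bsub>S\<^esub> f b = f a \<otimes>\<^bsub>S\<^esub> f d"
      using ring_hom_mult[OF f(1)] cd ab by metis
    thus ?thesis using cd ab f(2) ring_hom_closed[OF f(1)] by (simp add: S.frac_eq_iff)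
  qed
  moreover have "(a, b) \<in> fraction R a b" using ab by (auto simp: fraction_def frac_rel_def)
  ultimately show ?thesis unfolding frac_map_def by blast
qed

end

text \<open>An element algebraic over \<open>K\<close> is coded by the coefficients of an annihilating polynomial and
  the number of the root. This makes room for the algebraic closure in the type of test rings.\<close>

lemma algebraic_injects_into_list_set:
  fixes \<Omega> :: "('x, 'm) ring_scheme" and \<gamma> :: "'x \<Rightarrow> 'c \<times> 'c"
  assumes field: "field \<Omega>" and K: "subfield K \<Omega>" and inj: "inj_on \<gamma> K"
    and alg: "\<And>x. x \<in> carrier \<Omega> \<Longrightarrow> (ring.algebraic \<Omega> over K) x"
  shows "\<exists>h :: 'x \<Rightarrow> 'c list set. inj_on h (carrier \<Omega>)"
proof -
  interpret field \<Omega> by fact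
  \<comment> \<open>Each coefficient becomes exactly two letters, so the concatenation can be
    decoded without separators.\<close>
  define enc where "enc p = concat (map (\<lambda>k. [fst (\<gamma> k), snd (\<gamma> k)]) p)" for p
  have enc_inj: "enc p = enc q \<Longrightarrow> set p \<subseteq> K \<Longrightarrow> set q \<subseteq> K \<Longrightarrow> p = q" for p q
  proof (induction p arbitrary: q)
    case Nil
    thus ?case by (cases q) (auto simp: enc_def)
  next
    case (Cons a p)
    then obtain b q' where q: "q = b # q'" by (cases q) (auto simp: enc_def)
    have "\<gamma> a = \<gamma> b" "enc p = enc q'" using Cons(2) unfolding q by (auto simp: enc_def prod_eq_iff)
    moreover have "a \<in> K" "b \<in> K" "set p \<subseteq> K" "set q' \<subseteq> K" using Cons(3,4) q by auto
    ultimately have "a = b" "p = q'" using inj_onD[OF inj, of a b] Cons(1)[of q'] by blast+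
    thus ?case using q by simp
  qed
  define P where "P x = (SOME p. p \<in> carrier (univ_poly \<Omega> K) \<and> p \<noteq> [] \<and> eval p x = \<zero>\<^bsub>\<Omega>\<^esub>)" for x
  have P: "P x \<in> carrier (univ_poly \<Omega> K)" "P x \<noteq> []" "eval (P x) x = \<zero>\<^bsub>\<Omega>\<^esub>" if x: "x \<in> carrier \<Omega>" for x
  proof -
    obtain p where "p \<in> carrier (univ_poly \<Omega> K)" "p \<noteq> []" "eval p x = \<zero>\<^bsub>\<Omega>\<^esub>"
      using algebraicE[OF subfieldE(1)[OF K] x alg[OF x]] by blast
    hence "\<exists>p. p \<in> carrier (univ_poly \<Omega> K) \<and> p \<noteq> [] \<and> eval p x = \<zero>\<^bsub>\<Omega>\<^esub>" by blast
    hence "P x \<in> carrier (univ_poly \<Omega> K) \<and> P x \<noteq> [] \<and> eval (P x) x = \<zero>\<^bsub>\<Omega>\<^esub>"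
      unfolding P_def by (rule someI_ex)
    thus "P x \<in> carrier (univ_poly \<Omega> K)" "P x \<noteq> []" "eval (P x) x = \<zero>\<^bsub>\<Omega>\<^esub>" by auto
  qed
  \<comment> \<open>A numbering of the finitely many roots of \<open>p\<close>. It depends on
    \<open>p\<close> alone, so elements with the same chosen polynomial are numbered
    consistently.\<close>
  define idx where "idx p = (SOME f :: 'x \<Rightarrow> nat. inj_on f {x. is_root p x})" for p
  have idx: "inj_on (idx (P x)) {y. is_root (P x) y}" if x: "x \<in> carrier \<Omega>" for x
  proof -
    have "finite {y. is_root (P x) y}"
      using finite_number_of_roots[OF univ_poly_mono[OF subfieldE(3)[OF K] P(1)[OF x]]] .
    then obtain f :: "'x \<Rightarrow> nat" where "inj_on f {y. is_root (P x) y}"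
      using finite_imp_inj_to_nat_seg[of "{y. is_root (P x) y}"] by blast
    hence "inj_on (SOME f :: 'x \<Rightarrow> nat. inj_on f {y. is_root (P x) y}) {y. is_root (P x) y}"
      by (rule someI[of "\<lambda>f. inj_on f {y. is_root (P x) y}"])
    thus ?thesis by (simp add: idx_def)
  qed
  \<comment> \<open>The shorter word carries the polynomial, and the difference in length carries
    the number of the root. The padding is never empty because of \<open>Suc\<close>, so the two
    words are distinct and their roles cannot be confused; no letter beyond \<open>undefined\<close>
    is required.\<close>
  define h where "h x = {enc (P x), enc (P x) @ replicate (Suc (idx (P x) x)) undefined}" for x
  have "inj_on h (carrier \<Omega>)"
  proof (rule inj_onI)
    fix x y assume x: "x \<in> carrier \<Omega>" and y: "y \<in> carrier \<Omega>" and e: "h x = h y"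
    have "enc (P x) = enc (P y) \<and> idx (P x) x = idx (P y) y"
    proof (cases "enc (P x) = enc (P y)")
      case True
      hence "enc (P x) @ replicate (Suc (idx (P x) x)) undefined = enc (P y) @ replicate (Suc (idx (P y) y)) undefined"
        using e by (auto simp: h_def doubleton_eq_iff)
      hence "length (replicate (Suc (idx (P x) x)) (undefined :: 'c)) = length (replicate (Suc (idx (P y) y)) (undefined :: 'c))"
        unfolding True by (simp del: replicate.simps)
      thus ?thesis using True by simp
    next
      case False
      hence *: "enc (P x) = enc (P y) @ replicate (Suc (idx (P y) y)) undefined"
        "enc (P y) = enc (P x) @ replicate (Suc (idx (P x) x)) undefined"
        using e by (auto simp: h_def doubleton_eq_iff)
      have "length (enc (P x)) > length (enc (P y))" "length (enc (P y)) > length (enc (P x))"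
        using arg_cong[OF *(1), of length] arg_cong[OF *(2), of length] by simp_all
      thus ?thesis by simp
    qed
    moreover from this have "P x = P y"
      using enc_inj[OF _ univ_poly_carrierD(1)[OF subfieldE(1)[OF K] P(1)[OF x]]
          univ_poly_carrierD(1)[OF subfieldE(1)[OF K] P(1)[OF y]]] by simp
    ultimately have "idx (P x) x = idx (P x) y" by simp
    thus "x = y"
      using inj_onD[OF idx[OF x]] P[OF x] P[OF y] x y \<open>P x = P y\<close> by (simp add: is_root_def)
  qed
  thus ?thesis by blast
qed

section \<open>Extensions to quotients of the henselization\<close>

locale henselization_valuation =
  fixes R :: "('a, 'm) ring_scheme" and Rh :: "('b, 'n) ring_scheme" and i :: "'a \<Rightarrow> 'b"
    and \<Phi> :: "('g, 'p) ordered_group_scheme" and \<nu> :: "('a \<times> 'a) set \<Rightarrow> 'g"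
  assumes dom: "domain R" and loc: "local_ring R" and hens: "henselization R Rh i"
    and cent: "centered_valuation R \<Phi> \<nu>"
begin

abbreviation K where "K \<equiv> frac_field R"
abbreviation V\<nu> where "V\<nu> \<equiv> val_ring K \<Phi> \<nu>"
abbreviation M where "M \<equiv> max_ideal Rh"

sublocale R: domain R by (rule dom)
lemma hensel: "henselian Rh" and ihom: "i \<in> local_hom R Rh" using hens by (auto simp: henselization_def)
lemmas locRh = henselianD(1)[OF hensel]
sublocale Rh: cring Rh using henselianD(2)[OF hensel] .
sublocale i: ring_hom_ring R Rh i by (rule ring_hom_ringI2[OF R.ring_axioms Rh.ring_axioms local_homD(1)[OF ihom]])
sublocale val: valued_field K \<Phi> \<nu> using cent by unfold_locales (simp add: centered_valuation_def)
sublocale M: ideal M Rh by (rule local_ring_max_ideal(3)[OF locRh])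

lemma emb_in_V: "r \<in> carrier R \<Longrightarrow> frac_emb R r \<in> V\<nu>"
  using cent by (auto simp: centered_valuation_def)

lemma emb_in_m: "r \<in> carrier R \<Longrightarrow> frac_emb R r \<in> vmax K V\<nu> \<longleftrightarrow> r \<in> max_ideal R"
  using cent val.val_ideal_eq unfolding centered_valuation_def by blast

end

locale henselization_quotient = henselization_valuation +
  fixes H
  assumes prime: "primeideal H Rh" and contract: "{x \<in> carrier R. i x \<in> H} = {\<zero>\<^bsub>R\<^esub>}"
begin

abbreviation D where "D \<equiv> Rh Quot H"
abbreviation L where "L \<equiv> frac_field D"
definition \<pi> where "\<pi> x = H +>\<^bsub>Rh\<^esub> x"
definition e where "e x = frac_emb D (\<pi> x)"

sublocale H: primeideal H Rh by (rule prime)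
sublocale D: domain D by (rule H.quotient_is_domain)
sublocale L: field L by (rule D.field_frac_field)

lemma pi_hom: "\<pi> \<in> ring_hom Rh D"
  unfolding \<pi>_def by (rule H.rcos_ring_hom)

sublocale pi: ring_hom_ring Rh D \<pi> by (rule ring_hom_ringI2[OF Rh.ring_axioms D.ring_axioms pi_hom])

lemma pi_zero: "x \<in> carrier Rh \<Longrightarrow> \<pi> x = \<zero>\<^bsub>D\<^esub> \<longleftrightarrow> x \<in> H"
  using H.a_rcos_const[of x] H.rcos_const_imp_mem[of x] by (auto simp: \<pi>_def FactRing_def)

lemma carrier_D: "carrier D = \<pi> ` carrier Rh"
  by (auto simp: FactRing_def A_RCOSETS_def' \<pi>_def)

lemma e_hom: "e \<in> ring_hom Rh L"
  using ring_hom_trans[OF pi_hom D.frac_emb_hom] by (simp add: e_def[abs_def] comp_def)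

sublocale e: ring_hom_ring Rh L e by (rule ring_hom_ringI2[OF Rh.ring_axioms L.ring_axioms e_hom])

lemma e_zero: "x \<in> carrier Rh \<Longrightarrow> e x = \<zero>\<^bsub>L\<^esub> \<longleftrightarrow> x \<in> H"
  using D.frac_emb_zero_iff[of "\<pi> x"] pi_zero by (simp add: e_def)

lemma L_E:
  assumes "z \<in> carrier L"
  obtains x y where "x \<in> carrier Rh" "y \<in> carrier Rh" "y \<notin> H" "z = e x \<otimes>\<^bsub>L\<^esub> inv\<^bsub>L\<^esub> (e y)"
proof -
  obtain a b where ab: "a \<in> carrier D" "b \<in> carrier D" "b \<noteq> \<zero>\<^bsub>D\<^esub>" "z = frac_emb D a \<otimes>\<^bsub>L\<^esub> inv\<^bsub>L\<^esub> (frac_emb D b)"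
    using D.frac_fieldE[OF assms] by blast
  obtain x where x: "x \<in> carrier Rh" "a = \<pi> x" using ab(1) carrier_D by auto
  obtain y where y: "y \<in> carrier Rh" "b = \<pi> y" using ab(2) carrier_D by auto
  have "y \<notin> H" using pi_zero[OF y(1)] ab(3) y(2) by simp
  thus thesis using that[OF x(1) y(1)] ab(4) x y by (simp add: e_def)
qed

lemma i_H: "r \<in> carrier R \<Longrightarrow> i r \<in> H \<longleftrightarrow> r = \<zero>\<^bsub>R\<^esub>"
  using contract by blast

lemma e_i_zero: "r \<in> carrier R \<Longrightarrow> e (i r) = \<zero>\<^bsub>L\<^esub> \<longleftrightarrow> r = \<zero>\<^bsub>R\<^esub>"
  using e_zero i_H by simp

abbreviation j where "j \<equiv> quot_frac_map Rh i H"

lemma j_fraction: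
  assumes "r \<in> carrier R" "s \<in> carrier R" "s \<noteq> \<zero>\<^bsub>R\<^esub>"
  shows "j (fraction R r s) = e (i r) \<otimes>\<^bsub>L\<^esub> inv\<^bsub>L\<^esub> (e (i s))"
proof -
  have q: "quot_emb Rh i H x = \<pi> (i x)" for x by (simp add: quot_emb_def \<pi>_def)
  have "quot_emb Rh i H \<in> ring_hom R D"
    using ring_hom_trans[OF local_homD(1)[OF ihom] pi_hom] by (simp add: q[abs_def] comp_def)
  hence "j (fraction R r s) = fraction D (\<pi> (i r)) (\<pi> (i s))"
    using R.frac_map_fraction[OF D.domain_axioms _ _ assms, of "quot_emb Rh i H"] pi_zero i_H by (simp add: q)
  also have "\<dots> = e (i r) \<otimes>\<^bsub>L\<^esub> inv\<^bsub>L\<^esub> (e (i s))"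
    unfolding e_def using assms pi_zero i_H by (intro D.fraction_eq) auto
  finally show ?thesis .
qed

lemma K_E:
  assumes "k \<in> carrier K"
  obtains r s where "r \<in> carrier R" "s \<in> carrier R" "s \<noteq> \<zero>\<^bsub>R\<^esub>" "k = fraction R r s"
  using R.carrier_frac_fieldE[OF assms] by blast

lemma j_hom: "j \<in> ring_hom K L"
proof (rule ring_hom_memI)
  show "j \<one>\<^bsub>K\<^esub> = \<one>\<^bsub>L\<^esub>" using j_fraction[of "\<one>\<^bsub>R\<^esub>" "\<one>\<^bsub>R\<^esub>"] by (simp add: R.frac_field_one)
  fix x assume "x \<in> carrier K"
  then obtain r s where rs: "r \<in> carrier R" "s \<in> carrier R" "s \<noteq> \<zero>\<^bsub>R\<^esub>" "x = fraction R r s" by (rule K_E)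
  have es: "e (i s) \<noteq> \<zero>\<^bsub>L\<^esub>" using e_i_zero rs by simp
  show "j x \<in> carrier L" using j_fraction[OF rs(1-3)] rs es by simp
  fix y assume "y \<in> carrier K"
  then obtain r' s' where rs': "r' \<in> carrier R" "s' \<in> carrier R" "s' \<noteq> \<zero>\<^bsub>R\<^esub>" "y = fraction R r' s'" by (rule K_E)
  have es': "e (i s') \<noteq> \<zero>\<^bsub>L\<^esub>" using e_i_zero rs' by simp
  have n: "s \<otimes>\<^bsub>R\<^esub> s' \<noteq> \<zero>\<^bsub>R\<^esub>" using rs rs' R.integral_iff by simp
  show "j (x \<otimes>\<^bsub>K\<^esub> y) = j x \<otimes>\<^bsub>L\<^esub> j y"
    using rs rs' n es es' by (simp add: R.frac_mult j_fraction L.frac_mult_rule)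
  show "j (x \<oplus>\<^bsub>K\<^esub> y) = j x \<oplus>\<^bsub>L\<^esub> j y"
    using rs rs' n es es' by (simp add: R.frac_add j_fraction L.frac_add_rule)
qed

lemma H_M: "H \<subseteq> M"
proof
  fix x assume x: "x \<in> H"
  show "x \<in> M"
  proof (rule ccontr)
    assume "x \<notin> M"
    then obtain y where "y \<in> carrier Rh" "x \<otimes>\<^bsub>Rh\<^esub> y = \<one>\<^bsub>Rh\<^esub>" using local_ring_inverse[OF locRh] x H.Icarr by blast
    hence "\<one>\<^bsub>Rh\<^esub> \<in> H" using H.I_r_closed[OF x] by metis
    thus False using H.one_imp_carrier H.I_notcarr by simp
  qed
qed

lemma pi_M: "x \<in> carrier Rh \<Longrightarrow> \<pi> x \<in> \<pi> ` M \<longleftrightarrow> x \<in> M"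
proof
  assume x: "x \<in> carrier Rh" and "\<pi> x \<in> \<pi> ` M"
  then obtain m where m: "m \<in> M" "\<pi> x = \<pi> m" by auto
  have mc: "m \<in> carrier Rh" using m M.Icarr by simp
  have "\<pi> (x \<ominus>\<^bsub>Rh\<^esub> m) = \<zero>\<^bsub>D\<^esub>" using m mc x by (simp add: a_minus_def D.r_neg)
  hence "x \<ominus>\<^bsub>Rh\<^esub> m \<in> M" using pi_zero[of "x \<ominus>\<^bsub>Rh\<^esub> m"] H_M x mc by auto
  moreover have "x = (x \<ominus>\<^bsub>Rh\<^esub> m) \<oplus>\<^bsub>Rh\<^esub> m" using x mc by (simp add: a_minus_def Rh.a_assoc Rh.l_neg)
  ultimately show "x \<in> M" using M.a_closed m(1) by metis
qed auto

lemma max_ideal_D: "max_ideal D = \<pi> ` M"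
proof (rule local_ringI(2)[OF D.cring_axioms])
  show "ideal (\<pi> ` M) D"
  proof (rule idealI[OF D.ring_axioms])
    show "subgroup (\<pi> ` M) (add_monoid D)" by (rule pi.img_is_add_subgroup) (rule M.a_subgroup)
    fix a x assume "a \<in> \<pi> ` M" "x \<in> carrier D"
    then obtain m y where my: "m \<in> M" "a = \<pi> m" "y \<in> carrier Rh" "x = \<pi> y" using carrier_D by auto
    hence "x \<otimes>\<^bsub>D\<^esub> a = \<pi> (y \<otimes>\<^bsub>Rh\<^esub> m)" "a \<otimes>\<^bsub>D\<^esub> x = \<pi> (m \<otimes>\<^bsub>Rh\<^esub> y)" using M.Icarr by auto
    thus "x \<otimes>\<^bsub>D\<^esub> a \<in> \<pi> ` M" "a \<otimes>\<^bsub>D\<^esub> x \<in> \<pi> ` M"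
      using M.I_l_closed[OF my(1,3)] M.I_r_closed[OF my(1,3)] by (metis imageI)+
  qed
  show "\<one>\<^bsub>D\<^esub> \<notin> \<pi> ` M" using pi_M[of "\<one>\<^bsub>Rh\<^esub>"] local_ring_max_ideal(4)[OF locRh] by simp
  fix x assume x: "x \<in> carrier D" "x \<notin> \<pi> ` M"
  then obtain y where y: "y \<in> carrier Rh" "x = \<pi> y" "y \<notin> M" using carrier_D by auto
  obtain z where z: "z \<in> carrier Rh" "y \<otimes>\<^bsub>Rh\<^esub> z = \<one>\<^bsub>Rh\<^esub>" using local_ring_inverse[OF locRh y(1,3)] by blast
  have "x \<otimes>\<^bsub>D\<^esub> \<pi> z = \<one>\<^bsub>D\<^esub>" using pi.hom_mult[OF y(1) z(1)] y z by simp
  thus "\<exists>y\<in>carrier D. x \<otimes>\<^bsub>D\<^esub> y = \<one>\<^bsub>D\<^esub>" using z(1) by (intro bexI[of _ "\<pi> z"]) auto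
qed

text \<open>The form of \<open>quot_extension\<close> for a bare valuation ring, with
  \<open>e\<close> and \<open>i\<close> in place of embeddings of fraction fields.\<close>

definition ext_ring where
  "ext_ring V \<longleftrightarrow> e ` carrier Rh \<subseteq> V \<and> e ` M \<subseteq> vmax L V \<and>
    (\<forall>r\<in>carrier R. \<forall>s\<in>carrier R. s \<noteq> \<zero>\<^bsub>R\<^esub> \<longrightarrow> (e (i r) \<otimes>\<^bsub>L\<^esub> inv\<^bsub>L\<^esub> (e (i s)) \<in> V \<longleftrightarrow> fraction R r s \<in> V\<nu>))"

text \<open>The nontrivial point is domination: mapping \<open>M\<close> into the maximal ideal is
  enough, because elements of \<open>Rh\<close> outside \<open>M\<close> are units and stay units in
  the valuation ring.\<close>

lemma quot_extension_iff:
  assumes \<mu>: "valuation L \<Psi> \<mu>"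
  shows "quot_extension R Rh i \<Phi> \<nu> H \<Psi> \<mu> \<longleftrightarrow> ext_ring (val_ring L \<Psi> \<mu>)"
proof -
  interpret mu: valued_field L \<Psi> \<mu> by unfold_locales (rule \<mu>)
  let ?V = "val_ring L \<Psi> \<mu>"
  have "val_extends K \<Phi> \<nu> L \<Psi> \<mu> j \<longleftrightarrow> (\<forall>k\<in>carrier K. j k \<in> ?V \<longleftrightarrow> k \<in> V\<nu>)"
    unfolding val_extends_def using val.vs.V_carr by blast
  also have "\<dots> \<longleftrightarrow> (\<forall>r\<in>carrier R. \<forall>s\<in>carrier R. s \<noteq> \<zero>\<^bsub>R\<^esub> \<longrightarrow> (e (i r) \<otimes>\<^bsub>L\<^esub> inv\<^bsub>L\<^esub> (e (i s)) \<in> ?V \<longleftrightarrow> fraction R r s \<in> V\<nu>))"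
    (is "?A \<longleftrightarrow> ?B")
  proof
    assume A: ?A
    show ?B
    proof (intro ballI impI)
      fix r s assume rs: "r \<in> carrier R" "s \<in> carrier R" "s \<noteq> \<zero>\<^bsub>R\<^esub>"
      have k: "fraction R r s \<in> carrier K" using R.frac_in_carrier[of r s] rs by simp
      show "e (i r) \<otimes>\<^bsub>L\<^esub> inv\<^bsub>L\<^esub> (e (i s)) \<in> ?V \<longleftrightarrow> fraction R r s \<in> V\<nu>" using bspec[OF A k] by (simp only: j_fraction[OF rs])
    qed
  next
    assume B: ?B
    show ?A
    proof
      fix k assume "k \<in> carrier K"
      then obtain r s where rs: "r \<in> carrier R" "s \<in> carrier R" "s \<noteq> \<zero>\<^bsub>R\<^esub>" "k = fraction R r s" by (rule K_E)
      show "j k \<in> ?V \<longleftrightarrow> k \<in> V\<nu>"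
        unfolding rs(4) j_fraction[OF rs(1-3)] using B rs(1-3) by blast
    qed
  qed
  finally have ext: "val_extends K \<Phi> \<nu> L \<Psi> \<mu> j \<longleftrightarrow> ?B" .
  have im: "frac_emb D ` carrier D = e ` carrier Rh" by (simp only: carrier_D image_image e_def[abs_def])
  have core: "{a \<in> carrier D. frac_emb D a \<in> vmax L ?V} = max_ideal D \<longleftrightarrow> e ` M \<subseteq> vmax L ?V" if sub: "e ` carrier Rh \<subseteq> ?V"
  proof
    assume A: "{a \<in> carrier D. frac_emb D a \<in> vmax L ?V} = max_ideal D"
    show "e ` M \<subseteq> vmax L ?V"
    proof
      fix z assume "z \<in> e ` M"
      then obtain x where x: "x \<in> M" "z = e x" by blast
      hence "\<pi> x \<in> max_ideal D" by (simp add: max_ideal_D)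
      thus "z \<in> vmax L ?V" using x(2) unfolding A[symmetric] e_def by simp
    qed
  next
    assume m: "e ` M \<subseteq> vmax L ?V"
    have "x \<in> M" if x: "x \<in> carrier Rh" "e x \<in> vmax L ?V" for x
    proof (rule ccontr)
      assume "x \<notin> M"
      then obtain y where y: "y \<in> carrier Rh" "x \<otimes>\<^bsub>Rh\<^esub> y = \<one>\<^bsub>Rh\<^esub>" using local_ring_inverse[OF locRh x(1)] by blast
      have "e x \<otimes>\<^bsub>L\<^esub> e y = \<one>\<^bsub>L\<^esub>" using e.hom_mult[OF x(1) y(1)] y(2) by simp
      thus False using mu.vs.unitI[of "e x" "e y"] sub x y by auto
    qed
    hence *: "frac_emb D (\<pi> x) \<in> vmax L ?V \<longleftrightarrow> \<pi> x \<in> \<pi> ` M" if "x \<in> carrier Rh" for x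
      using m pi_M[OF that] that unfolding e_def by blast
    show "{a \<in> carrier D. frac_emb D a \<in> vmax L ?V} = max_ideal D"
      unfolding max_ideal_D
    proof (intro equalityI subsetI)
      fix a assume "a \<in> {a \<in> carrier D. frac_emb D a \<in> vmax L ?V}"
      then obtain x where "x \<in> carrier Rh" "a = \<pi> x" "frac_emb D a \<in> vmax L ?V" unfolding carrier_D by blast
      thus "a \<in> \<pi> ` M" using * by simp
    next
      fix a assume "a \<in> \<pi> ` M"
      then obtain x where x: "x \<in> M" "a = \<pi> x" by blast
      have xc: "x \<in> carrier Rh" using x(1) by (rule M.Icarr)
      have "frac_emb D a \<in> vmax L ?V" unfolding x(2) using *[OF xc] x(1) by blast
      thus "a \<in> {a \<in> carrier D. frac_emb D a \<in> vmax L ?V}" using xc x(2) by simp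
    qed
  qed
  have logic: "P \<Longrightarrow> (A \<Longrightarrow> B = C) \<Longrightarrow> (P \<and> A \<and> B) = (A \<and> C)" for P A B C by blast
  have cv: "centered_valuation D \<Psi> \<mu> \<longleftrightarrow> e ` carrier Rh \<subseteq> ?V \<and> e ` M \<subseteq> vmax L ?V"
    unfolding centered_valuation_def mu.val_ideal_eq im
    by (rule logic[OF \<mu> core])
  show ?thesis unfolding quot_extension_def ext_ring_def cv ext conj_assoc ..
qed

text \<open>The condition \<open>dense\<close> says that \<open>x / y\<close> has the value of
  \<open>r / s\<close>. It is stated with cross products, so that it compares images of elements of
  \<open>Rh\<close>.\<close>

lemma same_value_group_quot:
  assumes \<mu>: "quot_extension R Rh i \<Phi> \<nu> H \<Psi> \<mu>"
    and dense: "\<And>x y. \<lbrakk>x \<in> carrier Rh; y \<in> carrier Rh; x \<notin> H; y \<notin> H\<rbrakk> \<Longrightarrow> \<exists>r\<in>carrier R. \<exists>s\<in>carrier R. r \<noteq> \<zero>\<^bsub>R\<^esub> \<and> s \<noteq> \<zero>\<^bsub>R\<^esub> \<and>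
      e (x \<otimes>\<^bsub>Rh\<^esub> i s) \<otimes>\<^bsub>L\<^esub> inv\<^bsub>L\<^esub> (e (y \<otimes>\<^bsub>Rh\<^esub> i r)) \<in> val_ring L \<Psi> \<mu> \<and>
      e (y \<otimes>\<^bsub>Rh\<^esub> i r) \<otimes>\<^bsub>L\<^esub> inv\<^bsub>L\<^esub> (e (x \<otimes>\<^bsub>Rh\<^esub> i s)) \<in> val_ring L \<Psi> \<mu>"
  shows "same_value_group K \<Phi> \<nu> L \<Psi> \<mu> j"
proof (rule same_value_groupI)
  show "valuation K \<Phi> \<nu>" by (rule val.val)
  show "valuation L \<Psi> \<mu>"
    using \<mu> unfolding quot_extension_def centered_valuation_def by (elim conjE)
  show "val_extends K \<Phi> \<nu> L \<Psi> \<mu> j"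
    using \<mu> unfolding quot_extension_def by (elim conjE)
  show "ring_hom_ring K L j" by (rule ring_hom_ringI2[OF val.K.ring_axioms L.ring_axioms j_hom])
  fix z assume z: "z \<in> carrier L" "z \<noteq> \<zero>\<^bsub>L\<^esub>"
  obtain x y where xy: "x \<in> carrier Rh" "y \<in> carrier Rh" "y \<notin> H" "z = e x \<otimes>\<^bsub>L\<^esub> inv\<^bsub>L\<^esub> (e y)"
    using L_E[OF z(1)] by blast
  have ey: "e y \<noteq> \<zero>\<^bsub>L\<^esub>" "e y \<in> carrier L" "e x \<in> carrier L" using e_zero[OF xy(2)] xy(1-3) by simp_all
  have ex: "e x \<noteq> \<zero>\<^bsub>L\<^esub>"
  proof
    assume "e x = \<zero>\<^bsub>L\<^esub>"
    hence "z = \<zero>\<^bsub>L\<^esub>" unfolding xy(4) using ey by simp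
    thus False using z(2) by simp
  qed
  have xH: "x \<notin> H" using e_zero[OF xy(1)] ex by simp
  obtain r s where rs: "r \<in> carrier R" "s \<in> carrier R" "r \<noteq> \<zero>\<^bsub>R\<^esub>" "s \<noteq> \<zero>\<^bsub>R\<^esub>"
    "e (x \<otimes>\<^bsub>Rh\<^esub> i s) \<otimes>\<^bsub>L\<^esub> inv\<^bsub>L\<^esub> (e (y \<otimes>\<^bsub>Rh\<^esub> i r)) \<in> val_ring L \<Psi> \<mu>"
    "e (y \<otimes>\<^bsub>Rh\<^esub> i r) \<otimes>\<^bsub>L\<^esub> inv\<^bsub>L\<^esub> (e (x \<otimes>\<^bsub>Rh\<^esub> i s)) \<in> val_ring L \<Psi> \<mu>"
    using dense[OF xy(1,2) xH xy(3)] by (elim bexE conjE) (rule that; assumption)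
  have n: "e (i r) \<noteq> \<zero>\<^bsub>L\<^esub>" "e (i s) \<noteq> \<zero>\<^bsub>L\<^esub>" "e (i r) \<in> carrier L" "e (i s) \<in> carrier L"
    using e_i_zero[OF rs(1)] e_i_zero[OF rs(2)] rs(1-4) by simp_all
  let ?k = "fraction R r s"
  have k: "?k \<in> carrier K - {\<zero>\<^bsub>K\<^esub>}"
    using rs(1-4) R.frac_in_carrier[of r s] R.frac_eq_iff[of r s "\<zero>\<^bsub>R\<^esub>" "\<one>\<^bsub>R\<^esub>"] by (simp add: R.frac_field_zero)
  have jk: "j ?k = e (i r) \<otimes>\<^bsub>L\<^esub> inv\<^bsub>L\<^esub> (e (i s))" using j_fraction[OF rs(1,2,4)] .
  have "z \<otimes>\<^bsub>L\<^esub> inv\<^bsub>L\<^esub> (j ?k) = e (x \<otimes>\<^bsub>Rh\<^esub> i s) \<otimes>\<^bsub>L\<^esub> inv\<^bsub>L\<^esub> (e (y \<otimes>\<^bsub>Rh\<^esub> i r))"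
    unfolding jk xy(4) using n ey ex xy(1,2) rs(1,2) by (simp add: L.frac_inv_rule L.frac_mult_rule)
  moreover have "j ?k \<otimes>\<^bsub>L\<^esub> inv\<^bsub>L\<^esub> z = e (y \<otimes>\<^bsub>Rh\<^esub> i r) \<otimes>\<^bsub>L\<^esub> inv\<^bsub>L\<^esub> (e (x \<otimes>\<^bsub>Rh\<^esub> i s))"
    unfolding jk xy(4) using n ey ex xy(1,2) rs(1,2) by (simp add: L.frac_inv_rule L.frac_mult_rule L.m_comm)
  ultimately show "\<exists>x \<in> carrier K - {\<zero>\<^bsub>K\<^esub>}. z \<otimes>\<^bsub>L\<^esub> inv\<^bsub>L\<^esub> (j x) \<in> val_ring L \<Psi> \<mu> \<and> j x \<otimes>\<^bsub>L\<^esub> inv\<^bsub>L\<^esub> z \<in> val_ring L \<Psi> \<mu>"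
    using k rs(5,6) by (intro bexI[of _ ?k]) simp_all
qed

end

text \<open>What remains of the field \<open>F\<close> once the map into it is known: by
  \<open>\<theta>_dense\<close>, every nonzero \<open>\<theta> x\<close> has the value of a fraction
  \<open>r / s\<close>, here with the denominator cleared.\<close>

locale henselization_place = henselization_valuation R Rh i \<Phi> \<nu> + pl: val_closed_field \<Omega> W
  for R :: "('a, 'm) ring_scheme" and Rh :: "('b, 'n) ring_scheme" and i :: "'a \<Rightarrow> 'b"
    and \<Phi> :: "('g, 'p) ordered_group_scheme" and \<nu> :: "('a \<times> 'a) set \<Rightarrow> 'g"
    and \<Omega> :: "('c, 'k) ring_scheme" and W +
  fixes \<theta>
  assumes \<theta>: "\<theta> \<in> ring_hom Rh \<Omega>" "\<theta> ` carrier Rh \<subseteq> W" "\<theta> ` max_ideal Rh \<subseteq> vmax \<Omega> W"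
    and \<theta>_i: "\<lbrakk>s \<in> carrier R; s \<noteq> \<zero>\<^bsub>R\<^esub>\<rbrakk> \<Longrightarrow> \<theta> (i s) \<noteq> \<zero>\<^bsub>\<Omega>\<^esub>"
    and \<theta>_\<nu>: "\<lbrakk>r \<in> carrier R; s \<in> carrier R; s \<noteq> \<zero>\<^bsub>R\<^esub>\<rbrakk> \<Longrightarrow>
      \<theta> (i r) \<otimes>\<^bsub>\<Omega>\<^esub> inv\<^bsub>\<Omega>\<^esub> (\<theta> (i s)) \<in> W \<longleftrightarrow> fraction R r s \<in> val_ring (frac_field R) \<Phi> \<nu>"
    and \<theta>_dense: "\<lbrakk>x \<in> carrier Rh; \<theta> x \<noteq> \<zero>\<^bsub>\<Omega>\<^esub>\<rbrakk> \<Longrightarrow> \<exists>r\<in>carrier R. \<exists>s\<in>carrier R. r \<noteq> \<zero>\<^bsub>R\<^esub> \<and> s \<noteq> \<zero>\<^bsub>R\<^esub> \<and>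
      \<theta> (x \<otimes>\<^bsub>Rh\<^esub> i s) \<otimes>\<^bsub>\<Omega>\<^esub> inv\<^bsub>\<Omega>\<^esub> (\<theta> (i r)) \<in> W \<and> \<theta> (i r) \<otimes>\<^bsub>\<Omega>\<^esub> inv\<^bsub>\<Omega>\<^esub> (\<theta> (x \<otimes>\<^bsub>Rh\<^esub> i s)) \<in> W"
begin

sublocale t: ring_hom_ring Rh \<Omega> \<theta> by (rule ring_hom_ringI2[OF Rh.ring_axioms pl.Om.ring_axioms \<theta>(1)])

definition N where "N = {x \<in> carrier Rh. \<theta> x = \<zero>\<^bsub>\<Omega>\<^esub>}"

lemma prime_N: "primeideal N Rh"
proof (rule primeidealI)
  show "ideal N Rh" using t.kernel_is_ideal unfolding N_def a_kernel_def' .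
  show "cring Rh" by (rule Rh.cring_axioms)
  show "carrier Rh \<noteq> N"
  proof
    assume "carrier Rh = N"
    hence "\<one>\<^bsub>Rh\<^esub> \<in> N" using Rh.one_closed by simp
    thus False by (simp add: N_def)
  qed
  fix a b assume ab: "a \<in> carrier Rh" "b \<in> carrier Rh" "a \<otimes>\<^bsub>Rh\<^esub> b \<in> N"
  have "\<theta> a \<otimes>\<^bsub>\<Omega>\<^esub> \<theta> b = \<zero>\<^bsub>\<Omega>\<^esub>" using ab t.hom_mult[OF ab(1,2)] by (simp add: N_def)
  thus "a \<in> N \<or> b \<in> N" using pl.Om.integral_iff[of "\<theta> a" "\<theta> b"] ab by (simp add: N_def)
qed

lemma contract_N: "{x \<in> carrier R. i x \<in> N} = {\<zero>\<^bsub>R\<^esub>}"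
proof (intro equalityI subsetI)
  fix x assume "x \<in> {x \<in> carrier R. i x \<in> N}"
  thus "x \<in> {\<zero>\<^bsub>R\<^esub>}" using \<theta>_i[of x] by (cases "x = \<zero>\<^bsub>R\<^esub>") (simp_all add: N_def)
qed (simp add: N_def)

text \<open>Chevalley's theorem, applied to the fractions \<open>x / s\<close> with \<open>\<theta>(x) / s\<close> in \<open>W\<close>, extends the
  valuation to the quotient by every prime contained in the kernel of \<open>\<theta>\<close>.\<close>

lemma extension_primeI:
  assumes prime: "primeideal Q Rh" and QN: "Q \<subseteq> N"
  shows "extension_prime R Rh i \<Phi> \<nu> Q"
proof -
  interpret Q: primeideal Q Rh by fact
  have contract: "{x \<in> carrier R. i x \<in> Q} = {\<zero>\<^bsub>R\<^esub>}"
  proof (intro equalityI subsetI)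
    fix x assume "x \<in> {x \<in> carrier R. i x \<in> Q}"
    hence "x \<in> {x \<in> carrier R. i x \<in> N}" using QN by blast
    thus "x \<in> {\<zero>\<^bsub>R\<^esub>}" by (simp only: contract_N)
  qed (simp add: Q.zero_closed)
  interpret q: henselization_quotient R Rh i \<Phi> \<nu> Q
    by (intro henselization_quotient.intro henselization_quotient_axioms.intro henselization_valuation_axioms prime contract)
  let ?th = "\<lambda>x s. \<theta> x \<otimes>\<^bsub>\<Omega>\<^esub> inv\<^bsub>\<Omega>\<^esub> (\<theta> (i s))"
  let ?e = "\<lambda>x s. q.e x \<otimes>\<^bsub>q.L\<^esub> inv\<^bsub>q.L\<^esub> (q.e (i s))"
  define P where "P x s \<longleftrightarrow> x \<in> carrier Rh \<and> s \<in> carrier R \<and> s \<noteq> \<zero>\<^bsub>R\<^esub>" for x s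
  \<comment> \<open>The fractions \<open>x / s\<close> formed in the field of
    \<open>Rh Quot Q\<close> whose counterpart formed with \<open>\<theta>\<close> lies in
    \<open>Y\<close>. Membership asks for one suitable representation, so closure under sums and
    products needs no comparison of representations.\<close>
  define S where "S Y = {?e x s | x s. P x s \<and> ?th x s \<in> Y}" for Y
  have SI: "z \<in> S Y" if "P x s" "?th x s \<in> Y" "z = ?e x s" for x s z Y using that by (auto simp only: S_def)
  have Pn: "\<theta> (i s) \<noteq> \<zero>\<^bsub>\<Omega>\<^esub>" "q.e (i s) \<noteq> \<zero>\<^bsub>q.L\<^esub>" "\<theta> x \<in> carrier \<Omega>" "\<theta> (i s) \<in> carrier \<Omega>"
    "q.e x \<in> carrier q.L" "q.e (i s) \<in> carrier q.L" if "P x s" for x s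
    using that \<theta>_i[of s] q.e_i_zero[of s] by (simp_all add: P_def)
  have Pmult: "P (x \<otimes>\<^bsub>Rh\<^esub> y) (s \<otimes>\<^bsub>R\<^esub> u)" "?th (x \<otimes>\<^bsub>Rh\<^esub> y) (s \<otimes>\<^bsub>R\<^esub> u) = ?th x s \<otimes>\<^bsub>\<Omega>\<^esub> ?th y u"
    "?e (x \<otimes>\<^bsub>Rh\<^esub> y) (s \<otimes>\<^bsub>R\<^esub> u) = ?e x s \<otimes>\<^bsub>q.L\<^esub> ?e y u" if p: "P x s" "P y u" for x s y u
  proof -
    show "P (x \<otimes>\<^bsub>Rh\<^esub> y) (s \<otimes>\<^bsub>R\<^esub> u)" using p by (simp add: P_def R.integral_iff)
    show "?th (x \<otimes>\<^bsub>Rh\<^esub> y) (s \<otimes>\<^bsub>R\<^esub> u) = ?th x s \<otimes>\<^bsub>\<Omega>\<^esub> ?th y u"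
      using pl.Om.frac_mult_rule Pn[OF p(1)] Pn[OF p(2)] p by (simp add: P_def)
    show "?e (x \<otimes>\<^bsub>Rh\<^esub> y) (s \<otimes>\<^bsub>R\<^esub> u) = ?e x s \<otimes>\<^bsub>q.L\<^esub> ?e y u"
      using q.L.frac_mult_rule Pn[OF p(1)] Pn[OF p(2)] p by (simp add: P_def)
  qed
  define sm where "sm x s y u = x \<otimes>\<^bsub>Rh\<^esub> i u \<oplus>\<^bsub>Rh\<^esub> y \<otimes>\<^bsub>Rh\<^esub> i s" for x s y u
  have Padd: "P (sm x s y u) (s \<otimes>\<^bsub>R\<^esub> u)" "?th (sm x s y u) (s \<otimes>\<^bsub>R\<^esub> u) = ?th x s \<oplus>\<^bsub>\<Omega>\<^esub> ?th y u"
    "?e (sm x s y u) (s \<otimes>\<^bsub>R\<^esub> u) = ?e x s \<oplus>\<^bsub>q.L\<^esub> ?e y u" if p: "P x s" "P y u" for x s y u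
  proof -
    show "P (sm x s y u) (s \<otimes>\<^bsub>R\<^esub> u)" using p by (simp add: P_def R.integral_iff sm_def)
    show "?th (sm x s y u) (s \<otimes>\<^bsub>R\<^esub> u) = ?th x s \<oplus>\<^bsub>\<Omega>\<^esub> ?th y u"
      using pl.Om.frac_add_rule[of "\<theta> x" "\<theta> (i s)" "\<theta> y" "\<theta> (i u)"] Pn[OF p(1)] Pn[OF p(2)] p by (simp add: P_def sm_def)
    show "?e (sm x s y u) (s \<otimes>\<^bsub>R\<^esub> u) = ?e x s \<oplus>\<^bsub>q.L\<^esub> ?e y u"
      using q.L.frac_add_rule[of "q.e x" "q.e (i s)" "q.e y" "q.e (i u)"] Pn[OF p(1)] Pn[OF p(2)] p by (simp add: P_def sm_def)
  qed
  have Pneg: "P (\<ominus>\<^bsub>Rh\<^esub> x) s" "?th (\<ominus>\<^bsub>Rh\<^esub> x) s = \<ominus>\<^bsub>\<Omega>\<^esub> ?th x s" "?e (\<ominus>\<^bsub>Rh\<^esub> x) s = \<ominus>\<^bsub>q.L\<^esub> ?e x s" if p: "P x s" for x s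
    using p Pn[OF p] by (simp_all add: P_def pl.Om.l_minus q.L.l_minus)
  have Pone: "P x \<one>\<^bsub>R\<^esub>" "?th x \<one>\<^bsub>R\<^esub> = \<theta> x" "?e x \<one>\<^bsub>R\<^esub> = q.e x" if "x \<in> carrier Rh" for x
    using that by (simp_all add: P_def)
  note mV = pl.W.m_V
  have B: "subring (S W) q.L"
  proof (rule q.L.subringI)
    show "S W \<subseteq> carrier q.L"
    proof
      fix z assume "z \<in> S W"
      then obtain x s where xs: "P x s" "z = ?e x s" unfolding S_def by blast
      show "z \<in> carrier q.L" unfolding xs(2) using Pn[OF xs(1)] by simp
    qed
    show "\<one>\<^bsub>q.L\<^esub> \<in> S W" by (rule SI[OF Pone(1)[OF Rh.one_closed]]) simp_all
    fix z assume "z \<in> S W"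
    then obtain x s where xs: "P x s" "?th x s \<in> W" "z = ?e x s" unfolding S_def by blast
    show "\<ominus>\<^bsub>q.L\<^esub> z \<in> S W" by (rule SI[OF Pneg(1)[OF xs(1)]]) (simp_all only: Pneg[OF xs(1)] xs pl.W.V_inv)
    fix w assume "w \<in> S W"
    then obtain y u where yu: "P y u" "?th y u \<in> W" "w = ?e y u" unfolding S_def by blast
    show "z \<otimes>\<^bsub>q.L\<^esub> w \<in> S W"
      by (rule SI[OF Pmult(1)[OF xs(1) yu(1)]]) (simp_all only: Pmult[OF xs(1) yu(1)] xs yu pl.W.V_mult)
    show "z \<oplus>\<^bsub>q.L\<^esub> w \<in> S W"
      by (rule SI[OF Padd(1)[OF xs(1) yu(1)]]) (simp_all only: Padd[OF xs(1) yu(1)] xs yu pl.W.V_add)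
  qed
  have I1: "S (vmax \<Omega> W) \<subseteq> S W" unfolding S_def using mV by blast
  have I2: "\<zero>\<^bsub>q.L\<^esub> \<in> S (vmax \<Omega> W)" by (rule SI[OF Pone(1)[OF Rh.zero_closed]]) simp_all
  have I3: "z \<oplus>\<^bsub>q.L\<^esub> w \<in> S (vmax \<Omega> W)" if zw: "z \<in> S (vmax \<Omega> W)" "w \<in> S (vmax \<Omega> W)" for z w
  proof -
    obtain x s where xs: "P x s" "?th x s \<in> vmax \<Omega> W" "z = ?e x s" using zw(1) unfolding S_def by blast
    obtain y u where yu: "P y u" "?th y u \<in> vmax \<Omega> W" "w = ?e y u" using zw(2) unfolding S_def by blast
    show ?thesis
      by (rule SI[OF Padd(1)[OF xs(1) yu(1)]]) (simp_all only: Padd[OF xs(1) yu(1)] xs yu pl.W.m_add)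
  qed
  have I4: "z \<otimes>\<^bsub>q.L\<^esub> w \<in> S (vmax \<Omega> W)" if zw: "z \<in> S W" "w \<in> S (vmax \<Omega> W)" for z w
  proof -
    obtain x s where xs: "P x s" "?th x s \<in> W" "z = ?e x s" using zw(1) unfolding S_def by blast
    obtain y u where yu: "P y u" "?th y u \<in> vmax \<Omega> W" "w = ?e y u" using zw(2) unfolding S_def by blast
    show ?thesis
      by (rule SI[OF Pmult(1)[OF xs(1) yu(1)]]) (simp_all only: Pmult[OF xs(1) yu(1)] xs yu pl.W.m_mult)
  qed
  \<comment> \<open>Here \<open>Q \<subseteq> N\<close> enters. If \<open>x / s\<close> is one
    modulo \<open>Q\<close>, then \<open>x\<close> and \<open>i s\<close> differ by an element of
    the kernel of \<open>\<theta>\<close>, so the counterpart of \<open>x / s\<close> is one as well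
    and not in the maximal ideal.\<close>
  have I5: "\<one>\<^bsub>q.L\<^esub> \<notin> S (vmax \<Omega> W)"
  proof
    assume "\<one>\<^bsub>q.L\<^esub> \<in> S (vmax \<Omega> W)"
    then obtain x s where xs: "P x s" "?th x s \<in> vmax \<Omega> W" "\<one>\<^bsub>q.L\<^esub> = ?e x s" unfolding S_def by blast
    have c: "x \<in> carrier Rh" "i s \<in> carrier Rh" using xs(1) by (simp_all add: P_def)
    have "\<one>\<^bsub>q.L\<^esub> = ?e x s \<longleftrightarrow> \<one>\<^bsub>q.L\<^esub> \<otimes>\<^bsub>q.L\<^esub> q.e (i s) = q.e x"
      by (rule q.L.eq_div_iff) (use Pn[OF xs(1)] in simp_all)
    hence "\<one>\<^bsub>q.L\<^esub> \<otimes>\<^bsub>q.L\<^esub> q.e (i s) = q.e x" using xs(3) by (rule iffD1)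
    hence "q.e x = q.e (i s)" using Pn[OF xs(1)] by simp
    hence "q.e (x \<ominus>\<^bsub>Rh\<^esub> i s) = \<zero>\<^bsub>q.L\<^esub>" using c by (simp add: a_minus_def q.L.r_neg)
    hence "x \<ominus>\<^bsub>Rh\<^esub> i s \<in> N" using q.e_zero[of "x \<ominus>\<^bsub>Rh\<^esub> i s"] QN c by auto
    hence "\<theta> x \<oplus>\<^bsub>\<Omega>\<^esub> \<ominus>\<^bsub>\<Omega>\<^esub> \<theta> (i s) = \<zero>\<^bsub>\<Omega>\<^esub>" using c by (simp add: N_def a_minus_def)
    hence "\<theta> x = \<theta> (i s)"
      using pl.Om.r_right_minus_eq[of "\<theta> x" "\<theta> (i s)"] Pn[OF xs(1)] by (simp add: a_minus_def)
    thus False using xs(2) Pn[OF xs(1)] by simp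
  qed
  obtain V where V: "valuation_subring q.L V" "S W \<subseteq> V" "S (vmax \<Omega> W) \<subseteq> vmax q.L V"
    using q.L.chevalley_extension[OF B I1 I2 I3 I4 I5] by blast
  interpret V: valuation_subring q.L V by (rule V(1))
  have "q.ext_ring V"
    unfolding q.ext_ring_def
  proof (intro conjI ballI impI subsetI)
    fix z assume "z \<in> q.e ` carrier Rh"
    then obtain x where x: "x \<in> carrier Rh" "z = q.e x" by blast
    have "\<theta> x \<in> W" using \<theta>(2) x(1) by blast
    hence "z \<in> S W" by (intro SI[OF Pone(1)[OF x(1)]]) (simp_all only: Pone[OF x(1)] x)
    thus "z \<in> V" using V(2) by blast
  next
    fix z assume "z \<in> q.e ` M"
    then obtain x where x: "x \<in> M" "z = q.e x" by blast
    have xc: "x \<in> carrier Rh" by (rule M.Icarr[OF x(1)])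
    have "\<theta> x \<in> vmax \<Omega> W" using \<theta>(3) x(1) by blast
    hence "z \<in> S (vmax \<Omega> W)" by (intro SI[OF Pone(1)[OF xc]]) (simp_all only: Pone[OF xc] x)
    thus "z \<in> vmax q.L V" using V(3) by blast
  next
    fix r s assume rs: "r \<in> carrier R" "s \<in> carrier R" "s \<noteq> \<zero>\<^bsub>R\<^esub>"
    have p: "P (i r) s" using rs by (simp add: P_def)
    show "?e (i r) s \<in> V \<longleftrightarrow> fraction R r s \<in> V\<nu>"
    proof
      assume "fraction R r s \<in> V\<nu>"
      hence "?th (i r) s \<in> W" using \<theta>_\<nu>[OF rs] by simp
      thus "?e (i r) s \<in> V" using SI[OF p _ refl] V(2) by blast
    next
      assume v: "?e (i r) s \<in> V"
      show "fraction R r s \<in> V\<nu>"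
      \<comment> \<open>A fraction outside the valuation ring of \<open>\<nu>\<close> has its
        inverse in the maximal ideal. That inverse goes into the maximal ideal of \<open>V\<close>,
        so the fraction itself stays outside \<open>V\<close>.\<close>
      proof (rule ccontr)
        assume "fraction R r s \<notin> V\<nu>"
        hence n: "?th (i r) s \<notin> W" using \<theta>_\<nu>[OF rs] by simp
        have r0: "r \<noteq> \<zero>\<^bsub>R\<^esub>" using n Pn[OF p] by (auto simp: pl.Om.l_null)
        have p': "P (i s) r" using rs r0 by (simp add: P_def)
        have "?th (i s) r = inv\<^bsub>\<Omega>\<^esub> (?th (i r) s)" using Pn[OF p] Pn[OF p'] by (simp add: pl.Om.frac_inv_rule)
        hence "?th (i s) r \<in> vmax \<Omega> W" using pl.W.notin_V(2)[OF _ n] Pn[OF p] by simp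
        hence "?e (i s) r \<in> vmax q.L V" using SI[OF p' _ refl] V(3) by blast
        moreover have "?e (i s) r = inv\<^bsub>q.L\<^esub> (?e (i r) s)" using Pn[OF p] Pn[OF p'] by (simp add: q.L.frac_inv_rule)
        moreover have "?e (i r) s \<noteq> \<zero>\<^bsub>q.L\<^esub>" "?e (i r) s \<in> carrier q.L"
          using Pn[OF p] Pn[OF p'] by (simp_all add: q.L.integral_iff)
        ultimately show False
          using V.m_inv_notin[of "inv\<^bsub>q.L\<^esub> (?e (i r) s)"] v by simp
      qed
    qed
  qed
  moreover obtain \<Psi> :: "('b set \<times> 'b set) set set ordered_group" and \<mu> where "valuation q.L \<Psi> \<mu>" "val_ring q.L \<Psi> \<mu> = V"
    using V.exists_valuation by blast
  ultimately have "quot_extension R Rh i \<Phi> \<nu> Q \<Psi> \<mu>" using q.quot_extension_iff by simp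
  thus ?thesis using prime contract unfolding extension_prime_def by blast
qed

text \<open>Any extension yields a second place of \<open>Rh\<close>, namely \<open>e\<close> into
  the fraction field of \<open>Rh Quot H\<close>, with kernel \<open>H\<close>. Comparison with
  \<open>\<theta>\<close> by \<open>places_equivalent\<close> fixes both the kernel and the
  valuation ring.\<close>

lemma extension_determined:
  assumes prime: "primeideal H Rh" and contract: "{x \<in> carrier R. i x \<in> H} = {\<zero>\<^bsub>R\<^esub>}"
    and ext: "quot_extension R Rh i \<Phi> \<nu> H \<Psi> \<mu>"
  shows "H = N"
    and "\<lbrakk>x \<in> carrier Rh; y \<in> carrier Rh; y \<notin> H\<rbrakk> \<Longrightarrow>
      henselization_quotient.e Rh H x \<otimes>\<^bsub>frac_field (Rh Quot H)\<^esub> inv\<^bsub>frac_field (Rh Quot H)\<^esub> (henselization_quotient.e Rh H y)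
        \<in> val_ring (frac_field (Rh Quot H)) \<Psi> \<mu> \<longleftrightarrow> \<theta> x \<otimes>\<^bsub>\<Omega>\<^esub> inv\<^bsub>\<Omega>\<^esub> (\<theta> y) \<in> W"
proof -
  interpret q: henselization_quotient R Rh i \<Phi> \<nu> H
    by (intro henselization_quotient.intro henselization_quotient_axioms.intro henselization_valuation_axioms prime contract)
  have v: "valuation q.L \<Psi> \<mu>" using ext unfolding quot_extension_def centered_valuation_def by (elim conjE)
  interpret mu: valued_field q.L \<Psi> \<mu> by unfold_locales (rule v)
  have er: "q.ext_ring (val_ring q.L \<Psi> \<mu>)" using ext q.quot_extension_iff[OF v] by simp
  have eV: "q.e ` carrier Rh \<subseteq> val_ring q.L \<Psi> \<mu>" and eM: "q.e ` M \<subseteq> vmax q.L (val_ring q.L \<Psi> \<mu>)"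
    and eR: "\<forall>r\<in>carrier R. \<forall>s\<in>carrier R. s \<noteq> \<zero>\<^bsub>R\<^esub> \<longrightarrow>
      (q.e (i r) \<otimes>\<^bsub>q.L\<^esub> inv\<^bsub>q.L\<^esub> (q.e (i s)) \<in> val_ring q.L \<Psi> \<mu> \<longleftrightarrow> fraction R r s \<in> V\<nu>)"
    by (rule er[unfolded q.ext_ring_def, THEN conjunct1]) (rule er[unfolded q.ext_ring_def, THEN conjunct2, THEN conjunct1],
      rule er[unfolded q.ext_ring_def, THEN conjunct2, THEN conjunct2])
  interpret tp: two_places \<Omega> W q.L "val_ring q.L \<Psi> \<mu>" R Rh i \<theta> q.e
  proof (rule two_places.intro[OF pl.val_closed_field_axioms mu.vs.valuation_subring_axioms],
      rule two_places_axioms.intro[OF dom loc hens \<theta> q.e_hom eV eM \<theta>_i])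
    fix s assume s: "s \<in> carrier R" "s \<noteq> \<zero>\<^bsub>R\<^esub>"
    show "q.e (i s) \<noteq> \<zero>\<^bsub>q.L\<^esub>" by (rule notI) (rule notE[OF s(2)], rule iffD1[OF q.e_i_zero[OF s(1)]])
    fix r assume r: "r \<in> carrier R"
    show "\<theta> (i r) \<otimes>\<^bsub>\<Omega>\<^esub> inv\<^bsub>\<Omega>\<^esub> \<theta> (i s) \<in> W \<longleftrightarrow> q.e (i r) \<otimes>\<^bsub>q.L\<^esub> inv\<^bsub>q.L\<^esub> q.e (i s) \<in> val_ring q.L \<Psi> \<mu>"
      by (rule trans[OF \<theta>_\<nu>[OF r s] sym[OF mp[OF bspec[OF bspec[OF eR r] s(1)] s(2)]]])
  qed
  have zero: "x \<in> H \<longleftrightarrow> \<theta> x = \<zero>\<^bsub>\<Omega>\<^esub>" if "x \<in> carrier Rh" for x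
    by (rule trans[OF q.e_zero[OF that, symmetric] tp.places_equivalent(1)[OF that, symmetric]])
  show HN: "H = N"
    unfolding N_def using zero q.H.Icarr by blast
  show "q.e x \<otimes>\<^bsub>q.L\<^esub> inv\<^bsub>q.L\<^esub> (q.e y) \<in> val_ring q.L \<Psi> \<mu> \<longleftrightarrow> \<theta> x \<otimes>\<^bsub>\<Omega>\<^esub> inv\<^bsub>\<Omega>\<^esub> (\<theta> y) \<in> W"
    if xy: "x \<in> carrier Rh" "y \<in> carrier Rh" "y \<notin> H"
    by (rule tp.places_equivalent(2)[OF xy(1,2), symmetric]) (rule notI, rule notE[OF xy(3)], rule iffD2[OF zero[OF xy(2)]])
qed

text \<open>Values under \<open>\<mu>\<close> may be computed with \<open>\<theta>\<close> in
  \<open>W\<close>, by \<open>extension_determined\<close>, and there \<open>\<theta>_dense\<close>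
  finds them among the values of \<open>K\<close>.\<close>

lemma same_value_group_N:
  assumes prime: "primeideal H Rh" and contract: "{x \<in> carrier R. i x \<in> H} = {\<zero>\<^bsub>R\<^esub>}"
    and ext: "quot_extension R Rh i \<Phi> \<nu> H \<Psi> \<mu>"
  shows "same_value_group (frac_field R) \<Phi> \<nu> (frac_field (Rh Quot H)) \<Psi> \<mu> (quot_frac_map Rh i H)"
proof -
  interpret q: henselization_quotient R Rh i \<Phi> \<nu> H
    by (intro henselization_quotient.intro henselization_quotient_axioms.intro henselization_valuation_axioms prime contract)
  have HN: "H = N" by (rule extension_determined(1)[OF prime contract ext])
  note det = extension_determined(2)[OF prime contract ext]
  have th: "\<theta> z \<noteq> \<zero>\<^bsub>\<Omega>\<^esub>" if "z \<in> carrier Rh" "z \<notin> H" for z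
    using that unfolding HN N_def by blast
  have nH: "z \<otimes>\<^bsub>Rh\<^esub> i u \<notin> H" "z \<otimes>\<^bsub>Rh\<^esub> i u \<in> carrier Rh"
    if "z \<in> carrier Rh" "z \<notin> H" "u \<in> carrier R" "u \<noteq> \<zero>\<^bsub>R\<^esub>" for z u
  proof -
    have iu: "i u \<in> carrier Rh" by (rule i.hom_closed[OF that(3)])
    have "i u \<notin> H" using that(4) by (simp only: q.i_H[OF that(3)] not_False_eq_True)
    thus "z \<otimes>\<^bsub>Rh\<^esub> i u \<notin> H" using q.H.I_prime[OF that(1) iu] that(2) by blast
    show "z \<otimes>\<^bsub>Rh\<^esub> i u \<in> carrier Rh" by (rule Rh.m_closed[OF that(1) iu])
  qed
  show ?thesis
  proof (rule q.same_value_group_quot[OF ext])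
    fix x y assume xy: "x \<in> carrier Rh" "y \<in> carrier Rh" "x \<notin> H" "y \<notin> H"
    obtain r1 s1 where 1: "r1 \<in> carrier R" "s1 \<in> carrier R" "r1 \<noteq> \<zero>\<^bsub>R\<^esub>" "s1 \<noteq> \<zero>\<^bsub>R\<^esub>"
      "\<theta> (x \<otimes>\<^bsub>Rh\<^esub> i s1) \<otimes>\<^bsub>\<Omega>\<^esub> inv\<^bsub>\<Omega>\<^esub> (\<theta> (i r1)) \<in> W" "\<theta> (i r1) \<otimes>\<^bsub>\<Omega>\<^esub> inv\<^bsub>\<Omega>\<^esub> (\<theta> (x \<otimes>\<^bsub>Rh\<^esub> i s1)) \<in> W"
      using \<theta>_dense[OF xy(1) th[OF xy(1,3)]] by (elim bexE conjE) (rule that; assumption)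
    obtain r2 s2 where 2: "r2 \<in> carrier R" "s2 \<in> carrier R" "r2 \<noteq> \<zero>\<^bsub>R\<^esub>" "s2 \<noteq> \<zero>\<^bsub>R\<^esub>"
      "\<theta> (y \<otimes>\<^bsub>Rh\<^esub> i s2) \<otimes>\<^bsub>\<Omega>\<^esub> inv\<^bsub>\<Omega>\<^esub> (\<theta> (i r2)) \<in> W" "\<theta> (i r2) \<otimes>\<^bsub>\<Omega>\<^esub> inv\<^bsub>\<Omega>\<^esub> (\<theta> (y \<otimes>\<^bsub>Rh\<^esub> i s2)) \<in> W"
      using \<theta>_dense[OF xy(2) th[OF xy(2,4)]] by (elim bexE conjE) (rule that; assumption)
    \<comment> \<open>If \<open>x\<close> has the value of \<open>r1 / s1\<close> and
      \<open>y\<close> that of \<open>r2 / s2\<close>, then \<open>x / y\<close> has the value of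
      \<open>(r1 s2) / (s1 r2)\<close>.\<close>
    define r s where "r = r1 \<otimes>\<^bsub>R\<^esub> s2" and "s = s1 \<otimes>\<^bsub>R\<^esub> r2"
    have rs: "r \<in> carrier R" "s \<in> carrier R" "r \<noteq> \<zero>\<^bsub>R\<^esub>" "s \<noteq> \<zero>\<^bsub>R\<^esub>"
      using 1(1-4) 2(1-4) by (simp_all add: r_def s_def R.integral_iff)
    have ic: "i r1 \<in> carrier Rh" "i s1 \<in> carrier Rh" "i r2 \<in> carrier Rh" "i s2 \<in> carrier Rh"
      by (intro i.hom_closed 1 2)+
    define p1 p2 q1 q2 where "p1 = \<theta> (x \<otimes>\<^bsub>Rh\<^esub> i s1)" and "p2 = \<theta> (y \<otimes>\<^bsub>Rh\<^esub> i s2)" and "q1 = \<theta> (i r1)" and "q2 = \<theta> (i r2)"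
    have c: "p1 \<in> carrier \<Omega>" "p2 \<in> carrier \<Omega>" "q1 \<in> carrier \<Omega>" "q2 \<in> carrier \<Omega>"
      unfolding p1_def p2_def q1_def q2_def by (intro t.hom_closed Rh.m_closed xy ic)+
    have n: "p1 \<noteq> \<zero>\<^bsub>\<Omega>\<^esub>" "p2 \<noteq> \<zero>\<^bsub>\<Omega>\<^esub>" "q1 \<noteq> \<zero>\<^bsub>\<Omega>\<^esub>" "q2 \<noteq> \<zero>\<^bsub>\<Omega>\<^esub>"
      unfolding p1_def p2_def q1_def q2_def
      by (rule th[OF nH(2,1)[OF xy(1,3) 1(2,4)]], rule th[OF nH(2,1)[OF xy(2,4) 2(2,4)]], rule \<theta>_i[OF 1(1,3)], rule \<theta>_i[OF 2(1,3)])
    have e1: "\<theta> (x \<otimes>\<^bsub>Rh\<^esub> i s) = p1 \<otimes>\<^bsub>\<Omega>\<^esub> q2"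
      unfolding p1_def q2_def s_def i.hom_mult[OF 1(2) 2(1)] Rh.m_assoc[OF xy(1) ic(2,3), symmetric]
      by (rule t.hom_mult[OF Rh.m_closed[OF xy(1) ic(2)] ic(3)])
    have e2: "\<theta> (y \<otimes>\<^bsub>Rh\<^esub> i r) = p2 \<otimes>\<^bsub>\<Omega>\<^esub> q1"
      unfolding p2_def q1_def r_def R.m_comm[OF 1(1) 2(2)] i.hom_mult[OF 2(2) 1(1)] Rh.m_assoc[OF xy(2) ic(4,1), symmetric]
      by (rule t.hom_mult[OF Rh.m_closed[OF xy(2) ic(4)] ic(1)])
    note W = 1(5,6)[folded p1_def q1_def] 2(5,6)[folded p2_def q2_def]
    have "\<theta> (x \<otimes>\<^bsub>Rh\<^esub> i s) \<otimes>\<^bsub>\<Omega>\<^esub> inv\<^bsub>\<Omega>\<^esub> \<theta> (y \<otimes>\<^bsub>Rh\<^esub> i r) = (p1 \<otimes>\<^bsub>\<Omega>\<^esub> inv\<^bsub>\<Omega>\<^esub> q1) \<otimes>\<^bsub>\<Omega>\<^esub> (q2 \<otimes>\<^bsub>\<Omega>\<^esub> inv\<^bsub>\<Omega>\<^esub> p2)"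
      unfolding e1 e2 pl.Om.m_comm[OF c(2,3)] by (rule pl.Om.frac_mult_rule[symmetric]) (fact c n)+
    also have "\<dots> \<in> W" by (rule pl.W.V_mult[OF W(1,4)])
    finally have "q.e (x \<otimes>\<^bsub>Rh\<^esub> i s) \<otimes>\<^bsub>q.L\<^esub> inv\<^bsub>q.L\<^esub> (q.e (y \<otimes>\<^bsub>Rh\<^esub> i r)) \<in> val_ring q.L \<Psi> \<mu>"
      by (rule iffD2[OF det[OF nH(2)[OF xy(1,3) rs(2,4)] nH(2,1)[OF xy(2,4) rs(1,3)]]])
    moreover
    {
      have "\<theta> (y \<otimes>\<^bsub>Rh\<^esub> i r) \<otimes>\<^bsub>\<Omega>\<^esub> inv\<^bsub>\<Omega>\<^esub> \<theta> (x \<otimes>\<^bsub>Rh\<^esub> i s) = (p2 \<otimes>\<^bsub>\<Omega>\<^esub> inv\<^bsub>\<Omega>\<^esub> q2) \<otimes>\<^bsub>\<Omega>\<^esub> (q1 \<otimes>\<^bsub>\<Omega>\<^esub> inv\<^bsub>\<Omega>\<^esub> p1)"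
        unfolding e1 e2 pl.Om.m_comm[OF c(1,4)] by (rule pl.Om.frac_mult_rule[symmetric]) (fact c n)+
      also have "\<dots> \<in> W" by (rule pl.W.V_mult[OF W(3,2)])
      finally have "q.e (y \<otimes>\<^bsub>Rh\<^esub> i r) \<otimes>\<^bsub>q.L\<^esub> inv\<^bsub>q.L\<^esub> (q.e (x \<otimes>\<^bsub>Rh\<^esub> i s)) \<in> val_ring q.L \<Psi> \<mu>"
        by (rule iffD2[OF det[OF nH(2)[OF xy(2,4) rs(1,3)] nH(2,1)[OF xy(1,3) rs(2,4)]]])
    }
    ultimately show "\<exists>r\<in>carrier R. \<exists>s\<in>carrier R. r \<noteq> \<zero>\<^bsub>R\<^esub> \<and> s \<noteq> \<zero>\<^bsub>R\<^esub> \<and>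
      q.e (x \<otimes>\<^bsub>Rh\<^esub> i s) \<otimes>\<^bsub>q.L\<^esub> inv\<^bsub>q.L\<^esub> (q.e (y \<otimes>\<^bsub>Rh\<^esub> i r)) \<in> val_ring q.L \<Psi> \<mu> \<and>
      q.e (y \<otimes>\<^bsub>Rh\<^esub> i r) \<otimes>\<^bsub>q.L\<^esub> inv\<^bsub>q.L\<^esub> (q.e (x \<otimes>\<^bsub>Rh\<^esub> i s)) \<in> val_ring q.L \<Psi> \<mu>"
      using rs by (intro bexI[of _ r] bexI[of _ s] conjI)
  qed
qed

text \<open>Membership of \<open>x / y\<close> is decided by \<open>\<theta>\<close> and
  \<open>W\<close>, whatever the extension.\<close>

lemma val_ring_unique:
  assumes prime: "primeideal H Rh" and contract: "{x \<in> carrier R. i x \<in> H} = {\<zero>\<^bsub>R\<^esub>}"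
    and ext: "quot_extension R Rh i \<Phi> \<nu> H \<Psi> \<mu>" "quot_extension R Rh i \<Phi> \<nu> H \<Psi>' \<mu>'"
  shows "val_ring (frac_field (Rh Quot H)) \<Psi> \<mu> = val_ring (frac_field (Rh Quot H)) \<Psi>' \<mu>'"
proof -
  interpret q: henselization_quotient R Rh i \<Phi> \<nu> H
    by (intro henselization_quotient.intro henselization_quotient_axioms.intro henselization_valuation_axioms prime contract)
  have "z \<in> val_ring q.L \<Psi> \<mu> \<longleftrightarrow> z \<in> val_ring q.L \<Psi>' \<mu>'" if z: "z \<in> carrier q.L" for z
  proof -
    obtain x y where xy: "x \<in> carrier Rh" "y \<in> carrier Rh" "y \<notin> H" "z = q.e x \<otimes>\<^bsub>q.L\<^esub> inv\<^bsub>q.L\<^esub> (q.e y)"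
      using q.L_E[OF z] by blast
    show ?thesis
      unfolding xy(4) using extension_determined(2)[OF prime contract ext(1) xy(1-3)]
        extension_determined(2)[OF prime contract ext(2) xy(1-3)] by blast
  qed
  moreover have "val_ring q.L \<Psi> \<mu> \<subseteq> carrier q.L" "val_ring q.L \<Psi>' \<mu>' \<subseteq> carrier q.L" unfolding val_ring_def by blast+
  ultimately show ?thesis by blast
qed

lemma main_result:
  shows "(\<exists>!H. extension_prime R Rh i \<Phi> \<nu> H) \<and>
    (\<forall>H. extension_prime R Rh i \<Phi> \<nu> H \<longrightarrow>
       minimal_prime H Rh \<and>
       (\<forall>\<Psi>\<^sub>1 \<mu>\<^sub>1 \<Psi>\<^sub>2 \<mu>\<^sub>2.
          quot_extension R Rh i \<Phi> \<nu> H \<Psi>\<^sub>1 \<mu>\<^sub>1 \<and> quot_extension R Rh i \<Phi> \<nu> H \<Psi>\<^sub>2 \<mu>\<^sub>2 \<longrightarrow>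
          val_ring (frac_field (Rh Quot H)) \<Psi>\<^sub>1 \<mu>\<^sub>1 = val_ring (frac_field (Rh Quot H)) \<Psi>\<^sub>2 \<mu>\<^sub>2) \<and>
       (\<forall>\<Psi> \<mu>. quot_extension R Rh i \<Phi> \<nu> H \<Psi> \<mu> \<longrightarrow>
          same_value_group (frac_field R) \<Phi> \<nu>
            (frac_field (Rh Quot H)) \<Psi> \<mu> (quot_frac_map Rh i H)))"
proof -
  have unique: "H = N" if H: "extension_prime R Rh i \<Phi> \<nu> H" for H
  proof -
    obtain \<Psi> \<mu> where "quot_extension R Rh i \<Phi> \<nu> H \<Psi> \<mu>" using H unfolding extension_prime_def by blast
    thus ?thesis using extension_determined(1) H unfolding extension_prime_def by blast
  qed
  have ext: "extension_prime R Rh i \<Phi> \<nu> N" by (rule extension_primeI[OF prime_N subset_refl])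
  show ?thesis
  proof (intro conjI allI impI; (elim conjE)?)
    show "\<exists>!H. extension_prime R Rh i \<Phi> \<nu> H" using ext unique by (rule ex1I)
    fix H assume H: "extension_prime R Rh i \<Phi> \<nu> H"
    note p = H[unfolded extension_prime_def, THEN conjunct1] H[unfolded extension_prime_def, THEN conjunct2, THEN conjunct1]
    show "minimal_prime H Rh"
      unfolding minimal_prime_def
    proof (intro conjI allI impI p(1); elim conjE)
      fix Q assume Q: "primeideal Q Rh" "Q \<subseteq> H"
      have "extension_prime R Rh i \<Phi> \<nu> Q" using extension_primeI[OF Q(1)] Q(2) unique[OF H] by simp
      thus "Q = H" using unique[OF H] unique by simp
    qed
    show "val_ring (frac_field (Rh Quot H)) \<Psi>\<^sub>1 \<mu>\<^sub>1 = val_ring (frac_field (Rh Quot H)) \<Psi>\<^sub>2 \<mu>\<^sub>2"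
      if "quot_extension R Rh i \<Phi> \<nu> H \<Psi>\<^sub>1 \<mu>\<^sub>1" "quot_extension R Rh i \<Phi> \<nu> H \<Psi>\<^sub>2 \<mu>\<^sub>2" for \<Psi>\<^sub>1 \<mu>\<^sub>1 \<Psi>\<^sub>2 \<mu>\<^sub>2
      by (rule val_ring_unique[OF p that])
    show "same_value_group (frac_field R) \<Phi> \<nu> (frac_field (Rh Quot H)) \<Psi> \<mu> (quot_frac_map Rh i H)"
      if "quot_extension R Rh i \<Phi> \<nu> H \<Psi> \<mu>" for \<Psi> \<mu>
      by (rule same_value_group_N[OF p that])
  qed
qed

end

section \<open>Construction of the place\<close>

lemma field_hom_inverse:
  assumes "field K" "field L" "h \<in> ring_hom K L" "k \<in> carrier K" "k \<noteq> \<zero>\<^bsub>K\<^esub>"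
  shows "h k \<noteq> \<zero>\<^bsub>L\<^esub>" "h (inv\<^bsub>K\<^esub> k) = inv\<^bsub>L\<^esub> (h k)"
proof -
  interpret K: field K by fact
  interpret L: field L by fact
  have c: "h k \<in> carrier L" "h (inv\<^bsub>K\<^esub> k) \<in> carrier L"
    using ring_hom_closed[OF assms(3)] assms(4,5) by auto
  have "h k \<otimes>\<^bsub>L\<^esub> h (inv\<^bsub>K\<^esub> k) = h (k \<otimes>\<^bsub>K\<^esub> inv\<^bsub>K\<^esub> k)"
    by (rule ring_hom_mult[OF assms(3,4), symmetric]) (use assms in simp)
  hence *: "h k \<otimes>\<^bsub>L\<^esub> h (inv\<^bsub>K\<^esub> k) = \<one>\<^bsub>L\<^esub>" using assms(4,5) ring_hom_one[OF assms(3)] by simp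
  show "h k \<noteq> \<zero>\<^bsub>L\<^esub>"
  proof
    assume "h k = \<zero>\<^bsub>L\<^esub>"
    thus False using * c by simp
  qed
  show "h (inv\<^bsub>K\<^esub> k) = inv\<^bsub>L\<^esub> (h k)" using L.inv_eqI[of "h k" "h (inv\<^bsub>K\<^esub> k)"] * c by simp
qed

text \<open>Chevalley's theorem for the image of \<open>V\<close> and of its maximal ideal. Nothing
  new from \<open>K\<close> enters \<open>W\<close>: the inverse of an element outside
  \<open>V\<close> is mapped into the maximal ideal of \<open>W\<close>.\<close>

lemma valuation_subring_extends:
  assumes V: "valuation_subring K V" and L: "field L" and h: "h \<in> ring_hom K L"
  obtains W where "valuation_subring L W" "\<And>k. k \<in> carrier K \<Longrightarrow> h k \<in> W \<longleftrightarrow> k \<in> V"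
    "\<And>k. k \<in> vmax K V \<Longrightarrow> h k \<in> vmax L W"
proof -
  interpret V: valuation_subring K V by fact
  interpret L: field L by fact
  interpret h: ring_hom_ring K L h by (rule ring_hom_ringI2[OF V.ring_axioms L.ring_axioms h])
  note inverse = field_hom_inverse[OF V.field_axioms L h]
  have add: "h a \<oplus>\<^bsub>L\<^esub> h b \<in> h ` vmax K V" if "a \<in> vmax K V" "b \<in> vmax K V" for a b
    using V.m_add[OF that] h.hom_add[OF V.m_carr[OF that(1)] V.m_carr[OF that(2)]] by (metis imageI)
  have mult: "h a \<otimes>\<^bsub>L\<^esub> h b \<in> h ` vmax K V" if "a \<in> V" "b \<in> vmax K V" for a b
    using V.m_mult(1)[OF that] h.hom_mult[OF V.V_carr[OF that(1)] V.m_carr[OF that(2)]] by (metis imageI)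
  have one: "\<one>\<^bsub>L\<^esub> \<notin> h ` vmax K V"
  proof
    assume "\<one>\<^bsub>L\<^esub> \<in> h ` vmax K V"
    then obtain a where a: "a \<in> vmax K V" "h a = \<one>\<^bsub>L\<^esub>" by auto
    have ac: "a \<in> carrier K" using a(1) by simp
    have "h (a \<ominus>\<^bsub>K\<^esub> \<one>\<^bsub>K\<^esub>) = \<zero>\<^bsub>L\<^esub>" using a(2) ac by (simp add: a_minus_def L.r_neg)
    hence "a \<ominus>\<^bsub>K\<^esub> \<one>\<^bsub>K\<^esub> = \<zero>\<^bsub>K\<^esub>" using inverse(1)[of "a \<ominus>\<^bsub>K\<^esub> \<one>\<^bsub>K\<^esub>"] ac by auto
    hence "a = \<one>\<^bsub>K\<^esub>" using ac by simp
    thus False using a(1) V.m_one by simp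
  qed
  obtain W where W: "valuation_subring L W" "h ` V \<subseteq> W" "h ` vmax K V \<subseteq> vmax L W"
  proof (rule L.chevalley_extension[of "h ` V" "h ` vmax K V"])
    show "subring (h ` V) L" by (rule h.img_is_subring[OF V.subring])
    show "h ` vmax K V \<subseteq> h ` V" using V.m_V by blast
    show "\<zero>\<^bsub>L\<^esub> \<in> h ` vmax K V" using imageI[OF V.m_zero, of h] by simp
    show "a \<oplus>\<^bsub>L\<^esub> b \<in> h ` vmax K V" if "a \<in> h ` vmax K V" "b \<in> h ` vmax K V" for a b using that add by blast
    show "a \<otimes>\<^bsub>L\<^esub> b \<in> h ` vmax K V" if "a \<in> h ` V" "b \<in> h ` vmax K V" for a b using that mult by blast
    show "\<one>\<^bsub>L\<^esub> \<notin> h ` vmax K V" by (rule one)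
  qed (rule that)
  interpret W: valuation_subring L W by (rule W(1))
  have "h k \<notin> W" if k: "k \<in> carrier K" "k \<notin> V" for k
  proof
    assume "h k \<in> W"
    note n = V.notin_V[OF k]
    have "inv\<^bsub>L\<^esub> (h k) \<in> vmax L W" using n(2) W(3) inverse(2)[OF k(1) n(1)] by (metis image_subset_iff)
    moreover have "inv\<^bsub>L\<^esub> (inv\<^bsub>L\<^esub> (h k)) = h k" "inv\<^bsub>L\<^esub> (h k) \<noteq> \<zero>\<^bsub>L\<^esub>" using inverse(1)[OF k(1) n(1)] k(1) by simp_all
    ultimately show False using W.m_inv_notin[of "inv\<^bsub>L\<^esub> (h k)"] \<open>h k \<in> W\<close> by simp
  qed
  thus thesis by (intro that[OF W(1)]) (use W(2,3) in blast)+
qed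

context henselization_valuation
begin

text \<open>The type of \<open>\<Omega>\<close> is dictated by \<open>alg_closure\<close>, whose
  elements are functions from monomials to coefficients. It is not the type of the test rings, hence
  the coding of \<open>\<Omega>\<close> before the universal property is used.\<close>

lemma exists_place:
  obtains \<Omega> :: "((('a \<times> 'a) set list \<times> nat) multiset \<Rightarrow> ('a \<times> 'a) set) ring" and W \<theta>
  where "henselization_place R Rh i \<Phi> \<nu> \<Omega> W \<theta>"
proof -
  define \<Omega> where "\<Omega> = val.K.alg_closure"
  define \<iota> :: "('a \<times> 'a) set \<Rightarrow> (('a \<times> 'a) set list \<times> nat) multiset \<Rightarrow> ('a \<times> 'a) set" where "\<iota> = val.K.indexed_const"
  define K' where "K' = \<iota> ` carrier K"
  interpret Om: algebraic_closure \<Omega> K'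
    using val.K.alg_closureE(1) unfolding \<Omega>_def K'_def \<iota>_def .
  have \<iota>: "\<iota> \<in> ring_hom K \<Omega>" using val.K.alg_closureE(2) unfolding \<Omega>_def \<iota>_def .
  note inverse = field_hom_inverse[OF val.K.field_axioms Om.field_axioms \<iota>]
  have \<iota>_inj: "inj_on \<iota> (carrier K)" unfolding \<iota>_def by (rule val.K.indexed_const_inj_on)
  obtain W where W: "valuation_subring \<Omega> W" "\<And>k. k \<in> carrier K \<Longrightarrow> \<iota> k \<in> W \<longleftrightarrow> k \<in> V\<nu>"
    "\<And>k. k \<in> vmax K V\<nu> \<Longrightarrow> \<iota> k \<in> vmax \<Omega> W"
    using valuation_subring_extends[OF val.vs.valuation_subring_axioms Om.field_axioms \<iota>] by blast
  interpret pl: val_closed_field \<Omega> W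
    by (intro val_closed_field.intro Om.algebraically_closed_axioms W(1))
  obtain F where F: "subfield F \<Omega>" "K' \<subseteq> F" "pl.same_values K' F"
    "\<And>E. subfield E \<Omega> \<Longrightarrow> F \<subseteq> E \<Longrightarrow> pl.same_values K' E \<Longrightarrow> E = F"
    using pl.exists_maximal_same_values[OF Om.subfield_axioms] by blast
  define S where "S = \<Omega>\<lparr>carrier := W \<inter> F\<rparr>"
  have S: "henselian S" "max_ideal S = vmax \<Omega> W \<inter> F"
    unfolding S_def by (rule pl.maximal_same_values_henselian[OF Om.subfield_axioms F(1,3,4)]; assumption)+
  have Fc: "F \<subseteq> carrier \<Omega>" by (rule subfieldE(3)[OF F(1)])
  let ?f = "\<iota> \<circ> frac_emb R"
  have f: "?f \<in> ring_hom R \<Omega>" by (rule ring_hom_trans[OF R.frac_emb_hom \<iota>])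
  have fF: "?f r \<in> F" if "r \<in> carrier R" for r
    using F(2) R.frac_emb_closed[OF that] by (auto simp: K'_def)
  have fW: "?f r \<in> W" if "r \<in> carrier R" for r
    using W(2)[OF R.frac_emb_closed[OF that]] emb_in_V[OF that] by simp
  \<comment> \<open>Centeredness of \<open>\<nu>\<close> is what makes this map local.\<close>
  have fS: "?f \<in> local_hom R S"
    unfolding local_hom_def
  proof (intro CollectI conjI subsetI)
    show "?f \<in> ring_hom R S"
      using ring_hom_memE[OF f] fF fW by (intro ring_hom_memI) (simp_all add: S_def)
    fix y assume "y \<in> ?f ` max_ideal R"
    then obtain r where r: "r \<in> max_ideal R" "y = ?f r" by blast
    have rc: "r \<in> carrier R" by (rule ideal.Icarr[OF local_ring_max_ideal(3)[OF loc] r(1)])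
    have "?f r \<in> vmax \<Omega> W" using W(3) emb_in_m[OF rc] r(1) by simp
    thus "y \<in> max_ideal S" using fF[OF rc] unfolding S(2) r(2) by blast
  qed
  \<comment> \<open>An element of \<open>K'\<close> is coded by a pair representing the
    corresponding fraction. Fractions are equivalence classes, so two of them that share a
    representative are equal.\<close>
  define \<gamma> :: "((('a \<times> 'a) set list \<times> nat) multiset \<Rightarrow> ('a \<times> 'a) set) \<Rightarrow> ('a + 'b) \<times> ('a + 'b)"
    where "\<gamma> z = map_prod Inl Inl (SOME p. p \<in> inv_into (carrier K) \<iota> z)" for z
  have "inj_on \<gamma> K'"
  proof (rule inj_onI)
    fix y z assume "y \<in> K'" "z \<in> K'" and e: "\<gamma> y = \<gamma> z"
    then obtain k l where k: "k \<in> carrier K" "y = \<iota> k" and l: "l \<in> carrier K" "z = \<iota> l" by (auto simp: K'_def)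
    have some: "(SOME p. p \<in> k) \<in> k" if "k \<in> carrier K" for k
    proof -
      have "\<exists>p. p \<in> k"
        using R.carrier_frac_fieldE[OF that] by (metis DiffD1 DiffD2 equiv_class_self R.equiv_frac_rel fraction_def mem_Sigma_iff DiffI)
      thus ?thesis by (rule someI_ex)
    qed
    have "(SOME p. p \<in> k) = (SOME p. p \<in> l)"
      using e \<iota>_inj k l by (simp add: \<gamma>_def prod_eq_iff)
    hence "k \<inter> l \<noteq> {}" using some[OF k(1)] some[OF l(1)] by auto
    moreover have "k \<in> (carrier R \<times> (carrier R - {\<zero>\<^bsub>R\<^esub>})) // frac_rel R" "l \<in> (carrier R \<times> (carrier R - {\<zero>\<^bsub>R\<^esub>})) // frac_rel R"
      using k(1) l(1) by (simp_all add: frac_field_def)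
    ultimately have "k = l" using quotient_disj[OF R.equiv_frac_rel] by blast
    thus "y = z" using k l by simp
  qed
  then obtain h :: "((('a \<times> 'a) set list \<times> nat) multiset \<Rightarrow> ('a \<times> 'a) set) \<Rightarrow> ('a + 'b) list set" where h: "inj_on h (carrier \<Omega>)"
    using algebraic_injects_into_list_set[OF Om.field_axioms Om.subfield_axioms _ Om.algebraic_extension] by blast
  have "inj_on h (carrier S)" by (rule inj_on_subset[OF h]) (use Fc in \<open>auto simp: S_def\<close>)
  then obtain \<theta> where \<theta>: "\<theta> \<in> local_hom Rh S" "\<And>r. r \<in> carrier R \<Longrightarrow> \<theta> (i r) = ?f r"
    using henselization_lift[OF hens S(1) _ fS] by blast
  have \<theta>h: "\<theta> \<in> ring_hom Rh \<Omega>"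
    using ring_hom_memE[OF local_homD(1)[OF \<theta>(1)]] by (intro ring_hom_memI) (simp_all add: S_def)
  interpret t: ring_hom_ring Rh \<Omega> \<theta> by (rule ring_hom_ringI2[OF Rh.ring_axioms Om.ring_axioms \<theta>h])
  have \<theta>S: "\<theta> x \<in> W" "\<theta> x \<in> F" if "x \<in> carrier Rh" for x
    using ring_hom_closed[OF local_homD(1)[OF \<theta>(1)] that] by (simp_all add: S_def)
  have \<theta>_i: "\<theta> (i s) \<noteq> \<zero>\<^bsub>\<Omega>\<^esub>" if s: "s \<in> carrier R" "s \<noteq> \<zero>\<^bsub>R\<^esub>" for s
    using inverse(1)[OF R.frac_emb_closed[OF s(1)]] R.frac_emb_zero_iff[OF s(1)] s(2) \<theta>(2)[OF s(1)] by simp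
  have \<theta>_fraction: "\<theta> (i r) \<otimes>\<^bsub>\<Omega>\<^esub> inv\<^bsub>\<Omega>\<^esub> (\<theta> (i s)) = \<iota> (fraction R r s)"
    if rs: "r \<in> carrier R" "s \<in> carrier R" "s \<noteq> \<zero>\<^bsub>R\<^esub>" for r s
  proof -
    have n: "frac_emb R s \<noteq> \<zero>\<^bsub>K\<^esub>" using R.frac_emb_zero_iff[OF rs(2)] rs(3) by simp
    note c = R.frac_emb_closed[OF rs(1)] R.frac_emb_closed[OF rs(2)]
    have "\<iota> (fraction R r s) = \<iota> (frac_emb R r) \<otimes>\<^bsub>\<Omega>\<^esub> \<iota> (inv\<^bsub>K\<^esub> (frac_emb R s))"
      unfolding R.fraction_eq[OF rs] by (rule ring_hom_mult[OF \<iota> c(1)]) (simp add: c(2) n)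
    thus ?thesis using inverse(2)[OF c(2) n] \<theta>(2)[OF rs(1)] \<theta>(2)[OF rs(2)] by simp
  qed
  have "henselization_place R Rh i \<Phi> \<nu> \<Omega> W \<theta>"
  proof (rule henselization_place.intro[OF henselization_valuation_axioms pl.val_closed_field_axioms],
      rule henselization_place_axioms.intro[OF \<theta>h _ _ \<theta>_i])
    show "\<theta> ` carrier Rh \<subseteq> W" using \<theta>S(1) by blast
    show "\<theta> ` max_ideal Rh \<subseteq> vmax \<Omega> W" using local_homD(2)[OF \<theta>(1)] S(2) by blast
    fix r s assume rs: "r \<in> carrier R" "s \<in> carrier R" "s \<noteq> \<zero>\<^bsub>R\<^esub>"
    show "\<theta> (i r) \<otimes>\<^bsub>\<Omega>\<^esub> inv\<^bsub>\<Omega>\<^esub> \<theta> (i s) \<in> W \<longleftrightarrow> fraction R r s \<in> V\<nu>"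
      unfolding \<theta>_fraction[OF rs] by (rule W(2)) (use rs in blast)
  next
    fix x assume x: "x \<in> carrier Rh" "\<theta> x \<noteq> \<zero>\<^bsub>\<Omega>\<^esub>"
    have "\<theta> x \<in> F - {\<zero>\<^bsub>\<Omega>\<^esub>}" using \<theta>S(2)[OF x(1)] x(2) by blast
    \<comment> \<open>Since \<open>\<theta> x\<close> lies in \<open>F\<close>, its value is that of
      some \<open>k'\<close>, the image of a fraction \<open>r / s\<close>. Multiplying by the image
      of \<open>s\<close> turns this into the statement with cleared denominator.\<close>
    then obtain k' where k': "k' \<in> K' - {\<zero>\<^bsub>\<Omega>\<^esub>}" "pl.unit (\<theta> x \<otimes>\<^bsub>\<Omega>\<^esub> inv\<^bsub>\<Omega>\<^esub> k')"
      using F(3) unfolding pl.same_values_def by blast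
    then obtain k where k: "k \<in> carrier K" "k' = \<iota> k" by (auto simp: K'_def)
    obtain r s where rs: "r \<in> carrier R" "s \<in> carrier R - {\<zero>\<^bsub>R\<^esub>}" "k = fraction R r s"
      using R.carrier_frac_fieldE[OF k(1)] by blast
    have s: "s \<in> carrier R" "s \<noteq> \<zero>\<^bsub>R\<^esub>" using rs(2) by simp_all
    let ?r = "\<theta> (i r)" and ?s = "\<theta> (i s)"
    have k'e: "k' = ?r \<otimes>\<^bsub>\<Omega>\<^esub> inv\<^bsub>\<Omega>\<^esub> ?s" using \<theta>_fraction[OF rs(1) s] k(2) rs(3) by simp
    have ic: "i r \<in> carrier Rh" "i s \<in> carrier Rh" using rs(1) s(1) by simp_all
    have c: "?r \<in> carrier \<Omega>" "?s \<in> carrier \<Omega>" "\<theta> x \<in> carrier \<Omega>" using ic x(1) by simp_all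
    have s0: "?s \<noteq> \<zero>\<^bsub>\<Omega>\<^esub>" by (rule \<theta>_i[OF s])
    have r0: "?r \<noteq> \<zero>\<^bsub>\<Omega>\<^esub>"
    proof
      assume "?r = \<zero>\<^bsub>\<Omega>\<^esub>"
      hence "k' = \<zero>\<^bsub>\<Omega>\<^esub>" using c s0 unfolding k'e by simp
      thus False using k'(1) by simp
    qed
    have r: "r \<noteq> \<zero>\<^bsub>R\<^esub>"
    proof
      assume "r = \<zero>\<^bsub>R\<^esub>"
      thus False using r0 by simp
    qed
    have xs: "\<theta> (x \<otimes>\<^bsub>Rh\<^esub> i s) = \<theta> x \<otimes>\<^bsub>\<Omega>\<^esub> ?s" by (rule t.hom_mult[OF x(1) ic(2)])
    have xs0: "\<theta> x \<otimes>\<^bsub>\<Omega>\<^esub> ?s \<noteq> \<zero>\<^bsub>\<Omega>\<^esub>" "\<theta> x \<otimes>\<^bsub>\<Omega>\<^esub> ?s \<in> carrier \<Omega>" using x(2) s0 c by (simp_all add: Om.integral_iff)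
    have u: "\<theta> x \<otimes>\<^bsub>\<Omega>\<^esub> inv\<^bsub>\<Omega>\<^esub> k' = \<theta> (x \<otimes>\<^bsub>Rh\<^esub> i s) \<otimes>\<^bsub>\<Omega>\<^esub> inv\<^bsub>\<Omega>\<^esub> ?r"
      unfolding k'e xs using c r0 s0 by (simp add: Om.frac_inv_rule Om.m_assoc)
    have "inv\<^bsub>\<Omega>\<^esub> (\<theta> (x \<otimes>\<^bsub>Rh\<^esub> i s) \<otimes>\<^bsub>\<Omega>\<^esub> inv\<^bsub>\<Omega>\<^esub> ?r) = ?r \<otimes>\<^bsub>\<Omega>\<^esub> inv\<^bsub>\<Omega>\<^esub> (\<theta> (x \<otimes>\<^bsub>Rh\<^esub> i s))"
      unfolding xs by (rule Om.frac_inv_rule[OF xs0(2) c(1) xs0(1) r0])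
    moreover have "\<theta> (x \<otimes>\<^bsub>Rh\<^esub> i s) \<otimes>\<^bsub>\<Omega>\<^esub> inv\<^bsub>\<Omega>\<^esub> ?r \<in> W"
      using k'(2) unfolding pl.unit_def u by (rule conjunct1)
    moreover have "inv\<^bsub>\<Omega>\<^esub> (\<theta> (x \<otimes>\<^bsub>Rh\<^esub> i s) \<otimes>\<^bsub>\<Omega>\<^esub> inv\<^bsub>\<Omega>\<^esub> ?r) \<in> W"
      using pl.unitD(3)[OF k'(2)] unfolding u .
    ultimately show "\<exists>r\<in>carrier R. \<exists>s\<in>carrier R. r \<noteq> \<zero>\<^bsub>R\<^esub> \<and> s \<noteq> \<zero>\<^bsub>R\<^esub> \<and>
      \<theta> (x \<otimes>\<^bsub>Rh\<^esub> i s) \<otimes>\<^bsub>\<Omega>\<^esub> inv\<^bsub>\<Omega>\<^esub> (\<theta> (i r)) \<in> W \<and> \<theta> (i r) \<otimes>\<^bsub>\<Omega>\<^esub> inv\<^bsub>\<Omega>\<^esub> (\<theta> (x \<otimes>\<^bsub>Rh\<^esub> i s)) \<in> W"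
      using rs(1) s r by (intro bexI[of _ r] bexI[of _ s] conjI) simp_all
  qed
  thus thesis by (rule that)
qed

end

theorem theorem1:
  fixes R :: "('a, 'm) ring_scheme" and Rh :: "('b, 'n) ring_scheme" and i :: "'a \<Rightarrow> 'b"
    and \<Phi> :: "('g, 'p) ordered_group_scheme" and \<nu> :: "('a \<times> 'a) set \<Rightarrow> 'g"
  assumes "domain R" and "local_ring R"
    and "henselization R Rh i"
    and "centered_valuation R \<Phi> \<nu>"
  shows "(\<exists>!H. extension_prime R Rh i \<Phi> \<nu> H) \<and>
    (\<forall>H. extension_prime R Rh i \<Phi> \<nu> H \<longrightarrow>
       minimal_prime H Rh \<and>
       (\<forall>\<Psi>\<^sub>1 \<mu>\<^sub>1 \<Psi>\<^sub>2 \<mu>\<^sub>2.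
          quot_extension R Rh i \<Phi> \<nu> H \<Psi>\<^sub>1 \<mu>\<^sub>1 \<and> quot_extension R Rh i \<Phi> \<nu> H \<Psi>\<^sub>2 \<mu>\<^sub>2 \<longrightarrow>
          val_ring (frac_field (Rh Quot H)) \<Psi>\<^sub>1 \<mu>\<^sub>1 = val_ring (frac_field (Rh Quot H)) \<Psi>\<^sub>2 \<mu>\<^sub>2) \<and>
       (\<forall>\<Psi> \<mu>. quot_extension R Rh i \<Phi> \<nu> H \<Psi> \<mu> \<longrightarrow>
          same_value_group (frac_field R) \<Phi> \<nu>
            (frac_field (Rh Quot H)) \<Psi> \<mu> (quot_frac_map Rh i H)))"
proof -
  interpret henselization_valuation R Rh i \<Phi> \<nu> by (rule henselization_valuation.intro[OF assms])
  obtain \<Omega> :: "((('a \<times> 'a) set list \<times> nat) multiset \<Rightarrow> ('a \<times> 'a) set) ring" and W \<theta>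
    where "henselization_place R Rh i \<Phi> \<nu> \<Omega> W \<theta>" by (rule exists_place)
  thus ?thesis by (rule henselization_place.main_result)
qed

end
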